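(* Let $n\ge 1$, $1<p<\infty$, and let $U\subset\mathbb{R}^n$ be quasiopen. Let $u:U\to[-\infty,\infty]$ be an everywhere defined function. Then $u\in N^{1,p}(U)$ if and only if $u\in W^{1,p}(U)$ and $u$ is quasicontinuous (on $U$). Moreover, in this case $\|u\|_{N^{1,p}(U)}=\|u\|_{W^{1,p}(U)}$.
   Context: $\mathbb{R}^n$ carries the Euclidean metric and Lebesgue measure. Curves are nonconstant, compact, rectifiable curves $\gamma:[0,l_\gamma]\to\mathbb{R}^n$ parametrized by arc length. Any measurable $E\subset\mathbb{R}^n$ is regarded as a metric measure space with the restricted metric and measure. For $f:E\to[-\infty,\infty]$, a Borel function $g:E\to[0,\infty]$ is an upper gradient of $f$ in $E$ if $|f(\gamma(0))-f(\gamma(l_\gamma))|\le\int_\gamma g\,ds$ for every curve $\gamma$ in $E$ (the left side is $\infty$ if either value is infinite). $N^{1,p}(E)$ is the set of everywhere defined measurable $f:E\to[-\infty,\infty]$ with $\|f\|_{N^{1,p}(E)}:=\bigl(\int_E|f|^p\,dx+\inf_g\int_E g^p\,dx\bigr)^{1/p}<\infty$, the infimum over all upper gradients $g$ of $f$ in $E$. The Sobolev capacity of $E\subset\mathbb{R}^n$ is $C_p(E)=\inf\|v\|^p_{N^{1,p}(\mathbb{R}^n)}$ over $v\in N^{1,p}(\mathbb{R}^n)$ with $v\ge1$ on $E$. A set $U$ is quasiopen if for every $\varepsilon>0$ there is an open $G$ with $C_p(G)<\varepsilon$ and $U\cup G$ open. A function $u$ on $E$ is quasicontinuous if for every $\varepsilon>0$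 there is an open $G$ with $C_p(G)<\varepsilon$ such that $u|_{E\setminus G}$ is finite and continuous. A quasicovering of a set $E$ is a countable family $\mathcal B$ of quasiopen sets with $\bigcup_{V\in\mathcal B}V\subset E$ and $C_p(E\setminus\bigcup_{V\in\mathcal B}V)=0$. Definition (Kilpeläinen–Malý) of $W^{1,p}(U)$ for quasiopen $U$: a function $u$ on $U$ (considered up to sets of measure zero) belongs to $W^{1,p}(U)$ if (i) $u\in L^p(U)$; (ii) there is a quasicovering $\mathcal B$ of $U$ such that for every $V\in\mathcal B$ there are an open set $G_V\supset V$ and $u_V$ in the classical Sobolev space $W^{1,p}(G_V)$ with $u=u_V$ (a.e.) in $V$; (iii) the fine gradient $\nabla u$, defined by $\nabla u=\nabla u_V$ a.e. on each $V\in\mathcal B$, belongs to $L^p(U)$. Then $\|u\|_{W^{1,p}(U)}=\bigl(\int_U(|u|^p+|\nabla u|^p)\,dx\bigr)^{1/p}$. *)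

theory Defs
  imports "HOL-Analysis.Analysis"
begin

definition curve_length :: "(real \<Rightarrow> 'a::euclidean_space) \<Rightarrow> real \<Rightarrow> real \<Rightarrow> ennreal" where
  "curve_length \<gamma> a b =
     (SUP mt \<in> {(m, t). t 0 = a \<and> t m = b \<and> (\<forall>i<m. t i \<le> t (Suc i))}.
        ennreal (\<Sum>i<fst mt. dist (\<gamma> (snd mt i)) (\<gamma> (snd mt (Suc i)))))"

definition arclength_curve_in :: "'a::euclidean_space set \<Rightarrow> (real \<Rightarrow> 'a) \<Rightarrow> real \<Rightarrow> bool" where
  "arclength_curve_in E \<gamma> l \<longleftrightarrow> l > 0 \<and> \<gamma> ` {0..l} \<subseteq> E \<and>
     (\<forall>s t. 0 \<le> s \<and> s \<le> t \<and> t \<le> l \<longrightarrow> curve_length \<gamma> s t = ennreal (t - s))"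

text \<open>Line integral of a nonnegative function along an arc-length parametrized curve.\<close>
definition line_integral :: "('a::euclidean_space \<Rightarrow> ennreal) \<Rightarrow> (real \<Rightarrow> 'a) \<Rightarrow> real \<Rightarrow> ennreal" where
  "line_integral g \<gamma> l = set_nn_integral lborel {0..l} (\<lambda>t. g (\<gamma> t))"

definition ediff :: "ereal \<Rightarrow> ereal \<Rightarrow> ennreal" where
  "ediff a b = (if \<bar>a\<bar> = \<infinity> \<or> \<bar>b\<bar> = \<infinity> then \<infinity> else ennreal \<bar>real_of_ereal a - real_of_ereal b\<bar>)"

definition upper_gradient :: "'a::euclidean_space set \<Rightarrow> ('a \<Rightarrow> ereal) \<Rightarrow> ('a \<Rightarrow> ennreal) \<Rightarrow> bool" where
  "upper_gradient E f g \<longleftrightarrow> g \<in> borel_measurable (restrict_space borel E) \<and>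
     (\<forall>\<gamma> l. arclength_curve_in E \<gamma> l \<longrightarrow> ediff (f (\<gamma> 0)) (f (\<gamma> l)) \<le> line_integral g \<gamma> l)"

definition enn_pow :: "ennreal \<Rightarrow> real \<Rightarrow> ennreal" where
  "enn_pow x p = (if x = \<infinity> then \<infinity> else ennreal (enn2real x powr p))"

definition eabs_enn :: "ereal \<Rightarrow> ennreal" where
  "eabs_enn a = e2ennreal \<bar>a\<bar>"

definition N1p_energy :: "real \<Rightarrow> 'a::euclidean_space set \<Rightarrow> ('a \<Rightarrow> ereal) \<Rightarrow> ennreal" where
  "N1p_energy p E f =
     set_nn_integral lebesgue E (\<lambda>x. enn_pow (eabs_enn (f x)) p)
     + (INF g \<in> {g. upper_gradient E f g}. set_nn_integral lebesgue E (\<lambda>x. enn_pow (g x) p))"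

definition N1p :: "real \<Rightarrow> 'a::euclidean_space set \<Rightarrow> ('a \<Rightarrow> ereal) \<Rightarrow> bool" where
  "N1p p E f \<longleftrightarrow> f \<in> borel_measurable (restrict_space lebesgue E) \<and> N1p_energy p E f < \<infinity>"

definition N1p_norm :: "real \<Rightarrow> 'a::euclidean_space set \<Rightarrow> ('a \<Rightarrow> ereal) \<Rightarrow> real" where
  "N1p_norm p E f = enn2real (N1p_energy p E f) powr (1 / p)"

definition Cap :: "real \<Rightarrow> 'a::euclidean_space set \<Rightarrow> ennreal" where
  "Cap p E = (INF v \<in> {v. N1p p (UNIV :: 'a set) v \<and> (\<forall>x\<in>E. v x \<ge> 1)}. N1p_energy p UNIV v)"

definition quasiopen :: "real \<Rightarrow> 'a::euclidean_space set \<Rightarrow> bool" where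
  "quasiopen p U \<longleftrightarrow> (\<forall>\<epsilon>>0. \<exists>G. open G \<and> Cap p G < ennreal \<epsilon> \<and> open (U \<union> G))"

definition quasicontinuous_on :: "real \<Rightarrow> 'a::euclidean_space set \<Rightarrow> ('a \<Rightarrow> ereal) \<Rightarrow> bool" where
  "quasicontinuous_on p E u \<longleftrightarrow> (\<forall>\<epsilon>>0. \<exists>G. open G \<and> Cap p G < ennreal \<epsilon> \<and>
      (\<forall>x \<in> E - G. \<bar>u x\<bar> \<noteq> \<infinity>) \<and> continuous_on (E - G) (\<lambda>x. real_of_ereal (u x)))"

definition quasicovering :: "real \<Rightarrow> 'a::euclidean_space set \<Rightarrow> 'a set set \<Rightarrow> bool" where
  "quasicovering p E \<B> \<longleftrightarrow> countable \<B> \<and> (\<forall>V\<in>\<B>. quasiopen p V) \<and> \<Union>\<B> \<subseteq> E \<and>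
      Cap p (E - \<Union>\<B>) = 0"

text \<open>Iterated directional (Frechet) derivatives; C-infinity = all of them exist everywhere.\<close>
fun dderiv :: "'a::euclidean_space list \<Rightarrow> ('a \<Rightarrow> real) \<Rightarrow> 'a \<Rightarrow> real" where
  "dderiv [] \<phi> = \<phi>"
| "dderiv (v # vs) \<phi> = (\<lambda>x. frechet_derivative (dderiv vs \<phi>) (at x) v)"

definition test_function :: "'a::euclidean_space set \<Rightarrow> ('a \<Rightarrow> real) \<Rightarrow> bool" where
  "test_function G \<phi> \<longleftrightarrow> (\<forall>vs x. dderiv vs \<phi> differentiable (at x)) \<and>
     compact (closure {x. \<phi> x \<noteq> 0}) \<and> closure {x. \<phi> x \<noteq> 0} \<subseteq> G"

definition weak_gradient :: "'a::euclidean_space set \<Rightarrow> ('a \<Rightarrow> real) \<Rightarrow> ('a \<Rightarrow> 'a) \<Rightarrow> bool" where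
  "weak_gradient G v w \<longleftrightarrow> (\<forall>\<phi>. test_function G \<phi> \<longrightarrow> (\<forall>b\<in>Basis.
      (LINT x : G | lebesgue. v x * frechet_derivative \<phi> (at x) b)
        = - (LINT x : G | lebesgue. (w x \<bullet> b) * \<phi> x)))"

definition Lp_real :: "real \<Rightarrow> 'a::euclidean_space set \<Rightarrow> ('a \<Rightarrow> real) \<Rightarrow> bool" where
  "Lp_real p E f \<longleftrightarrow> f \<in> borel_measurable (restrict_space lebesgue E) \<and>
     set_nn_integral lebesgue E (\<lambda>x. ennreal (\<bar>f x\<bar> powr p)) < \<infinity>"

definition Lp_vec :: "real \<Rightarrow> 'a::euclidean_space set \<Rightarrow> ('a \<Rightarrow> 'a) \<Rightarrow> bool" where
  "Lp_vec p E f \<longleftrightarrow> f \<in> borel_measurable (restrict_space lebesgue E) \<and>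
     set_nn_integral lebesgue E (\<lambda>x. ennreal (norm (f x) powr p)) < \<infinity>"

definition sobolev_classical :: "real \<Rightarrow> 'a::euclidean_space set \<Rightarrow> ('a \<Rightarrow> real) \<Rightarrow> ('a \<Rightarrow> 'a) \<Rightarrow> bool" where
  "sobolev_classical p G v w \<longleftrightarrow> open G \<and> Lp_real p G v \<and> Lp_vec p G w \<and> weak_gradient G v w"

definition Lp_ereal :: "real \<Rightarrow> 'a::euclidean_space set \<Rightarrow> ('a \<Rightarrow> ereal) \<Rightarrow> bool" where
  "Lp_ereal p E u \<longleftrightarrow> u \<in> borel_measurable (restrict_space lebesgue E) \<and>
     set_nn_integral lebesgue E (\<lambda>x. enn_pow (eabs_enn (u x)) p) < \<infinity>"

definition fine_gradient :: "real \<Rightarrow> 'a::euclidean_space set \<Rightarrow> ('a \<Rightarrow> ereal) \<Rightarrow> ('a \<Rightarrow> 'a) \<Rightarrow> bool" where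
  "fine_gradient p U u D \<longleftrightarrow> Lp_ereal p U u \<and> Lp_vec p U D \<and>
     (\<exists>\<B>. quasicovering p U \<B> \<and>
        (\<forall>V\<in>\<B>. \<exists>G uV wV. V \<subseteq> G \<and> sobolev_classical p G uV wV \<and>
           (AE x in lebesgue. x \<in> V \<longrightarrow> u x = ereal (uV x)) \<and>
           (AE x in lebesgue. x \<in> V \<longrightarrow> D x = wV x)))"

definition W1p_KM :: "real \<Rightarrow> 'a::euclidean_space set \<Rightarrow> ('a \<Rightarrow> ereal) \<Rightarrow> bool" where
  "W1p_KM p U u \<longleftrightarrow> (\<exists>D. fine_gradient p U u D)"

definition W1p_KM_norm :: "real \<Rightarrow> 'a::euclidean_space set \<Rightarrow> ('a \<Rightarrow> ereal) \<Rightarrow> ('a \<Rightarrow> 'a) \<Rightarrow> real" where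
  "W1p_KM_norm p U u D = enn2real
     (set_nn_integral lebesgue U (\<lambda>x. enn_pow (eabs_enn (u x)) p)
      + set_nn_integral lebesgue U (\<lambda>x. ennreal (norm (D x) powr p))) powr (1 / p)"

end

theory Submission
  imports Defs "HOL-Complex_Analysis.Great_Picard"
begin

text \<open>
 Exceptional families of curves are those on which some \<open>L\<^sup>p\<close> density has infinite integral.

 A function with fine gradient \<open>D\<close> that is quasicontinuous is, on almost every curve, continuous and locally
 a limit of mollifications of the local Sobolev representatives, so \<open>norm D\<close> is an upper gradient up to an
 exceptional family, which costs arbitrarily little energy.

 Conversely, \<open>u\<close> with an upper gradient \<open>g\<close> is truncated and multiplied by cutoffs that live in \<open>U\<close>; these are
 built from capacity potentials of the open sets \<open>G\<close> with \<open>U \<union> G\<close> open. The products are Newtonian functions on the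
 whole space. Such functions have a weak gradient bounded by \<open>g\<close> (directional difference quotients of
 mollifications and a Mazur argument), and are quasicontinuous, because a null set met by almost no curve has open
 neighbourhoods of arbitrarily small capacity: the minimal cost of leaving such a neighbourhood along curves
 serves as a test function. Weak gradients agree almost everywhere on the set where the functions agree, so the
 pieces glue to a fine gradient, and every fine gradient is bounded by every \<open>p\<close>-integrable upper gradient.
\<close>

text \<open>Equality of the norms, not mere equivalence, forces both comparisons to hold with
  constant 1. The cutoffs threaten this: truncating and multiplying adds a term with the gradient of
  the cutoff. Where the cutoff is identically 1 that term may be scaled by any positive constant,
  and since the weak gradient of the product is unique up to null sets, it disappears in the limit.

  A second obstacle is that upper gradients see every point of a curve, mollifications only almost
  every point. Statements are carried from almost every to every parameter of almost every curve by
  continuity along the curve. Families of curves are the right tool because a curve that meets all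
  members of a sequence of sets with fast decreasing capacities has infinite integral of one fixed
  density of finite energy; along all other curves quasiopen and quasicontinuous mean open and
  continuous.

  Upper gradients must be Borel, while quasiopen sets are only Lebesgue measurable; hence the many
  Borel majorants and representatives.\<close>

abbreviation Borel :: "('a::topological_space => 'b::topological_space) => bool" where
 "Borel f \<equiv> f \<in> borel_measurable borel"

section \<open>Powers and p-energies with values in the extended half-line\<close>

lemma enn_pow_ennreal: "0 <= r ==> enn_pow (ennreal r) p = ennreal (r powr p)"
 by (simp add: enn_pow_def)

lemma power_powr: "0 < x ==> (x ^ n) powr p = (x powr p) ^ n" for x :: real
 by (induction n) (simp_all add: powr_mult)

lemma enn_pow_0[simp]: "enn_pow 0 p = 0"
 by (simp add: enn_pow_def)

lemma enn_pow_top[simp]: "enn_pow top p = top"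
 by (simp add: enn_pow_def)

lemma enn_pow_1[simp]: "enn_pow 1 p = 1"
 by (simp add: enn_pow_def)

lemma enn_pow_mono: "0 < p ==> x <= y ==> enn_pow x p <= enn_pow y p"
 by (cases x; cases y) (auto simp: enn_pow_ennreal top_unique intro!: powr_mono2)

lemma enn_pow_measurable[measurable]:
 assumes [measurable]: "f \<in> borel_measurable M"
 shows "(%x. enn_pow (f x) p) \<in> borel_measurable M"
 unfolding enn_pow_def by measurable

lemma enn_pow_inverse: "0 < p ==> enn_pow (enn_pow x p) (1/p) = x"
 by (cases x) (auto simp: enn_pow_ennreal powr_powr)

lemma enn_pow_inverse': "0 < p ==> enn_pow (enn_pow x (1/p)) p = x"
 using enn_pow_inverse[of "1/p" x] by simp

text \<open>Raising to a positive power is an order isomorphism of the extended half-line. In this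
  adjoint form it moves through suprema, which \<open>enn_pow_SUP_le\<close> exploits.\<close>

lemma enn_pow_le_iff: "0 < p ==> enn_pow x p <= y \<longleftrightarrow> x <= enn_pow y (1/p)"
 using enn_pow_mono[of p x "enn_pow y (1/p)"] enn_pow_mono[of "1/p" "enn_pow x p" y]
 by (auto simp: enn_pow_inverse enn_pow_inverse')

lemma enn_pow_mult: "0 <= c ==> 0 < p ==> enn_pow (ennreal c * x) p = ennreal (c powr p) * enn_pow x p"
 by (cases x; cases "c = 0")
  (auto simp: enn_pow_ennreal ennreal_mult'[symmetric] powr_mult ennreal_mult_top)

lemma enn_pow_eq_top_iff: "enn_pow x p = top \<longleftrightarrow> x = top"
 by (cases x) (auto simp: enn_pow_ennreal)

lemma enn_pow_SUP_le: "0 < p ==> (\<And>i. i \<in> I ==> enn_pow (f i) p <= y) ==> enn_pow (SUP i\<in>I. f i) p <= y"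
 by (auto simp: enn_pow_le_iff intro!: SUP_least)

lemma enn_pow_SUP_le_suminf:
 assumes "0 < p" shows "enn_pow (SUP i. f i) p <= (\<Sum>i::nat. enn_pow (f i) p)"
proof (intro enn_pow_SUP_le assms)
 fix i show "enn_pow (f i) p <= (\<Sum>i. enn_pow (f i) p)"
  using sum_le_suminf[of "%i. enn_pow (f i) p" "{i}"] by simp
qed

text \<open>Each term is at most \<open>(1/2) ^ Suc k\<close> times the supremum on the right, and
  these weights add up to 1. Unlike a sum, a supremum commutes with powers.\<close>

lemma suminf_le_weighted_SUP: "(\<Sum>k. a k) <= (SUP k. ennreal (2 ^ Suc k) * a k)"
proof -
 define S where "S = (SUP k. ennreal (2 ^ Suc k) * a k)"
 have "a k <= ennreal ((1/2) ^ Suc k) * S" for k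
 proof -
  have "ennreal ((1/2) ^ Suc k) * (ennreal (2 ^ Suc k) * a k) <= ennreal ((1/2) ^ Suc k) * S"
   unfolding S_def by (intro mult_left_mono SUP_upper) auto
  moreover have "ennreal ((1/2) ^ Suc k) * (ennreal (2 ^ Suc k) * a k) = a k"
   by (simp add: mult.assoc[symmetric] ennreal_mult'[symmetric] power_mult_distrib[symmetric] del: power_Suc)
  ultimately show ?thesis by simp
 qed
 then have "(\<Sum>k. a k) <= (\<Sum>k. ennreal ((1/2) ^ Suc k) * S)"
  by (intro suminf_le) auto
 also have "\<dots> = (\<Sum>k. ennreal ((1/2) ^ Suc k)) * S"
  by simp
 also have "(\<Sum>k. ennreal ((1/2) ^ Suc k)) = ennreal 1"
  by (intro suminf_ennreal_eq power_half_series) auto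
 finally show ?thesis by (simp add: S_def)
qed

text \<open>The sum is replaced by a weighted supremum, whose power is at most the sum of the powers
  of its members. The price is the factor \<open>(2 ^ Suc k) powr p\<close>, harmless for series
  whose energies decrease fast enough.\<close>

lemma enn_pow_suminf_le:
 assumes "0 < p"
 shows "enn_pow (\<Sum>k. a k) p <= (\<Sum>k. ennreal ((2 ^ Suc k) powr p) * enn_pow (a k) p)"
proof -
 have "enn_pow (\<Sum>k. a k) p <= enn_pow (SUP k. ennreal (2 ^ Suc k) * a k) p"
  by (intro enn_pow_mono assms suminf_le_weighted_SUP)
 also have "\<dots> <= (\<Sum>k. enn_pow (ennreal (2 ^ Suc k) * a k) p)"
  by (rule enn_pow_SUP_le_suminf[OF assms])
 finally show ?thesis using assms by (simp add: enn_pow_mult del: power_Suc)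
qed

lemma enn_pow_add_le:
 assumes "0 < p" shows "enn_pow (a + b) p <= ennreal (2 powr p) * (enn_pow a p + enn_pow b p)"
proof -
 have "a + b <= ennreal 2 * max a b"
  using add_mono[OF max.cobounded1[of a b] max.cobounded2[of b a]] by (simp add: mult_2)
 then have "enn_pow (a + b) p <= ennreal (2 powr p) * enn_pow (max a b) p"
  using enn_pow_mono[OF assms] enn_pow_mult[of 2 p "max a b"] assms by (metis zero_le_numeral)
 also have "\<dots> <= ennreal (2 powr p) * (enn_pow a p + enn_pow b p)"
  by (intro mult_left_mono) (auto simp: max_def intro: add_increasing add_increasing2)
 finally show ?thesis .
qed

text \<open>The p-th power of an L^p norm. Integration is over \<open>lborel\<close>, where Fubini
  and translations are at hand; by \<open>nn_integral_completion\<close> the value is the same over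
  \<open>lebesgue\<close>.\<close>

definition pint :: "real => ('a::euclidean_space => ennreal) => ennreal" where
 "pint p g = (\<integral>\<^sup>+x. enn_pow (g x) p \<partial>lborel)"

abbreviation pnorm :: "real => ('a::euclidean_space => 'b::real_normed_vector) => ennreal" where
 "pnorm p f \<equiv> pint p (%x. ennreal (norm (f x)))"

lemma pint_mono: "0 < p ==> (\<And>x. f x <= g x) ==> pint p f <= pint p g"
 unfolding pint_def by (intro nn_integral_mono enn_pow_mono) auto

lemma pint_mono_AE: "0 < p ==> AE x in lborel. f x <= g x ==> pint p f <= pint p g"
 unfolding pint_def by (intro nn_integral_mono_AE) (auto intro: enn_pow_mono)

lemma pint_cmult:
 assumes [measurable]: "Borel g" and "0 <= c" "0 < p"
 shows "pint p (%x. ennreal c * g x) = ennreal (c powr p) * pint p g"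
 unfolding pint_def using assms by (simp add: enn_pow_mult nn_integral_cmult)

lemma pint_add_le:
 assumes [measurable]: "Borel f" "Borel g" and "0 < p"
 shows "pint p (%x. f x + g x) <= ennreal (2 powr p) * (pint p f + pint p g)"
proof -
 have "pint p (%x. f x + g x) <= (\<integral>\<^sup>+x. ennreal (2 powr p) * (enn_pow (f x) p + enn_pow (g x) p) \<partial>lborel)"
  unfolding pint_def by (intro nn_integral_mono enn_pow_add_le assms)
 also have "\<dots> = ennreal (2 powr p) * (pint p f + pint p g)"
  unfolding pint_def by (simp add: nn_integral_cmult nn_integral_add)
 finally show ?thesis .
qed

lemma pint_add_finite:
 assumes "Borel f" "Borel g" and "0 < p"
  and "pint p f < \<infinity>" "pint p g < \<infinity>"
 shows "pint p (%x. f x + g x) < \<infinity>"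
 using pint_add_le[OF assms(1-3)] assms(4,5)
 by (auto simp: ennreal_mult_less_top elim!: le_less_trans)

lemma pint_cmult_finite:
 assumes "Borel g" and "0 <= c" "0 < p" "pint p g < \<infinity>"
 shows "pint p (%x. ennreal c * g x) < \<infinity>"
 using pint_cmult[OF assms(1-3)] assms(4) by (simp add: ennreal_mult_less_top)

lemma pint_suminf_le:
 assumes [measurable]: "\<And>k. Borel (g k)" and "0 < p"
 shows "pint p (%x. \<Sum>k. g k x) <= (\<Sum>k. ennreal ((2 ^ Suc k) powr p) * pint p (g k))"
proof -
 have "pint p (%x. \<Sum>k. g k x) <= (\<integral>\<^sup>+x. (\<Sum>k. ennreal ((2 ^ Suc k) powr p) * enn_pow (g k x) p) \<partial>lborel)"
  unfolding pint_def by (intro nn_integral_mono enn_pow_suminf_le assms)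
 also have "\<dots> = (\<Sum>k. ennreal ((2 ^ Suc k) powr p) * pint p (g k))"
  unfolding pint_def by (subst nn_integral_suminf) (auto simp: nn_integral_cmult)
 finally show ?thesis .
qed

lemma pint_SUP_le:
 assumes [measurable]: "\<And>k. Borel (g k)" and "0 < p"
 shows "pint p (%x. SUP k. g k x) <= (\<Sum>k::nat. pint p (g k))"
proof -
 have "pint p (%x. SUP k. g k x) <= (\<integral>\<^sup>+x. (\<Sum>k. enn_pow (g k x) p) \<partial>lborel)"
  unfolding pint_def by (intro nn_integral_mono enn_pow_SUP_le_suminf assms)
 also have "\<dots> = (\<Sum>k. pint p (g k))"
  unfolding pint_def by (subst nn_integral_suminf) auto
 finally show ?thesis .
qed

lemma pint_AE_finite:
 assumes [measurable]: "Borel g" and "pint p g < \<infinity>"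
 shows "AE x in lborel. g x \<noteq> \<infinity>"
proof -
 have "AE x in lborel. enn_pow (g x) p \<noteq> \<infinity>"
  using assms unfolding pint_def by (intro nn_integral_PInf_AE) auto
 then show ?thesis by (simp add: enn_pow_eq_top_iff)
qed

text \<open>The weight $2^{k+1}$ in \<open>enn_pow_suminf_le\<close> replaces Minkowski's inequality throughout:
 a series of functions with rapidly decreasing energies has finite energy.\<close>

lemma pint_suminf_fast:
 assumes [measurable]: "\<And>k. Borel (g k)" and "0 < p"
  and le: "\<And>k. pint p (g k) <= ennreal (((1/4) ^ Suc k) powr p)"
 shows "pint p (%x. \<Sum>k. g k x) < \<infinity>"
proof -
 have "pint p (%x. \<Sum>k. g k x) <= (\<Sum>k. ennreal ((2 ^ Suc k) powr p) * pint p (g k))"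
  by (intro pint_suminf_le assms)
 also have "\<dots> <= (\<Sum>k. ennreal ((1/2) powr p * ((1/2) powr p) ^ k))"
 proof (intro suminf_le)
  fix k
  have "ennreal ((2 ^ Suc k) powr p) * pint p (g k)
   <= ennreal ((2 ^ Suc k) powr p) * ennreal (((1/4) ^ Suc k) powr p)"
   by (intro mult_left_mono le) auto
  also have "\<dots> = ennreal (((1/2) ^ Suc k) powr p)"
  proof -
   have "(2::real) ^ Suc k * (1/4) ^ Suc k = (1/2) ^ Suc k"
    by (subst power_mult_distrib[symmetric]) simp
   then show ?thesis by (simp add: ennreal_mult'[symmetric] powr_mult[symmetric] del: power_Suc)
  qed
  also have "((1/2::real) ^ Suc k) powr p = (1/2) powr p * ((1/2) powr p) ^ k"
   by (subst power_powr) auto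
  finally show "ennreal ((2 ^ Suc k) powr p) * pint p (g k) <= ennreal ((1/2) powr p * ((1/2) powr p) ^ k)" .
 qed auto
 also have "\<dots> < \<infinity>"
 proof -
  have "(1/2) powr p < (1::real)" using powr_less_mono2[of p "1/2" 1] \<open>0 < p\<close> by simp
  then have "summable (%k. (1/2) powr p * ((1/2::real) powr p) ^ k)"
   by (intro summable_mult summable_geometric) simp
  then have "(\<Sum>k. ennreal ((1/2) powr p * ((1/2::real) powr p) ^ k)) = ennreal (\<Sum>k. (1/2) powr p * ((1/2::real) powr p) ^ k)"
   by (intro suminf_ennreal2) auto
  then show ?thesis using ennreal_less_top infinity_ennreal_def by metis
 qed
 finally show ?thesis .
qed

text \<open>Each density is scaled until its energy is below the threshold of
  \<open>pint_suminf_fast\<close>, and the scaled densities are added. Scaling by a positive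
  constant does not change which curves have finite integral, so one density controls countably
  many.\<close>

lemma pint_countable_majorant:
 assumes meas[measurable]: "\<And>k::nat. Borel (g k)" and p: "0 < p"
  and fin: "\<And>k. pint p (g k) < \<infinity>"
 obtains \<rho> where "Borel \<rho>" "pint p \<rho> < \<infinity>"
  "\<And>k. \<exists>c>0. \<forall>x. ennreal c * g k x <= \<rho> x"
proof -
 have "\<exists>c>0. pint p (%x. ennreal c * g k x) <= ennreal (((1/4) ^ Suc k) powr p)" for k
 proof -
  define P where "P = enn2real (pint p (g k)) + 1"
  have "pint p (g k) = ennreal (enn2real (pint p (g k)))"
   using fin[of k] by (simp add: less_top)
  also have "\<dots> <= ennreal P"
   by (intro ennreal_leI) (simp add: P_def)
  finally have P2: "pint p (g k) <= ennreal P" .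
  have "P > 0" unfolding P_def by (intro add_nonneg_pos) auto
  note P = this P2
  \<comment> \<open>\<open>(1/P) powr (1/p)\<close> brings the energy down to at most 1, and
    \<open>(1/4) ^ Suc k\<close> supplies the fast decay. The summand 1 in \<open>P\<close> keeps it
    positive.\<close>
  define c where "c = (1/4) ^ Suc k * (1/P) powr (1/p)"
  have "c > 0" using P by (simp add: c_def)
  moreover have "pint p (%x. ennreal c * g k x) <= ennreal (c powr p) * ennreal P"
   using \<open>c > 0\<close> p P by (simp add: pint_cmult mult_left_mono)
  moreover have "c powr p * P = ((1/4) ^ Suc k) powr p"
   using P p unfolding c_def by (subst powr_mult) (auto simp: powr_powr)
  moreover have "ennreal (c powr p) * ennreal P = ennreal (c powr p * P)"
   using P by (simp add: ennreal_mult')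
  ultimately have "c > 0 \<and> pint p (%x. ennreal c * g k x) <= ennreal (((1/4) ^ Suc k) powr p)" by simp
  then show ?thesis by blast
 qed
 then obtain c where c: "\<And>k. c k > 0" "\<And>k. pint p (%x. ennreal (c k) * g k x) <= ennreal (((1/4) ^ Suc k) powr p)"
  by metis
 show thesis
 proof (rule that[of "%x. \<Sum>k. ennreal (c k) * g k x"])
  show "pint p (%x. \<Sum>k. ennreal (c k) * g k x) < \<infinity>"
   by (rule pint_suminf_fast) (use p c in auto)
  fix k
  show "\<exists>c'>0. \<forall>x. ennreal c' * g k x <= (\<Sum>k. ennreal (c k) * g k x)"
   using c(1)[of k] sum_le_suminf[of "%k. ennreal (c k) * g k _" "{k}"] by (intro exI[of _ "c k"]) auto
 qed auto
qed

section \<open>Curves and exceptional families\<close>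

text \<open>Shifting partitions gives one inequality for every curve and every shift; the reverse
  one is the same inequality for the shifted curve and the shift \<open>-c\<close>.\<close>

lemma curve_length_shift: "curve_length (%t. Y (c + t)) a b = curve_length Y (c + a) (c + b)"
proof -
 have le: "curve_length (%t. Y (c + t)) a b <= curve_length Y (c + a) (c + b)" for Y :: "real => 'a" and a b c
  unfolding curve_length_def
 proof (intro SUP_least)
  fix mt assume mt: "mt \<in> {(m, t). t 0 = a \<and> t m = b \<and> (\<forall>i<m. t i <= (t (Suc i) :: real))}"
  show "ennreal (\<Sum>i<fst mt. dist (Y (c + snd mt i)) (Y (c + snd mt (Suc i))))
   <= (SUP mt\<in>{(m, t). t 0 = c + a \<and> t m = c + b \<and> (\<forall>i<m. t i <= t (Suc i))}.
     ennreal (\<Sum>i<fst mt. dist (Y (snd mt i)) (Y (snd mt (Suc i)))))"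
   by (rule SUP_upper2[of "(fst mt, %i. c + snd mt i)"]) (use mt in auto)
 qed
 show ?thesis
  using le[of Y c a b] le[of "%t. Y (c + t)" "-c" "c + a" "c + b"] by auto
qed

lemma dist_le_curve_length: "a <= b ==> ennreal (dist (Y a) (Y b)) <= curve_length Y a b"
 unfolding curve_length_def
 by (rule SUP_upper2[of "(1, %i. if i = 0 then a else b)"]) auto

lemma arclength_dist_le:
 assumes "arclength_curve_in E Y l" "0 <= s" "s <= l" "0 <= t" "t <= l"
 shows "dist (Y s) (Y t) <= \<bar>s - t\<bar>"
proof -
 have *: "dist (Y s) (Y t) <= t - s" if "0 <= s" "s <= t" "t <= l" for s t
  using dist_le_curve_length[of s t Y] assms(1) that by (auto simp: arclength_curve_in_def)
 show ?thesis using *[of s t] *[of t s] assms by (auto simp: dist_commute abs_if)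
qed

lemma arclength_continuous_on: "arclength_curve_in E Y l ==> continuous_on {0..l} Y"
 by (rule continuous_onI, rename_tac x \<epsilon>, rule_tac x="\<epsilon>" in exI)
  (auto intro!: order_trans[OF arclength_dist_le] simp: dist_real_def)

lemma arclength_mono: "arclength_curve_in E Y l ==> E \<subseteq> F ==> arclength_curve_in F Y l"
 by (auto simp: arclength_curve_in_def)

lemma arclength_UNIV: "arclength_curve_in E Y l ==> arclength_curve_in UNIV Y l"
 by (rule arclength_mono) auto

lemma arclength_restrict: "arclength_curve_in UNIV Y l ==> Y ` {0..l} \<subseteq> E ==> arclength_curve_in E Y l"
 by (auto simp: arclength_curve_in_def)

lemma arclength_subcurve:
 assumes "arclength_curve_in E Y l" "0 <= a" "a < b" "b <= l"
 shows "arclength_curve_in E (%t. Y (a + t)) (b - a)"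
 using assms by (force simp: arclength_curve_in_def curve_length_shift)

text \<open>Integral along the part of a curve between two parameters. Subcurves are then treated
  without reparametrization; \<open>lint_subcurve\<close> links this to
  \<open>line_integral\<close>.\<close>

definition lint :: "('a => ennreal) => (real => 'a) => real => real => ennreal" where
 "lint g Y a b = (\<integral>\<^sup>+t\<in>{a..b}. g (Y t) \<partial>lborel)"

lemma line_integral_eq_lint: "line_integral g Y l = lint g Y 0 l"
 by (simp add: line_integral_def lint_def)

lemma lint_subcurve_gen:
 assumes "Borel (%t. g (Y t) * indicator {a..b} t)"
 shows "line_integral g (%t. Y (a + t)) (b - a) = lint g Y a b"
 unfolding line_integral_def lint_def
 by (subst nn_integral_real_affine[OF assms, of 1 a]) (auto intro!: nn_integral_cong simp: indicator_def)

lemma measurable_restrict_compose_curve: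
 fixes g :: "'a::euclidean_space => ennreal"
 assumes g: "g \<in> borel_measurable (restrict_space borel E)" and "arclength_curve_in E Y l" "0 <= a" "b <= l"
 shows "Borel (%t. g (Y t) * indicator {a..b} t)"
proof -
 have "continuous_on {a..b} Y"
  using arclength_continuous_on[OF assms(2)] by (rule continuous_on_subset) (use assms in auto)
 then have "Y \<in> measurable (restrict_space borel {a..b}) borel"
  by (rule borel_measurable_continuous_on_restrict)
 then have "Y \<in> measurable (restrict_space borel {a..b}) (restrict_space borel E)"
  using assms by (intro measurable_restrict_space2) (auto simp: arclength_curve_in_def space_restrict_space)
 from measurable_compose[OF this g]
 have "(%t. g (Y t)) \<in> borel_measurable (restrict_space borel {a..b})" .
 then show ?thesis
  by (simp add: borel_measurable_restrict_space_iff_ennreal)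
qed

lemma measurable_compose_curve:
 fixes g :: "'a::euclidean_space => ennreal"
 assumes "Borel g" and "arclength_curve_in E Y l" "0 <= a" "b <= l"
 shows "Borel (%t. g (Y t) * indicator {a..b} t)"
 using measurable_restrict_compose_curve[of g UNIV Y l a b] assms arclength_UNIV[of E Y l] by auto

lemma lint_subcurve:
 assumes "g \<in> borel_measurable (restrict_space borel E)" "arclength_curve_in E Y l" "0 <= a" "b <= l"
 shows "line_integral g (%t. Y (a + t)) (b - a) = lint g Y a b"
 by (rule lint_subcurve_gen) (use assms measurable_restrict_compose_curve in blast)

lemma lint_mono_interval: "a' <= a ==> b <= b' ==> lint g Y a b <= lint g Y a' b'"
 unfolding lint_def by (intro nn_integral_mono) (auto simp: indicator_def)

lemma lint_mono: "(\<And>t. a <= t ==> t <= b ==> g (Y t) <= h (Y t)) ==> lint g Y a b <= lint h Y a b"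
 unfolding lint_def by (intro nn_integral_mono) (auto simp: indicator_def)

lemma lint_mono_AE:
 assumes "AE t in lborel. a <= t \<and> t <= b --> g (Y t) <= h (Y t)"
 shows "lint g Y a b <= lint h Y a b"
 unfolding lint_def by (intro nn_integral_mono_AE) (use assms in \<open>auto simp: indicator_def\<close>)

lemma lint_self[simp]: "lint g Y a a = 0"
proof -
 have "AE t in lborel. t \<noteq> a" by (rule AE_lborel_singleton)
 then have "lint g Y a a = (\<integral>\<^sup>+t. 0 \<partial>(lborel :: real measure))"
  unfolding lint_def by (intro nn_integral_cong_AE) (auto simp: indicator_def)
 then show ?thesis by simp
qed

lemma lint_add:
 assumes g: "Borel g" and c: "arclength_curve_in E Y l" and "0 <= a" "a <= b" "b <= c" "c <= l"
 shows "lint g Y a b + lint g Y b c = lint g Y a c"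
proof -
 note m = measurable_compose_curve[OF g c]
 have "lint g Y a b + lint g Y b c = (\<integral>\<^sup>+t. g (Y t) * indicator {a..b} t + g (Y t) * indicator {b..c} t \<partial>lborel)"
  unfolding lint_def by (subst nn_integral_add) (use m assms in auto)
 also have "\<dots> = lint g Y a c"
  unfolding lint_def
 proof (rule nn_integral_cong_AE)
  have "AE t in lborel. t \<noteq> b" by (rule AE_lborel_singleton)
  then show "AE t in lborel. g (Y t) * indicator {a..b} t + g (Y t) * indicator {b..c} t
   = g (Y t) * indicator {a..c} t"
   using assms by (auto simp: indicator_def)
 qed
 finally show ?thesis .
qed

lemma lint_add_fun:
 assumes "Borel g" "Borel h" "arclength_curve_in E Y l" "0 <= a" "b <= l"
 shows "lint (%x. g x + h x) Y a b = lint g Y a b + lint h Y a b"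
 unfolding lint_def using measurable_compose_curve[OF assms(1,3-5)] measurable_compose_curve[OF assms(2-5)]
 by (subst nn_integral_add[symmetric]) (auto intro!: nn_integral_cong simp: indicator_def)

lemma lint_cmult:
 assumes "Borel g" "arclength_curve_in E Y l" "0 <= a" "b <= l"
 shows "lint (%x. c * g x) Y a b = c * lint g Y a b"
 unfolding lint_def using measurable_compose_curve[OF assms]
 by (subst nn_integral_cmult[symmetric]) (auto intro!: nn_integral_cong simp: indicator_def mult_ac)

text \<open>Absolute continuity at one parameter: the measure with density \<open>g\<close> along
  the curve is finite, the intervals around \<open>s\<close> shrink to a single point, and points
  carry no mass.\<close>

lemma lint_small:
 assumes g: "Borel g" and c: "arclength_curve_in E Y l" and fin: "lint g Y 0 l < \<infinity>"
  and e: "0 < e"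
 obtains d where "d > 0" "\<And>a b. 0 <= a ==> b <= l ==> s - d <= a ==> b <= s + d ==> lint g Y a b < e"
proof -
 define h where "h = (%t. g (Y t) * indicator {0..l} t)"
 have h[measurable]: "Borel h"
  unfolding h_def using measurable_compose_curve[OF g c] by simp
 define M where "M = density lborel h"
 define A where "A n = {s - 1 / Suc n .. s + 1 / Suc n}" for n :: nat
 have "emeasure M UNIV = (\<integral>\<^sup>+t. h t \<partial>lborel)"
  unfolding M_def by (subst emeasure_density) auto
 then have "emeasure M UNIV = lint g Y 0 l"
  by (simp add: lint_def h_def)
 with fin have finM: "emeasure M X \<noteq> \<infinity>" for X
  using emeasure_space[of M X] by (auto simp: M_def top_unique)
 have lim: "(%n. emeasure M (A n)) \<longlonglongrightarrow> emeasure M (\<Inter>n. A n)"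
 proof (rule Lim_emeasure_decseq)
  show "decseq A" unfolding A_def decseq_def
  proof (safe)
   fix m n x assume *: "(m::nat) <= n" "x \<in> {s - 1 / real (Suc n)..s + 1 / real (Suc n)}"
   then have "1 / real (Suc n) <= 1 / real (Suc m)" by (simp add: field_simps)
   with * show "x \<in> {s - 1 / real (Suc m)..s + 1 / real (Suc m)}" by auto
  qed
 qed (use finM in \<open>auto simp: M_def A_def\<close>)
 have "(\<Inter>n. A n) \<subseteq> {s}"
 proof
  fix x assume x: "x \<in> (\<Inter>n. A n)"
  show "x \<in> {s}"
  proof (rule ccontr)
   assume "x \<notin> {s}"
   then have "\<bar>x - s\<bar> > 0" by auto
   then obtain n where "1 / Suc n < \<bar>x - s\<bar>" using nat_approx_posE by blast
   moreover have "x \<in> A n" using x by auto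
   ultimately show False unfolding A_def by (auto simp: abs_if split: if_splits)
  qed
 qed
 then have le: "emeasure M (\<Inter>n. A n) <= emeasure M {s}"
  by (intro emeasure_mono) (auto simp: M_def)
 have "emeasure M {s} = 0"
  unfolding M_def by (subst emeasure_density) (auto simp: nn_integral_indicator_singleton)
 with lim le have "(%n. emeasure M (A n)) \<longlonglongrightarrow> 0" by simp
 from order_tendstoD(2)[OF this e] obtain n where n: "emeasure M (A n) < e"
  by (auto simp: eventually_sequentially)
 show thesis
 proof (rule that[of "1 / Suc n"])
  fix a b assume ab: "0 <= a" "b <= l" "s - 1 / Suc n <= a" "b <= s + 1 / Suc n"
  have "emeasure M (A n) = (\<integral>\<^sup>+t. h t * indicator (A n) t \<partial>lborel)"
   unfolding M_def by (subst emeasure_density) (auto simp: A_def)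
  moreover have "lint g Y a b <= (\<integral>\<^sup>+t. h t * indicator (A n) t \<partial>lborel)"
   unfolding lint_def by (intro nn_integral_mono) (use ab in \<open>auto simp: A_def h_def indicator_def\<close>)
  ultimately have "lint g Y a b <= emeasure M (A n)" by simp
  with n show "lint g Y a b < e" by simp
 qed simp
qed

lemma ediff_ereal[simp]: "ediff (ereal a) (ereal b) = ennreal \<bar>a - b\<bar>"
 by (simp add: ediff_def)

text \<open>Upper gradients of finite functions on the whole space, phrased with real differences in
  place of \<open>ediff\<close>; \<open>upper_gradient_UNIV_iff\<close> is the translation.\<close>

definition ugrad :: "('a::euclidean_space => real) => ('a => ennreal) => bool" where
 "ugrad f g \<longleftrightarrow> Borel g \<and>
  (\<forall>Y l. arclength_curve_in UNIV Y l --> ennreal \<bar>f (Y 0) - f (Y l)\<bar> <= line_integral g Y l)"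

lemma restrict_borel_UNIV[simp]: "restrict_space borel UNIV = (borel :: 'a::topological_space measure)"
 by (rule measure_eqI) (auto simp: sets_restrict_space emeasure_restrict_space)

lemma upper_gradient_UNIV_iff: "upper_gradient UNIV (%x. ereal (f x)) g \<longleftrightarrow> ugrad f g"
 by (simp add: upper_gradient_def ugrad_def)

lemma ugrad_measurable[measurable_dest]: "ugrad f g ==> Borel g"
 by (simp add: ugrad_def)

lemma upper_gradient_subcurve:
 assumes u: "upper_gradient E f g" and c: "arclength_curve_in E Y l" and ab: "0 <= a" "a < b" "b <= l"
 shows "ediff (f (Y a)) (f (Y b)) <= lint g Y a b"
proof -
 have "ediff (f (Y (a + 0))) (f (Y (a + (b - a)))) <= line_integral g (%t. Y (a + t)) (b - a)"
  using u arclength_subcurve[OF c ab] unfolding upper_gradient_def by blast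
 also have "\<dots> = lint g Y a b"
  using u c ab by (intro lint_subcurve) (auto simp: upper_gradient_def)
 finally show ?thesis by simp
qed

lemma ugrad_subcurve:
 assumes u: "ugrad f g" and c: "arclength_curve_in E Y l" and ab: "0 <= a" "a <= b" "b <= l"
 shows "ennreal \<bar>f (Y a) - f (Y b)\<bar> <= lint g Y a b"
proof (cases "a = b")
 case False
 then show ?thesis
  using upper_gradient_subcurve[of UNIV "%x. ereal (f x)" g Y l a b] assms arclength_UNIV[OF c]
  by (simp add: upper_gradient_UNIV_iff)
qed simp

lemma ugradI:
 assumes "Borel g"
  and "\<And>Y l. arclength_curve_in UNIV Y l ==> ennreal \<bar>f (Y 0) - f (Y l)\<bar> <= lint g Y 0 l"
 shows "ugrad f g"
 using assms by (simp add: ugrad_def line_integral_eq_lint)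

lemma ugrad_contraction:
 assumes "ugrad f g" "\<And>x y. \<bar>f' x - f' y\<bar> <= \<bar>f x - f y\<bar>" shows "ugrad f' g"
 using assms unfolding ugrad_def by (meson ennreal_leI order_trans)

lemma ugrad_add:
 assumes "ugrad f g" "ugrad f' g'" "\<And>x y. \<bar>h x - h y\<bar> <= \<bar>f x - f y\<bar> + \<bar>f' x - f' y\<bar>"
 shows "ugrad h (%x. g x + g' x)"
proof (rule ugradI)
 fix Y :: "real => 'a" and l assume c: "arclength_curve_in UNIV Y l"
 have l: "0 <= l" using c by (auto simp: arclength_curve_in_def)
 have "ennreal \<bar>h (Y 0) - h (Y l)\<bar> <= ennreal \<bar>f (Y 0) - f (Y l)\<bar> + ennreal \<bar>f' (Y 0) - f' (Y l)\<bar>"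
  using ennreal_leI[OF assms(3)[of "Y 0" "Y l"]] by simp
 also have "\<dots> <= lint g Y 0 l + lint g' Y 0 l"
  using assms ugrad_subcurve[OF _ c] l by (intro add_mono) auto
 also have "\<dots> = lint (%x. g x + g' x) Y 0 l"
  using assms c l by (subst lint_add_fun) (auto dest: ugrad_measurable)
 finally show "ennreal \<bar>h (Y 0) - h (Y l)\<bar> <= lint (%x. g x + g' x) Y 0 l" .
qed (use assms in \<open>auto dest: ugrad_measurable\<close>)

lemma ugrad_scale:
 assumes "ugrad f g" "0 <= c" shows "ugrad (%x. c * f x) (%x. ennreal c * g x)"
proof (rule ugradI)
 fix Y :: "real => 'a" and l assume c: "arclength_curve_in UNIV Y l"
 have l: "0 <= l" using c by (auto simp: arclength_curve_in_def)
 have "ennreal \<bar>c * f (Y 0) - c * f (Y l)\<bar> = ennreal c * ennreal \<bar>f (Y 0) - f (Y l)\<bar>"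
  using assms by (simp add: ennreal_mult'[symmetric] abs_mult right_diff_distrib[symmetric])
 also have "\<dots> <= ennreal c * lint g Y 0 l"
  using assms ugrad_subcurve[OF _ c] l by (intro mult_left_mono) auto
 finally show "ennreal \<bar>c * f (Y 0) - c * f (Y l)\<bar> <= lint (%x. ennreal c * g x) Y 0 l"
  using assms c l by (subst lint_cmult) (auto dest: ugrad_measurable)
qed (use assms in \<open>auto dest: ugrad_measurable\<close>)

text \<open>Increments are bounded by integrals of \<open>g\<close> over short parameter intervals,
  and these are small by \<open>lint_small\<close>. If \<open>g\<close> has finite energy, the
  hypothesis on its integral holds on almost every curve.\<close>

lemma ugrad_continuous_on_curve:
 assumes "ugrad f g" "arclength_curve_in E Y l" "lint g Y 0 l < \<infinity>"
 shows "continuous_on {0..l} (%t. f (Y t))"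
proof (rule continuous_onI)
 fix s e assume s: "s \<in> {0..l}" and e: "0 < (e::real)"
 obtain d where d: "d > 0" "\<And>a b. 0 <= a ==> b <= l ==> s - d <= a ==> b <= s + d ==> lint g Y a b < ennreal e"
  using lint_small[of g E Y l "ennreal e" s] assms e by (auto simp: ugrad_measurable)
 have "dist (f (Y t)) (f (Y s)) <= e" if t: "t \<in> {0..l}" "dist t s < d" for t
 proof (cases "t <= s")
  case True
  have "ennreal \<bar>f (Y t) - f (Y s)\<bar> <= lint g Y t s"
   using ugrad_subcurve[OF assms(1,2), of t s] s t True by auto
  also have "\<dots> < ennreal e"
   using d s t True by (intro d(2)) (auto simp: dist_real_def)
  finally show ?thesis using e by (simp add: dist_real_def ennreal_less_iff)
 next
  case False
  have "ennreal \<bar>f (Y s) - f (Y t)\<bar> <= lint g Y s t"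
   using ugrad_subcurve[OF assms(1,2), of s t] s t False by auto
  also have "\<dots> < ennreal e"
   using d s t False by (intro d(2)) (auto simp: dist_real_def)
  finally show ?thesis using e by (simp add: dist_real_def ennreal_less_iff)
 qed
 with d(1) show "\<exists>d>0. \<forall>t\<in>{0..l}. dist t s < d --> dist (f (Y t)) (f (Y s)) <= e" by blast
qed

text \<open>\<open>pae p P\<close>: the property \<open>P\<close> holds for all curves outside a family of zero \<open>p\<close>-modulus.\<close>

definition pae :: "real => ((real => 'a::euclidean_space) => real => bool) => bool" where
 "pae p P \<longleftrightarrow> (\<exists>\<rho>\<in>borel_measurable borel. pint p \<rho> < \<infinity> \<and>
  (\<forall>Y l. arclength_curve_in UNIV Y l --> lint \<rho> Y 0 l < \<infinity> --> P Y l))"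

lemma pae_finite:
 "Borel g ==> pint p g < \<infinity> ==> pae p (%Y l. lint g Y 0 l < \<infinity>)"
 unfolding pae_def by blast

lemma pae_mono:
 "pae p P ==> (\<And>Y l. arclength_curve_in UNIV Y l ==> P Y l ==> Q Y l) ==> pae p Q"
 unfolding pae_def by blast

text \<open>Countable subadditivity of the modulus. A curve that violates some \<open>P k\<close>
  has infinite integral of \<open>g k\<close>, hence also of the common majorant, which dominates
  each \<open>g k\<close> up to a positive constant.\<close>

lemma pae_all:
 assumes p: "0 < p" and P: "\<And>k::nat. pae p (P k)"
 shows "pae p (%Y l. \<forall>k. P k Y l)"
proof -
 obtain g where g[measurable]: "\<And>k. Borel (g k)" and fin: "\<And>k. pint p (g k) < \<infinity>"
  and gP: "\<And>k Y l. arclength_curve_in UNIV Y l ==> lint (g k) Y 0 l < \<infinity> ==> P k Y l"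
  using P unfolding pae_def by metis
 obtain \<rho> where \<rho>: "Borel \<rho>" "pint p \<rho> < \<infinity>" "\<And>k. \<exists>c>0. \<forall>x. ennreal c * g k x <= \<rho> x"
  by (rule pint_countable_majorant[OF g p fin]) (rule that)
 show ?thesis unfolding pae_def
 proof (intro bexI[of _ \<rho>] conjI allI impI \<rho>)
  fix Y :: "real => 'a" and l k assume c: "arclength_curve_in UNIV Y l" and l: "lint \<rho> Y 0 l < \<infinity>"
  obtain c where c0: "c > 0" "\<And>x. ennreal c * g k x <= \<rho> x" using \<rho>(3) by blast
  have "ennreal c * lint (g k) Y 0 l = lint (%x. ennreal c * g k x) Y 0 l"
   by (rule lint_cmult[symmetric]) (use c in auto)
  also have "\<dots> <= lint \<rho> Y 0 l"
   by (rule lint_mono) (rule c0)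
  finally have "ennreal c * lint (g k) Y 0 l < \<infinity>" using l by simp
  then have "lint (g k) Y 0 l < \<infinity>" using c0(1) by (auto simp: ennreal_mult_less_top)
  then show "P k Y l" by (rule gP[OF c])
 qed
qed

lemma pae_conj:
 assumes "0 < p" "pae p P" "pae p Q"
 shows "pae p (%Y l. P Y l \<and> Q Y l)"
proof -
 have "pae p (%Y l. \<forall>k::nat. (if k = 0 then P else Q) Y l)"
  by (rule pae_all) (use assms in auto)
 then show ?thesis
 proof (rule pae_mono)
  fix Y l assume *: "\<forall>k::nat. (if k = 0 then P else Q) Y l"
  show "P Y l \<and> Q Y l" using spec[OF *, of 0] spec[OF *, of 1] by simp
 qed
qed

lemma pae_ball:
 assumes "0 < p" "countable I" "\<And>i. i \<in> I ==> pae p (P i)"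
 shows "pae p (%Y l. \<forall>i\<in>I. P i Y l)"
proof (cases "I = {}")
 case True
 have "pint p (%_. 0) < \<infinity>" by (simp add: pint_def)
 then show ?thesis using True unfolding pae_def by (intro bexI[of _ "%_. 0"]) auto
next
 case False
 have "pae p (%Y l. \<forall>k. P (from_nat_into I k) Y l)"
  by (rule pae_all) (use assms False in \<open>auto intro: from_nat_into\<close>)
 then show ?thesis
 proof (rule pae_mono, intro ballI)
  fix Y l i assume *: "\<forall>k. P (from_nat_into I k) Y l" and "i \<in> I"
  then obtain k where "from_nat_into I k = i" using from_nat_into_surj[OF assms(2)] by blast
  with * show "P i Y l" by blast
 qed
qed

text \<open>The density that is infinite on a Borel null set containing the bad points has zero
  energy. A curve on which its integral is finite spends almost no time in that set.\<close>

lemma pae_null: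
 assumes "AE x in lborel. Q x" "0 < p"
 shows "pae p (%Y l. AE t in lborel. 0 <= t \<and> t <= l --> Q (Y t))"
proof -
 obtain N where N: "N \<in> null_sets lborel" "{x. \<not> Q x} \<subseteq> N"
  using assms(1) by (rule AE_E) (auto simp: null_sets_def intro: that)
 define \<rho> :: "'a => ennreal" where "\<rho> x = \<infinity> * indicator N x" for x
 have [measurable]: "N \<in> sets borel" using N by auto
 have \<rho>[measurable]: "Borel \<rho>" unfolding \<rho>_def by measurable
 have "AE x in lborel. \<rho> x = 0"
  using AE_not_in[OF N(1)] by eventually_elim (simp add: \<rho>_def)
 then have "pint p \<rho> = (\<integral>\<^sup>+x. 0 \<partial>(lborel :: 'a measure))"
  unfolding pint_def by (intro nn_integral_cong_AE) auto
 then have "pint p \<rho> < \<infinity>" by simp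
 moreover have "AE t in lborel. 0 <= t \<and> t <= l --> Q (Y t)"
  if c: "arclength_curve_in UNIV Y l" and fin: "lint \<rho> Y 0 l < \<infinity>" for Y l
 proof -
  have "AE t in lborel. \<rho> (Y t) * indicator {0..l} t \<noteq> \<infinity>"
   using fin c unfolding lint_def by (intro nn_integral_PInf_AE) (auto intro!: measurable_compose_curve)
  then show ?thesis
   by eventually_elim (use N in \<open>auto simp: \<rho>_def indicator_def split: if_splits\<close>)
 qed
 ultimately show ?thesis unfolding pae_def by (intro bexI[OF _ \<rho>]) auto
qed

lemma curve_length_segment:
 assumes "norm e = 1" "s <= t"
 shows "curve_length (%t. x + t *\<^sub>R e) s t = ennreal (t - s)"
proof (rule antisym)
 show "curve_length (%t. x + t *\<^sub>R e) s t <= ennreal (t - s)"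
  unfolding curve_length_def
 proof (intro SUP_least)
  fix mt assume mt: "mt \<in> {(m, \<tau>). \<tau> 0 = s \<and> \<tau> m = t \<and> (\<forall>i<m. \<tau> i <= (\<tau> (Suc i) :: real))}"
  have "(\<Sum>i<fst mt. dist (x + snd mt i *\<^sub>R e) (x + snd mt (Suc i) *\<^sub>R e)) = (\<Sum>i<fst mt. snd mt (Suc i) - snd mt i)"
   using mt assms(1) by (intro sum.cong) (auto simp: dist_norm scaleR_diff_left[symmetric])
  also have "\<dots> = t - s" using mt by (subst sum_lessThan_telescope) auto
  finally show "ennreal (\<Sum>i<fst mt. dist (x + snd mt i *\<^sub>R e) (x + snd mt (Suc i) *\<^sub>R e)) <= ennreal (t - s)"
   by simp
 qed
 show "ennreal (t - s) <= curve_length (%t. x + t *\<^sub>R e) s t"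
  using dist_le_curve_length[of s t "%t. x + t *\<^sub>R e"] assms
  by (simp add: dist_norm scaleR_diff_left[symmetric])
qed

lemma arclength_segment:
 "norm e = 1 ==> 0 < l ==> arclength_curve_in UNIV (%t. x + t *\<^sub>R e) l"
 by (auto simp: arclength_curve_in_def curve_length_segment)

section \<open>Capacity\<close>

lemma restrict_lebesgue_UNIV[simp]: "restrict_space lebesgue UNIV = (lebesgue :: 'a::euclidean_space measure)"
 by (rule measure_eqI) (auto simp: sets_restrict_space emeasure_restrict_space)

lemma ediff_clamp_le: "ennreal \<bar>real_of_ereal (max (ereal (-m)) (min (ereal m) x)) - real_of_ereal (max (ereal (-m)) (min (ereal m) y))\<bar> <= ediff x y"
 by (cases x; cases y) (auto simp: ediff_def max_def min_def intro!: ennreal_leI)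

lemma ediff_clamp01_le: "ennreal \<bar>real_of_ereal (max 0 (min 1 x)) - real_of_ereal (max 0 (min 1 y))\<bar> <= ediff x y"
 by (cases x; cases y) (auto simp: ediff_def max_def min_def one_ereal_def zero_ereal_def intro!: ennreal_leI)

lemma energy_witness:
 assumes "N1p_energy p E f < c"
 obtains g where "upper_gradient E f g"
  "(\<integral>\<^sup>+x\<in>E. enn_pow (eabs_enn (f x)) p \<partial>lebesgue) + (\<integral>\<^sup>+x\<in>E. enn_pow (g x) p \<partial>lebesgue) < c"
proof -
 define A where "A = (\<integral>\<^sup>+x\<in>E. enn_pow (eabs_enn (f x)) p \<partial>lebesgue)"
 define B where "B g = (\<integral>\<^sup>+x\<in>E. enn_pow (g x) p \<partial>lebesgue)" for g
 have less: "A + (INF g\<in>{g. upper_gradient E f g}. B g) < c"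
  using assms unfolding N1p_energy_def A_def B_def .
 then have A: "A < \<infinity>"
  using less_top order_le_less_trans top.not_eq_extremum by fastforce
 have "(INF g\<in>{g. upper_gradient E f g}. B g) < c - A"
  using less A by (subst less_diff_eq_ennreal) (auto simp: add.commute)
 then obtain g where g: "upper_gradient E f g" "B g < c - A"
  by (auto simp: INF_less_iff)
 then have "A + B g < c" using A by (subst (asm) less_diff_eq_ennreal) (auto simp: add.commute)
 then show thesis using that g(1) unfolding A_def B_def by blast
qed

text \<open>Clamping an admissible function to values between 0 and 1 makes it equal to 1 on
  \<open>E\<close> and increases neither its modulus nor its increments. It also removes infinite
  values, so that capacities are handled with real-valued functions from here on.\<close>

lemma Cap_witness:
 fixes E :: "'a::euclidean_space set"
 assumes "Cap p E < c" "0 < p"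
 obtains v g where "v \<in> borel_measurable lebesgue" "\<And>x. 0 <= v x" "\<And>x. v x <= 1" "\<And>x. x \<in> E ==> v x = 1"
  "ugrad v g" "pint p (%x. ennreal (v x)) + pint p g < c"
proof -
 obtain w where w: "N1p p UNIV w" "\<And>x. x \<in> E ==> 1 <= w x" "N1p_energy p UNIV w < c"
  using assms by (auto simp: Cap_def INF_less_iff)
 obtain g where g: "upper_gradient UNIV w g"
  "(\<integral>\<^sup>+x. enn_pow (eabs_enn (w x)) p \<partial>lebesgue) + (\<integral>\<^sup>+x. enn_pow (g x) p \<partial>lebesgue) < c"
  by (rule energy_witness[OF w(3)], rule that, assumption, simp)
 define v where "v x = real_of_ereal (max 0 (min 1 (w x)))" for x
 have wm[measurable]: "w \<in> borel_measurable lebesgue"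
  using w(1) by (simp add: N1p_def)
 show thesis
 proof (rule that[of v g])
  show "v \<in> borel_measurable lebesgue" unfolding v_def by measurable
  show "0 <= v x" "v x <= 1" for x
   by (cases "w x"; auto simp: v_def max_def min_def one_ereal_def zero_ereal_def)+
  show "v x = 1" if "x \<in> E" for x
   using w(2)[OF that] by (simp add: v_def min_def max_def)
  show "ugrad v g"
   using g(1) order_trans[OF ediff_clamp01_le] unfolding ugrad_def upper_gradient_def v_def by auto
  have "pint p (%x. ennreal (v x)) <= (\<integral>\<^sup>+x. enn_pow (eabs_enn (w x)) p \<partial>lborel)"
   unfolding pint_def
  proof (intro nn_integral_mono enn_pow_mono assms)
   show "ennreal (v x) <= eabs_enn (w x)" for x
    by (cases "w x") (auto simp: v_def eabs_enn_def max_def min_def one_ereal_def zero_ereal_def e2ennreal_ereal intro!: ennreal_leI)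
  qed
  then show "pint p (%x. ennreal (v x)) + pint p g < c"
   using g(2) add_right_mono le_less_trans unfolding pint_def nn_integral_completion by blast
 qed
qed

text \<open>A real test function need not be known to lie in \<open>N1p\<close>: if the right side
  is finite it does, and otherwise the bound is trivial.\<close>

lemma Cap_le:
 assumes v: "v \<in> borel_measurable lebesgue" "\<And>x. x \<in> E ==> 1 <= v x" and g: "ugrad v g"
 shows "Cap p E <= pint p (%x. ennreal \<bar>v x\<bar>) + pint p g"
proof (cases "pint p (%x. ennreal \<bar>v x\<bar>) + pint p g < \<infinity>")
 case True
 have le: "N1p_energy p UNIV (%x. ereal (v x)) <= pint p (%x. ennreal \<bar>v x\<bar>) + pint p g"
  unfolding N1p_energy_def using g
  by (intro add_mono INF_lower2[of g])
   (auto simp: pint_def nn_integral_completion eabs_enn_def e2ennreal_ereal upper_gradient_UNIV_iff)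
 have "N1p p UNIV (%x. ereal (v x))"
  unfolding N1p_def using le_less_trans[OF le True] v by auto
 with le show ?thesis
  unfolding Cap_def using v by (intro INF_lower2[of "%x. ereal (v x)"]) (auto simp: one_ereal_def)
next
 case False
 then have "pint p (%x. ennreal \<bar>v x\<bar>) + pint p g = \<infinity>" by (metis top.not_eq_extremum infinity_ennreal_def)
 then show ?thesis by (metis infinity_ennreal_def top_greatest)
qed

lemma Cap_mono: "E \<subseteq> F ==> Cap p E <= Cap p F"
 unfolding Cap_def by (rule INF_superset_mono) auto

lemma pint_SUP_le_lebesgue:
 fixes g :: "nat => 'a::euclidean_space => ennreal"
 assumes [measurable]: "\<And>k. g k \<in> borel_measurable lebesgue" and "0 < p"
 shows "pint p (%x. SUP k. g k x) <= (\<Sum>k. pint p (g k))"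
proof -
 have "pint p (%x. SUP k. g k x) <= (\<integral>\<^sup>+x. (\<Sum>k. enn_pow (g k x) p) \<partial>lebesgue)"
  unfolding pint_def nn_integral_completion by (intro nn_integral_mono enn_pow_SUP_le_suminf assms)
 also have "\<dots> = (\<Sum>k. pint p (g k))"
  by (subst nn_integral_suminf) (auto simp: pint_def nn_integral_completion)
 finally show ?thesis .
qed

text \<open>Along a fixed curve all increments of the \<open>v n\<close> have the same bound, the
  integral of the supremum of the \<open>g n\<close>, and a bounded supremum inherits a common bound
  on increments.\<close>

lemma ugrad_SUP:
 fixes v :: "nat => 'a::euclidean_space => real"
 assumes u: "\<And>n. ugrad (v n) (g n)" and b: "\<And>n x. 0 <= v n x" "\<And>n x. v n x <= 1"
 shows "ugrad (%x. SUP n. v n x) (%x. SUP n. g n x)"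
proof (rule ugradI)
 have [measurable]: "Borel (g n)" for n using u by (auto dest: ugrad_measurable)
 show "Borel (%x. SUP n. g n x)" by measurable
 fix Y :: "real => 'a" and l assume c: "arclength_curve_in UNIV Y l"
 have l: "0 <= l" using c by (auto simp: arclength_curve_in_def)
 define L where "L = lint (%x. SUP n. g n x) Y 0 l"
 have *: "ennreal \<bar>v n (Y 0) - v n (Y l)\<bar> <= L" for n
  unfolding L_def using ugrad_subcurve[OF u c order_refl l order_refl, of n]
  by (rule order_trans) (auto intro!: lint_mono SUP_upper)
 have bdd: "bdd_above (range (%n. v n x))" for x using b by (auto intro!: bdd_aboveI[of _ 1])
 show "ennreal \<bar>(SUP n. v n (Y 0)) - (SUP n. v n (Y l))\<bar> <= L"
 proof (cases L)
  case (real r)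
  then have r: "\<bar>v n (Y 0) - v n (Y l)\<bar> <= r" for n using *[of n] by simp
  have "(SUP n. v n (Y 0)) <= (SUP n. v n (Y l)) + r"
  proof (rule cSUP_least)
   show "v n (Y 0) <= (SUP n. v n (Y l)) + r" for n
    using r[of n] cSUP_upper[OF UNIV_I bdd, of n "Y l"] by (simp add: abs_le_iff)
  qed simp
  moreover have "(SUP n. v n (Y l)) <= (SUP n. v n (Y 0)) + r"
  proof (rule cSUP_least)
   show "v n (Y l) <= (SUP n. v n (Y 0)) + r" for n
    using r[of n] cSUP_upper[OF UNIV_I bdd, of n "Y 0"] by (simp add: abs_le_iff)
  qed simp
  ultimately show ?thesis using real by (auto intro!: ennreal_leI)
 qed simp
qed

text \<open>The supremum of nearly optimal test functions is admissible for the union, the supremum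
  of their upper gradients is an upper gradient of it, and the p-th power of a supremum is at most
  the sum of the p-th powers.\<close>

lemma Cap_countable_Union:
 fixes E :: "nat => 'a::euclidean_space set"
 assumes less: "\<And>n. Cap p (E n) < c n" and p: "0 < p"
 shows "Cap p (\<Union>n. E n) <= (\<Sum>n. c n)"
proof -
 have "\<exists>v g. v \<in> borel_measurable lebesgue \<and> (\<forall>x. 0 <= v x \<and> v x <= 1) \<and> (\<forall>x\<in>E n. v x = (1::real)) \<and>
   ugrad v g \<and> pint p (%x. ennreal (v x)) + pint p g < c n" for n
  by (rule Cap_witness[OF less[of n] p]) blast
 then obtain v g where vm[measurable]: "\<And>n. v n \<in> borel_measurable lebesgue"
  and v: "\<And>n x. 0 <= v n x" "\<And>n x. v n x <= 1" "\<And>n x. x \<in> E n ==> v n x = 1"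
  and g: "\<And>n. ugrad (v n) (g n)" and e: "\<And>n. pint p (%x. ennreal (v n x)) + pint p (g n) < c n"
  by metis
 have [measurable]: "Borel (g n)" for n using g by (auto dest: ugrad_measurable)
 have bdd: "bdd_above (range (%n. v n x))" for x using v by (auto intro!: bdd_aboveI[of _ 1])
 define V where "V x = (SUP n. v n x)" for x
 have V0: "0 <= V x" for x unfolding V_def using v(1)[of 0 x] cSUP_upper[OF UNIV_I bdd, of 0 x] by linarith
 have "V \<in> borel_measurable lebesgue"
  unfolding V_def[abs_def] by (rule borel_measurable_cSUP) (use bdd in auto)
 moreover have "1 <= V x" if "x \<in> (\<Union>n. E n)" for x
  using that v(3) cSUP_upper[OF UNIV_I bdd, of _ x] unfolding V_def by (metis UN_iff)
 moreover have "ugrad V (%x. SUP n. g n x)"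
  unfolding V_def[abs_def] by (rule ugrad_SUP[OF g v(1,2)])
 ultimately have "Cap p (\<Union>n. E n) <= pint p (%x. ennreal \<bar>V x\<bar>) + pint p (%x. SUP n. g n x)"
  by (rule Cap_le)
 also have "\<dots> <= (\<Sum>n. pint p (%x. ennreal (v n x))) + (\<Sum>n. pint p (g n))"
 proof (intro add_mono)
  have "ennreal \<bar>V x\<bar> <= (SUP n. ennreal (v n x))" for x
  proof (cases "SUP n. ennreal (v n x)")
   case (real s)
   have "v n x <= s" for n
    using SUP_upper[of n UNIV "%n. ennreal (v n x)"] real by simp
   then have "V x <= s" unfolding V_def by (intro cSUP_least) auto
   then show ?thesis using real V0[of x] by simp
  qed (simp only: top_greatest)
  then have "pint p (%x. ennreal \<bar>V x\<bar>) <= pint p (%x. SUP n. ennreal (v n x))"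
   using p by (intro pint_mono) auto
  also have "\<dots> <= (\<Sum>n. pint p (%x. ennreal (v n x)))"
   by (rule pint_SUP_le_lebesgue) (use p in auto)
  finally show "pint p (%x. ennreal \<bar>V x\<bar>) <= (\<Sum>n. pint p (%x. ennreal (v n x)))" .
  show "pint p (%x. SUP n. g n x) <= (\<Sum>n. pint p (g n))"
   by (rule pint_SUP_le) (use p in auto)
 qed
 also have "\<dots> = (\<Sum>n. pint p (%x. ennreal (v n x)) + pint p (g n))"
  by (rule suminf_add) auto
 also have "\<dots> <= (\<Sum>n. c n)"
  by (intro suminf_le) (use e in \<open>auto intro: less_imp_le\<close>)
 finally show ?thesis .
qed

lemma suminf_half_pow_ennreal: "0 <= e ==> (\<Sum>n. ennreal (e * (1/2) ^ Suc n)) = ennreal e"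
 using sums_mult[OF power_half_series, of e] by (intro suminf_ennreal_eq) auto

lemma open_Union_small:
 assumes G: "\<And>n::nat. open (G n)" "\<And>n. Cap p (G n) < ennreal (e * (1/2) ^ Suc n)" and "0 < p" "0 <= e"
 shows "open (\<Union>n. G n)" "Cap p (\<Union>n. G n) <= ennreal e"
 using Cap_countable_Union[of p G, OF G(2) \<open>0 < p\<close>] G(1) suminf_half_pow_ennreal[OF \<open>0 <= e\<close>] by auto

lemma Cap_empty: "0 < p ==> Cap p {} = 0"
 using Cap_le[of "%_. 0" "{}" "%_. 0" p] by (simp add: pint_def ugrad_def)

text \<open>The shares 1/2 and 1/4 are the first two terms of the series in
  \<open>suminf_half_pow_ennreal\<close>; empty sets fill the rest of the sequence.\<close>

lemma Cap_Un_less: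
 assumes "Cap p A < ennreal (e * (1/2))" "Cap p B < ennreal (e * (1/4))" "0 < p" "0 < e"
 shows "Cap p (A \<union> B) <= ennreal e"
proof -
 define G where "G n = (if n = 0 then A else if n = 1 then B else {})" for n :: nat
 have "Cap p (G n) < ennreal (e * (1/2) ^ Suc n)" for n
  using assms by (auto simp: G_def Cap_empty power2_eq_square)
 from Cap_countable_Union[of p G, OF this \<open>0 < p\<close>]
 have "Cap p (\<Union>n. G n) <= ennreal e" unfolding suminf_half_pow_ennreal[OF less_imp_le[OF assms(4)]] .
 moreover have "A = G 0" "B = G 1" by (auto simp: G_def)
 then have "Cap p (A \<union> B) <= Cap p (\<Union>n. G n)" by (intro Cap_mono) blast
 ultimately show ?thesis by simp
qed

lemma le_inverse_Suc_imp_0: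
 assumes "\<And>n::nat. x <= ennreal (1 / Suc n)" shows "x = 0"
proof -
 have "(%n. ennreal (1 / Suc n)) \<longlonglongrightarrow> ennreal 0"
  using LIMSEQ_inverse_real_of_nat by (intro tendsto_ennrealI) (simp add: inverse_eq_divide)
 then have "x <= ennreal 0" by (rule LIMSEQ_le_const) (use assms in blast)
 then show ?thesis by simp
qed

text \<open>Chebyshev's inequality for a test function. \<open>E\<close> itself may fail to be
  measurable, so the superset on which the test function is at least 1 is measured.\<close>

lemma emeasure_le_Cap_superset:
 fixes E :: "'a::euclidean_space set"
 assumes "Cap p E < c" "0 < p"
 obtains A where "A \<in> sets lebesgue" "E \<subseteq> A" "emeasure lebesgue A < c"
proof -
 have "\<exists>v (g :: 'a => ennreal). v \<in> borel_measurable lebesgue \<and> (\<forall>x\<in>E. v x = (1::real)) \<and> pint p (%x. ennreal (v x)) + pint p g < c"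
  by (rule Cap_witness[OF assms]) blast
 then obtain v and g :: "'a => ennreal" where v[measurable]: "v \<in> borel_measurable lebesgue" and v1: "\<And>x. x \<in> E ==> v x = (1::real)"
  and e: "pint p (%x. ennreal (v x)) + pint p g < c"
  by blast
 define A where "A = {x\<in>space lebesgue. 1 <= v x}"
 have [measurable]: "A \<in> sets lebesgue" unfolding A_def by measurable
 have "emeasure lebesgue A = (\<integral>\<^sup>+x. indicator A x \<partial>lebesgue)" by simp
 also have "\<dots> <= (\<integral>\<^sup>+x. enn_pow (ennreal (v x)) p \<partial>lebesgue)"
 proof (intro nn_integral_mono)
  show "indicator A x <= enn_pow (ennreal (v x)) p" for x
   using assms(2) enn_pow_mono[of p 1 "ennreal (v x)"] by (auto simp: indicator_def A_def)
 qed
 also have "\<dots> <= pint p (%x. ennreal (v x)) + pint p g"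
  by (simp add: pint_def nn_integral_completion)
 also note e
 finally have "emeasure lebesgue A < c" .
 moreover have "E \<subseteq> A" using v1 by (auto simp: A_def)
 ultimately show thesis using that \<open>A \<in> sets lebesgue\<close> by blast
qed

lemma Cap_zero_null:
 fixes E :: "'a::euclidean_space set"
 assumes "Cap p E = 0" "0 < p" shows "E \<in> null_sets lebesgue"
proof -
 have "\<exists>A. A \<in> sets lebesgue \<and> E \<subseteq> A \<and> emeasure lebesgue A < ennreal (1 / Suc n)" for n
  by (rule emeasure_le_Cap_superset[of p E "ennreal (1 / Suc n)"]) (use assms in auto)
 then obtain A where A: "\<And>n. A n \<in> sets lebesgue" "\<And>n. E \<subseteq> A n" "\<And>n. emeasure lebesgue (A n) < ennreal (1 / Suc n)"
  by metis
 have "emeasure lebesgue (\<Inter>n. A n) <= ennreal (1 / Suc n)" for n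
  using A emeasure_mono[of "\<Inter>n. A n" "A n" lebesgue] by (meson INT_lower UNIV_I less_imp_le order_trans)
 then have "emeasure lebesgue (\<Inter>n. A n) <= 0"
  by (metis le_inverse_Suc_imp_0 order_refl)
 then have "(\<Inter>n. A n) \<in> null_sets lebesgue" using A by (auto simp: null_sets_def)
 then show ?thesis by (rule null_sets_completion_subset[rotated]) (use A in auto)
qed

text \<open>\<open>U\<close> lies in the intersection of the open sets \<open>U \<union> G n\<close>
  and differs from it only inside the intersection of the \<open>G n\<close>, which has zero
  capacity and hence zero measure.\<close>

lemma quasiopen_measurable:
 fixes U :: "'a::euclidean_space set"
 assumes "quasiopen p U" "0 < p" shows "U \<in> sets lebesgue"
proof -
 have "\<exists>G. open G \<and> Cap p G < ennreal (1 / Suc n) \<and> open (U \<union> G)" for n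
  using assms(1) by (auto simp: quasiopen_def)
 then obtain G where G: "\<And>n. open (G n)" "\<And>n. Cap p (G n) < ennreal (1 / Suc n)" "\<And>n. open (U \<union> G n)"
  by metis
 have "Cap p (\<Inter>n. G n) <= ennreal (1 / Suc n)" for n
  using Cap_mono[of "\<Inter>n. G n" "G n" p] G(2)[of n] by (meson INT_lower UNIV_I less_imp_le order_trans)
 then have "Cap p (\<Inter>n. G n) <= 0"
  by (metis le_inverse_Suc_imp_0 order_refl)
 then have "(\<Inter>n. G n) \<in> null_sets lebesgue" using assms(2) by (intro Cap_zero_null[of p]) auto
 moreover define B where "B = (\<Inter>n. U \<union> G n)"
 ultimately have "B - U \<in> null_sets lebesgue"
  by (auto intro: null_sets_completion_subset[rotated])
 moreover have "B \<in> sets borel" unfolding B_def by (intro sets.countable_INT'' borel_open G(3)) auto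
 ultimately have "B - (B - U) \<in> sets lebesgue" by (intro sets.Diff[of B _ "B - U"]) (auto dest: null_setsD2)
 moreover have "B - (B - U) = U" by (auto simp: B_def)
 ultimately show ?thesis by simp
qed

text \<open>A Borel version may be smaller at some points, which spoils inequalities required on
  whole curves. Adding infinity on a Borel null set that contains all disagreements makes it a
  majorant everywhere without changing integrals.\<close>

lemma borel_majorant:
 fixes f :: "'a::euclidean_space => ennreal"
 assumes "f \<in> borel_measurable lebesgue"
 obtains h where "Borel h" "\<And>x. f x <= h x" "AE x in lborel. f x = h x"
proof -
 obtain h0 where h0: "h0 \<in> borel_measurable lborel" "AE x in lborel. f x = h0 x"
  using completion_ex_borel_measurable[OF assms] by auto
 obtain N where N: "N \<in> null_sets lborel" "{x. f x \<noteq> h0 x} \<subseteq> N"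
  using h0(2) by (rule AE_E) (auto simp: null_sets_def intro: that)
 have [measurable]: "N \<in> sets borel" "Borel h0" using N h0 by auto
 show thesis
 proof (rule that[of "%x. h0 x + \<infinity> * indicator N x"])
  show "f x <= h0 x + \<infinity> * indicator N x" for x
  proof (cases "x \<in> N")
   case False
   then have "f x = h0 x" using N(2) by blast
   then show ?thesis by simp
  qed (simp add: ennreal_top_mult)
  show "AE x in lborel. f x = h0 x + \<infinity> * indicator N x"
   using AE_not_in[OF N(1)] h0(2) by eventually_elim auto
 qed measurable
qed

lemma suminf_const_ge_top:
 fixes a :: "nat => ennreal"
 assumes "0 < r" "\<And>k. ennreal r <= a k" shows "(\<Sum>k. a k) = \<infinity>"
proof (rule ccontr)
 assume "(\<Sum>k. a k) \<noteq> \<infinity>"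
 then obtain s where s: "(\<Sum>k. a k) = ennreal s" "0 <= s" by (cases "\<Sum>k. a k") auto
 obtain n :: nat where n: "s / r < n" using reals_Archimedean2 by blast
 have "ennreal (n * r) = (\<Sum>k<n. ennreal r)" using assms by (simp add: ennreal_mult' ennreal_of_nat_eq_real_of_nat)
 also have "\<dots> <= (\<Sum>k<n. a k)" by (intro sum_mono assms)
 also have "\<dots> <= ennreal s" unfolding s(1)[symmetric] by (rule sum_le_suminf) auto
 finally have "n * r <= s" using s by simp
 with n assms show False by (simp add: field_simps)
qed

lemma lint_suminf:
 fixes g :: "nat => 'a::euclidean_space => ennreal"
 assumes "\<And>k. Borel (g k)" "arclength_curve_in E Y l"
 shows "lint (%x. \<Sum>k. g k x) Y 0 l = (\<Sum>k. lint (g k) Y 0 l)"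
 unfolding lint_def using measurable_compose_curve[OF assms]
 by (subst nn_integral_suminf[symmetric]) (auto intro!: nn_integral_cong simp: indicator_def)

text \<open>Suppose a curve of length \<open>l\<close> meets every \<open>G n\<close>, so every test
  function \<open>v n\<close> reaches 1 on it. If \<open>v n\<close> also falls below 1/2, its upper
  gradient has integral at least 1/2; if not, the majorant of \<open>v n\<close> has integral at
  least \<open>l/2\<close>. Hence the two series of densities, whose energies are finite by the fast
  decay, cannot both have finite integral.\<close>

lemma pae_avoids_some:
 fixes G :: "nat => 'a::euclidean_space set"
 assumes less: "\<And>n. Cap p (G n) < ennreal (((1/4) ^ Suc n) powr p)" and p: "0 < p"
 shows "pae p (%Y l. \<exists>n. Y ` {0..l} \<inter> G n = {})"
proof -
 have "\<exists>v g. v \<in> borel_measurable lebesgue \<and> (\<forall>x. 0 <= v x \<and> v x <= 1) \<and> (\<forall>x\<in>G n. v x = (1::real)) \<and>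
   ugrad v g \<and> pint p (%x. ennreal (v x)) + pint p g < ennreal (((1/4) ^ Suc n) powr p)" for n
  by (rule Cap_witness[OF less[of n] p]) blast
 then obtain v g where vm[measurable]: "\<And>n. v n \<in> borel_measurable lebesgue"
  and v: "\<And>n x. 0 <= v n x" "\<And>n x. v n x <= 1" "\<And>n x. x \<in> G n ==> v n x = 1"
  and g: "\<And>n. ugrad (v n) (g n)" and e: "\<And>n. pint p (%x. ennreal (v n x)) + pint p (g n) < ennreal (((1/4) ^ Suc n) powr p)"
  by metis
 have gm[measurable]: "Borel (g n)" for n using g by (auto dest: ugrad_measurable)
 \<comment> \<open>\<open>v n\<close> is only Lebesgue measurable and may fail to be measurable
   along a curve, so a Borel majorant with the same energy is integrated instead.\<close>
 have "\<exists>h. Borel h \<and> (\<forall>x. ennreal (v n x) <= h x) \<and> (AE x in lborel. ennreal (v n x) = h x)" for n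
  by (rule borel_majorant[of "%x. ennreal (v n x)"]) auto
 then obtain h where hm[measurable]: "\<And>n. Borel (h n)" and h: "\<And>n x. ennreal (v n x) <= h n x"
  "\<And>n. AE x in lborel. ennreal (v n x) = h n x" by metis
 have ph: "pint p (h n) = pint p (%x. ennreal (v n x))" for n
  unfolding pint_def using h(2)[of n] by (intro nn_integral_cong_AE) auto
 have fast: "pint p (h n) <= ennreal (((1/4) ^ Suc n) powr p)" "pint p (g n) <= ennreal (((1/4) ^ Suc n) powr p)" for n
  unfolding ph by (rule order_trans[OF _ less_imp_le[OF e[of n]]]; simp)+
 have "pae p (%Y l. lint (%x. \<Sum>n. h n x) Y 0 l < \<infinity> \<and> lint (%x. \<Sum>n. g n x) Y 0 l < \<infinity>)"
  using p by (intro pae_conj pae_finite pint_suminf_fast fast) auto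
 then show ?thesis
 proof (rule pae_mono)
  fix Y :: "real => 'a" and l assume c: "arclength_curve_in UNIV Y l"
   and fin: "lint (%x. \<Sum>n. h n x) Y 0 l < \<infinity> \<and> lint (%x. \<Sum>n. g n x) Y 0 l < \<infinity>"
  show "\<exists>n. Y ` {0..l} \<inter> G n = {}"
  proof (rule ccontr)
  assume hits: "\<nexists>n. Y ` {0..l} \<inter> G n = {}"
  have l: "0 < l" using c by (auto simp: arclength_curve_in_def)
  have "ennreal (min (1/2) (l/2)) <= lint (h n) Y 0 l + lint (g n) Y 0 l" for n
  proof (cases "\<exists>t\<in>{0..l}. v n (Y t) < 1/2")
   case True
   then obtain t where t: "t \<in> {0..l}" "v n (Y t) < 1/2" by blast
   obtain s where s: "s \<in> {0..l}" "Y s \<in> G n" using hits by blast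
   have "ennreal (1/2) <= ennreal \<bar>v n (Y s) - v n (Y t)\<bar>"
    using t(2) v(3)[OF s(2)] by (intro ennreal_leI) auto
   also have "\<dots> <= lint (g n) Y 0 l"
   proof (cases "s <= t")
    case True
    then show ?thesis using ugrad_subcurve[OF g c, of s t n] s t lint_mono_interval[of 0 s t l "g n" Y]
     by auto
   next
    case False
    then show ?thesis using ugrad_subcurve[OF g c, of t s n] s t lint_mono_interval[of 0 t s l "g n" Y]
     by (auto simp: abs_minus_commute)
   qed
   finally have "ennreal (1/2) <= lint (g n) Y 0 l" .
   moreover have "ennreal (min (1/2) (l/2)) <= ennreal (1/2)" by (intro ennreal_leI) auto
   ultimately show ?thesis by (meson add_increasing order_trans zero_le)
  next
   case False
   have "ennreal (l/2) = ennreal (1/2) * ennreal l"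
    by (subst ennreal_mult'[symmetric]) auto
   also have "\<dots> = (\<integral>\<^sup>+t. ennreal (1/2) * indicator {0..l} t \<partial>lborel)"
    using l by (subst nn_integral_cmult_indicator) auto
   also have "\<dots> <= lint (h n) Y 0 l"
    unfolding lint_def
   proof (intro nn_integral_mono)
    fix t show "ennreal (1/2) * indicator {0..l} t <= h n (Y t) * indicator {0..l} t"
     using False order_trans[OF ennreal_leI[of "1/2" "v n (Y t)"] h(1)[of n "Y t"]] by (auto simp: indicator_def not_less)
   qed
   finally have "ennreal (l/2) <= lint (h n) Y 0 l" .
   moreover have "ennreal (min (1/2) (l/2)) <= ennreal (l/2)" by (intro ennreal_leI) auto
   ultimately show ?thesis by (meson add_increasing2 order_trans zero_le)
  qed
  then have "(\<Sum>n. lint (h n) Y 0 l + lint (g n) Y 0 l) = \<infinity>"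
   using l by (intro suminf_const_ge_top[of "min (1/2) (l/2)"]) auto
  also have "(\<Sum>n. lint (h n) Y 0 l + lint (g n) Y 0 l) = (\<Sum>n. lint (h n) Y 0 l) + (\<Sum>n. lint (g n) Y 0 l)"
   by (rule suminf_add[symmetric]) auto
  finally show False using fin by (auto simp: lint_suminf[OF hm c] lint_suminf[OF gm c])
  qed
 qed
qed

lemma quarter_pos: "0 < ((1/4::real) ^ Suc n) powr p" by simp

lemma pae_avoids_Cap_zero:
 assumes "Cap p Z = 0" "0 < p" shows "pae p (%Y l. Y ` {0..l} \<inter> Z = {})"
 by (rule pae_mono[OF pae_avoids_some[of p "%_. Z"]]) (use assms in auto)

text \<open>On a curve that misses \<open>G n\<close>, the sets \<open>V\<close> and
  \<open>V \<union> G n\<close> have the same preimage, and the latter is open.\<close>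

lemma pae_quasiopen:
 assumes "quasiopen p V" "0 < p"
 shows "pae p (%Y l. \<exists>W. open W \<and> {t\<in>{0..l}. Y t \<in> V} = {t\<in>{0..l}. Y t \<in> W})"
proof -
 have "\<exists>G. open G \<and> Cap p G < ennreal (((1/4) ^ Suc n) powr p) \<and> open (V \<union> G)" for n
  using assms(1) quarter_pos[of n p] unfolding quasiopen_def by blast
 then obtain G where G: "\<And>n. open (G n)" "\<And>n. Cap p (G n) < ennreal (((1/4) ^ Suc n) powr p)" "\<And>n. open (V \<union> G n)"
  by metis
 show ?thesis
 proof (rule pae_mono[OF pae_avoids_some[OF G(2) assms(2)]])
  fix Y l assume "\<exists>n. Y ` {0..l} \<inter> G n = {}"
  then obtain n where n: "Y ` {0..l} \<inter> G n = {}" by blast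
  show "\<exists>W. open W \<and> {t\<in>{0..l}. Y t \<in> V} = {t\<in>{0..l}. Y t \<in> W}"
   using G(3)[of n] n by (intro exI[of _ "V \<union> G n"]) blast
 qed
qed

text \<open>A curve in \<open>E\<close> that misses one of the exceptional sets runs where
  \<open>u\<close> is finite and continuous.\<close>

lemma pae_quasicontinuous:
 assumes "quasicontinuous_on p E u" "0 < p"
 shows "pae p (%Y l. Y ` {0..l} \<subseteq> E --> (\<forall>t\<in>{0..l}. \<bar>u (Y t)\<bar> \<noteq> \<infinity>) \<and>
  continuous_on {0..l} (%t. real_of_ereal (u (Y t))))"
proof -
 have "\<exists>G. Cap p G < ennreal (((1/4) ^ Suc n) powr p) \<and> (\<forall>x \<in> E - G. \<bar>u x\<bar> \<noteq> \<infinity>) \<and> continuous_on (E - G) (%x. real_of_ereal (u x))" for n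
  using assms(1) quarter_pos[of n p] unfolding quasicontinuous_on_def by blast
 then obtain G where G: "\<And>n. Cap p (G n) < ennreal (((1/4) ^ Suc n) powr p)" "\<And>n x. x \<in> E - G n ==> \<bar>u x\<bar> \<noteq> \<infinity>"
  "\<And>n. continuous_on (E - G n) (%x. real_of_ereal (u x))"
  by metis
 show ?thesis
 proof (rule pae_mono[OF pae_avoids_some[OF G(1) assms(2)]], rule impI)
  fix Y l assume c: "arclength_curve_in UNIV Y l" and "\<exists>n. Y ` {0..l} \<inter> G n = {}" and E: "Y ` {0..l} \<subseteq> E"
  then obtain n where n: "Y ` {0..l} \<inter> G n = {}" by blast
  then have sub: "Y ` {0..l} \<subseteq> E - G n" using E by blast
  have "continuous_on {0..l} (%t. real_of_ereal (u (Y t)))"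
   using continuous_on_compose2[OF G(3) arclength_continuous_on[OF c] sub] .
  moreover have "\<forall>t\<in>{0..l}. \<bar>u (Y t)\<bar> \<noteq> \<infinity>" by (intro ballI G(2)[of _ n] subsetD[OF sub] imageI)
  ultimately show "(\<forall>t\<in>{0..l}. \<bar>u (Y t)\<bar> \<noteq> \<infinity>) \<and> continuous_on {0..l} (%t. real_of_ereal (u (Y t)))" by blast
 qed
qed

text \<open>Between its first and its last encounter with \<open>A\<close> the curve contributes
  nothing to the total increment. The infimum and the supremum of the parameters in \<open>A\<close>
  need not be such parameters, but \<open>f\<close> vanishes there too, because the zeros of
  \<open>f\<close> along the curve form a closed set.\<close>

lemma ugrad_vanishing_curve:
 assumes u: "ugrad f g" and c: "arclength_curve_in E Y l" and fin: "lint g Y 0 l < \<infinity>"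
  and A[measurable]: "A \<in> sets borel" and z: "\<And>x. x \<in> A ==> f x = 0"
 shows "ennreal \<bar>f (Y 0) - f (Y l)\<bar> <= lint (%x. g x * indicator (- A) x) Y 0 l"
proof -
 have [measurable]: "Borel g" using u by (rule ugrad_measurable)
 have g': "Borel (%x. g x * indicator (- A) x)" by measurable
 have l: "0 <= l" using c by (auto simp: arclength_curve_in_def)
 define T where "T = {t\<in>{0..l}. Y t \<in> A}"
 show ?thesis
 proof (cases "T = {}")
  case True
  then have "lint g Y 0 l <= lint (%x. g x * indicator (- A) x) Y 0 l"
   by (intro lint_mono) (auto simp: T_def)
  then show ?thesis using ugrad_subcurve[OF u c order_refl l order_refl] by simp
 next
  case False
  define a b where "a = Inf T" and "b = Sup T"
  have bdd: "bdd_below T" "bdd_above T" by (auto simp: T_def)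
  define Z where "Z = {t\<in>{0..l}. f (Y t) = 0}"
  have "closed Z" unfolding Z_def
   using continuous_closed_preimage_constant[OF ugrad_continuous_on_curve[OF u c fin]] by (simp add: conj_commute)
  moreover have "T \<subseteq> Z" using z by (auto simp: T_def Z_def)
  ultimately have ab: "a \<in> Z" "b \<in> Z"
   using False bdd by (auto simp: a_def b_def intro: closed_subset_contains_Inf closed_subset_contains_Sup)
  obtain t where "t \<in> T" using False by blast
  then have "a <= b" unfolding a_def b_def using bdd by (meson cInf_lower cSup_upper order_trans)
  have out: "t \<notin> T" if "t < a \<or> b < t" for t
   using that bdd by (auto simp: a_def b_def dest: cInf_lower cSup_upper)
  let ?g = "%x. g x * indicator (- A) x"
  have "ennreal \<bar>f (Y 0) - f (Y l)\<bar> <= ennreal (\<bar>f (Y 0) - f (Y a)\<bar> + \<bar>f (Y b) - f (Y l)\<bar>)"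
   using ab by (intro ennreal_leI) (auto simp: Z_def)
  also have "\<dots> = ennreal \<bar>f (Y 0) - f (Y a)\<bar> + ennreal \<bar>f (Y b) - f (Y l)\<bar>" by simp
  also have "\<dots> <= lint g Y 0 a + lint g Y b l"
   using ab by (intro add_mono ugrad_subcurve[OF u c]) (auto simp: Z_def)
  also have "\<dots> <= lint ?g Y 0 a + lint ?g Y b l"
  proof (intro add_mono lint_mono_AE)
   show "AE t in lborel. 0 <= t \<and> t <= a --> g (Y t) <= ?g (Y t)"
    using AE_lborel_singleton[of a] by eventually_elim (use out ab in \<open>auto simp: T_def Z_def indicator_def\<close>)
   show "AE t in lborel. b <= t \<and> t <= l --> g (Y t) <= ?g (Y t)"
    using AE_lborel_singleton[of b] by eventually_elim (use out ab in \<open>auto simp: T_def Z_def indicator_def\<close>)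
  qed
  also have "\<dots> <= lint ?g Y 0 a + (lint ?g Y a b + lint ?g Y b l)"
   by (intro add_left_mono add_increasing) auto
  also have "\<dots> = lint ?g Y 0 l"
   using ab \<open>a <= b\<close> by (simp add: lint_add[OF g' c] Z_def)
  finally show ?thesis .
 qed
qed

text \<open>Curves on which \<open>g\<close> has infinite integral are outside the scope of
  \<open>ugrad_vanishing_curve\<close>; the term \<open>e * g\<close>, small in energy, has infinite
  integral on exactly these.\<close>

lemma ugrad_vanishing:
 assumes u: "ugrad f g" and A[measurable]: "A \<in> sets borel" and z: "\<And>x. x \<in> A ==> f x = 0" and e: "0 < e"
 shows "ugrad f (%x. g x * indicator (- A) x + ennreal e * g x)"
proof (rule ugradI)
 have [measurable]: "Borel g" using u by (rule ugrad_measurable)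
 show "Borel (%x. g x * indicator (- A) x + ennreal e * g x)" by measurable
 fix Y :: "real => 'a" and l assume c: "arclength_curve_in UNIV Y l"
 have "lint (%x. g x * indicator (- A) x + ennreal e * g x) Y 0 l
  = lint (%x. g x * indicator (- A) x) Y 0 l + ennreal e * lint g Y 0 l"
  using c by (subst lint_add_fun) (auto simp: lint_cmult[OF _ c])
 moreover have "ennreal e * \<infinity> = \<infinity>" using e by (simp add: ennreal_mult_top)
 ultimately show "ennreal \<bar>f (Y 0) - f (Y l)\<bar> <= lint (%x. g x * indicator (- A) x + ennreal e * g x) Y 0 l"
  using ugrad_vanishing_curve[OF u c _ A z]
  by (cases "lint g Y 0 l < \<infinity>") (auto intro: add_increasing2 simp: less_top[symmetric])
qed

lemma ugrad_lipschitz: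
 assumes "\<And>x y. \<bar>f x - f y\<bar> <= L * dist x y" "0 <= L"
 shows "ugrad f (%_. ennreal L)"
proof (rule ugradI)
 fix Y :: "real => 'a" and l assume c: "arclength_curve_in UNIV Y l"
 have l: "0 < l" using c by (auto simp: arclength_curve_in_def)
 have "\<bar>f (Y 0) - f (Y l)\<bar> <= L * dist (Y 0) (Y l)" by (rule assms)
 also have "\<dots> <= L * l" using arclength_dist_le[OF c, of 0 l] l assms by (intro mult_left_mono) auto
 finally have "ennreal \<bar>f (Y 0) - f (Y l)\<bar> <= ennreal (L * l)" by (rule ennreal_leI)
 also have "\<dots> = lint (%_. ennreal L) Y 0 l"
  unfolding lint_def using l assms by (subst nn_integral_cmult_indicator) (auto simp: ennreal_mult')
 finally show "ennreal \<bar>f (Y 0) - f (Y l)\<bar> <= lint (%_. ennreal L) Y 0 l" .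
qed simp

text \<open>A constant has finite integral on every curve, so the argument of
  \<open>ugrad_vanishing_curve\<close> applies to all curves and no extra term appears.\<close>

lemma ugrad_lipschitz_vanishing:
 assumes "\<And>x y. \<bar>f x - f y\<bar> <= L * dist x y" "0 <= L" "A \<in> sets borel" "\<And>x. x \<in> A ==> f x = 0"
 shows "ugrad f (%x. ennreal L * indicator (- A) x)"
proof (rule ugradI)
 fix Y :: "real => 'a" and l assume c: "arclength_curve_in UNIV Y l"
 have "lint (%_. ennreal L) Y 0 l < \<infinity>"
  unfolding lint_def using c
  by (subst nn_integral_cmult_indicator) (auto simp: ennreal_mult_less_top arclength_curve_in_def)
 then show "ennreal \<bar>f (Y 0) - f (Y l)\<bar> <= lint (%x. ennreal L * indicator (- A) x) Y 0 l"
  by (rule ugrad_vanishing_curve[OF ugrad_lipschitz[OF assms(1,2)] c _ assms(3,4)])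
qed (use assms in measurable)

section \<open>Smooth mollifiers\<close>

text \<open>The classical flat function, divided by \<open>t ^ m\<close> so that derivatives stay
  within linear combinations of the family, see \<open>flat_deriv\<close>.\<close>

definition flat :: "nat => real => real" where
 "flat m t = (if t > 0 then exp (- 1 / t) / t ^ m else 0)"

lemma flat_nonneg: "0 <= flat m t"
 by (simp add: flat_def)

lemma flat_tendsto_0: "(flat m \<longlongrightarrow> 0) (at 0)"
proof -
 have "((%x. x ^ m / exp x) \<longlongrightarrow> (0::real)) at_top"
  by (rule tendsto_power_div_exp_0)
 from filterlim_compose[OF this filterlim_inverse_at_top_right]
 have "((%t. inverse t ^ m / exp (inverse t)) \<longlongrightarrow> (0::real)) (at_right 0)" .
 then have "(flat m \<longlongrightarrow> 0) (at_right 0)"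
  by (rule Lim_transform_eventually)
   (auto simp: flat_def eventually_at_right_less exp_minus field_simps intro!: eventually_mono[OF eventually_at_right_less])
 moreover have "(flat m \<longlongrightarrow> 0) (at_left 0)"
  by (rule Lim_transform_eventually[OF tendsto_const])
   (auto simp: flat_def eventually_at intro!: exI[of _ 1])
 ultimately show ?thesis using filterlim_at_split by blast
qed

lemma flat_deriv: "(flat m has_real_derivative (flat (m + 2) t - m * flat (m + 1) t)) (at t)"
proof (cases "t = 0")
 case True
 \<comment> \<open>At 0 the difference quotient of \<open>flat m\<close> is
   \<open>flat (m + 1)\<close>, so differentiability there is the limit already found.\<close>
 have "((%h. (flat m (0 + h) - flat m 0) / h) \<longlongrightarrow> 0) (at 0)"
  by (rule Lim_transform_eventually[OF flat_tendsto_0[of "m + 1"]])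
   (auto simp: flat_def eventually_at_filter)
 then show ?thesis using True by (simp add: DERIV_def flat_def)
next
 case False
 show ?thesis
 proof (cases "t > 0")
  case True
  have "((%t. exp (- 1 / t) / t ^ m) has_real_derivative (flat (m + 2) t - m * flat (m + 1) t)) (at t)"
   using True by (auto simp: flat_def intro!: derivative_eq_intros)
    (cases m; simp add: field_simps power2_eq_square)
  then show ?thesis
   by (rule has_field_derivative_transform_within_open[where S="{0<..}"]) (use True in \<open>auto simp: flat_def\<close>)
 next
  case neg: False
  have "((%t. 0) has_real_derivative (flat (m + 2) t - m * flat (m + 1) t)) (at t)"
   using neg by (simp add: flat_def)
  then show ?thesis
   by (rule has_field_derivative_transform_within_open[where S="{..<0}"]) (use neg False in \<open>auto simp: flat_def\<close>)
 qed
qed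

text \<open>A class that contains the bump function and is closed under directional derivatives.
  Smoothness of test functions is defined through iterated Frechet derivatives, and induction over
  this class yields all of them at once.\<close>

inductive_set smooth_class :: "('a::euclidean_space => real) set" where
 const: "(%x. c) \<in> smooth_class"
| inner: "(%x. x \<bullet> v) \<in> smooth_class"
| add: "f \<in> smooth_class ==> g \<in> smooth_class ==> (%x. f x + g x) \<in> smooth_class"
| mult: "f \<in> smooth_class ==> g \<in> smooth_class ==> (%x. f x * g x) \<in> smooth_class"
| flat: "(%x. flat m (1 - x \<bullet> x)) \<in> smooth_class"

lemma smooth_class_deriv:
 assumes "f \<in> smooth_class"
 shows "\<exists>f'. (\<forall>x. (f has_derivative f' x) (at x)) \<and> (\<forall>v. (%x. f' x v) \<in> smooth_class)"
 using assms
proof induction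
 case (const c)
 show ?case by (intro exI[of _ "%x h. 0"]) (auto intro: smooth_class.const)
next
 case (inner v)
 show ?case by (intro exI[of _ "%x h. h \<bullet> v"]) (auto intro!: derivative_eq_intros smooth_class.const)
next
 case (add f g)
 then obtain f' g' where "\<And>x. (f has_derivative f' x) (at x)" "\<And>v. (%x. f' x v) \<in> smooth_class"
  "\<And>x. (g has_derivative g' x) (at x)" "\<And>v. (%x. g' x v) \<in> smooth_class" by blast
 then show ?case
  by (intro exI[of _ "%x h. f' x h + g' x h"]) (auto intro!: has_derivative_add smooth_class.add)
next
 case (mult f g)
 then obtain f' g' where "\<And>x. (f has_derivative f' x) (at x)" "\<And>v. (%x. f' x v) \<in> smooth_class"
  "\<And>x. (g has_derivative g' x) (at x)" "\<And>v. (%x. g' x v) \<in> smooth_class" by blast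
 then show ?case using mult.hyps
  by (intro exI[of _ "%x h. f x * g' x h + f' x h * g x"]) (auto intro!: has_derivative_mult smooth_class.add smooth_class.mult)
next
 case (flat m)
 let ?F = "%x. flat (m + 2) (1 - x \<bullet> x) + (- real m) * flat (m + 1) (1 - x \<bullet> x)"
 have "((%x. flat m (1 - x \<bullet> x)) has_derivative (%h. ?F x * ((-2) * (x \<bullet> h)))) (at x)" for x :: 'a
 proof -
  have "((%x. 1 - x \<bullet> x) has_derivative (%h. (-2) * (x \<bullet> h))) (at x)"
   by (auto intro!: derivative_eq_intros simp: inner_commute)
  from DERIV_compose_FDERIV[OF flat_deriv this]
  show ?thesis by (rule has_derivative_eq_rhs) (auto simp: mult_ac)
 qed
 then show ?case
  by (intro exI[of _ "%x h. ?F x * ((-2) * (x \<bullet> h))"])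
   (intro conjI allI smooth_class.intros, assumption)
qed

lemma dderiv_smooth_class: "f \<in> smooth_class ==> dderiv vs f \<in> smooth_class"
proof (induction vs)
 case (Cons v vs)
 then obtain f' where f': "\<And>x. (dderiv vs f has_derivative f' x) (at x)" "\<And>v. (%x. f' x v) \<in> smooth_class"
  using smooth_class_deriv by blast
 have "frechet_derivative (dderiv vs f) (at x) = f' x" for x
  using frechet_derivative_at[OF f'(1)] by metis
 then show ?case using f'(2) by simp
qed simp

lemma smooth_class_differentiable: "f \<in> smooth_class ==> dderiv vs f differentiable (at x)"
 using smooth_class_deriv[OF dderiv_smooth_class] by (meson differentiableI)

lemma smooth_class_continuous: "f \<in> smooth_class ==> continuous_on UNIV f"
 using smooth_class_differentiable[of f "[]"]
 by (simp add: continuous_on_eq_continuous_at differentiable_imp_continuous_within)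

definition bump :: "'a::euclidean_space => real" where "bump x = flat 0 (1 - x \<bullet> x)"

definition mol :: "'a::euclidean_space => real" where "mol x = inverse (\<integral>y. bump y \<partial>(lborel :: 'a measure)) * bump x"

lemma bump_smooth: "bump \<in> smooth_class"
 using smooth_class.flat[of 0] by (simp add: bump_def[abs_def])

lemma mol_smooth: "mol \<in> smooth_class"
 unfolding mol_def[abs_def] by (rule smooth_class.mult[OF smooth_class.const bump_smooth])

lemma bump_zero: "1 <= norm x ==> bump x = 0"
 using power_mono[of 1 "norm x" 2] by (simp add: bump_def flat_def power2_norm_eq_inner)

lemma bump_pos: "norm x < 1 ==> 0 < bump x"
 using power_strict_mono[of "norm x" 1 2] by (simp add: bump_def flat_def power2_norm_eq_inner)

lemma bump_nonneg: "0 <= bump x" by (simp add: bump_def flat_nonneg)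

lemma integrable_continuous_compact_support:
 fixes f :: "'a::euclidean_space => 'b::{banach, second_countable_topology}"
 assumes "continuous_on UNIV f" "\<And>x. R <= norm x ==> f x = 0"
 shows "integrable lborel f"
proof -
 have "integrable lborel (%x. indicator (cball 0 R) x *\<^sub>R f x)"
  by (rule borel_integrable_compact) (auto intro: continuous_on_subset[OF assms(1)])
 moreover have "(%x. indicator (cball 0 R) x *\<^sub>R f x) = f"
  using assms(2) by (auto simp: indicator_def fun_eq_iff)
 ultimately show ?thesis by simp
qed

lemma bump_integrable: "integrable lborel bump"
 by (rule integrable_continuous_compact_support[OF smooth_class_continuous[OF bump_smooth] bump_zero])

lemma bump_integral_pos: "0 < (\<integral>y. bump y \<partial>(lborel :: 'a::euclidean_space measure))"
proof -
 have "(\<integral>y. bump y \<partial>(lborel :: 'a measure)) \<noteq> 0"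
 proof
  assume "(\<integral>y. bump y \<partial>(lborel :: 'a measure)) = 0"
  then have "AE x in (lborel :: 'a measure). bump x = 0"
   using integral_nonneg_eq_0_iff_AE[OF bump_integrable] bump_nonneg by auto
  then have "AE x in (lborel :: 'a measure). x \<notin> ball 0 1"
   by eventually_elim (use bump_pos in fastforce)
  then have "emeasure lborel (ball (0::'a) 1) = 0"
   by (subst (asm) AE_iff_measurable[of "ball 0 1"]) auto
  then show False using emeasure_ball[of 1 "0::'a"] unit_ball_vol_pos[of "DIM('a)"] by simp
 qed
 moreover have "0 <= (\<integral>y. bump y \<partial>(lborel :: 'a measure))"
  by (rule Bochner_Integration.integral_nonneg) (auto simp: bump_nonneg)
 ultimately show ?thesis by simp
qed

lemma mol_nonneg: "0 <= mol x"
 using bump_integral_pos[where 'a='a] by (simp add: mol_def bump_nonneg)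

lemma mol_zero: "1 <= norm x ==> mol x = 0"
 by (simp add: mol_def bump_zero)

lemma mol_integrable: "integrable lborel mol"
 unfolding mol_def[abs_def] by (simp add: bump_integrable)

lemma mol_integral: "(\<integral>z. mol z \<partial>(lborel :: 'a::euclidean_space measure)) = 1"
 unfolding mol_def[abs_def] using bump_integral_pos[where 'a='a] by simp

lemma mol_continuous: "continuous_on UNIV mol"
 by (rule smooth_class_continuous[OF mol_smooth])

lemma mol_measurable[measurable]: "Borel mol"
 by (rule borel_measurable_continuous_onI[OF mol_continuous])

lemma nn_integral_mol: "(\<integral>\<^sup>+z. ennreal (mol z) \<partial>(lborel :: 'a::euclidean_space measure)) = 1"
 by (subst nn_integral_eq_integral) (auto simp: mol_integrable mol_nonneg mol_integral)

text \<open>Each derivative contributes one factor \<open>- a\<close> from the inner reflection and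
  scaling; through this formula translated and rescaled kernels inherit smoothness.\<close>

lemma dderiv_affine:
 assumes f: "\<And>vs x. dderiv vs f differentiable (at x)"
 shows "dderiv vs (%y. c * f (a *\<^sub>R (x0 - y))) = (%y. c * (- a) ^ length vs * dderiv vs f (a *\<^sub>R (x0 - y)))"
proof (induction vs)
 case (Cons v vs)
 have "((%y. c * (- a) ^ length vs * dderiv vs f (a *\<^sub>R (x0 - y))) has_derivative
   (%h. c * (- a) ^ length vs * frechet_derivative (dderiv vs f) (at (a *\<^sub>R (x0 - y))) (a *\<^sub>R (0 - h)))) (at y)" for y
 proof -
  have 1: "((%y. a *\<^sub>R (x0 - y)) has_derivative (%h. a *\<^sub>R (0 - h))) (at y)"
   by (auto intro!: derivative_eq_intros)
  have 2: "(dderiv vs f has_derivative frechet_derivative (dderiv vs f) (at (a *\<^sub>R (x0 - y)))) (at (a *\<^sub>R (x0 - y)))"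
   using f frechet_derivative_works by blast
  from has_derivative_compose[OF 1 2] show ?thesis by (rule has_derivative_mult_right)
 qed
 from frechet_derivative_at[OF this, symmetric]
 have "frechet_derivative (%y. c * (- a) ^ length vs * dderiv vs f (a *\<^sub>R (x0 - y))) (at y) v
  = c * (- a) ^ length vs * frechet_derivative (dderiv vs f) (at (a *\<^sub>R (x0 - y))) (a *\<^sub>R (0 - v))" for y by simp
 moreover have "frechet_derivative (dderiv vs f) (at z) (a *\<^sub>R (0 - v)) = - a * frechet_derivative (dderiv vs f) (at z) v" for z
 proof -
  interpret linear "frechet_derivative (dderiv vs f) (at z)" by (rule linear_frechet_derivative[OF f])
  show ?thesis using scale[of "-a" v] by simp
 qed
 ultimately show ?case unfolding dderiv.simps Cons.IH by (simp add: fun_eq_iff mult_ac)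
qed simp

definition grad :: "('a::euclidean_space => real) => 'a => 'a" where
 "grad f x = (\<Sum>b\<in>Basis. frechet_derivative f (at x) b *\<^sub>R b)"

lemma grad_inner:
 assumes "f differentiable (at x)" shows "grad f x \<bullet> h = frechet_derivative f (at x) h"
proof -
 interpret linear "frechet_derivative f (at x)" by (rule linear_frechet_derivative[OF assms])
 have "frechet_derivative f (at x) h = frechet_derivative f (at x) (\<Sum>b\<in>Basis. (h \<bullet> b) *\<^sub>R b)"
  by (simp add: euclidean_representation)
 also have "\<dots> = (\<Sum>b\<in>Basis. (h \<bullet> b) * frechet_derivative f (at x) b)"
  by (simp add: sum scale)
 also have "\<dots> = grad f x \<bullet> h"
  unfolding grad_def inner_sum_left by (intro sum.cong) (auto simp: inner_commute mult.commute)
 finally show ?thesis ..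
qed

lemma has_derivative_grad:
 assumes "f differentiable (at x)" shows "(f has_derivative (%h. grad f x \<bullet> h)) (at x)"
 using frechet_derivative_works[THEN iffD1, OF assms] grad_inner[OF assms] by (simp add: has_derivative_eq_rhs fun_eq_iff)

lemma grad_unique: "(f has_derivative (%h. k \<bullet> h)) (at x) ==> grad f x = k"
 using euclidean_representation[of k] unfolding grad_def frechet_derivative_at[of f "%h. k \<bullet> h" x, symmetric] by simp

text \<open>Test functions are used only through these consequences of smoothness.\<close>

definition C1c :: "real => ('a::euclidean_space => real) => bool" where
 "C1c R f \<longleftrightarrow> (\<forall>x. f differentiable (at x)) \<and> continuous_on UNIV (grad f) \<and> (\<forall>x. R <= norm x --> f x = 0 \<and> grad f x = 0)"

lemma C1cD:
 assumes "C1c R f"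
 shows "\<And>x. f differentiable (at x)" "continuous_on UNIV (grad f)" "\<And>x. R <= norm x ==> f x = 0" "\<And>x. R <= norm x ==> grad f x = 0"
  "continuous_on UNIV f" "integrable lborel f" "\<And>b. integrable lborel (%x. grad f x \<bullet> b)"
  "Borel f" "Borel (grad f)"
proof -
 show 1: "f differentiable (at x)" for x using assms by (simp add: C1c_def)
 show 2: "continuous_on UNIV (grad f)" using assms by (simp add: C1c_def)
 show 3: "R <= norm x ==> f x = 0" for x using assms by (simp add: C1c_def)
 show 4: "R <= norm x ==> grad f x = 0" for x using assms by (simp add: C1c_def)
 show 5: "continuous_on UNIV f"
  using 1 by (simp add: continuous_on_eq_continuous_at differentiable_imp_continuous_within)
 show "integrable lborel f" by (rule integrable_continuous_compact_support[OF 5 3])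
 show "integrable lborel (%x. grad f x \<bullet> b)" for b
  by (rule integrable_continuous_compact_support[of _ R]) (use 2 4 in \<open>auto intro!: continuous_intros\<close>)
 show "Borel f" "Borel (grad f)"
  using 2 5 by (auto intro: borel_measurable_continuous_onI)
qed

lemma test_function_C1c:
 assumes "test_function G \<phi>"
 obtains R where "C1c R \<phi>"
proof -
 have d: "\<phi> differentiable (at x)" for x
 proof -
  have "dderiv [] \<phi> differentiable (at x)" using assms unfolding test_function_def by blast
  then show ?thesis by simp
 qed
 have d2: "(%x. frechet_derivative \<phi> (at x) b) differentiable (at x)" for x b
 proof -
  have "dderiv [b] \<phi> differentiable (at x)" using assms unfolding test_function_def by blast
  then show ?thesis by simp
 qed
 have "continuous_on UNIV (grad \<phi>)"
  unfolding grad_def[abs_def] using d2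
  by (intro continuous_intros) (simp add: continuous_on_eq_continuous_at differentiable_imp_continuous_within)
 have "bounded (closure {x. \<phi> x \<noteq> 0})" using assms by (simp add: test_function_def compact_imp_bounded)
 then obtain R where R: "\<And>x. x \<in> closure {x. \<phi> x \<noteq> 0} ==> norm x < R"
  by (metis bounded_pos_less)
 have "\<phi> x = 0 \<and> grad \<phi> x = 0" if "R <= norm x" for x
 proof -
  have x: "x \<in> - closure {x. \<phi> x \<noteq> 0}" using R[of x] that by auto
  have "((%_. 0) has_derivative (%h. 0)) (at x)" by simp
  then have "(\<phi> has_derivative (%h. 0)) (at x)"
   by (rule has_derivative_transform_within_open[OF _ _ x]) (use closure_subset[of "{x. \<phi> x \<noteq> 0}"] in auto)
  then have "grad \<phi> x = 0" by (intro grad_unique) simp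
  then show ?thesis using x closure_subset[of "{x. \<phi> x \<noteq> 0}"] by auto
 qed
 then have "C1c R \<phi>" using d \<open>continuous_on UNIV (grad \<phi>)\<close> by (simp add: C1c_def)
 then show thesis by (rule that)
qed

definition ker :: "real => 'a::euclidean_space => real" where
 "ker r x = inverse (r ^ DIM('a)) * mol (x /\<^sub>R r)"

text \<open>The kernel is taken as a function of the integration variable, for a fixed centre
  \<open>x\<close>; testing a weak gradient with it produces the mollification at
  \<open>x\<close>.\<close>

lemma ker_test_function:
 assumes "0 < r" "cball x r \<subseteq> G"
 shows "test_function G (%y. ker r (x - y))"
proof -
 have eq: "(%y. ker r (x - y)) = (%y. inverse (r ^ DIM('a)) * mol (inverse r *\<^sub>R (x - y)))"
  by (simp add: ker_def)
 have "{y. ker r (x - y) \<noteq> 0} \<subseteq> cball x r"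
 proof
  fix y assume "y \<in> {y. ker r (x - y) \<noteq> 0}"
  then have "\<not> 1 <= norm ((x - y) /\<^sub>R r)" using mol_zero by (force simp: ker_def)
  moreover have "norm ((x - y) /\<^sub>R r) = norm (x - y) / r" using assms(1) by (simp add: divide_inverse mult.commute)
  ultimately show "y \<in> cball x r" using assms(1) by (simp add: dist_norm divide_less_eq)
 qed
 then have sub: "closure {y. ker r (x - y) \<noteq> 0} \<subseteq> cball x r" by (rule closure_minimal) simp
 show ?thesis unfolding test_function_def
 proof (intro conjI allI)
  fix vs y
  have "(%y. dderiv vs mol (inverse r *\<^sub>R (x - y))) differentiable (at y)"
  proof (rule differentiable_compose[where f="dderiv vs mol"])
   show "dderiv vs mol differentiable at (inverse r *\<^sub>R (x - y))" by (rule smooth_class_differentiable[OF mol_smooth])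
  qed (auto intro!: derivative_intros)
  then show "dderiv vs (%y. ker r (x - y)) differentiable at y"
   unfolding eq dderiv_affine[OF smooth_class_differentiable[OF mol_smooth]]
   by (intro differentiable_mult) auto
  show "compact (closure {y. ker r (x - y) \<noteq> 0})"
   using sub bounded_subset[OF bounded_cball] by (auto simp: compact_eq_bounded_closed)
  show "closure {y. ker r (x - y) \<noteq> 0} \<subseteq> G" using sub assms(2) by blast
 qed
qed

lemma ker_C1c:
 assumes "0 < r" shows "\<exists>R. C1c R (ker r :: 'a::euclidean_space => real)"
proof -
 have "ker r differentiable (at x)" for x :: 'a
 proof -
  have "(%y. mol (y /\<^sub>R r)) differentiable (at x)"
   by (rule differentiable_compose[where f=mol]) (use smooth_class_differentiable[OF mol_smooth, of "[]"] in \<open>auto intro!: derivative_intros\<close>)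
  then show ?thesis unfolding ker_def[abs_def] by (intro differentiable_mult) auto
 qed
 have "test_function UNIV (%y. ker r (0 - y) :: real)" using ker_test_function[of r 0 UNIV] assms by simp
 moreover have "(%y::'a. ker r (0 - y)) = ker r"
  by (simp add: ker_def mol_def bump_def fun_eq_iff)
 ultimately show ?thesis using test_function_C1c by metis
qed

definition vanishes_beyond :: "real => ('a::real_normed_vector => 'b::zero) => bool" where
 "vanishes_beyond R k \<longleftrightarrow> (\<forall>x. R <= norm x --> k x = 0)"

lemma vanishes_beyondD: "vanishes_beyond R k ==> R <= norm x ==> k x = 0"
 by (simp add: vanishes_beyond_def)

lemma C1c_vanishes_beyond: "C1c R f ==> vanishes_beyond R f" "C1c R f ==> vanishes_beyond R (grad f)"
 by (auto simp: vanishes_beyond_def C1c_def)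

lemma compact_support_bounded:
 fixes k :: "'a::euclidean_space => 'b::real_normed_vector"
 assumes "continuous_on UNIV k" "vanishes_beyond R k"
 obtains M where "0 < M" "\<And>x. norm (k x) <= M"
proof -
 have "compact (k ` cball 0 R)"
  by (intro compact_continuous_image continuous_on_subset[OF assms(1)]) auto
 then obtain M where M: "0 < M" "\<And>y. y \<in> k ` cball 0 R ==> norm y <= M"
  by (metis compact_imp_bounded bounded_pos)
 have "norm (k x) <= M" for x
 proof (cases "x \<in> cball 0 R")
  case False
  then have "k x = 0" by (intro vanishes_beyondD[OF assms(2)]) auto
  then show ?thesis using M(1) by simp
 qed (use M in auto)
 with M(1) show thesis by (rule that)
qed

lemma compact_support_uniform:
 fixes k :: "'a::euclidean_space => 'b::real_normed_vector"
 assumes "continuous_on UNIV k" "vanishes_beyond R k" "0 < e"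
 obtains d where "0 < d" "d <= 1" "\<And>x y. norm (x - y) < d ==> norm (k x - k y) < e"
proof -
 have "uniformly_continuous_on (cball 0 (R + 1)) k"
  by (intro compact_uniformly_continuous continuous_on_subset[OF assms(1)]) auto
 then obtain d where d: "d > 0" "\<And>x y. x \<in> cball 0 (R + 1) ==> y \<in> cball 0 (R + 1) ==> dist x y < d ==> dist (k x) (k y) < e"
  using assms(3) unfolding uniformly_continuous_on_def by metis
 show thesis
 proof (rule that[of "min d 1"])
  fix x y :: 'a assume xy: "norm (x - y) < min d 1"
  have tri: "norm x <= norm y + norm (x - y)" "norm y <= norm x + norm (x - y)"
   using norm_triangle_sub[of x y] norm_triangle_sub[of y x] by (auto simp: norm_minus_commute)
  show "norm (k x - k y) < e"
  proof (cases "R <= norm x \<and> R <= norm y")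
   case True
   then show ?thesis using vanishes_beyondD[OF assms(2)] assms(3) by simp
  next
   case False
   then have "x \<in> cball 0 (R + 1)" "y \<in> cball 0 (R + 1)" using tri xy by auto
   then show ?thesis using d(2)[of x y] xy by (simp add: dist_norm)
  qed
 qed (use d in auto)
qed

section \<open>Convolution with compactly supported kernels\<close>

definition locint :: "('a::euclidean_space => 'b::euclidean_space) => bool" where
 "locint f \<longleftrightarrow> Borel f \<and> (\<forall>R. integrable lborel (%x. indicator (cball 0 R) x *\<^sub>R f x))"

lemma locint_measurable[measurable_dest]: "locint f ==> Borel f"
 by (simp add: locint_def)

lemma locint_norm_integrable: "locint f ==> integrable lborel (%x. indicator (cball 0 R) x * norm (f x))"
 unfolding locint_def using integrable_norm[of lborel "%x. indicator (cball 0 R) x *\<^sub>R f x"] by simp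

lemma locint_mult_integrable:
 fixes f :: "'a::euclidean_space => real" and k :: "'a => 'b::euclidean_space"
 assumes "locint f" "Borel k" "\<And>x. norm (k x) <= M" "vanishes_beyond R k"
 shows "integrable lborel (%x. f x *\<^sub>R k x)"
proof (rule Bochner_Integration.integrable_bound)
 show "integrable lborel (%x. M * (indicator (cball 0 R) x * norm (f x)))"
  using locint_norm_integrable[OF assms(1)] by simp
 have "norm (f x *\<^sub>R k x) <= norm (M * (indicator (cball 0 R) x * norm (f x)))" for x
 proof (cases "R <= norm x")
  case False
  then have "norm (f x) * norm (k x) <= norm (f x) * \<bar>M\<bar>"
   using assms(3)[of x] by (intro mult_left_mono) auto
  then show ?thesis using False by (simp add: indicator_def abs_mult mult.commute)
 qed (use vanishes_beyondD[OF assms(4)] in auto)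
 then show "AE x in lborel. norm (f x *\<^sub>R k x) <= norm (M * (indicator (cball 0 R) x * norm (f x)))" by simp
qed (use assms in \<open>auto dest: locint_measurable\<close>)

text \<open>The kernel may be vector-valued, so that the same convolution serves for a scalar kernel
  and for its gradient.\<close>

definition vconv :: "('a::euclidean_space => 'b::euclidean_space) => ('a => real) => 'a => 'b" where
 "vconv k f x = (\<integral>y. f y *\<^sub>R k (x - y) \<partial>lborel)"

lemma vconv_integrable:
 fixes k :: "'a::euclidean_space => 'b::euclidean_space"
 assumes "locint f" "continuous_on UNIV k" "vanishes_beyond R k"
 shows "integrable lborel (%y. f y *\<^sub>R k (x - y))"
proof -
 obtain M where M: "0 < M" "\<And>x. norm (k x) <= M" by (rule compact_support_bounded[OF assms(2,3)]) (rule that)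
 show ?thesis
 proof (rule locint_mult_integrable[OF assms(1), of _ M "R + norm x"])
  have "continuous_on UNIV (%y. k (x - y))"
   by (rule continuous_on_compose2[OF assms(2)]) (auto intro!: continuous_intros)
  then show "Borel (%y. k (x - y))" by (rule borel_measurable_continuous_onI)
  show "norm (k (x - y)) <= M" for y by (rule M)
  show "vanishes_beyond (R + norm x) (%y. k (x - y))"
   unfolding vanishes_beyond_def
  proof (intro allI impI)
   fix y :: 'a assume "R + norm x <= norm y"
   then show "k (x - y) = 0"
    using norm_triangle_ineq2[of y x] by (intro vanishes_beyondD[OF assms(3)]) (simp add: norm_minus_commute)
  qed
 qed
qed

lemma integral_bound_locint:
 fixes F :: "'a::euclidean_space => 'b::euclidean_space"
 assumes "locint f" "integrable lborel F" "\<And>y. norm (F y) <= e * (indicator (cball 0 R) y * norm (f y))"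
 shows "norm (\<integral>y. F y \<partial>lborel) <= e * (\<integral>y. indicator (cball 0 R) y * norm (f y) \<partial>lborel)"
proof -
 have "norm (\<integral>y. F y \<partial>lborel) <= (\<integral>y. norm (F y) \<partial>lborel)" by (rule integral_norm_bound)
 also have "\<dots> <= (\<integral>y. e * (indicator (cball 0 R) y * norm (f y)) \<partial>lborel)"
  using assms locint_norm_integrable[OF assms(1)] by (intro Bochner_Integration.integral_mono) auto
 finally show ?thesis by simp
qed

lemma vconv_continuous:
 fixes k :: "'a::euclidean_space => 'b::euclidean_space"
 assumes f: "locint f" and k: "continuous_on UNIV k" "vanishes_beyond R k"
 shows "continuous_on UNIV (vconv k f)"
proof (rule continuous_onI)
 fix x :: 'a and e :: real assume e: "0 < e"
 \<comment> \<open>Within distance 1 of \<open>x\<close> the kernel sees \<open>f\<close> only on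
   this ball; the extra 1 matches \<open>d <= 1\<close>. Below, \<open>e\<close> is divided by
   \<open>I + 1\<close> because \<open>I\<close> may be 0.\<close>
 define I where "I = (\<integral>y. indicator (cball 0 (R + norm x + 1)) y * norm (f y) \<partial>lborel)"
 have I: "0 <= I" unfolding I_def by (intro Bochner_Integration.integral_nonneg) auto
 have pos: "0 < e / (I + 1)" using e I by simp
 obtain d where d: "0 < d" "d <= 1" "\<And>x y. norm (x - y) < d ==> norm (k x - k y) < e / (I + 1)"
  by (rule compact_support_uniform[OF k pos]) (rule that)
 have "dist (vconv k f x') (vconv k f x) <= e" if x': "dist x' x < d" for x'
 proof -
  have "vconv k f x' - vconv k f x = (\<integral>y. f y *\<^sub>R k (x' - y) - f y *\<^sub>R k (x - y) \<partial>lborel)"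
   unfolding vconv_def using vconv_integrable[OF f k] by simp
  also have "norm \<dots> <= e / (I + 1) * I"
   unfolding I_def
  proof (rule integral_bound_locint[OF f])
   fix y
   show "norm (f y *\<^sub>R k (x' - y) - f y *\<^sub>R k (x - y)) <= e / (integral\<^sup>L lborel (%y. indicator (cball 0 (R + norm x + 1)) y * norm (f y)) + 1) * (indicator (cball 0 (R + norm x + 1)) y * norm (f y))"
    unfolding I_def[symmetric]
   proof (cases "norm y <= R + norm x + 1")
    case True
    have "norm (f y *\<^sub>R k (x' - y) - f y *\<^sub>R k (x - y)) = norm (f y) * norm (k (x' - y) - k (x - y))"
     by (simp add: scaleR_diff_right[symmetric])
    also have "\<dots> <= norm (f y) * (e / (I + 1))"
     using d(3)[of "x' - y" "x - y"] x' by (intro mult_left_mono) (auto simp: dist_norm)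
    finally show "norm (f y *\<^sub>R k (x' - y) - f y *\<^sub>R k (x - y)) <= e / (I + 1) * (indicator (cball 0 (R + norm x + 1)) y * norm (f y))"
     using True by (simp add: mult.commute)
   next
    case False
    have "norm y <= norm (x - y) + norm x" "norm x' <= norm x + norm (x' - x)" "norm y <= norm (x' - y) + norm x'"
     using norm_triangle_ineq2[of y x] norm_triangle_ineq2[of y x'] norm_triangle_ineq2[of x' x]
     by (auto simp: norm_minus_commute)
    then have "R <= norm (x - y)" "R <= norm (x' - y)" using False d x' by (auto simp: dist_norm)
    then show "norm (f y *\<^sub>R k (x' - y) - f y *\<^sub>R k (x - y)) <= e / (I + 1) * (indicator (cball 0 (R + norm x + 1)) y * norm (f y))"
     using vanishes_beyondD[OF k(2)] e I by simp
   qed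
  qed (use vconv_integrable[OF f k] in auto)
  also have "\<dots> <= e" using e I by (simp add: field_simps)
  finally show ?thesis by (simp add: dist_norm)
 qed
 with d(1) show "\<exists>d>0. \<forall>x'\<in>UNIV. dist x' x < d --> dist (vconv k f x') (vconv k f x) <= e" by blast
qed

text \<open>The mean value theorem on the segment and uniform continuity of the gradient. That the
  remainder is uniform in the base point permits differentiation under the integral.\<close>

lemma C1c_taylor:
 assumes "C1c R K" "0 < e"
 obtains d where "0 < d" "d <= 1" "\<And>x h. norm h < d ==> \<bar>K (x + h) - K x - grad K x \<bullet> h\<bar> <= e * norm h"
proof -
 note C = assms(1) note K = C1cD[OF C]
 obtain d where d: "0 < d" "d <= 1" "\<And>x y. norm (x - y) < d ==> norm (grad K x - grad K y) < e"
  by (rule compact_support_uniform[OF K(2) C1c_vanishes_beyond(2)[OF C] assms(2)]) (rule that)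
 have "\<bar>K (x + h) - K x - grad K x \<bullet> h\<bar> <= e * norm h" if h: "norm h < d" for x h
 proof -
  have "((%t. K (x + t *\<^sub>R h)) has_real_derivative (grad K (x + t *\<^sub>R h) \<bullet> h)) (at t)" for t
  proof -
   have 1: "((%t. x + t *\<^sub>R h) has_derivative (%s. s *\<^sub>R h)) (at t)" by (auto intro!: derivative_eq_intros)
   have "((%t. K (x + t *\<^sub>R h)) has_derivative (%s. grad K (x + t *\<^sub>R h) \<bullet> (s *\<^sub>R h))) (at t)"
    by (rule has_derivative_compose[OF 1 has_derivative_grad[OF K(1)]])
   then show ?thesis unfolding has_field_derivative_def by (rule has_derivative_eq_rhs) (auto simp: mult.commute)
  qed
  then have "\<exists>z::real. z > 0 \<and> z < 1 \<and> K (x + 1 *\<^sub>R h) - K (x + 0 *\<^sub>R h) = (1 - 0) * (grad K (x + z *\<^sub>R h) \<bullet> h)"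
   by (intro MVT2) auto
  then obtain z :: real where z: "0 < z" "z < 1" "K (x + h) - K x = grad K (x + z *\<^sub>R h) \<bullet> h" by auto
  have "norm (z *\<^sub>R h) <= 1 * norm h" unfolding norm_scaleR using z by (intro mult_right_mono) auto
  then have "norm (grad K (x + z *\<^sub>R h) - grad K x) < e" using h by (intro d(3)) auto
  then have "norm (grad K (x + z *\<^sub>R h) - grad K x) * norm h <= e * norm h" by (intro mult_right_mono) auto
  then have "\<bar>(grad K (x + z *\<^sub>R h) - grad K x) \<bullet> h\<bar> <= e * norm h"
   using Cauchy_Schwarz_ineq2[of "grad K (x + z *\<^sub>R h) - grad K x" h] by linarith
  then show ?thesis using z(3) by (simp add: inner_diff_left)
 qed
 with d show thesis by (intro that)
qed

text \<open>Differentiation under the integral sign: the uniform remainder of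
  \<open>C1c_taylor\<close> is integrated against \<open>f\<close> over a ball outside which the
  kernel and its small translates vanish.\<close>

lemma vconv_has_derivative:
 fixes K :: "'a::euclidean_space => real"
 assumes f: "locint f" and C: "C1c R K"
 shows "(vconv K f has_derivative (%h. vconv (grad K) f x \<bullet> h)) (at x)"
 unfolding has_derivative_at_alt
proof (intro conjI allI impI)
 show "bounded_linear (%h. vconv (grad K) f x \<bullet> h)" by (rule bounded_linear_inner_right)
 note K = C1cD[OF C]
 fix e :: real assume e: "0 < e"
 define I where "I = (\<integral>y. indicator (cball 0 (R + norm x + 1)) y * norm (f y) \<partial>lborel)"
 have I: "0 <= I" unfolding I_def by (intro Bochner_Integration.integral_nonneg) auto
 have pos: "0 < e / (I + 1)" using e I by simp
 obtain d where d: "0 < d" "d <= 1" "\<And>x h. norm h < d ==> \<bar>K (x + h) - K x - grad K x \<bullet> h\<bar> <= e / (I + 1) * norm h"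
  by (rule C1c_taylor[OF C pos]) (rule that)
 have "norm (vconv K f x' - vconv K f x - vconv (grad K) f x \<bullet> (x' - x)) <= e * norm (x' - x)" if x': "norm (x' - x) < d" for x'
 proof -
  define h where "h = x' - x"
  have h: "norm h < d" "x' = x + h" using x' by (auto simp: h_def)
  note i1 = vconv_integrable[OF f K(5) C1c_vanishes_beyond(1)[OF C]] and i2 = vconv_integrable[OF f K(2) C1c_vanishes_beyond(2)[OF C], where x=x]
  have i3: "integrable lborel (%y. f y * (grad K (x - y) \<bullet> h))"
   using integrable_inner_left[OF i2, of h] by simp
  have "vconv K f x' - vconv K f x - vconv (grad K) f x \<bullet> h
    = (\<integral>y. f y * K (x' - y) \<partial>lborel) - (\<integral>y. f y * K (x - y) \<partial>lborel) - (\<integral>y. f y * (grad K (x - y) \<bullet> h) \<partial>lborel)"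
   unfolding vconv_def using integral_inner_left[OF i2, of h] by simp
  also have "\<dots> = (\<integral>y. f y * K (x' - y) - f y * K (x - y) - f y * (grad K (x - y) \<bullet> h) \<partial>lborel)"
   using i1[where x=x] i1[where x=x'] i3 by simp
  also have "norm \<dots> <= (e / (I + 1) * norm h) * I"
   unfolding I_def
  proof (rule integral_bound_locint[OF f])
   fix y
   have "\<bar>f y * K (x' - y) - f y * K (x - y) - f y * (grad K (x - y) \<bullet> h)\<bar> <= e / (I + 1) * norm h * (indicator (cball 0 (R + norm x + 1)) y * \<bar>f y\<bar>)"
   proof (cases "norm y <= R + norm x + 1")
    case True
    have "\<bar>f y * K (x' - y) - f y * K (x - y) - f y * (grad K (x - y) \<bullet> h)\<bar> = \<bar>f y\<bar> * \<bar>K ((x - y) + h) - K (x - y) - grad K (x - y) \<bullet> h\<bar>"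
     by (simp add: abs_mult[symmetric] right_diff_distrib h(2) algebra_simps)
    also have "\<dots> <= \<bar>f y\<bar> * (e / (I + 1) * norm h)"
     using d(3)[OF h(1)] by (intro mult_left_mono) auto
    finally show ?thesis using True by (simp add: mult.commute)
   next
    case False
    have "norm y <= norm (x - y) + norm x" "norm x' <= norm x + norm (x' - x)" "norm y <= norm (x' - y) + norm x'"
     using norm_triangle_ineq2[of y x] norm_triangle_ineq2[of y x'] norm_triangle_ineq2[of x' x]
     by (auto simp: norm_minus_commute)
    then have "R <= norm (x - y)" "R <= norm (x' - y)" using False d x' by auto
    then show ?thesis using K(3,4) e I by simp
   qed
   then show "norm (f y * K (x' - y) - f y * K (x - y) - f y * (grad K (x - y) \<bullet> h)) <= e / (integral\<^sup>L lborel (%y. indicator (cball 0 (R + norm x + 1)) y * norm (f y)) + 1) * norm h * (indicator (cball 0 (R + norm x + 1)) y * norm (f y))"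
    unfolding I_def by simp
  qed (use i1[where x=x] i1[where x=x'] i3 in auto)
  also have "\<dots> = e * norm h * (I / (I + 1))" by simp
  also have "\<dots> <= e * norm h * 1" using e I by (intro mult_left_mono) auto
  finally show ?thesis by (simp add: h_def)
 qed
 with d(1) show "\<exists>d>0. \<forall>x'. norm (x' - x) < d --> norm (vconv K f x' - vconv K f x - vconv (grad K) f x \<bullet> (x' - x)) <= e * norm (x' - x)"
  by blast
qed

lemma lborel_integral_translate:
 fixes f :: "'a::euclidean_space => 'b::{banach, second_countable_topology}"
 assumes [measurable]: "Borel f"
 shows "(\<integral>x. f (x + a) \<partial>lborel) = (\<integral>x. f x \<partial>lborel)"
proof -
 have "(\<integral>x. f x \<partial>lborel) = (\<integral>x. f x \<partial>distr lborel borel ((+) a))" by (simp add: lborel_distr_plus)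
 also have "\<dots> = (\<integral>x. f (a + x) \<partial>lborel)" by (subst integral_distr) auto
 finally show ?thesis by (simp add: add.commute)
qed

lemma nn_integral_translate:
 fixes f :: "'a::euclidean_space => ennreal"
 assumes [measurable]: "Borel f"
 shows "(\<integral>\<^sup>+x. f (x + a) \<partial>lborel) = (\<integral>\<^sup>+x. f x \<partial>lborel)"
proof -
 have "(\<integral>\<^sup>+x. f x \<partial>lborel) = (\<integral>\<^sup>+x. f x \<partial>distr lborel borel ((+) a))" by (simp add: lborel_distr_plus)
 also have "\<dots> = (\<integral>\<^sup>+x. f (a + x) \<partial>lborel)" by (subst nn_integral_distr) auto
 finally show ?thesis by (simp add: add.commute)
qed

text \<open>By translation invariance the integral of \<open>K (x + t *\<^sub>R b) - K x\<close>
  vanishes, while by \<open>C1c_taylor\<close> it equals \<open>t\<close> times the integral in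
  question up to a small multiple of \<open>t\<close>.\<close>

lemma C1c_integral_grad_zero:
 fixes K :: "'a::euclidean_space => real"
 assumes C: "C1c R K" and b: "norm b = 1"
 shows "(\<integral>x. grad K x \<bullet> b \<partial>lborel) = 0"
proof -
 note K = C1cD[OF C]
 define J where "J = (\<integral>x. grad K x \<bullet> b \<partial>lborel)"
 define V where "V = (\<integral>x. indicat_real (cball (0::'a) (R + 1)) x \<partial>lborel)"
 have V: "0 <= V" unfolding V_def by (intro Bochner_Integration.integral_nonneg) auto
 have iV: "integrable lborel (indicator (cball (0::'a) (R + 1)) :: _ => real)"
  by (rule integrable_real_indicator) (use emeasure_bounded_finite[OF bounded_cball] in auto)
 have "\<bar>J\<bar> <= e" if e: "0 < e" for e
 proof -
  have pos: "0 < e / (V + 1)" using e V by simp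
  obtain d where d: "0 < d" "d <= 1" "\<And>x h. norm h < d ==> \<bar>K (x + h) - K x - grad K x \<bullet> h\<bar> <= e / (V + 1) * norm h"
   by (rule C1c_taylor[OF C pos]) (rule that)
  define t where "t = d / 2"
  have t: "0 < t" "t < 1" "norm (t *\<^sub>R b) = t" "t < d" using d b by (auto simp: t_def)
  have iK: "integrable lborel (%x. K (x + t *\<^sub>R b))"
  proof (rule integrable_continuous_compact_support[of _ "R + 1"])
   show "continuous_on UNIV (%x. K (x + t *\<^sub>R b))"
    by (rule continuous_on_compose2[OF K(5)]) (auto intro!: continuous_intros)
   show "K (x + t *\<^sub>R b) = 0" if "R + 1 <= norm x" for x
    using that t norm_diff_ineq[of x "t *\<^sub>R b"] by (intro K(3)) auto
  qed
  have "t * J = (\<integral>x. t * (grad K x \<bullet> b) \<partial>lborel)" by (simp add: J_def)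
  also have "\<dots> = (\<integral>x. t * (grad K x \<bullet> b) \<partial>lborel) - ((\<integral>x. K (x + t *\<^sub>R b) \<partial>lborel) - (\<integral>x. K x \<partial>lborel))"
   using lborel_integral_translate[OF K(8)] by simp
  also have "\<dots> = (\<integral>x. t * (grad K x \<bullet> b) - (K (x + t *\<^sub>R b) - K x) \<partial>lborel)"
   using iK K(6) K(7)[of b] by simp
  finally have "\<bar>t * J\<bar> = norm (\<integral>x. t * (grad K x \<bullet> b) - (K (x + t *\<^sub>R b) - K x) \<partial>lborel)" by simp
  also have "\<dots> <= (\<integral>x. norm (t * (grad K x \<bullet> b) - (K (x + t *\<^sub>R b) - K x)) \<partial>lborel)" by (rule integral_norm_bound)
  also have "\<dots> <= (\<integral>x. e / (V + 1) * t * indicator (cball (0::'a) (R + 1)) x \<partial>lborel)"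
  proof (rule Bochner_Integration.integral_mono)
   fix x :: 'a
   show "norm (t * (grad K x \<bullet> b) - (K (x + t *\<^sub>R b) - K x)) <= e / (V + 1) * t * indicator (cball 0 (R + 1)) x"
   proof (cases "norm x <= R + 1")
    case True
    then show ?thesis using d(3)[of "t *\<^sub>R b" x] t by (simp add: abs_minus_commute)
   next
    case False
    then have "R <= norm (x + t *\<^sub>R b)" using t norm_diff_ineq[of x "t *\<^sub>R b"] by auto
    then show ?thesis using K(3,4) False e V t by simp
   qed
  qed (use iK K(6) K(7)[of b] iV in auto)
  also have "\<dots> = e / (V + 1) * t * V" by (simp add: V_def)
  also have "\<dots> = t * (e * (V / (V + 1)))" by simp
  also have "\<dots> <= t * (e * 1)" using e V t by (intro mult_left_mono) auto
  finally show ?thesis using t by (simp add: abs_mult)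
 qed
 note small = this
 have "\<bar>J\<bar> <= 0"
 proof (rule field_le_epsilon)
  fix e :: real assume "0 < e"
  then show "\<bar>J\<bar> <= 0 + e" using small[of e] by simp
 qed
 then show ?thesis by (simp add: J_def)
qed

lemma C1c_mult:
 assumes F: "\<And>x. (F has_derivative (%h. k x \<bullet> h)) (at x)" "continuous_on UNIV k" and C: "C1c R \<phi>"
 shows "C1c R (%x. F x * \<phi> x)" "grad (%x. F x * \<phi> x) x = F x *\<^sub>R grad \<phi> x + \<phi> x *\<^sub>R k x"
proof -
 note K = C1cD[OF C]
 have d: "((%x. F x * \<phi> x) has_derivative (%h. (F x *\<^sub>R grad \<phi> x + \<phi> x *\<^sub>R k x) \<bullet> h)) (at x)" for x
  by (rule has_derivative_eq_rhs[OF has_derivative_mult[OF F(1) has_derivative_grad[OF K(1)]]])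
   (auto simp: inner_add_left mult.commute)
 then show g: "grad (%x. F x * \<phi> x) x = F x *\<^sub>R grad \<phi> x + \<phi> x *\<^sub>R k x" for x by (rule grad_unique)
 have cF: "continuous_on UNIV F"
  using has_derivative_continuous[OF F(1)] by (simp add: continuous_on_eq_continuous_at)
 have "continuous_on UNIV (grad (%x. F x * \<phi> x))"
  unfolding g[abs_def] by (intro continuous_intros cF K F(2))
 then show "C1c R (%x. F x * \<phi> x)"
  unfolding C1c_def using d K(3,4) g by (auto simp: differentiable_def)
qed

text \<open>\<open>F\<close> need not have compact support, but its product with
  \<open>\<phi>\<close> does, and the gradient of the product integrates to 0.\<close>

lemma integration_by_parts_C1:
 assumes F: "\<And>x. (F has_derivative (%h. k x \<bullet> h)) (at x)" "continuous_on UNIV k" and C: "C1c R \<phi>" and b: "norm b = 1"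
 shows "(\<integral>x. F x * (grad \<phi> x \<bullet> b) \<partial>lborel) = - (\<integral>x. (k x \<bullet> b) * \<phi> x \<partial>lborel)"
proof -
 note K = C1cD[OF C]
 have cF: "continuous_on UNIV F"
  using has_derivative_continuous[OF F(1)] by (simp add: continuous_on_eq_continuous_at)
 have i: "integrable lborel (%x. F x * (grad \<phi> x \<bullet> b))" "integrable lborel (%x. (k x \<bullet> b) * \<phi> x)"
  by (rule integrable_continuous_compact_support[of _ R]; use K(3,4) in \<open>auto intro!: continuous_intros cF K F(2)\<close>)+
 have "0 = (\<integral>x. grad (%x. F x * \<phi> x) x \<bullet> b \<partial>lborel)"
  using C1c_integral_grad_zero[OF C1c_mult(1)[OF F C] b] by simp
 also have "\<dots> = (\<integral>x. F x * (grad \<phi> x \<bullet> b) + (k x \<bullet> b) * \<phi> x \<partial>lborel)"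
  unfolding C1c_mult(2)[OF F C] by (simp add: inner_add_left mult.commute)
 also have "\<dots> = (\<integral>x. F x * (grad \<phi> x \<bullet> b) \<partial>lborel) + (\<integral>x. (k x \<bullet> b) * \<phi> x \<partial>lborel)"
  using i by simp
 finally show ?thesis by linarith
qed

text \<open>Here the function may be vector-valued, whereas in \<open>vconv\<close> the kernel may
  be; on scalar functions the two agree by \<open>moll_eq_vconv\<close>.\<close>

definition moll :: "real => ('a::euclidean_space => 'b::euclidean_space) => 'a => 'b" where
 "moll r f x = (\<integral>y. ker r (x - y) *\<^sub>R f y \<partial>lborel)"

lemma moll_eq_vconv: "moll r f = vconv (ker r) f" for f :: "'a::euclidean_space => real"
 by (simp add: moll_def vconv_def fun_eq_iff mult.commute)

lemma moll_integrable:
 fixes f :: "'a::euclidean_space => 'b::euclidean_space"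
 assumes "locint f" "0 < r" shows "integrable lborel (%y. ker r (x - y) *\<^sub>R f y)"
proof -
 obtain R where C: "C1c R (ker r :: 'a => real)" using ker_C1c[OF assms(2)] by blast
 note K = C1cD[OF C]
 have [measurable]: "Borel f" "Borel (ker r :: 'a => real)"
  using assms K by (auto dest: locint_measurable)
 have "locint (%y. norm (f y))"
  using assms(1) locint_norm_integrable[OF assms(1)] by (auto simp: locint_def)
 from vconv_integrable[OF this K(5) C1c_vanishes_beyond(1)[OF C], where x=x]
 have "integrable lborel (%y. norm (f y) * ker r (x - y))" by simp
 then show ?thesis
  by (rule Bochner_Integration.integrable_bound) (auto simp: abs_mult)
qed

lemma locint_inner: "locint w ==> locint (%x. w x \<bullet> b)"
 unfolding locint_def using integrable_inner_left[of b lborel "%x. indicator (cball 0 _) x *\<^sub>R w x"] by auto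

lemma moll_inner:
 assumes "locint f" "0 < r" shows "moll r f x \<bullet> b = moll r (%y. f y \<bullet> b) x"
 unfolding moll_def using integral_inner_left[OF moll_integrable[OF assms, where x=x], where c=b] by simp

lemma moll_continuous:
 fixes f :: "'a::euclidean_space => 'b::euclidean_space"
 assumes "locint f" "0 < r" shows "continuous_on UNIV (moll r f)"
proof -
 obtain R where C: "C1c R (ker r :: 'a => real)" using ker_C1c[OF assms(2)] by blast
 note K = C1cD[OF C]
 have "continuous_on UNIV (%x. moll r f x \<bullet> b)" for b
  using vconv_continuous[OF locint_inner[OF assms(1)] K(5) C1c_vanishes_beyond(1)[OF C]] by (simp add: moll_inner[OF assms] moll_eq_vconv)
 then show ?thesis by (subst continuous_on_componentwise) auto
qed

lemma moll_has_derivative: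
 fixes f :: "'a::euclidean_space => real"
 assumes "locint f" "0 < r"
 shows "(moll r f has_derivative (%h. vconv (grad (ker r)) f x \<bullet> h)) (at x)"
  "continuous_on UNIV (vconv (grad (ker r)) f)"
proof -
 obtain R where C: "C1c R (ker r :: 'a => real)" using ker_C1c[OF assms(2)] by blast
 note K = C1cD[OF C]
 show "(moll r f has_derivative (%h. vconv (grad (ker r)) f x \<bullet> h)) (at x)"
  unfolding moll_eq_vconv by (rule vconv_has_derivative[OF assms(1) C])
 show "continuous_on UNIV (vconv (grad (ker r)) f)"
  by (rule vconv_continuous[OF assms(1) K(2) C1c_vanishes_beyond(2)[OF C]])
qed

lemma measurable_lebesgue_cong_AE:
 assumes g: "g \<in> borel_measurable lebesgue" and ae: "AE y in lborel. f y = g y"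
 shows "f \<in> borel_measurable (lebesgue :: 'a::euclidean_space measure)"
proof (rule measurableI)
 obtain N where N: "N \<in> null_sets lborel" "{x. f x \<noteq> g x} \<subseteq> N"
  using ae by (rule AE_E) (auto simp: null_sets_def intro: that)
 fix A :: "'b set" assume [measurable]: "A \<in> sets borel"
 have "f -` A \<inter> N \<in> sets lebesgue"
  by (rule null_setsD2, rule null_sets_completion_subset[of _ N]) (use N in \<open>auto intro: null_sets_completionI\<close>)
 moreover have "(g -` A \<inter> space lebesgue) - N \<in> sets lebesgue"
  using N by (intro sets.Diff measurable_sets[OF g]) auto
 moreover have "f -` A \<inter> space lebesgue = ((g -` A \<inter> space lebesgue) - N) \<union> (f -` A \<inter> N)" using N(2) by auto
 ultimately show "f -` A \<inter> space lebesgue \<in> sets lebesgue" by (metis sets.Un)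
qed simp

lemma integral_cong_AE_completion:
 fixes f g :: "'a::euclidean_space => 'b::{banach, second_countable_topology}"
 assumes "AE y in lborel. f y = g y" "Borel g"
 shows "(\<integral>y. f y \<partial>lebesgue) = (\<integral>y. g y \<partial>lebesgue)"
proof -
 have ae: "AE y in lebesgue. g y = f y" using assms(1) by (intro AE_completion) (auto elim: eventually_mono)
 have g: "g \<in> borel_measurable lebesgue" using assms(2) by (intro measurable_completion) auto
 have "f \<in> borel_measurable lebesgue" by (rule measurable_lebesgue_cong_AE[OF g assms(1)])
 with g ae show ?thesis by (intro integral_cong_AE) auto
qed

text \<open>Since the ball about \<open>x\<close> lies in \<open>G\<close>, the kernel centred at
  \<open>x\<close> is a test function, and the definition of the weak gradient moves the derivative
  from the kernel to \<open>w\<close>. The minus sign is cancelled by the reflection in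
  \<open>x - y\<close>. \<open>v'\<close> and \<open>w'\<close> are Borel representatives extended
  by 0, whose values outside \<open>G\<close> the kernel does not see.\<close>

lemma moll_weak_gradient:
 fixes v :: "'a::euclidean_space => real"
 assumes wg: "weak_gradient G v w" and v': "locint v'" "AE x in lborel. v' x = indicator G x * v x"
  and w': "locint w'" "AE x in lborel. w' x = indicator G x *\<^sub>R w x" and x: "cball x r \<subseteq> G" "0 < r"
 shows "(moll r v' has_derivative (%h. moll r w' x \<bullet> h)) (at x)"
proof -
 obtain R where C: "C1c R (ker r :: 'a => real)" using ker_C1c[OF x(2)] by blast
 note K = C1cD[OF C]
 have [measurable]: "Borel v'" "Borel w'"
  "Borel (ker r :: 'a => real)" "Borel (grad (ker r) :: 'a => 'a)"
  using v' w' K by (auto dest: locint_measurable)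
 have "vconv (grad (ker r)) v' x = moll r w' x"
 proof (rule euclidean_eqI)
  fix b :: 'a assume b: "b \<in> Basis"
  have fd: "frechet_derivative (%y. ker r (x - y)) (at y) b = - (grad (ker r) (x - y) \<bullet> b)" for y
  proof -
   have 1: "((%y. x - y) has_derivative (%h. - h)) (at y)" by (auto intro!: derivative_eq_intros)
   have "((%y. ker r (x - y)) has_derivative (%h. grad (ker r) (x - y) \<bullet> (- h))) (at y)"
    by (rule has_derivative_compose[OF 1 has_derivative_grad[OF K(1)]])
   from frechet_derivative_at[OF this, symmetric] show ?thesis by simp
  qed
  have "(LINT y : G | lebesgue. v y * frechet_derivative (%y. ker r (x - y)) (at y) b)
    = - (LINT y : G | lebesgue. (w y \<bullet> b) * ker r (x - y))"
   using wg ker_test_function[OF x(2,1)] b unfolding weak_gradient_def by blast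
  moreover have "(LINT y : G | lebesgue. v y * frechet_derivative (%y. ker r (x - y)) (at y) b)
   = (\<integral>y. v' y * - (grad (ker r) (x - y) \<bullet> b) \<partial>lebesgue)"
   unfolding set_lebesgue_integral_def fd
  proof (rule integral_cong_AE_completion)
   show "AE y in lborel. indicat_real G y *\<^sub>R (v y * - (grad (ker r) (x - y) \<bullet> b)) = v' y * - (grad (ker r) (x - y) \<bullet> b)"
    using v'(2) by eventually_elim simp
  qed measurable
  moreover have "(LINT y : G | lebesgue. (w y \<bullet> b) * ker r (x - y)) = (\<integral>y. (w' y \<bullet> b) * ker r (x - y) \<partial>lebesgue)"
   unfolding set_lebesgue_integral_def
  proof (rule integral_cong_AE_completion)
   show "AE y in lborel. indicat_real G y *\<^sub>R (w y \<bullet> b * ker r (x - y)) = (w' y \<bullet> b) * ker r (x - y)"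
    using w'(2) by eventually_elim simp
  qed measurable
  ultimately have "(\<integral>y. v' y * - (grad (ker r) (x - y) \<bullet> b) \<partial>lebesgue) = - (\<integral>y. (w' y \<bullet> b) * ker r (x - y) \<partial>lebesgue)" by simp
  then have "(\<integral>y. v' y * - (grad (ker r) (x - y) \<bullet> b) \<partial>lborel) = - (\<integral>y. (w' y \<bullet> b) * ker r (x - y) \<partial>lborel)"
   by (subst (asm) (1 2) integral_completion) auto
  then have "(\<integral>y. v' y * (grad (ker r) (x - y) \<bullet> b) \<partial>lborel) = (\<integral>y. ker r (x - y) * (w' y \<bullet> b) \<partial>lborel)"
   by (simp add: mult.commute)
  moreover have "vconv (grad (ker r)) v' x \<bullet> b = (\<integral>y. v' y * (grad (ker r) (x - y) \<bullet> b) \<partial>lborel)"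
   unfolding vconv_def using integral_inner_left[OF vconv_integrable[OF v'(1) K(2) C1c_vanishes_beyond(2)[OF C], where x=x], of b] by simp
  moreover have "moll r w' x \<bullet> b = (\<integral>y. ker r (x - y) * (w' y \<bullet> b) \<partial>lborel)"
   unfolding moll_inner[OF w'(1) x(2)] by (simp add: moll_def)
  ultimately show "vconv (grad (ker r)) v' x \<bullet> b = moll r w' x \<bullet> b" by simp
 qed
 then show ?thesis using moll_has_derivative(1)[OF v'(1) x(2), of x] by simp
qed

section \<open>Convergence of mollifications in L^p\<close>

lemma pint_cong_AE: "AE x in lborel. f x = g x ==> pint p f = pint p g"
 unfolding pint_def by (rule nn_integral_cong_AE) auto

lemma pint_translate:
 assumes [measurable]: "Borel g"
 shows "pint p (%x. g (x - a)) = pint p g"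
 unfolding pint_def using nn_integral_translate[of "%x. enn_pow (g x) p" "- a"] by simp

text \<open>Jensen's inequality via Young's inequality with an optimised free parameter.\<close>

lemma jensen_mol:
 fixes h :: "'a::euclidean_space => ennreal"
 assumes [measurable]: "Borel h" and p: "1 < p"
 shows "enn_pow (\<integral>\<^sup>+z. ennreal (mol z) * h z \<partial>lborel) p <= (\<integral>\<^sup>+z. ennreal (mol z) * enn_pow (h z) p \<partial>lborel)"
proof -
 define I where "I = (\<integral>\<^sup>+z. ennreal (mol z) * enn_pow (h z) p \<partial>lborel)"
 have young: "x <= ennreal (t powr (1 - p) / p) * enn_pow x p + ennreal ((1 - 1/p) * t)" if t: "0 < t" for x t
 proof (cases x)
  case (real r)
  have "r powr 1 * 1 <= r powr p * t powr (1 - p) / p + (1 - 1/p) * t"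
  proof (cases "r = 0")
   case True
   then show ?thesis using p t by simp
  next
   case False
   have "(r powr p * t powr (1 - p)) powr (1/p) * t powr (1 - 1/p) <= (1/p) * (r powr p * t powr (1 - p)) + (1 - 1/p) * t"
    using p t False real by (intro Youngs_inequality_0) auto
   moreover have "(r powr p * t powr (1 - p)) powr (1/p) * t powr (1 - 1/p) = r"
    using p t False real by (simp add: powr_mult powr_powr powr_add[symmetric] field_simps)
   ultimately show ?thesis using real by simp
  qed
  then have "r <= (t powr (1 - p) / p) * r powr p + (1 - 1/p) * t"
   using real by (simp add: mult.commute)
  then have "ennreal r <= ennreal ((t powr (1 - p) / p) * r powr p + (1 - 1/p) * t)" by (rule ennreal_leI)
  also have "\<dots> = ennreal (t powr (1 - p) / p) * ennreal (r powr p) + ennreal ((1 - 1/p) * t)"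
   using p t by (subst ennreal_plus, simp, simp, subst ennreal_mult') auto
  finally show ?thesis using real by (simp add: enn_pow_ennreal)
 next
  case top
  then show ?thesis using p t by (simp add: ennreal_mult_top)
 qed
 have *: "(\<integral>\<^sup>+z. ennreal (mol z) * h z \<partial>lborel) <= ennreal (t powr (1 - p) / p) * I + ennreal ((1 - 1/p) * t)" if t: "0 < t" for t
 proof -
  have "(\<integral>\<^sup>+z. ennreal (mol z) * h z \<partial>lborel) <= (\<integral>\<^sup>+z. ennreal (t powr (1 - p) / p) * (ennreal (mol z) * enn_pow (h z) p) + ennreal (mol z) * ennreal ((1 - 1/p) * t) \<partial>lborel)"
  proof (rule nn_integral_mono)
   fix z :: 'a
   have "ennreal (mol z) * h z <= ennreal (mol z) * (ennreal (t powr (1 - p) / p) * enn_pow (h z) p + ennreal ((1 - 1/p) * t))"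
    by (intro mult_left_mono young t) simp
   then show "ennreal (mol z) * h z <= ennreal (t powr (1 - p) / p) * (ennreal (mol z) * enn_pow (h z) p) + ennreal (mol z) * ennreal ((1 - 1/p) * t)"
    by (simp add: distrib_left mult_ac)
  qed
  also have "\<dots> = ennreal (t powr (1 - p) / p) * I + (\<integral>\<^sup>+z. ennreal (mol z) \<partial>(lborel :: 'a measure)) * ennreal ((1 - 1/p) * t)"
   unfolding I_def by (subst nn_integral_add) (auto simp: nn_integral_cmult nn_integral_multc)
  finally show ?thesis by (simp add: nn_integral_mol)
 qed
 have "enn_pow (\<integral>\<^sup>+z. ennreal (mol z) * h z \<partial>lborel) p <= I"
 proof (cases I)
  case (real i)
  show ?thesis
  proof (cases "i = 0")
   case True
   have "(\<integral>\<^sup>+z. ennreal (mol z) * h z \<partial>lborel) <= ennreal (1 / Suc n)" for n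
   proof -
    have "(1 - 1/p) * (1 / Suc n) <= 1 * (1 / Suc n)" using p by (intro mult_right_mono) auto
    then have le: "ennreal ((1 - 1/p) * (1 / Suc n)) <= ennreal (1 * (1 / Suc n))" by (rule ennreal_leI)
    have I0: "I = 0" using real True by simp
    have "(\<integral>\<^sup>+z. ennreal (mol z) * h z \<partial>lborel) <= ennreal ((1 / Suc n) powr (1 - p) / p) * I + ennreal ((1 - 1/p) * (1 / Suc n))"
     by (rule *) simp
    also have "\<dots> <= ennreal (1 * (1 / Suc n))" using le unfolding I0 by simp
    finally show ?thesis by simp
   qed
   then have "(\<integral>\<^sup>+z. ennreal (mol z) * h z \<partial>lborel) = 0" by (rule le_inverse_Suc_imp_0)
   then show ?thesis by simp
  next
   case False
   with real have i: "0 < i" by simp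
   \<comment> \<open>With this value of the free parameter the two terms add up to exactly
     \<open>t\<close>. It would be 0 when \<open>i\<close> is 0, so in that case the parameter tends
     to 0 instead.\<close>
   define t where "t = i powr (1/p)"
   have t: "0 < t" "i = t powr p" using i p by (auto simp: t_def powr_powr)
   have "(\<integral>\<^sup>+z. ennreal (mol z) * h z \<partial>lborel) <= ennreal (t powr (1 - p) / p * i + (1 - 1/p) * t)"
   proof -
    have "ennreal (t powr (1 - p) / p * i + (1 - 1/p) * t) = ennreal (t powr (1 - p) / p) * ennreal i + ennreal ((1 - 1/p) * t)"
     using p t(1) i by (subst ennreal_plus, simp, simp, subst ennreal_mult') auto
    then show ?thesis using *[OF t(1)] unfolding real(2) by simp
   qed
   also have "t powr (1 - p) / p * i + (1 - 1/p) * t = t"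
    using t p by (simp add: powr_add[symmetric] field_simps)
   finally have "enn_pow (\<integral>\<^sup>+z. ennreal (mol z) * h z \<partial>lborel) p <= enn_pow (ennreal t) p"
    using p by (intro enn_pow_mono) auto
   then show ?thesis using real t by (simp add: enn_pow_ennreal)
  qed
 qed simp
 then show ?thesis by (simp add: I_def)
qed

text \<open>The substitution \<open>y = x - r z\<close> makes the weight independent of the radius,
  so that Jensen's inequality and Fubini apply with one fixed probability density.\<close>

lemma moll_eq_scaled:
 fixes f :: "'a::euclidean_space => 'b::euclidean_space"
 assumes [measurable]: "Borel f" and r: "0 < r"
 shows "moll r f x = (\<integral>z. mol z *\<^sub>R f (x - r *\<^sub>R z) \<partial>lborel)"
proof -
 define F where "F y = ker r (x - y) *\<^sub>R f y" for y
 have [measurable]: "Borel F" unfolding F_def ker_def by measurable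
 have "moll r f x = (\<integral>y. F y \<partial>lborel)" by (simp add: moll_def F_def)
 also have "\<dots> = (\<integral>y. F y \<partial>density (distr lborel borel (%z. x + (- r) *\<^sub>R z)) (%_. \<bar>- r\<bar> ^ DIM('a)))"
  using r by (subst lborel_affine[of "- r" x]) auto
 also have "\<dots> = (\<integral>z. \<bar>- r\<bar> ^ DIM('a) *\<^sub>R F (x + (- r) *\<^sub>R z) \<partial>lborel)"
 proof -
  have "(\<integral>y. F y \<partial>density (distr lborel borel (%z. x + (- r) *\<^sub>R z)) (%_. ennreal (\<bar>- r\<bar> ^ DIM('a))))
   = (\<integral>y. (\<bar>- r\<bar> ^ DIM('a)) *\<^sub>R F y \<partial>(distr lborel borel (%z. x + (- r) *\<^sub>R z)))"
   by (rule integral_density) auto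
  also have "\<dots> = (\<integral>z. \<bar>- r\<bar> ^ DIM('a) *\<^sub>R F (x + (- r) *\<^sub>R z) \<partial>lborel)"
   by (subst integral_distr) auto
  finally show ?thesis .
 qed
 also have "(%z. \<bar>- r\<bar> ^ DIM('a) *\<^sub>R F (x + (- r) *\<^sub>R z)) = (%z. mol z *\<^sub>R f (x - r *\<^sub>R z))"
  using r by (auto simp: F_def ker_def fun_eq_iff)
 finally show ?thesis .
qed

text \<open>Continuity of translation in L^p, along sequences because it is later applied to
  \<open>r n *\<^sub>R z\<close> inside dominated convergence.\<close>

definition trans_cont :: "real => ('a::euclidean_space => 'b::real_normed_vector) => bool" where
 "trans_cont p f \<longleftrightarrow> (\<forall>a. a \<longlonglongrightarrow> 0 --> (%n. pnorm p (%x. f (x - a n) - f x)) \<longlonglongrightarrow> 0)"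

lemma tendsto_0_ennreal_le:
 fixes X Y :: "nat => ennreal"
 assumes "Y \<longlonglongrightarrow> 0" "\<And>n. X n <= Y n" shows "X \<longlonglongrightarrow> 0"
 by (rule tendsto_sandwich[OF _ _ tendsto_const assms(1)]) (use assms in auto)

lemma tendsto_ennreal_0I:
 fixes X :: "nat => ennreal"
 assumes "\<And>e::real. 0 < e ==> eventually (%n. X n <= ennreal e) sequentially"
 shows "X \<longlonglongrightarrow> 0"
proof (rule order_tendstoI)
 fix a :: ennreal assume "0 < a"
 then obtain e where e: "0 < e" "ennreal e < a"
  by (metis ennreal_less_zero_iff ennreal_zero_less_one gr0I ennreal_rat_dense dense ennreal_cases less_top top_greatest not_gr_zero order.strict_trans)
 with assms[OF e(1)] show "eventually (%n. X n < a) sequentially"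
  by (auto elim!: eventually_mono)
qed auto

lemma tendsto_cmult_0_ennreal:
 fixes X :: "nat => ennreal"
 assumes "X \<longlonglongrightarrow> 0" "c < \<infinity>" shows "(%n. c * X n) \<longlonglongrightarrow> 0"
 using tendsto_mult_ennreal[OF tendsto_const[of c] assms(1)] assms(2) by auto

lemma tendsto_add_0_ennreal:
 fixes X Y :: "nat => ennreal"
 assumes "X \<longlonglongrightarrow> 0" "Y \<longlonglongrightarrow> 0" shows "(%n. X n + Y n) \<longlonglongrightarrow> 0"
 using tendsto_add[OF assms] by simp

lemma trans_cont_add:
 fixes f g :: "'a::euclidean_space => 'b::euclidean_space"
 assumes [measurable]: "Borel f" "Borel g" and tc: "trans_cont p f" "trans_cont p g" and p: "0 < p"
 shows "trans_cont p (%x. f x + g x)"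
 unfolding trans_cont_def
proof (intro allI impI)
 fix a :: "nat => 'a" assume a: "a \<longlonglongrightarrow> 0"
 let ?F = "%n x. ennreal (norm (f (x - a n) - f x))" and ?G = "%n x. ennreal (norm (g (x - a n) - g x))"
 show "(%n. pnorm p (%x. f (x - a n) + g (x - a n) - (f x + g x))) \<longlonglongrightarrow> 0"
 proof (rule tendsto_0_ennreal_le)
  show "(%n. ennreal (2 powr p) * (pint p (?F n) + pint p (?G n))) \<longlonglongrightarrow> 0"
   using tc a by (intro tendsto_cmult_0_ennreal tendsto_add_0_ennreal) (auto simp: trans_cont_def)
  fix n
  have "pnorm p (%x. f (x - a n) + g (x - a n) - (f x + g x)) <= pint p (%x. ?F n x + ?G n x)"
  proof (rule pint_mono[OF p])
   fix x
   have "norm (f (x - a n) + g (x - a n) - (f x + g x)) <= norm (f (x - a n) - f x) + norm (g (x - a n) - g x)"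
    by (metis add_diff_add norm_triangle_ineq)
   then show "ennreal (norm (f (x - a n) + g (x - a n) - (f x + g x))) <= ?F n x + ?G n x"
    by (metis ennreal_leI ennreal_plus norm_ge_zero)
  qed
  also have "\<dots> <= ennreal (2 powr p) * (pint p (?F n) + pint p (?G n))"
   by (rule pint_add_le) (use p in auto)
  finally show "pnorm p (%x. f (x - a n) + g (x - a n) - (f x + g x)) <= ennreal (2 powr p) * (pint p (?F n) + pint p (?G n))" .
 qed
qed

lemma trans_cont_scale:
 fixes f :: "'a::euclidean_space => real"
 assumes [measurable]: "Borel f" and tc: "trans_cont p f" and p: "0 < p"
 shows "trans_cont p (%x. f x *\<^sub>R (b::'b::euclidean_space))"
 unfolding trans_cont_def
proof (intro allI impI)
 fix a :: "nat => 'a" assume a: "a \<longlonglongrightarrow> 0"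
 have "pnorm p (%x. f (x - a n) *\<^sub>R b - f x *\<^sub>R b) = ennreal (norm b powr p) * pnorm p (%x. f (x - a n) - f x)" for n
  using p by (subst pint_cmult[symmetric]) (auto simp: scaleR_diff_left[symmetric] ennreal_mult' mult.commute)
 then show "(%n. pnorm p (%x. f (x - a n) *\<^sub>R b - f x *\<^sub>R b)) \<longlonglongrightarrow> 0"
  using tc a by (auto simp: trans_cont_def intro!: tendsto_cmult_0_ennreal)
qed

lemma trans_cont_approx:
 fixes f :: "'a::euclidean_space => real"
 assumes [measurable]: "Borel f" and p: "0 < p"
  and ap: "\<And>e::real. 0 < e ==> \<exists>g\<in>borel_measurable borel. trans_cont p g \<and> pnorm p (%x. f x - g x) <= ennreal e"
 shows "trans_cont p f"
 unfolding trans_cont_def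
proof (intro allI impI tendsto_ennreal_0I)
 fix a :: "nat => 'a" and e :: real assume a: "a \<longlonglongrightarrow> 0" and e: "0 < e"
 define C where "C = (2::real) powr p"
 have C: "0 < C" by (simp add: C_def)
 \<comment> \<open>Two uses of \<open>pint_add_le\<close> give the bound
   \<open>C * (e' + C * (e' + e'))\<close>, which this choice makes equal to
   \<open>e\<close>.\<close>
 define e' where "e' = e / (C + 2 * C * C)"
 have e': "0 < e'" using e C by (simp add: e'_def add_pos_pos)
 obtain g where [measurable]: "Borel g" and g: "trans_cont p g" "pnorm p (%x. f x - g x) <= ennreal e'"
  using ap[OF e'] by blast
 let ?D = "%x. ennreal (norm (f x - g x))"
 have "eventually (%n. pnorm p (%x. g (x - a n) - g x) < ennreal e') sequentially"
  using g(1) a e' by (intro order_tendstoD(2)[of _ 0]) (auto simp: trans_cont_def)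
 then show "eventually (%n. pnorm p (%x. f (x - a n) - f x) <= ennreal e) sequentially"
 proof eventually_elim
  case (elim n)
  let ?G = "%x. ennreal (norm (g (x - a n) - g x))"
  have "pnorm p (%x. f (x - a n) - f x) <= pint p (%x. ?G x + (?D (x - a n) + ?D x))"
  proof (rule pint_mono[OF p])
   fix x
   have "norm (f (x - a n) - f x) <= norm (g (x - a n) - g x) + (norm (f (x - a n) - g (x - a n)) + norm (f x - g x))"
    by simp
   then have "ennreal (norm (f (x - a n) - f x)) <= ennreal (norm (g (x - a n) - g x) + (norm (f (x - a n) - g (x - a n)) + norm (f x - g x)))"
    by (rule ennreal_leI)
   then show "ennreal (norm (f (x - a n) - f x)) <= ?G x + (?D (x - a n) + ?D x)" by (simp add: ennreal_plus)
  qed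
  also have "\<dots> <= ennreal C * (pint p ?G + pint p (%x. ?D (x - a n) + ?D x))"
   unfolding C_def by (rule pint_add_le) (use p in auto)
  also have "\<dots> <= ennreal C * (pint p ?G + ennreal C * (pint p (%x. ?D (x - a n)) + pint p ?D))"
   unfolding C_def by (intro mult_left_mono add_left_mono pint_add_le) (use p in auto)
  also have "pint p (%x. ?D (x - a n)) = pint p ?D" by (rule pint_translate) measurable
  also have "ennreal C * (pint p ?G + ennreal C * (pint p ?D + pint p ?D)) <= ennreal C * (ennreal e' + ennreal C * (ennreal e' + ennreal e'))"
   using elim g(2) by (intro mult_left_mono add_mono) auto
  also have "\<dots> = ennreal (C * (e' + C * (e' + e')))"
   using C e' by (simp only: ennreal_mult' ennreal_plus less_imp_le add_nonneg_nonneg mult_nonneg_nonneg)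
  also have "C * (e' + C * (e' + e')) = e' * (C + 2 * C * C)" by (simp add: algebra_simps)
  also have "\<dots> = e" using C by (simp add: e'_def add_pos_pos less_imp_neq[symmetric])
  finally show ?case .
 qed
qed

text \<open>At a point of an open set the translated indicator is eventually 1, which handles the
  part of \<open>T\<close> outside its translate. The other half of the symmetric difference has the
  same measure by translation invariance.\<close>

lemma trans_cont_open:
 assumes T: "open T" "emeasure lborel T < \<infinity>" and p: "0 < p"
 shows "trans_cont p (indicator T :: 'a::euclidean_space => real)"
 unfolding trans_cont_def
proof (intro allI impI)
 fix a :: "nat => 'a" assume a: "a \<longlonglongrightarrow> 0"
 have [measurable]: "T \<in> sets borel" using T by simp
 let ?I = "%n x. indicator T x * indicator T (x - a n) :: ennreal"
 have lim: "(%n. \<integral>\<^sup>+x. indicator T x - ?I n x \<partial>lborel) \<longlonglongrightarrow> (\<integral>\<^sup>+x. 0 \<partial>(lborel :: 'a measure))"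
 proof (rule nn_integral_dominated_convergence[where w="indicator T"])
  show "AE x in lborel. (%n. indicator T x - ?I n x) \<longlonglongrightarrow> 0"
  proof (rule AE_I2)
   fix x
   show "(%n. indicator T x - ?I n x) \<longlonglongrightarrow> 0"
   proof (cases "x \<in> T")
    case True
    have "(%n. x - a n) \<longlonglongrightarrow> x - 0" by (intro tendsto_intros a)
    then have "eventually (%n. x - a n \<in> T) sequentially"
     using T(1) True by (intro topological_tendstoD) auto
    then have "eventually (%n. indicator T x - ?I n x = 0) sequentially"
     by eventually_elim (simp add: True)
    then show ?thesis by (rule tendsto_eventually)
   qed simp
  qed
  show "(\<integral>\<^sup>+x. indicator T x \<partial>lborel) < \<infinity>" using T by simp
 qed (auto simp: indicator_def)
 have eq: "pnorm p (%x. indicator T (x - a n) - indicat_real T x) <= 2 * (\<integral>\<^sup>+x. indicator T x - ?I n x \<partial>lborel)" for n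
 proof -
  have *: "(\<integral>\<^sup>+x. indicator T (x - a n) - ?I n x \<partial>lborel) = (\<integral>\<^sup>+x. indicator T x - ?I n x \<partial>lborel)"
  proof -
   have "(\<integral>\<^sup>+x. ?I n x \<partial>lborel) <= (\<integral>\<^sup>+x. indicator T x \<partial>lborel)"
    by (intro nn_integral_mono) (auto simp: indicator_def)
   then have fin: "(\<integral>\<^sup>+x. ?I n x \<partial>lborel) < \<infinity>" using T(2) by (simp add: le_less_trans)
   have "(\<integral>\<^sup>+x. indicator T (x - a n) - ?I n x \<partial>lborel) = (\<integral>\<^sup>+x. indicator T (x - a n) \<partial>lborel) - (\<integral>\<^sup>+x. ?I n x \<partial>lborel)"
    by (rule nn_integral_diff) (use fin in \<open>auto simp: indicator_def\<close>)
   also have "(\<integral>\<^sup>+x. indicator T (x - a n) \<partial>lborel) = (\<integral>\<^sup>+x. indicator T x \<partial>lborel)"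
    using nn_integral_translate[of "indicator T" "- a n"] by simp
   also have "(\<integral>\<^sup>+x. indicator T x \<partial>lborel) - (\<integral>\<^sup>+x. ?I n x \<partial>lborel) = (\<integral>\<^sup>+x. indicator T x - ?I n x \<partial>lborel)"
    by (rule nn_integral_diff[symmetric]) (use fin in \<open>auto simp: indicator_def\<close>)
   finally show ?thesis .
  qed
  have "pnorm p (%x. indicator T (x - a n) - indicat_real T x) <= (\<integral>\<^sup>+x. (indicator T x - ?I n x) + (indicator T (x - a n) - ?I n x) \<partial>lborel)"
   unfolding pint_def by (intro nn_integral_mono) (auto simp: indicator_def)
  also have "\<dots> = (\<integral>\<^sup>+x. indicator T x - ?I n x \<partial>lborel) + (\<integral>\<^sup>+x. indicator T (x - a n) - ?I n x \<partial>lborel)"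
   by (rule nn_integral_add) auto
  finally show ?thesis using * by (simp add: mult_2)
 qed
 show "(%n. pnorm p (%x. indicator T (x - a n) - indicat_real T x)) \<longlonglongrightarrow> 0"
  by (rule tendsto_0_ennreal_le[OF _ eq]) (use lim in \<open>auto intro!: tendsto_cmult_0_ennreal\<close>)
qed

text \<open>Measurable sets are approximated from outside by open sets, and functions by the usual
  induction over simple functions and monotone limits. Finite energy is a premise inside the
  conclusion, so that it can be passed down to the pieces in the induction.\<close>

lemma trans_cont_nonneg:
 fixes f :: "'a::euclidean_space => real"
 assumes f: "Borel f" "\<And>x. 0 <= f x" and p: "0 < p"
 shows "pint p (%x. ennreal (f x)) < \<infinity> --> trans_cont p f"
 using f
proof (induction rule: borel_measurable_induct_real)
 case (set A)
 then have [measurable]: "A \<in> sets borel" by simp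
 show ?case
 proof (intro impI trans_cont_approx p)
  assume fin: "pint p (%x. ennreal (indicator A x)) < \<infinity>"
  have "pint p (%x. ennreal (indicator A x)) = (\<integral>\<^sup>+x. indicator A x \<partial>lborel)"
   unfolding pint_def by (intro nn_integral_cong) (auto simp: indicator_def)
  then have finA: "emeasure lborel A < \<infinity>" using fin by simp
  fix e :: real assume e: "0 < e"
  obtain T where T: "open T" "A \<subseteq> T" "emeasure lebesgue (T - A) < ennreal e"
   by (rule sets_lebesgue_outer_open[of A e]) (use e in auto)
  have [measurable]: "T \<in> sets borel" using T by simp
  have TA: "emeasure lborel (T - A) < ennreal e" using T(3) by (subst (asm) emeasure_completion) auto
  have "emeasure lborel T <= emeasure lborel A + emeasure lborel (T - A)"
   using T(2) by (subst plus_emeasure) (auto simp: Un_absorb1)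
  also have "\<dots> < \<infinity>" using finA TA by (auto simp: less_top[symmetric])
  finally have "trans_cont p (indicator T :: 'a => real)" by (intro trans_cont_open T p)
  moreover have "pnorm p (%x. indicat_real A x - indicat_real T x) = (\<integral>\<^sup>+x. indicator (T - A) x \<partial>lborel)"
   unfolding pint_def using T(2) by (intro nn_integral_cong) (auto simp: indicator_def)
  ultimately show "\<exists>g\<in>borel_measurable borel. trans_cont p g \<and> pnorm p (%x. indicat_real A x - g x) <= ennreal e"
   using TA by (intro bexI[of _ "indicator T"]) auto
 qed auto
next
 case (mult u c)
 then have [measurable]: "Borel u" by simp
 show ?case
 proof
  assume fin: "pint p (%x. ennreal (c * u x)) < \<infinity>"
  show "trans_cont p (%x. c * u x)"
  proof (cases "c = 0")
   case True
   then show ?thesis by (simp add: trans_cont_def pint_def)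
  next
   case False
   have "pint p (%x. ennreal (c * u x)) = ennreal (c powr p) * pint p (%x. ennreal (u x))"
    using mult p by (subst pint_cmult[symmetric]) (auto simp: ennreal_mult')
   then have "pint p (%x. ennreal (u x)) < \<infinity>" using fin False mult by (auto simp: ennreal_mult_less_top)
   then have "trans_cont p u" using mult by simp
   from trans_cont_scale[OF _ this p, of "c"] show ?thesis by (simp add: mult.commute)
  qed
 qed
next
 case (add u v)
 then have [measurable]: "Borel u" "Borel v" by simp_all
 show ?case
 proof
  assume fin: "pint p (%x. ennreal (v x + u x)) < \<infinity>"
  have "pint p (%x. ennreal (u x)) < \<infinity>" "pint p (%x. ennreal (v x)) < \<infinity>"
   by (rule le_less_trans[OF pint_mono[OF p] fin]; use add in \<open>auto intro!: ennreal_leI simp: ennreal_plus[symmetric] simp del: ennreal_plus\<close>)+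
  then show "trans_cont p (%x. v x + u x)" using add p by (intro trans_cont_add) auto
 qed
next
 case (seq U)
 then have [measurable]: "\<And>i. Borel (U i)" by simp
 have [measurable]: "Borel f" by fact
 have le: "U i x <= f x" for i x
  using seq by (intro incseq_le[of "%i. U i x"]) (auto simp: incseq_def le_fun_def)
 have absle: "norm (f x - U i x) <= f x" for i x
  using le[of i x] \<open>\<And>i x. 0 <= U i x\<close>[of i x] by simp
 show ?case
 proof (intro impI trans_cont_approx p)
  assume fin: "pint p (%x. ennreal (f x)) < \<infinity>"
  fix e :: real assume e: "0 < e"
  have "(%i. pnorm p (%x. f x - U i x)) \<longlonglongrightarrow> (\<integral>\<^sup>+x. 0 \<partial>(lborel :: 'a measure))"
   unfolding pint_def
  proof (rule nn_integral_dominated_convergence[where w="%x. enn_pow (ennreal (f x)) p"])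
   show "AE x in lborel. (%i. enn_pow (ennreal (norm (f x - U i x))) p) \<longlonglongrightarrow> 0"
   proof (rule AE_I2)
    fix x
    have "(%i. norm (f x - U i x)) \<longlonglongrightarrow> norm (f x - f x)" using seq by (intro tendsto_intros) auto
    then have "(%i. norm (f x - U i x) powr p) \<longlonglongrightarrow> 0 powr p"
     using p by (intro tendsto_powr2) auto
    then show "(%i. enn_pow (ennreal (norm (f x - U i x))) p) \<longlonglongrightarrow> 0"
     using p tendsto_ennrealI[of "%i. norm (f x - U i x) powr p" 0] by (simp add: enn_pow_ennreal)
   qed
   show "AE x in lborel. enn_pow (ennreal (norm (f x - U i x))) p <= enn_pow (ennreal (f x)) p" for i
    by (intro AE_I2 enn_pow_mono p ennreal_leI absle)
  qed (use fin in \<open>auto simp: pint_def\<close>)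
  then have "eventually (%i. pnorm p (%x. f x - U i x) < ennreal e) sequentially"
   using e by (intro order_tendstoD(2)[of _ 0]) auto
  then obtain i where i: "pnorm p (%x. f x - U i x) < ennreal e" by (auto simp: eventually_sequentially)
  have "pint p (%x. ennreal (U i x)) < \<infinity>"
   by (rule le_less_trans[OF pint_mono[OF p] fin]) (use le in \<open>auto intro!: ennreal_leI\<close>)
  then have "trans_cont p (U i)" using seq by simp
  with i show "\<exists>g\<in>borel_measurable borel. trans_cont p g \<and> pnorm p (%x. f x - g x) <= ennreal e"
   by (intro bexI[of _ "U i"]) auto
 qed auto
qed

lemma trans_cont_real:
 fixes f :: "'a::euclidean_space => real"
 assumes [measurable]: "Borel f" and p: "0 < p" and fin: "pint p (%x. ennreal \<bar>f x\<bar>) < \<infinity>"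
 shows "trans_cont p f"
proof -
 have "pint p (%x. ennreal (max 0 (f x))) < \<infinity>" "pint p (%x. ennreal (max 0 (- f x))) < \<infinity>"
  by (rule le_less_trans[OF pint_mono[OF p] fin]; auto intro!: ennreal_leI)+
 then have 1: "trans_cont p (%x. max 0 (f x))" and 2: "trans_cont p (%x. max 0 (- f x))"
  using trans_cont_nonneg[of "%x. max 0 (f x)" p] trans_cont_nonneg[of "%x. max 0 (- f x)" p] p by auto
 have "trans_cont p (%x. max 0 (f x) + max 0 (- f x) *\<^sub>R (-1))"
  by (intro trans_cont_add trans_cont_scale 1 2 p) auto
 moreover have "(%x. max 0 (f x) + max 0 (- f x) *\<^sub>R (-1)) = f" by (auto simp: fun_eq_iff max_def)
 ultimately show ?thesis by simp
qed

lemma trans_cont_vec: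
 fixes f :: "'a::euclidean_space => 'b::euclidean_space"
 assumes [measurable]: "Borel f" and p: "0 < p" and fin: "pnorm p f < \<infinity>"
 shows "trans_cont p f"
proof -
 have 1: "trans_cont p (%x. f x \<bullet> b)" if "b \<in> Basis" for b
 proof (rule trans_cont_real[OF _ p])
  show "pint p (%x. ennreal \<bar>f x \<bullet> b\<bar>) < \<infinity>"
   by (rule le_less_trans[OF pint_mono[OF p] fin]) (use that in \<open>auto intro!: ennreal_leI Basis_le_norm\<close>)
 qed measurable
 have "trans_cont p (%x. \<Sum>b\<in>B. (f x \<bullet> b) *\<^sub>R b)" if "B \<subseteq> Basis" for B
  using finite_subset[OF that finite_Basis] that
 proof induction
  case empty
  then show ?case by (simp add: trans_cont_def pint_def)
 next
  case (insert b B)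
  then have "trans_cont p (%x. (f x \<bullet> b) *\<^sub>R b + (\<Sum>b\<in>B. (f x \<bullet> b) *\<^sub>R b))"
   by (intro trans_cont_add trans_cont_scale 1 p) auto
  then show ?case using insert by simp
 qed
 from this[of Basis] show ?thesis by (simp add: euclidean_representation)
qed

text \<open>For \<open>p >= 1\<close> the norm is at most 1 plus its p-th power, and the constant 1
  is integrable on balls.\<close>

lemma locint_Lp:
 fixes f :: "'a::euclidean_space => 'b::euclidean_space"
 assumes [measurable]: "Borel f" and p: "1 <= p" and fin: "pnorm p f < \<infinity>"
 shows "locint f"
 unfolding locint_def
proof (intro conjI allI)
 fix R
 show "integrable lborel (%x. indicator (cball 0 R) x *\<^sub>R f x)"
  unfolding integrable_iff_bounded
 proof
  have "(\<integral>\<^sup>+x. ennreal (norm (indicator (cball 0 R) x *\<^sub>R f x)) \<partial>lborel) <= (\<integral>\<^sup>+x. indicator (cball 0 R) x + enn_pow (ennreal (norm (f x))) p \<partial>lborel)"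
  proof (rule nn_integral_mono)
   fix x
   show "ennreal (norm (indicator (cball 0 R) x *\<^sub>R f x)) <= indicator (cball 0 R) x + enn_pow (ennreal (norm (f x))) p"
   proof (cases "x \<in> cball 0 R")
    case True
    have "norm (f x) <= 1 + norm (f x) powr p"
    proof (cases "norm (f x) <= 1")
     case False
     then have "norm (f x) powr 1 <= norm (f x) powr p" using p by (intro powr_mono) auto
     then show ?thesis by simp
    qed (simp add: add_increasing2)
    from ennreal_leI[OF this] show ?thesis using True by (simp add: enn_pow_ennreal ennreal_plus)
   qed simp
  qed
  also have "\<dots> = emeasure lborel (cball (0::'a) R) + pnorm p f"
   unfolding pint_def by (subst nn_integral_add) (auto intro!: borel_measurable_indicator borel_closed)
  also have "\<dots> < \<infinity>" using fin emeasure_bounded_finite[OF bounded_cball, of "0::'a" R] by auto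
  finally show "(\<integral>\<^sup>+x. ennreal (norm (indicator (cball 0 R) x *\<^sub>R f x)) \<partial>lborel) < \<infinity>" .
 qed (use assms(1) in \<open>auto intro!: borel_measurable_scaleR borel_measurable_indicator borel_closed\<close>)
qed measurable

text \<open>Jensen's inequality and Fubini bound the error by the average of
  \<open>T (r n *\<^sub>R z)\<close> over the mollifier, where \<open>T a\<close> is the energy of
  the difference between \<open>f\<close> and its translate by \<open>a\<close>. \<open>T\<close> is
  bounded and tends to 0 at 0, so dominated convergence finishes.\<close>

lemma moll_tendsto_Lp:
 fixes f :: "'a::euclidean_space => 'b::euclidean_space"
 assumes fm[measurable]: "Borel f" and p: "1 < p" and fin: "pnorm p f < \<infinity>"
  and r: "\<And>n. 0 < r n" "r \<longlonglongrightarrow> 0"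
 shows "(%n. pnorm p (%x. moll (r n) f x - f x)) \<longlonglongrightarrow> 0"
proof -
 have p0: "0 < p" using p by simp
 have lf: "locint f" by (rule locint_Lp[OF fm _ fin]) (use p in simp)
 have tc: "trans_cont p f" by (rule trans_cont_vec[OF fm p0 fin])
 define T where "T a = pnorm p (%x. f (x - a) - f x)" for a
 have [measurable]: "Borel T"
  unfolding T_def[abs_def] pint_def by measurable
 define B where "B = ennreal (2 powr p) * (pnorm p f + pnorm p f)"
 have B: "B < \<infinity>" using fin by (auto simp: B_def ennreal_mult_less_top)
 have TB: "T a <= B" for a
 proof -
  have "T a <= pint p (%x. ennreal (norm (f (x - a))) + ennreal (norm (f x)))"
   unfolding T_def
  proof (rule pint_mono[OF p0])
   show "ennreal (norm (f (x - a) - f x)) <= ennreal (norm (f (x - a))) + ennreal (norm (f x))" for x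
    using ennreal_leI[OF norm_triangle_ineq4[of "f (x - a)" "f x"]] by simp
  qed
  also have "\<dots> <= ennreal (2 powr p) * (pnorm p (%x. f (x - a)) + pnorm p f)"
   by (rule pint_add_le) (use p0 in auto)
  also have "pnorm p (%x. f (x - a)) = pnorm p f"
   by (rule pint_translate) measurable
  finally show ?thesis by (simp add: B_def)
 qed
 have le: "pnorm p (%x. moll (r n) f x - f x) <= (\<integral>\<^sup>+z. ennreal (mol z) * T (r n *\<^sub>R z) \<partial>lborel)" for n
 proof -
  have [measurable]: "Borel (moll (r n) f)"
   by (rule borel_measurable_continuous_onI[OF moll_continuous[OF lf r(1)]])
  have pt: "ennreal (norm (moll (r n) f x - f x)) <= (\<integral>\<^sup>+z. ennreal (mol z) * ennreal (norm (f (x - r n *\<^sub>R z) - f x)) \<partial>lborel)" for x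
  proof (cases "(\<integral>\<^sup>+z. ennreal (mol z) * ennreal (norm (f (x - r n *\<^sub>R z) - f x)) \<partial>lborel) < \<infinity>")
   case True
   have i: "integrable lborel (%z. mol z *\<^sub>R (f (x - r n *\<^sub>R z) - f x))"
    unfolding integrable_iff_bounded using True by (auto simp: ennreal_mult' mol_nonneg)
   have i2: "integrable (lborel :: 'a measure) (%z. mol z *\<^sub>R f x)" by (intro integrable_scaleR_left mol_integrable)
   have i3: "integrable lborel (%z. mol z *\<^sub>R f (x - r n *\<^sub>R z))"
    using Bochner_Integration.integrable_add[OF i i2] by (simp add: scaleR_diff_right)
   have "moll (r n) f x - f x = (\<integral>z. mol z *\<^sub>R f (x - r n *\<^sub>R z) \<partial>lborel) - (\<integral>z. mol z *\<^sub>R f x \<partial>(lborel :: 'a measure))"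
    using mol_integral[where 'a='a] by (subst integral_scaleR_left) (auto simp: moll_eq_scaled[OF fm r(1)] mol_integrable)
   also have "\<dots> = (\<integral>z. mol z *\<^sub>R (f (x - r n *\<^sub>R z) - f x) \<partial>lborel)"
    using i2 i3 by (simp add: scaleR_diff_right)
   finally have eq: "moll (r n) f x - f x = (\<integral>z. mol z *\<^sub>R (f (x - r n *\<^sub>R z) - f x) \<partial>lborel)" .
   show ?thesis unfolding eq
    by (rule order_trans[OF integral_norm_bound_ennreal[OF i]]) (simp add: ennreal_mult' mol_nonneg)
  qed (simp add: less_top[symmetric])
  have "pnorm p (%x. moll (r n) f x - f x)
    <= (\<integral>\<^sup>+x. (\<integral>\<^sup>+z. ennreal (mol z) * enn_pow (ennreal (norm (f (x - r n *\<^sub>R z) - f x))) p \<partial>lborel) \<partial>lborel)"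
   unfolding pint_def
  proof (rule nn_integral_mono)
   fix x
   have "enn_pow (ennreal (norm (moll (r n) f x - f x))) p <= enn_pow (\<integral>\<^sup>+z. ennreal (mol z) * ennreal (norm (f (x - r n *\<^sub>R z) - f x)) \<partial>lborel) p"
    by (intro enn_pow_mono p0 pt)
   also have "\<dots> <= (\<integral>\<^sup>+z. ennreal (mol z) * enn_pow (ennreal (norm (f (x - r n *\<^sub>R z) - f x))) p \<partial>lborel)"
    by (rule jensen_mol) (use p in auto)
   finally show "enn_pow (ennreal (norm (moll (r n) f x - f x))) p <= (\<integral>\<^sup>+z. ennreal (mol z) * enn_pow (ennreal (norm (f (x - r n *\<^sub>R z) - f x))) p \<partial>lborel)" .
  qed
  also have "\<dots> = (\<integral>\<^sup>+z. (\<integral>\<^sup>+x. ennreal (mol z) * enn_pow (ennreal (norm (f (x - r n *\<^sub>R z) - f x))) p \<partial>lborel) \<partial>lborel)"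
   by (rule lborel_pair.Fubini') measurable
  also have "\<dots> = (\<integral>\<^sup>+z. ennreal (mol z) * T (r n *\<^sub>R z) \<partial>lborel)"
   unfolding T_def pint_def by (simp add: nn_integral_cmult)
  finally show ?thesis .
 qed
 have "(%n. \<integral>\<^sup>+z. ennreal (mol z) * T (r n *\<^sub>R z) \<partial>lborel) \<longlonglongrightarrow> (\<integral>\<^sup>+z. 0 \<partial>(lborel :: 'a measure))"
 proof (rule nn_integral_dominated_convergence[where w="%z. ennreal (mol z) * B"])
  show "AE z in lborel. (%n. ennreal (mol z) * T (r n *\<^sub>R z)) \<longlonglongrightarrow> 0"
  proof (rule AE_I2)
   fix z :: 'a
   have "(%n. r n *\<^sub>R z) \<longlonglongrightarrow> 0 *\<^sub>R z" by (intro tendsto_intros r)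
   then have "(%n. T (r n *\<^sub>R z)) \<longlonglongrightarrow> 0" using tc unfolding trans_cont_def T_def by simp
   then show "(%n. ennreal (mol z) * T (r n *\<^sub>R z)) \<longlonglongrightarrow> 0" by (intro tendsto_cmult_0_ennreal) auto
  qed
  show "(\<integral>\<^sup>+z. ennreal (mol z) * B \<partial>(lborel :: 'a measure)) < \<infinity>"
   using B by (simp add: nn_integral_multc nn_integral_mol)
  show "AE z in lborel. ennreal (mol z) * T (r n *\<^sub>R z) <= ennreal (mol z) * B" for n
   using TB by (intro AE_I2 mult_left_mono) auto
 qed measurable
 then have lim: "(%n. \<integral>\<^sup>+z. ennreal (mol z) * T (r n *\<^sub>R z) \<partial>lborel) \<longlonglongrightarrow> 0" by simp
 show ?thesis by (rule tendsto_0_ennreal_le[OF lim le])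
qed

lemma fast_AE_tendsto_0:
 fixes h :: "nat => 'a::euclidean_space => real"
 assumes [measurable]: "\<And>k. Borel (h k)" and "0 < p" and nn: "\<And>k x. 0 <= h k x"
  and le: "\<And>k. pint p (%x. ennreal (h k x)) <= ennreal (((1/4) ^ Suc k) powr p)"
 shows "AE x in lborel. (%k. h k x) \<longlonglongrightarrow> 0"
proof -
 have "pint p (%x. \<Sum>k. ennreal (h k x)) < \<infinity>"
  by (rule pint_suminf_fast) (use assms in auto)
 then have "AE x in lborel. (\<Sum>k. ennreal (h k x)) \<noteq> \<infinity>" by (intro pint_AE_finite) auto
 then show ?thesis
 proof eventually_elim
  case (elim x)
  then have "summable (%k. h k x)" using nn by (intro summable_suminf_not_top) auto
  then show ?case by (rule summable_LIMSEQ_zero)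
 qed
qed

section \<open>Newtonian functions have weak gradients\<close>

text \<open>The curve is merely Lipschitz, so no chain rule is applied. Bolzano's subdivision
  reduces the claim to short parameter intervals, where the oscillation of \<open>k\<close> is
  absorbed by adding \<open>e\<close> to the integrand; the error is removed at the end.\<close>

lemma C1_curve:
 fixes F :: "'a::euclidean_space => real"
 assumes S: "open S" and F: "\<And>x. x \<in> S ==> (F has_derivative (%h. k x \<bullet> h)) (at x)" and k: "continuous_on UNIV k"
  and c: "arclength_curve_in UNIV Y l" and ab: "0 <= a" "a <= b" "b <= l" and im: "Y ` {a..b} \<subseteq> S"
 shows "ennreal \<bar>F (Y a) - F (Y b)\<bar> <= lint (%x. ennreal (norm (k x))) Y a b"
proof (rule ennreal_le_epsilon)
 fix e0 :: real assume e0: "0 < e0"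
 define e where "e = e0 / (b - a + 1)"
 have e: "0 < e" "e * (b - a) <= e0"
  using e0 ab by (auto simp: e_def field_simps)
 have kb[measurable]: "Borel k" using k by (rule borel_measurable_continuous_onI)
 let ?g = "%x. ennreal (norm (k x) + e)"
 have g[measurable]: "Borel (?g)" by measurable
 have "a <= a --> b <= b --> ennreal \<bar>F (Y a) - F (Y b)\<bar> <= lint ?g Y a b"
  using ab(2)
 proof (induct rule: Bolzano[where P="%s t. a <= s --> t <= b --> ennreal \<bar>F (Y s) - F (Y t)\<bar> <= lint ?g Y s t"])
  case (trans s t u)
  show ?case
  proof (intro impI)
   assume su: "a <= s" "u <= b"
   have "ennreal \<bar>F (Y s) - F (Y u)\<bar> <= ennreal (\<bar>F (Y s) - F (Y t)\<bar> + \<bar>F (Y t) - F (Y u)\<bar>)"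
    by (intro ennreal_leI) auto
   also have "\<dots> = ennreal \<bar>F (Y s) - F (Y t)\<bar> + ennreal \<bar>F (Y t) - F (Y u)\<bar>" by simp
   also have "\<dots> <= lint ?g Y s t + lint ?g Y t u" using trans su by (intro add_mono) auto
   also have "\<dots> = lint ?g Y s u" by (rule lint_add[OF g c]) (use trans su ab in auto)
   finally show "ennreal \<bar>F (Y s) - F (Y u)\<bar> <= lint ?g Y s u" .
  qed
 next
  case (local x)
  have xS: "Y x \<in> S" using local im by auto
  obtain \<rho>1 where \<rho>1: "0 < \<rho>1" "ball (Y x) \<rho>1 \<subseteq> S" using S xS by (meson open_contains_ball)
  obtain \<rho>2 where \<rho>2: "0 < \<rho>2" "\<And>y. dist y (Y x) < \<rho>2 ==> dist (k y) (k (Y x)) < e / 2"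
   using k e(1) by (metis UNIV_I continuous_on_iff half_gt_zero)
  define \<rho> where "\<rho> = min \<rho>1 \<rho>2"
  have \<rho>: "0 < \<rho>" using \<rho>1 \<rho>2 by (simp add: \<rho>_def)
  have "a <= s --> t <= b --> ennreal \<bar>F (Y s) - F (Y t)\<bar> <= lint ?g Y s t" if st: "s <= x" "x <= t" "t - s < \<rho>" for s t
  proof (intro impI)
   assume ast: "a <= s" "t <= b"
   define B where "B = norm (k (Y x)) + e / 2"
   have near: "Y y \<in> ball (Y x) \<rho>" if "s <= y" "y <= t" for y
    using arclength_dist_le[OF c, of x y] that st ast ab local by (auto simp: abs_if split: if_splits)
   have nk: "norm (k y) <= B" "B <= norm (k y) + e" if "y \<in> ball (Y x) \<rho>" for y
    using \<rho>2(2)[of y] that norm_triangle_ineq2[of "k y" "k (Y x)"] norm_triangle_ineq2[of "k (Y x)" "k y"]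
    by (auto simp: \<rho>_def B_def dist_commute dist_norm norm_minus_commute)
   have "norm (F (Y s) - F (Y t)) <= B * norm (Y s - Y t)"
   proof (rule differentiable_bound[where S="ball (Y x) \<rho>" and f'="%y h. k y \<bullet> h"])
    fix y assume y: "y \<in> ball (Y x) \<rho>"
    then have "y \<in> S" using \<rho>1 by (auto simp: \<rho>_def)
    then show "(F has_derivative (%h. k y \<bullet> h)) (at y within ball (Y x) \<rho>)"
     using F has_derivative_at_withinI by blast
    show "onorm (%h. k y \<bullet> h) <= B"
    proof (rule onorm_bound)
     show "0 <= B" using e by (simp add: B_def)
     fix h
     have "norm (k y \<bullet> h) <= norm (k y) * norm h" by (simp add: Cauchy_Schwarz_ineq2)
     also have "\<dots> <= B * norm h" using nk[OF y] by (intro mult_right_mono) auto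
     finally show "norm (k y \<bullet> h) <= B * norm h" .
    qed
   qed (use near[of s] near[of t] st in auto)
   also have "\<dots> <= B * (t - s)"
   proof (rule mult_left_mono)
    have "dist (Y s) (Y t) <= \<bar>s - t\<bar>" using arclength_dist_le[OF c, of s t] st ast ab by auto
    then show "norm (Y s - Y t) <= t - s" using st by (simp add: dist_norm)
    show "0 <= B" using e by (simp add: B_def)
   qed
   finally have "ennreal \<bar>F (Y s) - F (Y t)\<bar> <= ennreal (B * (t - s))" by (simp add: ennreal_leI)
   also have "\<dots> = (\<integral>\<^sup>+y\<in>{s..t}. ennreal B \<partial>lborel)"
    using st e by (subst nn_integral_cmult_indicator) (auto simp: ennreal_mult' B_def)
   also have "\<dots> <= lint ?g Y s t"
    unfolding lint_def using nk near by (intro nn_integral_mono) (auto simp: indicator_def intro!: ennreal_leI)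
   finally show "ennreal \<bar>F (Y s) - F (Y t)\<bar> <= lint ?g Y s t" .
  qed
  then show ?case using \<rho> by blast
 qed
 then have "ennreal \<bar>F (Y a) - F (Y b)\<bar> <= lint ?g Y a b" by simp
 also have "?g = (%x. ennreal (norm (k x)) + ennreal e)" using e by (auto simp: fun_eq_iff)
 also have "lint (%x. ennreal (norm (k x)) + ennreal e) Y a b = lint (%x. ennreal (norm (k x))) Y a b + lint (%x. ennreal e) Y a b"
  by (rule lint_add_fun[OF _ _ c]) (use ab in auto)
 also have "lint (%x. ennreal e) Y a b = ennreal (e * (b - a))"
  unfolding lint_def using ab e by (subst nn_integral_cmult_indicator) (auto simp: ennreal_mult')
 also have "lint (%x. ennreal (norm (k x))) Y a b + ennreal (e * (b - a)) <= lint (%x. ennreal (norm (k x))) Y a b + ennreal e0"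
  using e by (intro add_left_mono ennreal_leI)
 finally show "ennreal \<bar>F (Y a) - F (Y b)\<bar> <= lint (%x. ennreal (norm (k x))) Y a b + ennreal e0" .
qed

lemma C1_ugrad:
 assumes F: "\<And>x. (F has_derivative (%h. k x \<bullet> h)) (at x)" and k: "continuous_on UNIV k"
 shows "ugrad F (%x. ennreal (norm (k x)))"
proof (rule ugradI)
 show "Borel (%x. ennreal (norm (k x)))"
  using borel_measurable_continuous_onI[OF k] by measurable
 show "arclength_curve_in UNIV Y l ==> ennreal \<bar>F (Y 0) - F (Y l)\<bar> <= lint (%x. ennreal (norm (k x))) Y 0 l" for Y l
  using C1_curve[of UNIV F k Y l 0 l] F k by (auto simp: arclength_curve_in_def)
qed

lemma AE_lborel_affine:
 fixes P :: "'a::euclidean_space => bool"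
 assumes "AE y in lborel. P y" "c \<noteq> 0" shows "AE z in lborel. P (t + c *\<^sub>R z)"
proof -
 obtain N where N: "N \<in> null_sets lborel" "{x. \<not> P x} \<subseteq> N"
  using assms(1) by (rule AE_E) (auto simp: null_sets_def intro: that)
 have [measurable]: "N \<in> sets borel" using N by auto
 have "0 = (\<integral>\<^sup>+y. indicator N y \<partial>lborel)" using N by auto
 also have "\<dots> = (\<integral>\<^sup>+y. indicator N y \<partial>density (distr lborel borel (%z. t + c *\<^sub>R z)) (%_. \<bar>c\<bar> ^ DIM('a)))"
  using lborel_affine[OF assms(2), of t] by simp
 also have "\<dots> = ennreal (\<bar>c\<bar> ^ DIM('a)) * (\<integral>\<^sup>+z. indicator N (t + c *\<^sub>R z) \<partial>lborel)"
  by (subst nn_integral_density, measurable, subst nn_integral_cmult, measurable, subst nn_integral_distr, measurable)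
 finally have "(\<integral>\<^sup>+z. indicator N (t + c *\<^sub>R z) \<partial>lborel) = 0"
  using assms(2) by (metis ennreal_eq_0_iff mult_eq_0_iff not_le power_not_zero abs_eq_0 zero_less_power zero_less_abs_iff)
 then have "AE z in lborel. (indicator N (t + c *\<^sub>R z) :: ennreal) = 0"
  by (subst (asm) nn_integral_0_iff_AE) auto
 then show ?thesis by eventually_elim (use N(2) in \<open>auto simp: indicator_def split: if_splits\<close>)
qed

lemma moll_norm_le:
 fixes f :: "'a::euclidean_space => 'b::euclidean_space"
 assumes [measurable]: "Borel f" and "0 < r"
 shows "ennreal (norm (moll r f x)) <= (\<integral>\<^sup>+z. ennreal (mol z) * ennreal (norm (f (x - r *\<^sub>R z))) \<partial>lborel)"
proof (cases "(\<integral>\<^sup>+z. ennreal (mol z) * ennreal (norm (f (x - r *\<^sub>R z))) \<partial>lborel) < \<infinity>")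
 case True
 then have i: "integrable lborel (%z. mol z *\<^sub>R f (x - r *\<^sub>R z))"
  unfolding integrable_iff_bounded by (auto simp: ennreal_mult' mol_nonneg)
 show ?thesis unfolding moll_eq_scaled[OF assms]
  by (rule order_trans[OF integral_norm_bound_ennreal[OF i]]) (simp add: ennreal_mult' mol_nonneg)
qed (simp add: less_top[symmetric])

lemma moll_bounded:
 fixes f :: "'a::euclidean_space => 'b::euclidean_space"
 assumes [measurable]: "Borel f" and "0 < r" "\<And>x. norm (f x) <= M" "0 <= M"
 shows "norm (moll r f x) <= M"
proof -
 have "ennreal (norm (moll r f x)) <= (\<integral>\<^sup>+z. ennreal (mol z) * ennreal (norm (f (x - r *\<^sub>R z))) \<partial>lborel)"
  by (rule moll_norm_le) (use assms in auto)
 also have "\<dots> <= (\<integral>\<^sup>+z. ennreal (mol z) * ennreal M \<partial>(lborel :: 'a measure))"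
  by (intro nn_integral_mono mult_left_mono ennreal_leI assms) auto
 also have "\<dots> = ennreal M" by (simp add: nn_integral_multc nn_integral_mol)
 finally show ?thesis using assms by simp
qed

lemma moll_scaled_integrable:
 fixes g :: "'a::euclidean_space => real"
 assumes g: "locint g" and r: "0 < r"
 shows "integrable lborel (%z. mol z *\<^sub>R g (x - r *\<^sub>R z))"
proof -
 have [measurable]: "Borel g" using g by (auto dest: locint_measurable)
 define F where "F y = ker r (x - y) *\<^sub>R g y" for y
 have [measurable]: "Borel F" unfolding F_def ker_def by measurable
 have "integrable lborel F" unfolding F_def by (rule moll_integrable[OF g(1) r])
 then have "integrable (density (distr lborel borel (%z. x + (- r) *\<^sub>R z)) (%_. ennreal (\<bar>- r\<bar> ^ DIM('a)))) F"
  using lborel_affine[of "- r" x] r by simp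
 then have "integrable (distr lborel borel (%z. x + (- r) *\<^sub>R z)) (%y. (\<bar>- r\<bar> ^ DIM('a)) *\<^sub>R F y)"
  by (subst (asm) integrable_density) auto
 then have "integrable lborel (%z. (\<bar>- r\<bar> ^ DIM('a)) *\<^sub>R F (x + (- r) *\<^sub>R z))"
  by (subst (asm) integrable_distr_eq) auto
 moreover have eq: "(%z. (\<bar>- r\<bar> ^ DIM('a)) *\<^sub>R F (x + (- r) *\<^sub>R z)) = (%z. mol z *\<^sub>R g (x - r *\<^sub>R z))"
  using r by (auto simp: F_def ker_def fun_eq_iff)
 ultimately show ?thesis unfolding eq by blast
qed

lemma moll_nonneg_eq:
 fixes g :: "'a::euclidean_space => real"
 assumes g: "locint g" "\<And>x. 0 <= g x" and r: "0 < r"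
 shows "ennreal (moll r g x) = (\<integral>\<^sup>+z. ennreal (mol z) * ennreal (g (x - r *\<^sub>R z)) \<partial>lborel)" "0 <= moll r g x"
proof -
 have [measurable]: "Borel g" using g by (auto dest: locint_measurable)
 show "0 <= moll r g x" unfolding moll_eq_scaled[OF \<open>Borel g\<close> r]
  by (intro Bochner_Integration.integral_nonneg) (auto simp: g mol_nonneg)
 have "integrable lborel (%z. mol z *\<^sub>R g (x - r *\<^sub>R z))" by (rule moll_scaled_integrable[OF g(1) r])
 then show "ennreal (moll r g x) = (\<integral>\<^sup>+z. ennreal (mol z) * ennreal (g (x - r *\<^sub>R z)) \<partial>lborel)"
  unfolding moll_eq_scaled[OF \<open>Borel g\<close> r]
  by (subst nn_integral_eq_integral[symmetric]) (auto simp: g mol_nonneg ennreal_mult')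
qed

text \<open>The upper gradient inequality on the segments starting at
  \<open>x - r *\<^sub>R z\<close>, averaged over \<open>z\<close>, bounds increments of the
  mollification in the direction \<open>e\<close> by integrals of the mollification of
  \<open>g'\<close>. Choosing \<open>e\<close> as the direction of \<open>k\<close> turns the
  directional derivative into \<open>norm k\<close>. \<open>f\<close> may differ from
  \<open>f'\<close> on a null set, which the end points avoid for almost every
  \<open>z\<close>.\<close>

lemma moll_grad_le:
 fixes f :: "'a::euclidean_space => real"
 assumes u: "ugrad f g" and f': "Borel f'" "AE x in lborel. f x = f' x" "locint f'"
  and g': "locint g'" "\<And>x. 0 <= g' x" "AE x in lborel. g x = ennreal (g' x)"
  and r: "0 < r" and k: "(moll r f' has_derivative (%h. k \<bullet> h)) (at x)"
 shows "norm k <= moll r g' x"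
proof (cases "k = 0")
 case True
 then show ?thesis using moll_nonneg_eq(2)[OF g'(1,2) r] by simp
next
 case False
 have [measurable]: "Borel f'" "Borel g'" "Borel g"
  using f' g' u by (auto dest: locint_measurable ugrad_measurable)
 define e where "e = k /\<^sub>R norm k"
 have e: "norm e = 1" "k \<bullet> e = norm k" using False by (auto simp: e_def power2_norm_eq_inner[symmetric] power2_eq_square)
 have iff: "integrable lborel (%z. mol z *\<^sub>R f' (y - r *\<^sub>R z))" for y
  by (rule moll_scaled_integrable[OF f'(3) r])
 have bound: "ennreal \<bar>moll r f' (x + t *\<^sub>R e) - moll r f' x\<bar> <= (\<integral>\<^sup>+s\<in>{0..t}. ennreal (moll r g' (x + s *\<^sub>R e)) \<partial>lborel)" if t: "0 < t" for t
 proof -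
  define D where "D y = f' (y + t *\<^sub>R e) - f' y" for y
  have [measurable]: "Borel D" unfolding D_def by measurable
  have "moll r f' (x + t *\<^sub>R e) - moll r f' x = (\<integral>z. mol z *\<^sub>R f' (x + t *\<^sub>R e - r *\<^sub>R z) - mol z *\<^sub>R f' (x - r *\<^sub>R z) \<partial>lborel)"
   unfolding moll_eq_scaled[OF f'(1) r] using iff by (subst Bochner_Integration.integral_diff) auto
  also have "\<dots> = moll r D x"
   unfolding moll_eq_scaled[OF \<open>Borel D\<close> r] D_def by (simp add: algebra_simps)
  finally have "ennreal \<bar>moll r f' (x + t *\<^sub>R e) - moll r f' x\<bar> <= (\<integral>\<^sup>+z. ennreal (mol z) * ennreal (norm (D (x - r *\<^sub>R z))) \<partial>lborel)"
   using moll_norm_le[of D r x] r by simp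
  also have "\<dots> <= (\<integral>\<^sup>+z. ennreal (mol z) * (\<integral>\<^sup>+s\<in>{0..t}. g (x - r *\<^sub>R z + s *\<^sub>R e) \<partial>lborel) \<partial>lborel)"
  proof (rule nn_integral_mono_AE)
   have a1: "AE z in lborel. f (x - r *\<^sub>R z) = f' (x - r *\<^sub>R z)"
    using AE_lborel_affine[OF f'(2), of "- r" x] r by simp
   have a2: "AE z in lborel. f (x + t *\<^sub>R e - r *\<^sub>R z) = f' (x + t *\<^sub>R e - r *\<^sub>R z)"
    using AE_lborel_affine[OF f'(2), of "- r" "x + t *\<^sub>R e"] r by simp
   show "AE z in lborel. ennreal (mol z) * ennreal (norm (D (x - r *\<^sub>R z))) <= ennreal (mol z) * (\<integral>\<^sup>+s\<in>{0..t}. g (x - r *\<^sub>R z + s *\<^sub>R e) \<partial>lborel)"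
    using a1 a2
   proof eventually_elim
    case (elim z)
    have "ennreal \<bar>f (x - r *\<^sub>R z + 0 *\<^sub>R e) - f (x - r *\<^sub>R z + t *\<^sub>R e)\<bar> <= lint g (%s. x - r *\<^sub>R z + s *\<^sub>R e) 0 t"
     using ugrad_subcurve[OF u arclength_segment[OF e(1) t, of "x - r *\<^sub>R z"], of 0 t] t by simp
    then have "ennreal (norm (D (x - r *\<^sub>R z))) <= (\<integral>\<^sup>+s\<in>{0..t}. g (x - r *\<^sub>R z + s *\<^sub>R e) \<partial>lborel)"
     using elim by (simp add: D_def lint_def algebra_simps abs_minus_commute)
    then show ?case by (rule mult_left_mono) simp
   qed
  qed
  also have "\<dots> = (\<integral>\<^sup>+z. (\<integral>\<^sup>+s. ennreal (mol z) * (g (x - r *\<^sub>R z + s *\<^sub>R e) * indicator {0..t} s) \<partial>lborel) \<partial>lborel)"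
   by (intro nn_integral_cong nn_integral_cmult[symmetric]) measurable
  also have "\<dots> = (\<integral>\<^sup>+s. (\<integral>\<^sup>+z. ennreal (mol z) * (g (x - r *\<^sub>R z + s *\<^sub>R e) * indicator {0..t} s) \<partial>lborel) \<partial>lborel)"
   by (rule lborel_pair.Fubini') measurable
  also have "\<dots> = (\<integral>\<^sup>+s\<in>{0..t}. ennreal (moll r g' (x + s *\<^sub>R e)) \<partial>lborel)"
  proof (rule nn_integral_cong)
   fix s
   have "(\<integral>\<^sup>+z. ennreal (mol z) * (g (x - r *\<^sub>R z + s *\<^sub>R e) * indicator {0..t} s) \<partial>lborel)
     = (\<integral>\<^sup>+z. ennreal (mol z) * ennreal (g' (x + s *\<^sub>R e - r *\<^sub>R z)) * indicator {0..t} s \<partial>lborel)"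
   proof (rule nn_integral_cong_AE)
    have "AE z in lborel. g (x + s *\<^sub>R e - r *\<^sub>R z) = ennreal (g' (x + s *\<^sub>R e - r *\<^sub>R z))"
     using AE_lborel_affine[OF g'(3), of "- r" "x + s *\<^sub>R e"] r by simp
    then show "AE z in lborel. ennreal (mol z) * (g (x - r *\<^sub>R z + s *\<^sub>R e) * indicator {0..t} s)
     = ennreal (mol z) * ennreal (g' (x + s *\<^sub>R e - r *\<^sub>R z)) * indicator {0..t} s"
     by eventually_elim (simp add: algebra_simps)
   qed
   also have "\<dots> = ennreal (moll r g' (x + s *\<^sub>R e)) * indicator {0..t} s"
    unfolding moll_nonneg_eq(1)[OF g'(1,2) r] by (rule nn_integral_multc) measurable
   finally show "(\<integral>\<^sup>+z. ennreal (mol z) * (g (x - r *\<^sub>R z + s *\<^sub>R e) * indicator {0..t} s) \<partial>lborel) = ennreal (moll r g' (x + s *\<^sub>R e)) * indicator {0..t} s" .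
  qed
  finally show ?thesis .
 qed
 show ?thesis
 proof (rule field_le_epsilon)
  fix \<epsilon> :: real assume \<epsilon>: "0 < \<epsilon>"
  have "continuous_on UNIV (moll r g')" by (rule moll_continuous[OF g'(1) r])
  then obtain d1 where d1: "0 < d1" "\<And>y. dist y x < d1 ==> dist (moll r g' y) (moll r g' x) < \<epsilon> / 2"
   using \<epsilon> by (metis UNIV_I continuous_on_iff half_gt_zero)
  obtain d2 where d2: "0 < d2" "\<And>y. norm (y - x) < d2 ==> norm (moll r f' y - moll r f' x - k \<bullet> (y - x)) <= \<epsilon> / 2 * norm (y - x)"
   using k \<epsilon> unfolding has_derivative_at_alt by (metis half_gt_zero)
  define t where "t = min d1 d2 / 2"
  have t: "0 < t" "t < d1" "t < d2" using d1 d2 by (auto simp: t_def)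
  have m0: "0 <= moll r g' x" by (rule moll_nonneg_eq(2)[OF g'(1,2) r])
  have "ennreal \<bar>moll r f' (x + t *\<^sub>R e) - moll r f' x\<bar> <= (\<integral>\<^sup>+s. ennreal (moll r g' x + \<epsilon> / 2) * indicator {0..t} s \<partial>lborel)"
  proof (rule order_trans[OF bound[OF t(1)] nn_integral_mono])
   fix s
   have "moll r g' (x + s *\<^sub>R e) <= moll r g' x + \<epsilon> / 2" if "0 <= s" "s <= t"
    using d1(2)[of "x + s *\<^sub>R e"] that t e by (simp add: dist_norm dist_real_def abs_if split: if_splits)
   then show "ennreal (moll r g' (x + s *\<^sub>R e)) * indicator {0..t} s <= ennreal (moll r g' x + \<epsilon> / 2) * indicator {0..t} s"
    by (auto simp: indicator_def intro!: ennreal_leI)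
  qed
  also have "\<dots> = ennreal ((moll r g' x + \<epsilon> / 2) * t)"
   using t m0 \<epsilon> by (subst nn_integral_cmult_indicator) (auto simp: ennreal_mult')
  finally have 1: "\<bar>moll r f' (x + t *\<^sub>R e) - moll r f' x\<bar> <= (moll r g' x + \<epsilon> / 2) * t"
   using m0 \<epsilon> t by (subst (asm) ennreal_le_iff) auto
  have 2: "\<bar>moll r f' (x + t *\<^sub>R e) - moll r f' x - t * norm k\<bar> <= \<epsilon> / 2 * t"
   using d2(2)[of "x + t *\<^sub>R e"] t e by simp
  have "t * norm k <= (moll r g' x + \<epsilon> / 2) * t + \<epsilon> / 2 * t"
   using 1 2 by linarith
  also have "\<dots> = t * (moll r g' x + \<epsilon>)" by (simp add: algebra_simps)
  finally show "norm k <= moll r g' x + \<epsilon>" using t by simp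
 qed
qed

text \<open>Midpoints replace general convex combinations: they are what the parallelogram law
  needs, and invariants have to be checked for one average of two pairs only. Function and gradient
  are averaged together.\<close>

inductive_set midhull :: "(('a::euclidean_space => real) \<times> ('a => 'a)) set => (('a => real) \<times> ('a => 'a)) set"
 for S where
 base: "(f, w) \<in> S ==> (f, w) \<in> midhull S"
| mid: "(f1, w1) \<in> midhull S ==> (f2, w2) \<in> midhull S ==>
  ((%x. (f1 x + f2 x) / 2), (%x. (1/2) *\<^sub>R (w1 x + w2 x))) \<in> midhull S"

lemma midhull_mono: "S \<subseteq> T ==> midhull S \<subseteq> midhull T"
proof -
 assume "S \<subseteq> T"
 have "(f, w) \<in> midhull T" if "(f, w) \<in> midhull S" for f w
  using that by induction (use \<open>S \<subseteq> T\<close> in \<open>auto intro: midhull.intros\<close>)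
 then show ?thesis by auto
qed

lemma exists_strict_mono_eventually:
 assumes "\<And>m::nat. eventually (%n. P m n) sequentially"
 obtains s :: "nat => nat" where "strict_mono s" "\<And>m. P m (s m)"
proof -
 obtain N where N: "\<And>m n. N m <= n ==> P m n"
  using assms unfolding eventually_sequentially by metis
 \<comment> \<open>Partial sums of \<open>N i + 1\<close> are strictly increasing and exceed each
   single \<open>N m\<close>.\<close>
 define s where "s m = (\<Sum>i\<le>m. N i + 1)" for m
 have "strict_mono s" unfolding strict_mono_Suc_iff by (auto simp: s_def)
 moreover have "N m <= s m" for m unfolding s_def by (rule order_trans[OF _ member_le_sum[of m]]) auto
 ultimately show thesis using that N by blast
qed

lemma parallelogram_arith:
 fixes X N a b c :: real
 assumes "X + 4 * N <= 2 * (a + c) + 2 * (b + c)" "b <= N"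
 shows "X <= 2 * (a - b) + 4 * c"
 using assms by argo

text \<open>A Mazur-type lemma. The weight \<open>h powr (p - 2)\<close> turns the dominated sequence into a bounded one
 in a weighted \<open>L\<^sup>2\<close>, where almost minimal elements of the midpoint hulls of the tails form a Cauchy
 sequence by the parallelogram law.\<close>

lemma mazur_midhull:
 fixes F :: "nat => 'a::euclidean_space => real" and W :: "nat => 'a => 'a"
 defines "S \<equiv> %j. midhull {(F k, W k) |k. j <= k}"
 assumes Wm[measurable]: "\<And>k. Borel (W k)" and hm[measurable]: "Borel h" and h0: "\<And>x. 0 <= h x"
  and hp: "pint p (%x. ennreal (h x)) < \<infinity>" and dom: "AE x in lborel. \<forall>k. norm (W k x) <= h x" and p: "0 < p"
 obtains q w where "\<And>m. q m \<in> S m" "Borel w" "AE x in lborel. (%m. snd (q m) x) \<longlonglongrightarrow> w x"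
proof -
 define \<sigma> where "\<sigma> x = h x powr ((p - 2) / 2)" for x
 have \<sigma>m[measurable]: "Borel \<sigma>" unfolding \<sigma>_def[abs_def] by measurable
 have \<sigma>0: "0 <= \<sigma> x" for x by (simp add: \<sigma>_def)
 have h\<sigma>: "(h x * \<sigma> x)\<^sup>2 = h x powr p" for x
 proof (cases "h x = 0")
  case False
  then have hx: "0 < h x" using h0[of x] by simp
  have "(\<sigma> x)\<^sup>2 = h x powr (p - 2)" unfolding \<sigma>_def power2_eq_square powr_add[symmetric] by simp
  moreover have "(h x)\<^sup>2 = h x powr 2" using hx by (simp add: powr_numeral)
  ultimately have "(h x * \<sigma> x)\<^sup>2 = h x powr 2 * h x powr (p - 2)" by (simp only: power_mult_distrib)
  then show ?thesis by (simp add: powr_add[symmetric])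
 qed simp
 have iH: "integrable lborel (%x. h x powr p)"
  unfolding integrable_iff_bounded using hp by (auto simp: pint_def enn_pow_ennreal h0)
 define n where "n w = (\<integral>x. (norm (w x) * \<sigma> x)\<^sup>2 \<partial>lborel)" for w :: "'a => 'a"
 have inv: "Borel w \<and> (\<forall>x. (\<forall>k. norm (W k x) <= h x) --> norm (w x) <= h x)" if "(f, w) \<in> S j" for f w j
  using that unfolding S_def
 proof induction
  case (mid f1 w1 f2 w2)
  have "norm ((1/2) *\<^sub>R (w1 x + w2 x)) <= h x" if "\<forall>k. norm (W k x) <= h x" for x
   using mid.IH that norm_triangle_ineq[of "w1 x" "w2 x"] by auto (smt (verit, best))
  then show ?case using mid.IH by auto
 qed auto
 have wm: "Borel w" if "(f, w) \<in> S j" for f w j using inv[OF that] by blast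
 have wh: "AE x in lborel. norm (w x) <= h x" if "(f, w) \<in> S j" for f w j
  using dom by eventually_elim (use inv[OF that] in blast)
 have int: "integrable lborel (%x. (norm (w x) * \<sigma> x)\<^sup>2)"
  if [measurable]: "Borel w" and le: "AE x in lborel. norm (w x) <= 2 * h x" for w :: "'a => 'a"
 proof (rule Bochner_Integration.integrable_bound)
  show "integrable lborel (%x. 4 * h x powr p)" using iH by simp
  show "AE x in lborel. norm ((norm (w x) * \<sigma> x)\<^sup>2) <= norm (4 * h x powr p)"
   using le
  proof eventually_elim
   case (elim x)
   have "(norm (w x) * \<sigma> x)\<^sup>2 <= (2 * h x * \<sigma> x)\<^sup>2"
    using elim \<sigma>0[of x] by (intro power_mono mult_right_mono) auto
   also have "\<dots> = 4 * (h x * \<sigma> x)\<^sup>2" by (simp add: power_mult_distrib)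
   finally show ?case by (simp add: h\<sigma>)
  qed
 qed measurable
 have intS: "integrable lborel (%x. (norm (w x) * \<sigma> x)\<^sup>2)" if "(f, w) \<in> S j" for f w j
 proof (rule int[OF wm[OF that]])
  show "AE x in lborel. norm (w x) <= 2 * h x" using wh[OF that] by eventually_elim (use h0 in \<open>smt (verit)\<close>)
 qed
 have n0: "0 <= n w" for w unfolding n_def by (intro Bochner_Integration.integral_nonneg) auto
 \<comment> \<open>Infima over the hulls of the tails. They increase with \<open>j\<close>, as the
   hulls shrink, and are bounded by the integral of \<open>h powr p\<close>, so they
   converge.\<close>
 define d where "d j = Inf {n w |f w. (f, w) \<in> S j}" for j
 have bdd: "bdd_below {n w |f w. (f, w) \<in> S j}" for j using n0 by (auto intro!: bdd_belowI[of _ 0])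
 have ne: "{n w |f w. (f, w) \<in> S j} \<noteq> {}" for j
 proof -
  have "(F j, W j) \<in> S j" unfolding S_def by (rule midhull.base) auto
  then show ?thesis by blast
 qed
 have dle: "d j <= n w" if "(f, w) \<in> S j" for f w j
  unfolding d_def by (intro cInf_lower bdd) (use that in blast)
 have Ssub: "S i \<subseteq> S j" if "j <= i" for i j
  unfolding S_def using that by (intro midhull_mono) auto
 have nH: "n w <= (\<integral>x. h x powr p \<partial>lborel)" if "(f, w) \<in> S j" for f w j
  unfolding n_def
 proof (rule integral_mono_AE[OF intS[OF that] iH])
  show "AE x in lborel. (norm (w x) * \<sigma> x)\<^sup>2 <= h x powr p"
   using wh[OF that]
  proof eventually_elim
   case (elim x)
   then have "(norm (w x) * \<sigma> x)\<^sup>2 <= (h x * \<sigma> x)\<^sup>2" using \<sigma>0[of x] by (intro power_mono mult_right_mono) auto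
   then show ?case by (simp add: h\<sigma>)
  qed
 qed
 have inc: "incseq d"
 proof (rule incseq_SucI)
  show "d i <= d (Suc i)" for i
   unfolding d_def by (intro cInf_superset_mono ne bdd) (use Ssub[of i "Suc i"] in auto)
 qed
 have bnd: "d j <= (\<integral>x. h x powr p \<partial>lborel)" for j
 proof -
  have "(F j, W j) \<in> S j" unfolding S_def by (rule midhull.base) auto
  then show ?thesis using order_trans[OF dle nH] by blast
 qed
 obtain dinf where di: "d \<longlonglongrightarrow> dinf" "\<forall>i. d i <= dinf"
  by (rule incseq_convergent[OF inc allI[OF bnd]])
 have dinf: "d \<longlonglongrightarrow> dinf" "\<And>i. d i <= dinf" using di by auto
 have "\<exists>f w. (f, w) \<in> S j \<and> n w < d j + 1 / Suc j" for j
 proof -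
  have "\<exists>y\<in>{n w |f w. (f, w) \<in> S j}. y < d j + 1 / Suc j"
   using cInf_less_iff[OF ne bdd, of j "d j + 1 / Suc j"] unfolding d_def by simp
  then show ?thesis by blast
 qed
 then obtain f w where fw: "\<And>j. (f j, w j) \<in> S j" "\<And>j. n (w j) < d j + 1 / Suc j" by metis
 have diff: "integrable lborel (%x. (norm (w i x - w j x) * \<sigma> x)\<^sup>2)" for i j
 proof (rule int)
  show "Borel (%x. w i x - w j x)" using wm[OF fw(1)] by measurable
  show "AE x in lborel. norm (w i x - w j x) <= 2 * h x"
   using wh[OF fw(1)[of i]] wh[OF fw(1)[of j]]
   by eventually_elim (smt (verit) norm_triangle_ineq4)
 qed
 \<comment> \<open>The midpoint of two almost minimal elements again lies in the hull
   \<open>S j\<close>, so its weighted square norm is at least \<open>d j\<close>; the parallelogram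
   law then leaves little room for their difference.\<close>
 have cauchy: "(\<integral>x. (norm (w i x - w j x) * \<sigma> x)\<^sup>2 \<partial>lborel) <= 2 * (dinf - d j) + 4 / Suc j" if ij: "j <= i" for i j
 proof -
  have mem: "(f i, w i) \<in> S j" using Ssub[OF ij] fw(1) by blast
  have mid: "((%x. (f i x + f j x) / 2), (%x. (1/2) *\<^sub>R (w i x + w j x))) \<in> S j"
   using mem fw(1)[of j] unfolding S_def by (rule midhull.mid)
  have "(\<integral>x. (norm (w i x - w j x) * \<sigma> x)\<^sup>2 \<partial>lborel) + 4 * n (%x. (1/2) *\<^sub>R (w i x + w j x))
   = (\<integral>x. (norm (w i x - w j x) * \<sigma> x)\<^sup>2 + 4 * (norm ((1/2) *\<^sub>R (w i x + w j x)) * \<sigma> x)\<^sup>2 \<partial>lborel)"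
   unfolding n_def using diff intS[OF mid] by simp
  also have "(%x. (norm (w i x - w j x) * \<sigma> x)\<^sup>2 + 4 * (norm ((1/2) *\<^sub>R (w i x + w j x)) * \<sigma> x)\<^sup>2)
   = (%x. 2 * (norm (w i x) * \<sigma> x)\<^sup>2 + 2 * (norm (w j x) * \<sigma> x)\<^sup>2)"
  proof
   fix x
   have "(norm (w i x - w j x))\<^sup>2 + (norm (w i x + w j x))\<^sup>2 = 2 * (norm (w i x))\<^sup>2 + 2 * (norm (w j x))\<^sup>2"
    by (simp add: power2_norm_eq_inner inner_simps inner_commute)
   then have "((norm (w i x - w j x))\<^sup>2 + (norm (w i x + w j x))\<^sup>2) * (\<sigma> x)\<^sup>2 = (2 * (norm (w i x))\<^sup>2 + 2 * (norm (w j x))\<^sup>2) * (\<sigma> x)\<^sup>2" by simp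
   then show "(norm (w i x - w j x) * \<sigma> x)\<^sup>2 + 4 * (norm ((1/2) *\<^sub>R (w i x + w j x)) * \<sigma> x)\<^sup>2
   = 2 * (norm (w i x) * \<sigma> x)\<^sup>2 + 2 * (norm (w j x) * \<sigma> x)\<^sup>2"
    unfolding norm_scaleR by (simp add: power_mult_distrib power_divide algebra_simps)
  qed
  also have "(\<integral>x. 2 * (norm (w i x) * \<sigma> x)\<^sup>2 + 2 * (norm (w j x) * \<sigma> x)\<^sup>2 \<partial>lborel) = 2 * n (w i) + 2 * n (w j)"
   unfolding n_def using intS[OF fw(1)] by simp
  also have "\<dots> <= 2 * (d i + 1 / Suc i) + 2 * (d j + 1 / Suc j)" using fw(2)[of i] fw(2)[of j] by (intro add_mono mult_left_mono) auto
  also have "\<dots> <= 2 * (dinf + 1 / Suc j) + 2 * (d j + 1 / Suc j)"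
  proof -
   have "1 / real (Suc i) <= 1 / Suc j" using ij by (simp add: field_simps)
   then show ?thesis using dinf(2)[of i] by (intro add_mono mult_left_mono) auto
  qed
  finally have fin: "(\<integral>x. (norm (w i x - w j x) * \<sigma> x)\<^sup>2 \<partial>lborel) + 4 * n (%x. (1/2) *\<^sub>R (w i x + w j x))
   <= 2 * (dinf + 1 / Suc j) + 2 * (d j + 1 / Suc j)" .
  from parallelogram_arith[OF fin dle[OF mid]] show ?thesis by simp
 qed
 have lim0: "(%j. 2 * (dinf - d j) + 4 / Suc j) \<longlonglongrightarrow> 0"
 proof -
  have "(%j. 2 * (dinf - d j) + 4 * (inverse (real (Suc j)))) \<longlonglongrightarrow> 2 * (dinf - dinf) + 4 * 0"
   by (intro tendsto_intros dinf(1) LIMSEQ_inverse_real_of_nat)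
  then show ?thesis by (simp add: divide_inverse)
 qed
 have ev: "eventually (%j. 2 * (dinf - d j) + 4 / Suc j < ((1/4) ^ Suc m) powr 2) sequentially" for m
  by (rule order_tendstoD(2)[OF lim0]) simp
 obtain s where s: "strict_mono s" "\<And>m. 2 * (dinf - d (s m)) + 4 / Suc (s m) < ((1/4) ^ Suc m) powr 2"
  by (rule exists_strict_mono_eventually[where P="%m j. 2 * (dinf - d j) + 4 / Suc j < ((1/4) ^ Suc m) powr 2", OF ev]) (rule that)
 define v where "v m = w (s m)" for m
 have vm[measurable]: "Borel (v m)" for m unfolding v_def by (rule wm[OF fw(1)])
 have "pint 2 (%x. \<Sum>m. ennreal (norm (v (Suc m) x - v m x) * \<sigma> x)) < \<infinity>"
 proof (rule pint_suminf_fast)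
  fix m
  have "pint 2 (%x. ennreal (norm (v (Suc m) x - v m x) * \<sigma> x)) = (\<integral>\<^sup>+x. ennreal ((norm (v (Suc m) x - v m x) * \<sigma> x)\<^sup>2) \<partial>lborel)"
   unfolding pint_def by (intro nn_integral_cong) (simp add: enn_pow_ennreal \<sigma>0 powr_numeral)
  also have "\<dots> = ennreal (\<integral>x. (norm (v (Suc m) x - v m x) * \<sigma> x)\<^sup>2 \<partial>lborel)"
   unfolding v_def by (rule nn_integral_eq_integral[OF diff]) simp
  also have "\<dots> <= ennreal (((1/4) ^ Suc m) powr 2)"
  proof (rule ennreal_leI)
   have "s m <= s (Suc m)" using s(1) by (simp add: strict_mono_less_eq)
   from cauchy[OF this] s(2)[of m]
   show "(\<integral>x. (norm (v (Suc m) x - v m x) * \<sigma> x)\<^sup>2 \<partial>lborel) <= ((1/4) ^ Suc m) powr 2" unfolding v_def by (meson less_imp_le order_trans)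
  qed
  finally show "pint 2 (%x. ennreal (norm (v (Suc m) x - v m x) * \<sigma> x)) <= ennreal (((1/4) ^ Suc m) powr 2)" .
 qed auto
 then have fin: "AE x in lborel. (\<Sum>m. ennreal (norm (v (Suc m) x - v m x) * \<sigma> x)) \<noteq> \<infinity>"
  by (intro pint_AE_finite) auto
 have vh: "AE x in lborel. \<forall>m. norm (v m x) <= h x"
  unfolding AE_all_countable v_def using wh[OF fw(1)] by blast
 have "AE x in lborel. convergent (%m. v m x)"
  using fin vh
 proof eventually_elim
  case (elim x)
  show ?case
  \<comment> \<open>Convergence is known in the weighted sense only. The weight vanishes exactly
    where \<open>h\<close> does, and there all \<open>v m\<close> vanish as well.\<close>
  proof (cases "h x = 0")
   case True
   then have "(%m. v m x) = (%m. 0)" using elim(2) by auto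
   then show ?thesis by (simp add: convergent_const)
  next
   case False
   then have pos: "0 < \<sigma> x" using h0[of x] by (simp add: \<sigma>_def)
   have "summable (%m. norm (v (Suc m) x - v m x) * \<sigma> x)"
    by (rule summable_suminf_not_top) (use elim(1) \<sigma>0[of x] in simp_all)
   then have "summable (%m. norm (v (Suc m) x - v m x))"
    using summable_mult2[of "%m. norm (v (Suc m) x - v m x) * \<sigma> x" "inverse (\<sigma> x)"] pos by (simp add: mult.assoc)
   then have "summable (%m. v (Suc m) x - v m x)" by (rule summable_norm_cancel)
   then have "convergent (%n. \<Sum>m<n. v (Suc m) x - v m x)" by (simp add: summable_iff_convergent)
   then have "convergent (%n. v n x - v 0 x)" using sum_lessThan_telescope[of "%m. v m x"] by simp
   then have "convergent (%n. (v n x - v 0 x) + v 0 x)" by (intro convergent_add convergent_const)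
   then show ?thesis by simp
  qed
 qed
 then have lim: "AE x in lborel. (%m. v m x) \<longlonglongrightarrow> lim (%m. v m x)"
  by eventually_elim (simp add: convergent_LIMSEQ_iff)
 show thesis
 proof (rule that[of "%m. (f (s m), w (s m))" "%x. lim (%m. v m x)"])
  show "(f (s m), w (s m)) \<in> S m" for m
   using fw(1)[of "s m"] Ssub[OF seq_suble[OF s(1), of m]] by blast
  show "Borel (%x. lim (%m. v m x))" by (rule borel_measurable_lim_metric) measurable
  show "AE x in lborel. (%m. snd (f (s m), w (s m)) x) \<longlonglongrightarrow> lim (%m. v m x)" using lim by (simp add: v_def)
 qed
qed

text \<open>Tested against all compactly supported functions of class C^1, a larger class than that
  in \<open>weak_gradient\<close>, and with Borel integrals. It is reached as a limit of C^1 pairs,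
  for which the larger class costs nothing.\<close>

definition weakly_diff :: "('a::euclidean_space => real) => ('a => 'a) => bool" where
 "weakly_diff f w \<longleftrightarrow> (\<forall>R \<phi> b. C1c R \<phi> --> b \<in> Basis -->
  (\<integral>x. f x * (grad \<phi> x \<bullet> b) \<partial>lborel) = - (\<integral>x. (w x \<bullet> b) * \<phi> x \<partial>lborel))"

lemma C1c_bounded:
 assumes "C1c R \<phi>" obtains M where "\<And>x. \<bar>\<phi> x\<bar> <= M" "\<And>x. norm (grad \<phi> x) <= M"
proof -
 note K = C1cD[OF assms] and V = C1c_vanishes_beyond[OF assms]
 obtain M1 where M1: "0 < M1" "\<And>x. norm (\<phi> x) <= M1" by (rule compact_support_bounded[OF K(5) V(1)]) (rule that)
 obtain M2 where M2: "0 < M2" "\<And>x. norm (grad \<phi> x) <= M2" by (rule compact_support_bounded[OF K(2) V(2)]) (rule that)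
 show thesis
  by (rule that[of "max M1 M2"]) (use M1(2) M2(2) in \<open>auto simp: le_max_iff_disj\<close>)
qed

lemma weakly_diff_limit:
 fixes f :: "'a::euclidean_space => real"
 assumes wd: "\<And>m. weakly_diff (F m) (W m)" and [measurable]: "\<And>m. Borel (F m)" "\<And>m. Borel (W m)"
   "Borel f" "Borel w"
  and limF: "AE x in lborel. (%m. F m x) \<longlonglongrightarrow> f x" and bF: "\<And>m x. \<bar>F m x\<bar> <= M"
  and limW: "AE x in lborel. (%m. W m x) \<longlonglongrightarrow> w x" and bW: "\<And>m. AE x in lborel. norm (W m x) <= h x" and h: "locint h"
 shows "weakly_diff f w"
 unfolding weakly_diff_def
proof (intro allI impI)
 fix R and \<phi> :: "'a => real" and b :: 'a assume C: "C1c R \<phi>" and b: "b \<in> Basis"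
 note K = C1cD[OF C]
 have [measurable]: "Borel \<phi>" "Borel (grad \<phi>)" "Borel h"
  using K h by (auto dest: locint_measurable)
 obtain B where B: "\<And>x. \<bar>\<phi> x\<bar> <= B" "\<And>x. norm (grad \<phi> x) <= B" by (rule C1c_bounded[OF C]) (rule that)
 have "(%m. \<integral>x. F m x * (grad \<phi> x \<bullet> b) \<partial>lborel) \<longlonglongrightarrow> (\<integral>x. f x * (grad \<phi> x \<bullet> b) \<partial>lborel)"
 proof (rule integral_dominated_convergence[where w="%x. M * norm (grad \<phi> x \<bullet> b)"])
  show "integrable lborel (%x. M * norm (grad \<phi> x \<bullet> b))" using K(7)[of b] by (intro integrable_mult_right integrable_norm)
  show "AE x in lborel. (%m. F m x * (grad \<phi> x \<bullet> b)) \<longlonglongrightarrow> f x * (grad \<phi> x \<bullet> b)"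
   using limF by eventually_elim (intro tendsto_intros)
  show "AE x in lborel. norm (F m x * (grad \<phi> x \<bullet> b)) <= M * norm (grad \<phi> x \<bullet> b)" for m
   using bF by (auto simp: abs_mult intro!: AE_I2 mult_right_mono)
 qed measurable
 moreover have "(%m. \<integral>x. (W m x \<bullet> b) * \<phi> x \<partial>lborel) \<longlonglongrightarrow> (\<integral>x. (w x \<bullet> b) * \<phi> x \<partial>lborel)"
 proof (rule integral_dominated_convergence[where w="%x. norm (h x *\<^sub>R \<phi> x)"])
  show "integrable lborel (%x. norm (h x *\<^sub>R \<phi> x))"
   by (intro integrable_norm locint_mult_integrable[OF h, of _ B R]) (use B C1c_vanishes_beyond[OF C] in auto)
  show "AE x in lborel. (%m. (W m x \<bullet> b) * \<phi> x) \<longlonglongrightarrow> (w x \<bullet> b) * \<phi> x"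
   using limW by eventually_elim (intro tendsto_intros)
  show "AE x in lborel. norm ((W m x \<bullet> b) * \<phi> x) <= norm (h x *\<^sub>R \<phi> x)" for m
   using bW[of m]
  proof eventually_elim
   case (elim x)
   have "\<bar>W m x \<bullet> b\<bar> <= \<bar>h x\<bar>" using Basis_le_norm[OF b, of "W m x"] elim by linarith
   then show ?case by (simp add: abs_mult mult_right_mono)
  qed
 qed measurable
 moreover have "(\<integral>x. F m x * (grad \<phi> x \<bullet> b) \<partial>lborel) = - (\<integral>x. (W m x \<bullet> b) * \<phi> x \<partial>lborel)" for m
  using wd[of m] C b unfolding weakly_diff_def by blast
 ultimately have "(%m. - (\<integral>x. (W m x \<bullet> b) * \<phi> x \<partial>lborel)) \<longlonglongrightarrow> (\<integral>x. f x * (grad \<phi> x \<bullet> b) \<partial>lborel)"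
  "(%m. - (\<integral>x. (W m x \<bullet> b) * \<phi> x \<partial>lborel)) \<longlonglongrightarrow> - (\<integral>x. (w x \<bullet> b) * \<phi> x \<partial>lborel)"
  by (simp_all add: tendsto_minus)
 then show "(\<integral>x. f x * (grad \<phi> x \<bullet> b) \<partial>lborel) = - (\<integral>x. (w x \<bullet> b) * \<phi> x \<partial>lborel)"
  by (rule LIMSEQ_unique)
qed

lemma borel_version_bounded:
 fixes f :: "'a::euclidean_space => real"
 assumes "f \<in> borel_measurable lebesgue" "\<And>x. \<bar>f x\<bar> <= M"
 obtains f' where "Borel f'" "\<And>x. \<bar>f' x\<bar> <= M" "AE x in lborel. f x = f' x"
proof -
 obtain f0 where f0: "f0 \<in> borel_measurable lborel" "AE x in lborel. f x = f0 x"
  using completion_ex_borel_measurable_real[OF assms(1)] by blast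
 have M: "0 <= M" using assms(2)[of 0] by linarith
 have [measurable]: "Borel f0" using f0 by simp
 show thesis
 proof (rule that[of "%x. max (-M) (min M (f0 x))"])
  show "AE x in lborel. f x = max (-M) (min M (f0 x))"
   using f0(2)
  proof eventually_elim
   case (elim x)
   then show ?case using assms(2)[of x] by (auto simp: abs_le_iff max_def min_def)
  qed
  show "\<bar>max (-M) (min M (f0 x))\<bar> <= M" for x using M by auto
 qed measurable
qed

text \<open>One sequence of radii serves two functions, typically a function together with its
  gradient or upper gradient, so that both are mollified simultaneously.\<close>

lemma fast_radii:
 fixes f :: "'a::euclidean_space => 'b::euclidean_space" and g :: "'a => 'c::euclidean_space"
 assumes "Borel f" "pnorm p f < \<infinity>"
  and "Borel g" "pnorm p g < \<infinity>" and p: "1 < p"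
 obtains r where "\<And>k::nat. 0 < r k" "r \<longlonglongrightarrow> 0"
  "\<And>k. pnorm p (%x. moll (r k) f x - f x) <= ennreal (((1/4) ^ Suc k) powr p)"
  "\<And>k. pnorm p (%x. moll (r k) g x - g x) <= ennreal (((1/4) ^ Suc k) powr p)"
proof -
 define t where "t n = inverse (real (Suc n))" for n
 have t: "\<And>n. 0 < t n" "t \<longlonglongrightarrow> 0" using LIMSEQ_inverse_real_of_nat by (auto simp: t_def[abs_def])
 have ev: "eventually (%n. pnorm p (%x. moll (t n) f x - f x) < ennreal (((1/4) ^ Suc k) powr p) \<and>
  pnorm p (%x. moll (t n) g x - g x) < ennreal (((1/4) ^ Suc k) powr p)) sequentially" for k
  by (intro eventually_conj order_tendstoD(2)[OF moll_tendsto_Lp[OF assms(1) p assms(2) t]] order_tendstoD(2)[OF moll_tendsto_Lp[OF assms(3) p assms(4) t]]) auto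
 obtain s where s: "strict_mono s" and s2: "\<And>k. pnorm p (%x. moll (t (s k)) f x - f x) < ennreal (((1/4) ^ Suc k) powr p) \<and>
  pnorm p (%x. moll (t (s k)) g x - g x) < ennreal (((1/4) ^ Suc k) powr p)"
  by (rule exists_strict_mono_eventually[where P="%k n. pnorm p (%x. moll (t n) f x - f x) < ennreal (((1/4) ^ Suc k) powr p) \<and>
  pnorm p (%x. moll (t n) g x - g x) < ennreal (((1/4) ^ Suc k) powr p)", OF ev]) (rule that)
 show thesis
 proof (rule that[of "%k. t (s k)"])
  show "(%k. t (s k)) \<longlonglongrightarrow> 0" using LIMSEQ_subseq_LIMSEQ[OF t(2) s] by (simp add: comp_def)
 qed (use t s2 in \<open>auto intro: less_imp_le\<close>)
qed

lemma abs_midpoint_le: "\<bar>a - d\<bar> <= c ==> \<bar>b - d\<bar> <= c ==> \<bar>(a + b) / 2 - d\<bar> <= c" for a b c d :: real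
 unfolding abs_le_iff by (auto simp: field_simps)

lemma ennreal_suminf_upper: "a k <= (\<Sum>k. a k)" for a :: "nat => ennreal"
 using sum_le_suminf[of a "{k}"] by simp

text \<open>The sum of \<open>norm (f x)\<close> and of all errors has finite energy by the fast
  decay. Where finite it dominates every mollification, and it is finite almost everywhere, which
  forces the errors to 0.\<close>

lemma fast_moll:
 fixes f :: "'a::euclidean_space => 'b::euclidean_space"
 assumes fm[measurable]: "Borel f" and fin: "pnorm p f < \<infinity>" and p: "1 < p"
  and r: "\<And>k. 0 < r k" and fast: "\<And>k. pnorm p (%x. moll (r k) f x - f x) <= ennreal (((1/4) ^ Suc k) powr p)"
 shows "AE x in lborel. (%k. moll (r k) f x) \<longlonglongrightarrow> f x"
  "\<exists>H. Borel H \<and> (\<forall>x. 0 <= H x) \<and> pint p (%x. ennreal (H x)) < \<infinity> \<and> locint H \<and>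
   (AE x in lborel. \<forall>k. norm (moll (r k) f x) <= H x) \<and> (\<forall>x. norm (f x) <= H x \<or> H x = 0) \<and> (AE x in lborel. norm (f x) <= H x)"
proof -
 have p0: "0 < p" using p by simp
 have lf: "locint f" by (rule locint_Lp[OF fm _ fin]) (use p in simp)
 have [measurable]: "Borel (moll (r k) f)" for k
  by (rule borel_measurable_continuous_onI[OF moll_continuous[OF lf r]])
 have "AE x in lborel. (%k. norm (moll (r k) f x - f x)) \<longlonglongrightarrow> 0"
  by (rule fast_AE_tendsto_0[OF _ p0 _ fast]) auto
 then show "AE x in lborel. (%k. moll (r k) f x) \<longlonglongrightarrow> f x"
  by eventually_elim (metis Lim_null tendsto_norm_zero_iff)
 define E where "E x = ennreal (norm (f x)) + (\<Sum>k. ennreal (norm (moll (r k) f x - f x)))" for x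
 have [measurable]: "Borel E" unfolding E_def[abs_def] by measurable
 have Efin: "pint p E < \<infinity>"
  unfolding E_def by (intro pint_add_finite p0 fin pint_suminf_fast fast) auto
 then have AEfin: "AE x in lborel. E x \<noteq> \<infinity>" by (intro pint_AE_finite) auto
 \<comment> \<open>\<open>enn2real\<close> sends infinity to 0; at such points, a null set,
   \<open>H\<close> need not bound anything, whence the alternative \<open>H x = 0\<close> in the
   conclusion.\<close>
 define H where "H x = enn2real (E x)" for x
 have HE: "ennreal (H x) <= E x" for x by (cases "E x") (auto simp: H_def)
 have 1: "Borel H" unfolding H_def[abs_def] by measurable
 have 2: "pint p (%x. ennreal (H x)) < \<infinity>" by (rule le_less_trans[OF pint_mono[OF p0 HE] Efin])
 have 3: "0 <= H x" for x by (simp add: H_def)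
 have 4: "locint H" by (rule locint_Lp[OF 1]) (use p 2 3 in auto)
 have 5: "norm (moll (r k) f x) <= H x" "norm (f x) <= H x" if "E x \<noteq> \<infinity>" for x k
 proof -
  have EH: "E x = ennreal (H x)" using that by (simp add: H_def less_top)
  have "ennreal (norm (moll (r k) f x)) <= ennreal (norm (f x)) + ennreal (norm (moll (r k) f x - f x))"
   using ennreal_leI[OF norm_triangle_sub[of "moll (r k) f x" "f x"]] by simp
  also have "\<dots> <= E x"
   unfolding E_def by (intro add_left_mono ennreal_suminf_upper)
  finally show "norm (moll (r k) f x) <= H x" using EH 3 by simp
  have "ennreal (norm (f x)) <= E x" unfolding E_def by simp
  then show "norm (f x) <= H x" using EH 3 by simp
 qed
 have 6: "AE x in lborel. \<forall>k. norm (moll (r k) f x) <= H x" "AE x in lborel. norm (f x) <= H x"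
  using AEfin by (eventually_elim, use 5 in blast)+
 have 7: "norm (f x) <= H x \<or> H x = 0" for x
  using 5(2)[of x] by (cases "E x = \<infinity>") (auto simp: H_def)
 show "\<exists>H. Borel H \<and> (\<forall>x. 0 <= H x) \<and> pint p (%x. ennreal (H x)) < \<infinity> \<and> locint H \<and>
   (AE x in lborel. \<forall>k. norm (moll (r k) f x) <= H x) \<and> (\<forall>x. norm (f x) <= H x \<or> H x = 0) \<and> (AE x in lborel. norm (f x) <= H x)"
  using 1 2 3 4 6 7 by blast
qed

lemma enn2real_version:
 fixes g :: "'a::euclidean_space => ennreal"
 assumes [measurable]: "Borel g" and fin: "pint p g < \<infinity>"
 shows "Borel (%x. enn2real (g x))" "AE x in lborel. g x = ennreal (enn2real (g x))"
  "pint p (%x. ennreal (enn2real (g x))) < \<infinity>"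
proof -
 show "Borel (%x. enn2real (g x))" by measurable
 show ae: "AE x in lborel. g x = ennreal (enn2real (g x))"
  using pint_AE_finite[OF assms] by eventually_elim (simp add: less_top)
 show "pint p (%x. ennreal (enn2real (g x))) < \<infinity>"
  using pint_cong_AE[OF ae, of p] fin by simp
qed

text \<open>The mollifications of \<open>f'\<close> have gradients bounded by mollifications of
  \<open>g'\<close>, which share one p-integrable majorant. Averages from
  \<open>mazur_midhull\<close> converge almost everywhere, and the integration by parts passes to
  the limit. The bound by \<open>g\<close> itself survives because averages of a tail obey every
  bound common to the tail.\<close>

theorem newtonian_weakly_diff:
 fixes f :: "'a::euclidean_space => real"
 assumes u: "ugrad f g" and gp: "pint p g < \<infinity>" and p: "1 < p"
  and f': "Borel f'" "\<And>x. \<bar>f' x\<bar> <= M" "AE x in lborel. f x = f' x"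
  and fp: "pint p (%x. ennreal \<bar>f' x\<bar>) < \<infinity>"
 obtains w where "Borel w" "weakly_diff f' w" "AE x in lborel. ennreal (norm (w x)) <= g x"
proof -
 have p0: "0 < p" using p by simp
 have M: "0 <= M" using f'(2)[of 0] by linarith
 have gm: "Borel g" using u by (rule ugrad_measurable)
 define g' where "g' x = enn2real (g x)" for x
 note G = enn2real_version[OF gm gp, folded g'_def]
 have gp': "pnorm p g' < \<infinity>" using G(3) by (simp add: g'_def)
 have fp': "pnorm p f' < \<infinity>" using fp by simp
 have lf: "locint f'" by (rule locint_Lp[OF f'(1) _ fp']) (use p in simp)
 have lg: "locint g'" by (rule locint_Lp[OF G(1) _ gp']) (use p in simp)
 have g0: "0 <= g' x" for x by (simp add: g'_def)
 obtain r where r: "\<And>k::nat. 0 < r k" "r \<longlonglongrightarrow> 0"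
  and rf: "\<And>k. pnorm p (%x. moll (r k) f' x - f' x) <= ennreal (((1/4) ^ Suc k) powr p)"
  and rg: "\<And>k. pnorm p (%x. moll (r k) g' x - g' x) <= ennreal (((1/4) ^ Suc k) powr p)"
  by (rule fast_radii[OF f'(1) fp' G(1) gp' p]) (rule that)
 define F where "F k = moll (r k) f'" for k
 define W where "W k = vconv (grad (ker (r k))) f'" for k
 have FW: "(F k has_derivative (%h. W k x \<bullet> h)) (at x)" "continuous_on UNIV (W k)" for k x
  unfolding F_def W_def by (rule moll_has_derivative[OF lf r(1)])+
 have cF: "continuous_on UNIV (F k)" for k unfolding F_def by (rule moll_continuous[OF lf r(1)])
 have Wg: "norm (W k x) <= moll (r k) g' x" for k x
  by (rule moll_grad_le[OF u f'(1,3) lf lg g0 G(2) r(1)]) (use FW(1) in \<open>simp add: F_def\<close>)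
 obtain H where H: "Borel H" "\<And>x. 0 <= H x" "pint p (%x. ennreal (H x)) < \<infinity>" "locint H"
  "AE x in lborel. \<forall>k. norm (moll (r k) g' x) <= H x"
  using fast_moll(2)[OF G(1) gp' p r(1) rg] by auto
 have dom: "AE x in lborel. \<forall>k. norm (W k x) <= H x"
  using H(5)
 proof eventually_elim
  case (elim x)
  show ?case
  proof
   fix k
   have "norm (W k x) <= norm (moll (r k) g' x)" using Wg[of k x] by simp
   then show "norm (W k x) <= H x" using elim by (meson order_trans)
  qed
 qed
 have Wm: "Borel (W k)" for k by (rule borel_measurable_continuous_onI[OF FW(2)])
 obtain q w where q: "\<And>m. q m \<in> midhull {(F k, W k) |k. m <= k}" and w: "Borel w" "AE x in lborel. (%m. snd (q m) x) \<longlonglongrightarrow> w x"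
  by (rule mazur_midhull[OF Wm H(1,2,3) dom p0]) (rule that)
 \<comment> \<open>The last two clauses say that a pointwise bound valid for the whole tail from
   \<open>j\<close> on is inherited by every averaged pair; convergence of the functions and the
   bound on the gradients follow from these.\<close>
 have inv: "continuous_on UNIV f1 \<and> continuous_on UNIV w1 \<and> weakly_diff f1 w1 \<and> (\<forall>x. \<bar>f1 x\<bar> <= M) \<and>
   (\<forall>x c. (\<forall>k\<ge>j. \<bar>F k x - f' x\<bar> <= c) --> \<bar>f1 x - f' x\<bar> <= c) \<and>
   (\<forall>x c. (\<forall>k\<ge>j. norm (W k x) <= c) --> norm (w1 x) <= c)"
  if "(f1, w1) \<in> midhull {(F k, W k) |k. j <= k}" for f1 w1 j
  using that
 proof induction
  case (base f1 w1)
  then obtain k where k: "f1 = F k" "w1 = W k" "j <= k" by blast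
  have "weakly_diff (F k) (W k)"
   unfolding weakly_diff_def using integration_by_parts_C1[OF FW] by auto
  moreover have "\<bar>F k x\<bar> <= M" for x
   unfolding F_def using moll_bounded[OF f'(1) r(1)[of k], of M x] f'(2) M by simp
  ultimately show ?case using k cF FW(2) by auto
 next
  case (mid f1 w1 f2 w2)
  note I1 = mid.IH(1) and I2 = mid.IH(2)
  have c: "continuous_on UNIV (%x. (f1 x + f2 x) / 2)" "continuous_on UNIV (%x. (1/2) *\<^sub>R (w1 x + w2 x))"
   using I1 I2 by (auto intro!: continuous_intros)
  have "weakly_diff (%x. (f1 x + f2 x) / 2) (%x. (1/2) *\<^sub>R (w1 x + w2 x))"
   unfolding weakly_diff_def
  proof (intro allI impI)
   fix R and \<phi> :: "'a => real" and b :: 'a assume C: "C1c R \<phi>" and b: "b \<in> Basis"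
   note K = C1cD[OF C]
   have i: "integrable lborel (%x. f1 x * (grad \<phi> x \<bullet> b))" "integrable lborel (%x. f2 x * (grad \<phi> x \<bullet> b))"
    "integrable lborel (%x. (w1 x \<bullet> b) * \<phi> x)" "integrable lborel (%x. (w2 x \<bullet> b) * \<phi> x)"
    by (rule integrable_continuous_compact_support[of _ R]; use I1 I2 K(3,4) in \<open>auto intro!: continuous_intros K\<close>)+
   have e: "(\<integral>x. f1 x * (grad \<phi> x \<bullet> b) \<partial>lborel) = - (\<integral>x. (w1 x \<bullet> b) * \<phi> x \<partial>lborel)"
    "(\<integral>x. f2 x * (grad \<phi> x \<bullet> b) \<partial>lborel) = - (\<integral>x. (w2 x \<bullet> b) * \<phi> x \<partial>lborel)"
    using I1 I2 C b unfolding weakly_diff_def by blast+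
   have "(\<integral>x. (f1 x + f2 x) / 2 * (grad \<phi> x \<bullet> b) \<partial>lborel) = (\<integral>x. (1/2) * (f1 x * (grad \<phi> x \<bullet> b) + f2 x * (grad \<phi> x \<bullet> b)) \<partial>lborel)"
    by (intro Bochner_Integration.integral_cong) (auto simp: algebra_simps)
   also have "\<dots> = - ((1/2) * ((\<integral>x. (w1 x \<bullet> b) * \<phi> x \<partial>lborel) + (\<integral>x. (w2 x \<bullet> b) * \<phi> x \<partial>lborel)))"
    using i e by (simp add: field_simps)
   also have "\<dots> = - (\<integral>x. (1/2) * ((w1 x \<bullet> b) * \<phi> x + (w2 x \<bullet> b) * \<phi> x) \<partial>lborel)"
    using i by simp
   also have "\<dots> = - (\<integral>x. ((1/2) *\<^sub>R (w1 x + w2 x) \<bullet> b) * \<phi> x \<partial>lborel)"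
    by (intro arg_cong[of _ _ uminus] Bochner_Integration.integral_cong) (auto simp: inner_simps algebra_simps)
   finally show "(\<integral>x. (f1 x + f2 x) / 2 * (grad \<phi> x \<bullet> b) \<partial>lborel) = - (\<integral>x. ((1/2) *\<^sub>R (w1 x + w2 x) \<bullet> b) * \<phi> x \<partial>lborel)" .
  qed
  moreover have "\<bar>(f1 x + f2 x) / 2\<bar> <= M" for x
  proof -
   have "\<bar>f1 x\<bar> <= M" "\<bar>f2 x\<bar> <= M" using I1 I2 by blast+
   then show ?thesis using abs_midpoint_le[of "f1 x" 0 M "f2 x"] by simp
  qed
  moreover have "\<bar>(f1 x + f2 x) / 2 - f' x\<bar> <= c" if "\<forall>k\<ge>j. \<bar>F k x - f' x\<bar> <= c" for x c
  proof -
   have "\<bar>f1 x - f' x\<bar> <= c" "\<bar>f2 x - f' x\<bar> <= c" using I1 I2 that by blast+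
   then show ?thesis by (rule abs_midpoint_le)
  qed
  moreover have "norm ((1/2) *\<^sub>R (w1 x + w2 x)) <= c" if "\<forall>k\<ge>j. norm (W k x) <= c" for x c
  proof -
   have "norm (w1 x) <= c" "norm (w2 x) <= c" using I1 I2 that by blast+
   then show ?thesis using norm_triangle_ineq[of "w1 x" "w2 x"] unfolding norm_scaleR by simp
  qed
  ultimately show ?case using c by blast
 qed
 define f\<^sub>1 where "f\<^sub>1 m = fst (q m)" for m
 define w\<^sub>1 where "w\<^sub>1 m = snd (q m)" for m
 have inv': "continuous_on UNIV (f\<^sub>1 m)" "continuous_on UNIV (w\<^sub>1 m)" "weakly_diff (f\<^sub>1 m) (w\<^sub>1 m)" "\<And>x. \<bar>f\<^sub>1 m x\<bar> <= M"
  "\<And>x c. (\<And>k. m <= k ==> \<bar>F k x - f' x\<bar> <= c) ==> \<bar>f\<^sub>1 m x - f' x\<bar> <= c"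
  "\<And>x c. (\<And>k. m <= k ==> norm (W k x) <= c) ==> norm (w\<^sub>1 m x) <= c" for m
  using inv[of "f\<^sub>1 m" "w\<^sub>1 m" m] q[of m] by (auto simp: f\<^sub>1_def w\<^sub>1_def)
 have limw: "AE x in lborel. (%m. w\<^sub>1 m x) \<longlonglongrightarrow> w x" using w(2) by (simp add: w\<^sub>1_def)
 have limF: "AE x in lborel. (%m. f\<^sub>1 m x) \<longlonglongrightarrow> f' x"
  using fast_moll(1)[OF f'(1) fp' p r(1) rf]
 proof eventually_elim
  case (elim x)
  show ?case
  proof (rule LIMSEQ_I)
   fix e :: real assume e: "0 < e"
   then obtain N where N: "\<And>k. N <= k ==> norm (moll (r k) f' x - f' x) < e / 2" using LIMSEQ_D[OF elim, of "e / 2"] by auto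
   have "norm (f\<^sub>1 m x - f' x) < e" if "N <= m" for m
   proof -
    have "\<bar>f\<^sub>1 m x - f' x\<bar> <= e / 2"
    proof (rule inv'(5))
     fix k assume "m <= k"
     then show "\<bar>F k x - f' x\<bar> <= e / 2" using N[of k] that by (simp add: F_def)
    qed
    then show ?thesis using e by simp
   qed
   then show "\<exists>no. \<forall>m\<ge>no. norm (f\<^sub>1 m x - f' x) < e" by blast
  qed
 qed
 have "weakly_diff f' w"
 proof (rule weakly_diff_limit[OF inv'(3) _ _ f'(1) w(1) limF inv'(4) limw _ H(4)])
  show "AE x in lborel. norm (w\<^sub>1 m x) <= H x" for m
   using dom by eventually_elim (intro inv'(6), blast)
 qed (use inv'(1,2) in \<open>auto intro: borel_measurable_continuous_onI\<close>)
 moreover have "AE x in lborel. ennreal (norm (w x)) <= g x"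
  using limw G(2) fast_moll(1)[OF G(1) gp' p r(1) rg]
 proof eventually_elim
  case (elim x)
  have "norm (w x) <= g' x"
  proof (rule field_le_epsilon)
   fix e :: real assume e: "0 < e"
   then obtain N where N: "\<And>k. N <= k ==> norm (moll (r k) g' x - g' x) < e" using LIMSEQ_D[OF elim(3)] by blast
   have "norm (w\<^sub>1 m x) <= g' x + e" if "N <= m" for m
   proof (rule inv'(6))
    fix k assume "m <= k"
    then show "norm (W k x) <= g' x + e" using N[of k] that Wg[of k x] by (simp add: abs_less_iff)
   qed
   then show "norm (w x) <= g' x + e"
    by (intro LIMSEQ_le_const2[OF tendsto_norm[OF elim(1)]]) blast
  qed
  then show ?case using elim(2) by (metis ennreal_leI)
 qed
 ultimately show thesis using w(1) that by blast
qed

section \<open>Uniqueness and locality of weak gradients\<close>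

lemma mollified_zero_AE:
 fixes q :: "'a::euclidean_space => real"
 assumes q: "Borel q" "pint p (%x. ennreal \<bar>q x\<bar>) < \<infinity>" and p: "1 < p" and G: "open G"
  and z: "\<And>x r. 0 < r ==> cball x r \<subseteq> G ==> moll r q x = 0"
 shows "AE x in lborel. x \<in> G --> q x = 0"
proof -
 have q2: "pnorm p q < \<infinity>" using q(2) by simp
 obtain r where r: "\<And>k::nat. 0 < r k" "r \<longlonglongrightarrow> 0"
  and rq: "\<And>k. pnorm p (%x. moll (r k) q x - q x) <= ennreal (((1/4) ^ Suc k) powr p)"
  by (rule fast_radii[OF q(1) q2 q(1) q2 p]) (rule that)
 show ?thesis
  using fast_moll(1)[OF q(1) q2 p r(1) rq]
 proof eventually_elim
  case (elim x)
  show ?case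
  proof
   assume "x \<in> G"
   then obtain \<rho> where \<rho>: "0 < \<rho>" "cball x \<rho> \<subseteq> G" using G by (meson open_contains_cball)
   have "eventually (%k. r k < \<rho>) sequentially" by (rule order_tendstoD(2)[OF r(2) \<rho>(1)])
   then have "eventually (%k. moll (r k) q x = 0) sequentially"
   proof eventually_elim
    case (elim k)
    show ?case by (rule z[OF r(1)]) (use elim \<rho>(2) in auto)
   qed
   then have "(%k. moll (r k) q x) \<longlonglongrightarrow> 0" by (rule tendsto_eventually)
   then show "q x = 0" using elim LIMSEQ_unique by blast
  qed
 qed
qed

lemma ker_translate_C1c:
 assumes "0 < r" obtains R where "C1c R (%y. ker r (x - y))"
 using test_function_C1c[OF ker_test_function[OF assms, of x UNIV]] by auto

lemma pint_inner_finite: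
 assumes "pnorm p w < \<infinity>" "0 < p" "b \<in> Basis"
 shows "pint p (%x. ennreal \<bar>w x \<bullet> b\<bar>) < \<infinity>"
 by (rule le_less_trans[OF pint_mono[OF assms(2)] assms(1)]) (use assms(3) in \<open>auto intro!: ennreal_leI Basis_le_norm\<close>)

text \<open>Testing with kernels shows that all mollifications of the difference vanish, component
  by component, and along fast radii these converge to the difference almost everywhere.\<close>

lemma weakly_diff_unique:
 fixes f :: "'a::euclidean_space => real"
 assumes wd: "weakly_diff f w1" "weakly_diff f w2" and [measurable]: "Borel w1" "Borel w2"
  and fin: "pnorm p w1 < \<infinity>" "pnorm p w2 < \<infinity>" and p: "1 < p"
 shows "AE x in lborel. w1 x = w2 x"
proof -
 have p0: "0 < p" using p by simp
 have l: "locint w1" "locint w2" by (rule locint_Lp[of _ p]; use p fin in simp)+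
 have "AE x in lborel. x \<in> UNIV --> w1 x \<bullet> b - w2 x \<bullet> b = 0" if b: "b \<in> Basis" for b
 proof (rule mollified_zero_AE[OF _ _ p])
  show "Borel (%x. w1 x \<bullet> b - w2 x \<bullet> b)" by measurable
  show "pint p (%x. ennreal \<bar>w1 x \<bullet> b - w2 x \<bullet> b\<bar>) < \<infinity>"
  proof (rule le_less_trans[OF pint_mono[OF p0]])
   show "pint p (%x. ennreal \<bar>w1 x \<bullet> b\<bar> + ennreal \<bar>w2 x \<bullet> b\<bar>) < \<infinity>"
    by (intro pint_add_finite p0 pint_inner_finite fin b) measurable
   show "ennreal \<bar>w1 x \<bullet> b - w2 x \<bullet> b\<bar> <= ennreal \<bar>w1 x \<bullet> b\<bar> + ennreal \<bar>w2 x \<bullet> b\<bar>" for x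
    using ennreal_leI[OF abs_triangle_ineq4[of "w1 x \<bullet> b" "w2 x \<bullet> b"]] by simp
  qed
  fix x :: 'a and r :: real assume r: "0 < r"
  obtain R where C: "C1c R (%y. ker r (x - y))" by (rule ker_translate_C1c[OF r])
  have "(\<integral>y. f y * (grad (%y. ker r (x - y)) y \<bullet> b) \<partial>lborel) = - (\<integral>y. (w1 y \<bullet> b) * ker r (x - y) \<partial>lborel)"
   "(\<integral>y. f y * (grad (%y. ker r (x - y)) y \<bullet> b) \<partial>lborel) = - (\<integral>y. (w2 y \<bullet> b) * ker r (x - y) \<partial>lborel)"
   using wd C b unfolding weakly_diff_def by blast+
  then have "(\<integral>y. (w1 y \<bullet> b) * ker r (x - y) \<partial>lborel) = (\<integral>y. (w2 y \<bullet> b) * ker r (x - y) \<partial>lborel)" by simp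
  moreover have "moll r (%x. w1 x \<bullet> b - w2 x \<bullet> b) x = (\<integral>y. ker r (x - y) *\<^sub>R (w1 y \<bullet> b) \<partial>lborel) - (\<integral>y. ker r (x - y) *\<^sub>R (w2 y \<bullet> b) \<partial>lborel)"
   unfolding moll_def scaleR_diff_right
   by (rule Bochner_Integration.integral_diff[OF moll_integrable[OF locint_inner[OF l(1)] r] moll_integrable[OF locint_inner[OF l(2)] r]])
  ultimately show "moll r (%x. w1 x \<bullet> b - w2 x \<bullet> b) x = 0" by (simp add: mult.commute)
 qed simp
 then have "AE x in lborel. \<forall>b\<in>Basis. x \<in> UNIV --> w1 x \<bullet> b - w2 x \<bullet> b = 0"
  by (rule AE_finite_allI[OF finite_Basis])
 then show ?thesis by eventually_elim (rule euclidean_eqI, simp)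
qed

lemma weakly_diff_weak_gradient:
 fixes f :: "'a::euclidean_space => real"
 assumes wd: "weakly_diff f' w" and [measurable]: "Borel f'" "Borel w" and ae: "AE x in lborel. f x = f' x"
 shows "weak_gradient UNIV f w"
 unfolding weak_gradient_def
proof (intro allI impI ballI)
 fix \<phi> :: "'a => real" and b :: 'a assume t: "test_function UNIV \<phi>" and b: "b \<in> Basis"
 obtain R where C: "C1c R \<phi>" by (rule test_function_C1c[OF t])
 note K = C1cD[OF C]
 have [measurable]: "Borel \<phi>" "Borel (grad \<phi>)" by (rule K)+
 have "(LINT x : UNIV | lebesgue. f x * frechet_derivative \<phi> (at x) b) = (\<integral>x. f' x * (grad \<phi> x \<bullet> b) \<partial>lebesgue)"
  unfolding set_lebesgue_integral_def
 proof (rule integral_cong_AE_completion)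
  show "AE x in lborel. indicat_real UNIV x *\<^sub>R (f x * frechet_derivative \<phi> (at x) b) = f' x * (grad \<phi> x \<bullet> b)"
   using ae by eventually_elim (simp add: grad_inner[OF K(1)])
 qed measurable
 also have "\<dots> = (\<integral>x. f' x * (grad \<phi> x \<bullet> b) \<partial>lborel)" by (rule integral_completion) measurable
 also have "\<dots> = - (\<integral>x. (w x \<bullet> b) * \<phi> x \<partial>lborel)" using wd C b unfolding weakly_diff_def by blast
 also have "(\<integral>x. (w x \<bullet> b) * \<phi> x \<partial>lborel) = (\<integral>x. (w x \<bullet> b) * \<phi> x \<partial>lebesgue)" by (rule integral_completion[symmetric]) measurable
 finally show "(LINT x : UNIV | lebesgue. f x * frechet_derivative \<phi> (at x) b) = - (LINT x : UNIV | lebesgue. (w x \<bullet> b) * \<phi> x)"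
  by (simp add: set_lebesgue_integral_def)
qed

lemma abs_one_over_one_plus_le: "0 <= y ==> \<bar>1 / (1 + y)\<bar> <= 1" for y :: real
 by (simp add: divide_le_eq)

text \<open>The truncations \<open>\<delta> * arctan (t / \<delta>)\<close> tend to \<open>0\<close> uniformly while their derivatives tend to the
 indicator of \<open>t = 0\<close>.\<close>

lemma weak_gradient_zero_on_zero_set:
 fixes v :: "'a::euclidean_space => real"
 assumes wg: "weak_gradient G v w" and G: "open G" and p: "1 < p"
  and v': "Borel v'" "pnorm p v' < \<infinity>" "AE x in lborel. v' x = indicator G x * v x"
  and w': "Borel w'" "pnorm p w' < \<infinity>" "AE x in lborel. w' x = indicator G x *\<^sub>R w x"
 shows "AE x in lborel. x \<in> G \<and> v' x = 0 --> w' x = 0"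
proof -
 have p0: "0 < p" using p by simp
 have lv: "locint v'" by (rule locint_Lp[OF v'(1) _ v'(2)]) (use p in simp)
 have lw: "locint w'" by (rule locint_Lp[OF w'(1) _ w'(2)]) (use p in simp)
 note [measurable] = v'(1) w'(1)
 obtain s where s: "\<And>k::nat. 0 < s k" "s \<longlonglongrightarrow> 0"
  and sv: "\<And>k. pnorm p (%x. moll (s k) v' x - v' x) <= ennreal (((1/4) ^ Suc k) powr p)"
  and sw: "\<And>k. pnorm p (%x. moll (s k) w' x - w' x) <= ennreal (((1/4) ^ Suc k) powr p)"
  by (rule fast_radii[OF v'(1,2) w'(1,2) p]) (rule that)
 note limv = fast_moll(1)[OF v'(1,2) p s(1) sv] and limw = fast_moll(1)[OF w'(1,2) p s(1) sw]
 obtain H where H: "Borel H" "\<And>x. 0 <= H x" "locint H"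
  "AE x in lborel. \<forall>k. norm (moll (s k) w' x) <= H x" "AE x in lborel. norm (w' x) <= H x"
  using fast_moll(2)[OF w'(1,2) p s(1) sw] by auto
 note [measurable] = H(1)
 have [measurable]: "Borel (moll (s k) v')" "Borel (moll (s k) w')" for k
  by (rule borel_measurable_continuous_onI[OF moll_continuous]; use lv lw s(1) in simp)+
 have "AE x in lborel. x \<in> G --> indicator {x. v' x = 0} x * (w' x \<bullet> b) = 0" if b: "b \<in> Basis" for b
 proof (rule mollified_zero_AE[OF _ _ p G])
  show "Borel (%x. indicator {x. v' x = 0} x * (w' x \<bullet> b))" by measurable
  show "pint p (%x. ennreal \<bar>indicator {x. v' x = 0} x * (w' x \<bullet> b)\<bar>) < \<infinity>"
   by (rule le_less_trans[OF pint_mono[OF p0] w'(2)]) (use b in \<open>auto intro!: ennreal_leI Basis_le_norm simp: indicator_def\<close>)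
  fix x :: 'a and r :: real assume r: "0 < r" and xG: "cball x r \<subseteq> G"
  define \<phi> where "\<phi> y = ker r (x - y)" for y
  obtain R where C: "C1c R \<phi>" unfolding \<phi>_def[abs_def] by (rule ker_translate_C1c[OF r])
  note K = C1cD[OF C]
  have [measurable]: "Borel \<phi>" "Borel (grad \<phi>)" by (rule K)+
  obtain B where B: "\<And>x. \<bar>\<phi> x\<bar> <= B" "\<And>x. norm (grad \<phi> x) <= B" by (rule C1c_bounded[OF C]) (rule that)
  have \<phi>0: "\<phi> y = 0" if "y \<notin> cball x r" for y
  proof -
   have "norm ((x - y) /\<^sub>R r) = norm (x - y) / r" using r by (simp add: divide_inverse mult.commute)
   then have "1 <= norm ((x - y) /\<^sub>R r)" using that r by (simp add: dist_norm)
   then show ?thesis by (simp add: \<phi>_def ker_def mol_zero)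
  qed
  \<comment> \<open>A uniform margin between the support of the kernel and the complement of
    \<open>G\<close>: for radii below it the gradient of the mollified \<open>v'\<close> is the
    mollified \<open>w'\<close> on the entire support.\<close>
  obtain \<rho> where \<rho>: "0 < \<rho>" "(\<Union>y\<in>cball x r. cball y \<rho>) \<subseteq> G"
   using compact_subset_open_imp_cball_epsilon_subset[OF compact_cball G xG] by blast
  have iH: "integrable lborel (%y. norm (H y *\<^sub>R \<phi> y))"
   by (intro integrable_norm locint_mult_integrable[OF H(3), of _ B R]) (use B C1c_vanishes_beyond[OF C] in auto)
  have ig: "integrable lborel (%y. norm (grad \<phi> y \<bullet> b))" using K(7)[of b] by (intro integrable_norm)
  \<comment> \<open>Chain rule for the truncation. It is proved for the mollifications, which are of
    class C^1, and the radius then tends to 0 with \<open>\<delta>\<close> fixed.\<close>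
  have step: "(\<integral>y. (\<delta> * arctan (v' y / \<delta>)) * (grad \<phi> y \<bullet> b) \<partial>lborel) = - (\<integral>y. (1 / (1 + (v' y / \<delta>)\<^sup>2)) * (w' y \<bullet> b) * \<phi> y \<partial>lborel)"
   if \<delta>: "0 < \<delta>" for \<delta>
  proof -
   define A where "A t = \<delta> * arctan (t / \<delta>)" for t
   define A' where "A' t = 1 / (1 + (t / \<delta>)\<^sup>2)" for t
   have dA: "(A has_real_derivative A' t) (at t)" for t
   proof -
    have 1: "((%t. t / \<delta>) has_real_derivative 1 / \<delta>) (at t)" using \<delta> by (auto intro!: derivative_eq_intros)
    from DERIV_cmult[OF DERIV_chain2[OF DERIV_arctan 1], of \<delta>] show ?thesis
     using \<delta> by (simp add: A_def[abs_def] A'_def inverse_eq_divide)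
   qed
   have cA: "continuous_on UNIV A" "continuous_on UNIV A'"
    unfolding A_def[abs_def] A'_def[abs_def] using \<delta>
    by (auto intro!: continuous_intros simp: add_nonneg_eq_0_iff)
   have [measurable]: "Borel A" "Borel A'"
    using cA by (auto intro: borel_measurable_continuous_onI)
   have bA: "\<bar>A t\<bar> <= \<delta> * (pi / 2)" for t
    unfolding A_def abs_mult using arctan_bounded[of "t / \<delta>"] \<delta> by (auto simp: abs_le_iff intro!: mult_left_mono)
   have bA': "\<bar>A' t\<bar> <= 1" for t unfolding A'_def by (rule abs_one_over_one_plus_le) simp
   have ev: "eventually (%k. (\<integral>y. A (moll (s k) v' y) * (grad \<phi> y \<bullet> b) \<partial>lborel) = - (\<integral>y. A' (moll (s k) v' y) * (moll (s k) w' y \<bullet> b) * \<phi> y \<partial>lborel)) sequentially"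
    using order_tendstoD(2)[OF s(2) \<rho>(1)]
   proof eventually_elim
    case (elim k)
    let ?k = "vconv (grad (ker (s k))) v'"
    note md = moll_has_derivative[OF lv s(1)[of k]]
    have d: "((%y. A (moll (s k) v' y)) has_derivative (%h. (A' (moll (s k) v' y) *\<^sub>R ?k y) \<bullet> h)) (at y)" for y
     by (rule has_derivative_eq_rhs[OF DERIV_compose_FDERIV[OF dA md(1)]]) (auto simp: mult.commute)
    have c: "continuous_on UNIV (%y. A' (moll (s k) v' y) *\<^sub>R ?k y)"
     by (intro continuous_intros md(2) continuous_on_compose2[OF cA(2) moll_continuous[OF lv s(1)]]) auto
    have "(\<integral>y. A (moll (s k) v' y) * (grad \<phi> y \<bullet> b) \<partial>lborel) = - (\<integral>y. ((A' (moll (s k) v' y) *\<^sub>R ?k y) \<bullet> b) * \<phi> y \<partial>lborel)"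
     by (rule integration_by_parts_C1[OF d c C]) (use b in simp)
    also have "(%y. ((A' (moll (s k) v' y) *\<^sub>R ?k y) \<bullet> b) * \<phi> y) = (%y. A' (moll (s k) v' y) * (moll (s k) w' y \<bullet> b) * \<phi> y)"
    proof
     fix y
     show "((A' (moll (s k) v' y) *\<^sub>R ?k y) \<bullet> b) * \<phi> y = A' (moll (s k) v' y) * (moll (s k) w' y \<bullet> b) * \<phi> y"
     proof (cases "y \<in> cball x r")
      case True
      then have "cball y (s k) \<subseteq> G" using \<rho>(2) elim by force
      from moll_weak_gradient[OF wg lv v'(3) lw w'(3) this s(1)]
      have "grad (moll (s k) v') y = moll (s k) w' y" by (rule grad_unique)
      moreover have "grad (moll (s k) v') y = ?k y" by (rule grad_unique[OF md(1)])
      ultimately show ?thesis by simp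
     qed (simp add: \<phi>0)
    qed
    finally show ?case .
   qed
   have "(%k. \<integral>y. A (moll (s k) v' y) * (grad \<phi> y \<bullet> b) \<partial>lborel) \<longlonglongrightarrow> (\<integral>y. A (v' y) * (grad \<phi> y \<bullet> b) \<partial>lborel)"
   proof (rule integral_dominated_convergence[where w="%y. (\<delta> * (pi / 2)) * norm (grad \<phi> y \<bullet> b)"])
    show "AE y in lborel. (%k. A (moll (s k) v' y) * (grad \<phi> y \<bullet> b)) \<longlonglongrightarrow> A (v' y) * (grad \<phi> y \<bullet> b)"
     using limv by eventually_elim (intro tendsto_intros continuous_on_tendsto_compose[OF cA(1)], auto)
    show "AE y in lborel. norm (A (moll (s k) v' y) * (grad \<phi> y \<bullet> b)) <= (\<delta> * (pi / 2)) * norm (grad \<phi> y \<bullet> b)" for k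
     unfolding real_norm_def abs_mult by (intro AE_I2 mult_right_mono bA abs_ge_zero)
   qed (use ig in auto)
   moreover have "(%k. \<integral>y. A' (moll (s k) v' y) * (moll (s k) w' y \<bullet> b) * \<phi> y \<partial>lborel) \<longlonglongrightarrow> (\<integral>y. A' (v' y) * (w' y \<bullet> b) * \<phi> y \<partial>lborel)"
   proof (rule integral_dominated_convergence[where w="%y. norm (H y *\<^sub>R \<phi> y)"])
    show "AE y in lborel. (%k. A' (moll (s k) v' y) * (moll (s k) w' y \<bullet> b) * \<phi> y) \<longlonglongrightarrow> A' (v' y) * (w' y \<bullet> b) * \<phi> y"
     using limv limw by eventually_elim (intro tendsto_intros continuous_on_tendsto_compose[OF cA(2)], auto)
    show "AE y in lborel. norm (A' (moll (s k) v' y) * (moll (s k) w' y \<bullet> b) * \<phi> y) <= norm (H y *\<^sub>R \<phi> y)" for k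
     using H(4)
    proof eventually_elim
     case (elim y)
     have "\<bar>moll (s k) w' y \<bullet> b\<bar> <= \<bar>H y\<bar>"
      using Basis_le_norm[OF b, of "moll (s k) w' y"] elim[rule_format, of k] by linarith
     then have "\<bar>A' (moll (s k) v' y)\<bar> * \<bar>moll (s k) w' y \<bullet> b\<bar> <= 1 * \<bar>H y\<bar>" using bA' by (intro mult_mono) auto
     then show ?case by (simp add: abs_mult mult_right_mono)
    qed
   qed (use iH in auto)
   ultimately have 1: "(%k. \<integral>y. A (moll (s k) v' y) * (grad \<phi> y \<bullet> b) \<partial>lborel) \<longlonglongrightarrow> (\<integral>y. A (v' y) * (grad \<phi> y \<bullet> b) \<partial>lborel)"
    and 2: "(%k. - (\<integral>y. A' (moll (s k) v' y) * (moll (s k) w' y \<bullet> b) * \<phi> y \<partial>lborel)) \<longlonglongrightarrow> - (\<integral>y. A' (v' y) * (w' y \<bullet> b) * \<phi> y \<partial>lborel)"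
    by (simp_all add: tendsto_minus)
   have "(\<integral>y. A (v' y) * (grad \<phi> y \<bullet> b) \<partial>lborel) = - (\<integral>y. A' (v' y) * (w' y \<bullet> b) * \<phi> y \<partial>lborel)"
    by (rule LIMSEQ_unique[OF Lim_transform_eventually[OF 1 ev] 2])
   then show ?thesis by (simp add: A_def A'_def)
  qed
  define \<delta> where "\<delta> n = inverse (real (Suc n))" for n
  have \<delta>: "0 < \<delta> n" "\<delta> n <= 1" for n by (auto simp: \<delta>_def inverse_le_1_iff)
  have \<delta>lim: "\<delta> \<longlonglongrightarrow> 0" unfolding \<delta>_def[abs_def] by (rule LIMSEQ_inverse_real_of_nat)
  have "(%n. \<integral>y. (\<delta> n * arctan (v' y / \<delta> n)) * (grad \<phi> y \<bullet> b) \<partial>lborel) \<longlonglongrightarrow> (\<integral>y. 0 \<partial>(lborel :: 'a measure))"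
  proof (rule integral_dominated_convergence[where w="%y. (pi / 2) * norm (grad \<phi> y \<bullet> b)"])
   have bd: "\<bar>\<delta> n * arctan t\<bar> <= \<delta> n * (pi / 2)" for n t
    unfolding abs_mult using arctan_bounded[of t] \<delta>(1)[of n] by (auto simp: abs_le_iff intro!: mult_left_mono)
   show "AE y in lborel. (%n. (\<delta> n * arctan (v' y / \<delta> n)) * (grad \<phi> y \<bullet> b)) \<longlonglongrightarrow> 0"
   proof (rule AE_I2)
    fix y
    have "(%n. \<delta> n * arctan (v' y / \<delta> n)) \<longlonglongrightarrow> 0"
     by (rule Lim_null_comparison[of _ "%n. \<delta> n * (pi / 2)"]) (use bd \<delta>lim in \<open>auto intro: tendsto_mult_left_zero\<close>)
    then show "(%n. (\<delta> n * arctan (v' y / \<delta> n)) * (grad \<phi> y \<bullet> b)) \<longlonglongrightarrow> 0" by (rule tendsto_mult_left_zero)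
   qed
   show "AE y in lborel. norm ((\<delta> n * arctan (v' y / \<delta> n)) * (grad \<phi> y \<bullet> b)) <= (pi / 2) * norm (grad \<phi> y \<bullet> b)" for n
   proof (rule AE_I2)
    fix y
    have "\<bar>\<delta> n * arctan (v' y / \<delta> n)\<bar> <= 1 * (pi / 2)"
     by (rule order_trans[OF bd]) (intro mult_right_mono \<delta>, simp)
    then show "norm ((\<delta> n * arctan (v' y / \<delta> n)) * (grad \<phi> y \<bullet> b)) <= (pi / 2) * norm (grad \<phi> y \<bullet> b)"
     unfolding real_norm_def abs_mult[of "\<delta> n * arctan (v' y / \<delta> n)"] by (intro mult_right_mono) auto
   qed
  qed (use ig in auto)
  moreover have "(%n. \<integral>y. (1 / (1 + (v' y / \<delta> n)\<^sup>2)) * (w' y \<bullet> b) * \<phi> y \<partial>lborel) \<longlonglongrightarrow> (\<integral>y. indicator {x. v' x = 0} y * (w' y \<bullet> b) * \<phi> y \<partial>lborel)"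
  proof (rule integral_dominated_convergence[where w="%y. norm (H y *\<^sub>R \<phi> y)"])
   show "AE y in lborel. (%n. (1 / (1 + (v' y / \<delta> n)\<^sup>2)) * (w' y \<bullet> b) * \<phi> y) \<longlonglongrightarrow> indicator {x. v' x = 0} y * (w' y \<bullet> b) * \<phi> y"
   proof (rule AE_I2)
    fix y
    have "(%n. 1 / (1 + (v' y / \<delta> n)\<^sup>2)) \<longlonglongrightarrow> indicator {x. v' x = 0} y"
    proof (cases "v' y = 0")
     case False
     have "(%n. 1 / (1 + (v' y / \<delta> n)\<^sup>2)) \<longlonglongrightarrow> 0"
     proof (rule Lim_null_comparison[of _ "%n. (\<delta> n)\<^sup>2 * (1 / (v' y)\<^sup>2)"])
      have "norm (1 / (1 + (v' y / \<delta> n)\<^sup>2)) <= (\<delta> n)\<^sup>2 * (1 / (v' y)\<^sup>2)" for n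
      proof -
       have pos: "0 < (v' y / \<delta> n)\<^sup>2" using False \<delta>(1)[of n] by simp
       have "norm (1 / (1 + (v' y / \<delta> n)\<^sup>2)) = 1 / (1 + (v' y / \<delta> n)\<^sup>2)" using pos by simp
       also have "\<dots> <= 1 / (v' y / \<delta> n)\<^sup>2" by (intro divide_left_mono mult_pos_pos add_pos_pos pos) auto
       also have "\<dots> = (\<delta> n)\<^sup>2 * (1 / (v' y)\<^sup>2)" using \<delta>(1)[of n] by (simp add: power_divide)
       finally show ?thesis .
      qed
      then show "eventually (%n. norm (1 / (1 + (v' y / \<delta> n)\<^sup>2)) <= (\<delta> n)\<^sup>2 * (1 / (v' y)\<^sup>2)) sequentially" by simp
      have "(%n. (\<delta> n)\<^sup>2 * (1 / (v' y)\<^sup>2)) \<longlonglongrightarrow> 0\<^sup>2 * (1 / (v' y)\<^sup>2)" by (intro tendsto_intros \<delta>lim)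
      then show "(%n. (\<delta> n)\<^sup>2 * (1 / (v' y)\<^sup>2)) \<longlonglongrightarrow> 0" by simp
     qed
     then show ?thesis using False by simp
    qed simp
    then show "(%n. (1 / (1 + (v' y / \<delta> n)\<^sup>2)) * (w' y \<bullet> b) * \<phi> y) \<longlonglongrightarrow> indicator {x. v' x = 0} y * (w' y \<bullet> b) * \<phi> y"
     by (intro tendsto_mult tendsto_const)
   qed
   show "AE y in lborel. norm ((1 / (1 + (v' y / \<delta> n)\<^sup>2)) * (w' y \<bullet> b) * \<phi> y) <= norm (H y *\<^sub>R \<phi> y)" for n
    using H(5)
   proof eventually_elim
    case (elim y)
    have "\<bar>w' y \<bullet> b\<bar> <= \<bar>H y\<bar>" using Basis_le_norm[OF b, of "w' y"] elim by linarith
    moreover have "\<bar>1 / (1 + (v' y / \<delta> n)\<^sup>2)\<bar> <= 1" by (rule abs_one_over_one_plus_le) simp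
    ultimately have "\<bar>1 / (1 + (v' y / \<delta> n)\<^sup>2)\<bar> * \<bar>w' y \<bullet> b\<bar> <= 1 * \<bar>H y\<bar>" by (intro mult_mono) auto
    then show ?case unfolding real_norm_def real_scaleR_def abs_mult by (intro mult_right_mono) (simp_all add: abs_mult)
   qed
  qed (use iH in auto)
  ultimately have l: "(%n. - (\<integral>y. (1 / (1 + (v' y / \<delta> n)\<^sup>2)) * (w' y \<bullet> b) * \<phi> y \<partial>lborel)) \<longlonglongrightarrow> 0"
   "(%n. - (\<integral>y. (1 / (1 + (v' y / \<delta> n)\<^sup>2)) * (w' y \<bullet> b) * \<phi> y \<partial>lborel)) \<longlonglongrightarrow> - (\<integral>y. indicator {x. v' x = 0} y * (w' y \<bullet> b) * \<phi> y \<partial>lborel)"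
   unfolding step[OF \<delta>(1)] by (simp_all add: tendsto_minus)
  have "- (\<integral>y. indicator {x. v' x = 0} y * (w' y \<bullet> b) * \<phi> y \<partial>lborel) = 0" by (rule LIMSEQ_unique[OF l(2,1)])
  then show "moll r (%x. indicator {x. v' x = 0} x * (w' x \<bullet> b)) x = 0"
   by (simp add: moll_def \<phi>_def mult_ac)
 qed
 then have "AE x in lborel. \<forall>b\<in>Basis. x \<in> G --> indicator {x. v' x = 0} x * (w' x \<bullet> b) = 0"
  by (rule AE_finite_allI[OF finite_Basis])
 then show ?thesis
 proof eventually_elim
  case (elim x)
  show ?case
  proof
   assume "x \<in> G \<and> v' x = 0"
   then have "w' x \<bullet> b = 0 \<bullet> b" if "b \<in> Basis" for b using elim that by simp
   then show "w' x = 0" by (rule euclidean_eqI)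
  qed
 qed
qed

section \<open>Arc-length parametrization of Lipschitz curves\<close>

abbreviation partitions :: "real => real => (nat \<times> (nat => real)) set" where
 "partitions a b \<equiv> {(m, t). t 0 = a \<and> t m = b \<and> (\<forall>i<m. t i <= t (Suc i))}"

lemma partition_mono:
 assumes "\<And>i. i < m ==> t i <= (t (Suc i) :: real)" "i <= j" "j <= m" shows "t i <= t j"
 using assms(2,3)
proof (induction j)
 case (Suc j)
 then show ?case using assms(1)[of j] by (cases "i = Suc j") (auto intro: order_trans)
qed simp

lemma curve_length_le:
 assumes "\<And>mt. mt \<in> partitions a b ==> (\<Sum>i<fst mt. dist (Y (snd mt i)) (Y (snd mt (Suc i)))) <= c"
 shows "curve_length Y a b <= ennreal c"
 unfolding curve_length_def by (intro SUP_least ennreal_leI assms)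

lemma partitions_nonempty: "a <= b ==> partitions a b \<noteq> {}"
 by (auto intro!: exI[of _ 1] exI[of _ "%i. if i = 0 then a else b"])

lemma sum_lessThan_add: "(\<Sum>i<m + n. f i) = (\<Sum>i<m. f i) + (\<Sum>i<n. f (m + i))" for f :: "nat => real"
 by (induction n) auto

text \<open>Partitions of the two halves are concatenated for one inequality; for the other, a
  partition is cut at \<open>b\<close> by taking minima and maxima with \<open>b\<close>. Repeated
  points are harmless because partitions need only be weakly increasing.\<close>

lemma curve_length_add:
 assumes ab: "a <= b" "b <= c"
 shows "curve_length Y a b + curve_length Y b c = curve_length Y a c"
proof (rule antisym)
 let ?s = "%mt. (\<Sum>i<fst mt. dist (Y (snd mt i)) (Y (snd mt (Suc i))))"
 have ne: "partitions a b \<noteq> {}" "partitions b c \<noteq> {}" by (rule partitions_nonempty[OF ab(1)], rule partitions_nonempty[OF ab(2)])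
 have "curve_length Y a b + curve_length Y b c = (SUP x\<in>partitions a b. SUP y\<in>partitions b c. ennreal (?s x) + ennreal (?s y))"
  unfolding curve_length_def ennreal_SUP_add_left[OF ne(1), symmetric] ennreal_SUP_add_right[OF ne(2)] by (rule SUP_commute)
 also have "\<dots> <= curve_length Y a c"
 proof (intro SUP_least)
  fix x y assume x: "x \<in> partitions a b" and y: "y \<in> partitions b c"
  obtain m t where mt: "x = (m, t)" "t 0 = a" "t m = b" "\<And>i. i < m ==> t i <= t (Suc i)" using x by auto
  obtain n u where nu: "y = (n, u)" "u 0 = b" "u n = c" "\<And>i. i < n ==> u i <= u (Suc i)" using y by auto
  define v where "v i = (if i <= m then t i else u (i - m))" for i
  have v2: "v (m + i) = u i" for i using mt nu by (auto simp: v_def)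
  have vmono: "v i <= v (Suc i)" if "i < m + n" for i
  proof (cases "i < m")
   case False
   define j where "j = i - m"
   have j: "i = m + j" "Suc i = m + Suc j" "j < n" using False that by (auto simp: j_def)
   show ?thesis unfolding j(2) unfolding j(1) v2 using nu(4)[OF j(3)] .
  qed (use mt in \<open>auto simp: v_def\<close>)
  have p: "(m + n, v) \<in> partitions a c"
  proof -
   have "v 0 = a" using mt(2) by (simp add: v_def)
   moreover have "v (m + n) = c" using v2[of n] nu(3) by simp
   ultimately show ?thesis using vmono by blast
  qed
  have "?s x = (\<Sum>i<m. dist (Y (v i)) (Y (v (Suc i))))" using mt(1) by (auto simp: v_def intro!: sum.cong)
  moreover have "?s y = (\<Sum>i<n. dist (Y (v (m + i))) (Y (v (Suc (m + i)))))"
   using nu(1) v2 by (intro sum.cong) (auto simp flip: add_Suc_right)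
  ultimately have "?s x + ?s y = ?s (m + n, v)" by (simp add: sum_lessThan_add)
  then have "ennreal (?s x) + ennreal (?s y) = ennreal (?s (m + n, v))"
   by (metis (no_types, lifting) ennreal_plus sum_nonneg zero_le_dist)
  also have "\<dots> <= curve_length Y a c" unfolding curve_length_def by (rule SUP_upper[OF p])
  finally show "ennreal (?s x) + ennreal (?s y) <= curve_length Y a c" .
 qed
 finally show "curve_length Y a b + curve_length Y b c <= curve_length Y a c" .
 show "curve_length Y a c <= curve_length Y a b + curve_length Y b c"
  unfolding curve_length_def[of Y a c]
 proof (intro SUP_least)
  fix x assume "x \<in> partitions a c"
  then obtain m t where mt: "x = (m, t)" "t 0 = a" "t m = c" "\<And>i. i < m ==> t i <= t (Suc i)" by auto
  define t1 t2 where "t1 i = min (t i) b" and "t2 i = max (t i) b" for i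
  have p: "(m, t1) \<in> partitions a b" "(m, t2) \<in> partitions b c"
   using mt ab by (auto simp: t1_def t2_def min_def max_def intro: order_trans)
  have "?s (m, t) <= (\<Sum>i<m. dist (Y (t1 i)) (Y (t1 (Suc i))) + dist (Y (t2 i)) (Y (t2 (Suc i))))"
   unfolding fst_conv snd_conv
  proof (rule sum_mono)
   fix i assume "i \<in> {..<m}"
   then have "t i <= t (Suc i)" using mt by auto
   then show "dist (Y (t i)) (Y (t (Suc i))) <= dist (Y (t1 i)) (Y (t1 (Suc i))) + dist (Y (t2 i)) (Y (t2 (Suc i)))"
    using dist_triangle[of "Y (t i)" "Y (t (Suc i))" "Y b"] by (auto simp: t1_def t2_def min_def max_def)
  qed
  also have "\<dots> = ?s (m, t1) + ?s (m, t2)" by (simp add: sum.distrib)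
  finally have "ennreal (?s x) <= ennreal (?s (m, t1) + ?s (m, t2))" using mt(1) by (intro ennreal_leI) simp
  also have "\<dots> = ennreal (?s (m, t1)) + ennreal (?s (m, t2))" by (intro ennreal_plus sum_nonneg) auto
  also have "\<dots> <= curve_length Y a b + curve_length Y b c"
   unfolding curve_length_def by (intro add_mono SUP_upper p)
  finally show "ennreal (?s x) <= curve_length Y a b + curve_length Y b c" .
 qed
qed

text \<open>Curves with speed at most 1, defined on the whole line. This class is stable under
  limits, unlike the class of arc-length parametrizations.\<close>

definition lip1 :: "(real => 'a::metric_space) => bool" where
 "lip1 Y \<longleftrightarrow> (\<forall>s t. dist (Y s) (Y t) <= \<bar>s - t\<bar>)"

lemma lip1_continuous: "lip1 Y ==> continuous_on UNIV Y"
 unfolding lip1_def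
proof (rule continuous_onI)
 fix x e :: real assume *: "\<forall>s t. dist (Y s) (Y t) <= \<bar>s - t\<bar>" and e: "0 < e"
 have "dist (Y y) (Y x) <= e" if "dist y x < e" for y
  using *[rule_format, of y x] that by (simp add: dist_real_def)
 then show "\<exists>d>0. \<forall>y\<in>UNIV. dist y x < d --> dist (Y y) (Y x) <= e" using e by blast
qed

lemma lip1_curve_length_le:
 assumes "lip1 Y" "a <= b" shows "curve_length Y a b <= ennreal (b - a)"
proof (rule curve_length_le)
 fix mt assume mt: "mt \<in> partitions a b"
 have "(\<Sum>i<fst mt. dist (Y (snd mt i)) (Y (snd mt (Suc i)))) <= (\<Sum>i<fst mt. snd mt (Suc i) - snd mt i)"
 proof (rule sum_mono)
  fix i assume "i \<in> {..<fst mt}"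
  then have "snd mt i <= snd mt (Suc i)" using mt by auto
  then show "dist (Y (snd mt i)) (Y (snd mt (Suc i))) <= snd mt (Suc i) - snd mt i"
   using assms(1)[unfolded lip1_def, rule_format, of "snd mt i" "snd mt (Suc i)"] by simp
 qed
 also have "\<dots> = b - a" using mt by (subst sum_lessThan_telescope) auto
 finally show "(\<Sum>i<fst mt. dist (Y (snd mt i)) (Y (snd mt (Suc i)))) <= b - a" .
qed

lemma lip1_measurable:
 fixes g :: "'a::euclidean_space => ennreal"
 assumes "lip1 Y" "Borel g" shows "Borel (%t. g (Y t))"
 using measurable_compose[OF borel_measurable_continuous_onI[OF lip1_continuous[OF assms(1)]] assms(2)] .

lemma lip1_lint_add:
 fixes g :: "'a::euclidean_space => ennreal"
 assumes "lip1 Y" "Borel g" "a <= b" "b <= c"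
 shows "lint g Y a b + lint g Y b c = lint g Y a c"
proof -
 note [measurable] = lip1_measurable[OF assms(1,2)]
 have "lint g Y a b + lint g Y b c = (\<integral>\<^sup>+t. g (Y t) * indicator {a..b} t + g (Y t) * indicator {b..c} t \<partial>lborel)"
  unfolding lint_def by (subst nn_integral_add) auto
 also have "\<dots> = lint g Y a c"
  unfolding lint_def
 proof (rule nn_integral_cong_AE)
  show "AE t in lborel. g (Y t) * indicator {a..b} t + g (Y t) * indicator {b..c} t = g (Y t) * indicator {a..c} t"
   using AE_lborel_singleton[of b] by eventually_elim (use assms in \<open>auto simp: indicator_def\<close>)
 qed
 finally show ?thesis .
qed

lemma lint_const: "a <= b ==> 0 <= c ==> lint (%_. ennreal c) Y a b = ennreal (c * (b - a))"
 unfolding lint_def by (subst nn_integral_cmult_indicator) (auto simp: ennreal_mult')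

text \<open>The length function \<open>S\<close> is monotone, continuous and grows no faster than
  the parameter, and \<open>Y\<close> is constant where \<open>S\<close> is, so \<open>Y\<close>
  factors through \<open>S\<close>. That \<open>Y\<close> leaves its starting point makes the total
  length positive. Integrals of continuous \<open>h\<close> are compared on short intervals with a
  slack \<open>e\<close> and added up by subdivision.\<close>

lemma arclength_reparametrization:
 fixes Y :: "real => 'a::euclidean_space"
 assumes lip: "lip1 Y" and T: "0 <= T" "t0 \<in> {0..T}" "Y t0 \<noteq> Y 0"
 obtains \<sigma> l where "arclength_curve_in UNIV \<sigma> l" "\<sigma> 0 = Y 0"
  "\<And>h. continuous_on UNIV h ==> (\<And>x. 0 <= h x) ==> lint (%x. ennreal (h x)) \<sigma> 0 l <= lint (%x. ennreal (h x)) Y 0 T"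
proof -
 define S where "S t = enn2real (curve_length Y 0 t)" for t
 have len: "curve_length Y a b = ennreal (S b - S a)" "S a <= S b" "S b - S a <= b - a" if "0 <= a" "a <= b" for a b
 proof -
  have fin: "curve_length Y a b < top" if "a <= b" for a b
   using lip1_curve_length_le[OF lip that] by (rule le_less_trans) simp
  have e: "curve_length Y 0 t = ennreal (S t)" if "0 <= t" for t
   unfolding S_def using fin[OF that] by simp
  obtain r where r: "curve_length Y a b = ennreal r" "0 <= r" using fin[OF \<open>a <= b\<close>] by (cases "curve_length Y a b") auto
  have S0: "0 <= S t" for t by (simp add: S_def)
  have "ennreal (S a) + ennreal r = ennreal (S b)"
   using curve_length_add[OF that, of Y] e[of a] e[of b] r that by simp
  then have rr: "S a + r = S b" using S0 r(2) by (simp flip: ennreal_plus)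
  have "r <= b - a" using lip1_curve_length_le[OF lip that(2)] r that by simp
  then show "curve_length Y a b = ennreal (S b - S a)" "S a <= S b" "S b - S a <= b - a" using r rr by auto
 qed
 have S0: "S 0 = 0" using lip1_curve_length_le[OF lip, of 0 0] by (simp add: S_def)
 define l where "l = S T"
 have dS: "dist (Y a) (Y b) <= S b - S a" if "0 <= a" "a <= b" for a b
  using dist_le_curve_length[OF that(2), of Y] len[OF that] by simp
 have l: "0 < l"
 proof -
  have "0 < dist (Y 0) (Y t0)" using T by simp
  also have "\<dots> <= S t0 - S 0" using T by (intro dS) auto
  also have "\<dots> <= l" using len(2)[of t0 T] T S0 by (simp add: l_def)
  finally show ?thesis .
 qed
 have cS: "continuous_on {0..T} S"
 proof (rule continuous_onI)
  fix x e :: real assume x: "x \<in> {0..T}" and e: "0 < e"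
  have "dist (S y) (S x) <= e" if "y \<in> {0..T}" "dist y x < e" for y
   using len(2,3)[of x y] len(2,3)[of y x] x that by (cases "x <= y") (auto simp: dist_real_def)
  then show "\<exists>d>0. \<forall>y\<in>{0..T}. dist y x < d --> dist (S y) (S x) <= e" using e by blast
 qed
 have "\<exists>t. 0 <= t \<and> t <= T \<and> S t = s" if "0 <= s" "s <= l" for s
  using IVT'[of S 0 s T] cS that T S0 by (auto simp: l_def)
 \<comment> \<open>Any right inverse of \<open>S\<close> will do, continuous or not: by
   \<open>\<sigma>S\<close> below the curve does not depend on the choice.\<close>
 then obtain \<tau> where \<tau>: "\<And>s. 0 <= s ==> s <= l ==> 0 <= \<tau> s \<and> \<tau> s <= T \<and> S (\<tau> s) = s" by metis
 define \<sigma> where "\<sigma> s = Y (\<tau> s)" for s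
 have S_range: "0 <= S t \<and> S t <= l" if "0 <= t" "t <= T" for t
  using len(2)[of 0 t] len(2)[of t T] that S0 by (auto simp: l_def)
 have \<sigma>S: "\<sigma> (S t) = Y t" if t: "0 <= t" "t <= T" for t
 proof -
  have *: "0 <= \<tau> (S t)" "S (\<tau> (S t)) = S t" using \<tau>[of "S t"] S_range[OF t] by auto
  have "dist (Y (\<tau> (S t))) (Y t) <= 0"
  proof (cases "\<tau> (S t) <= t")
   case True
   then show ?thesis using dS[OF *(1) True] unfolding *(2) by simp
  next
   case False
   then have "dist (Y t) (Y (\<tau> (S t))) <= S (\<tau> (S t)) - S t" using t by (intro dS) auto
   then show ?thesis unfolding *(2) by (simp add: dist_commute)
  qed
  then show ?thesis by (simp add: \<sigma>_def)
 qed
 have \<tau>mono: "\<tau> s <= \<tau> s'" if "0 <= s" "s <= s'" "s' <= l" for s s'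
 proof (rule ccontr)
  assume *: "\<not> \<tau> s <= \<tau> s'"
  then have "S (\<tau> s') <= S (\<tau> s)" using \<tau>[of s'] that by (intro len(2)) auto
  then have "s = s'" using \<tau>[of s] \<tau>[of s'] that by auto
  with * show False by simp
 qed
 have clen: "curve_length \<sigma> s s' = ennreal (s' - s)" if s: "0 <= s" "s <= s'" "s' <= l" for s s'
 proof -
  have le: "\<tau> s <= \<tau> s'" by (rule \<tau>mono[OF s])
  have "curve_length \<sigma> s s' = curve_length Y (\<tau> s) (\<tau> s')"
  proof (rule antisym)
   show "curve_length \<sigma> s s' <= curve_length Y (\<tau> s) (\<tau> s')"
    unfolding curve_length_def[of \<sigma>]
   proof (rule SUP_least)
    fix x assume "x \<in> partitions s s'"
    then obtain m t where mt: "x = (m, t)" "t 0 = s" "t m = s'" "\<And>i. i < m ==> t i <= t (Suc i)" by auto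
    have rng: "0 <= t i \<and> t i <= l" if "i <= m" for i
     using partition_mono[of m t 0 i] partition_mono[of m t i m] mt s that by fastforce
    have p: "(m, %i. \<tau> (t i)) \<in> partitions (\<tau> s) (\<tau> s')"
     using mt rng \<tau>mono by (auto simp: Suc_le_eq less_imp_le)
    have "ennreal (\<Sum>i<fst x. dist (\<sigma> (snd x i)) (\<sigma> (snd x (Suc i)))) = ennreal (\<Sum>i<fst (m, %i. \<tau> (t i)). dist (Y (snd (m, %i. \<tau> (t i)) i)) (Y (snd (m, %i. \<tau> (t i)) (Suc i))))"
     using mt(1) by (simp add: \<sigma>_def)
    also have "\<dots> <= curve_length Y (\<tau> s) (\<tau> s')" unfolding curve_length_def by (rule SUP_upper[OF p])
    finally show "ennreal (\<Sum>i<fst x. dist (\<sigma> (snd x i)) (\<sigma> (snd x (Suc i)))) <= curve_length Y (\<tau> s) (\<tau> s')" .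
   qed
   show "curve_length Y (\<tau> s) (\<tau> s') <= curve_length \<sigma> s s'"
    unfolding curve_length_def[of Y]
   proof (rule SUP_least)
    fix x assume "x \<in> partitions (\<tau> s) (\<tau> s')"
    then obtain m t where mt: "x = (m, t)" "t 0 = \<tau> s" "t m = \<tau> s'" "\<And>i. i < m ==> t i <= t (Suc i)" by auto
    have rng: "0 <= t i \<and> t i <= T" if "i <= m" for i
    proof -
     have "t 0 <= t i" "t i <= t m" using partition_mono[of m t 0 i] partition_mono[of m t i m] mt(4) that by auto
     then show ?thesis using mt(2,3) \<tau>[of s] \<tau>[of s'] s by auto
    qed
    have p: "(m, %i. S (t i)) \<in> partitions s s'"
     using mt rng \<tau>[of s] \<tau>[of s'] s len(2) by (auto simp: Suc_le_eq less_imp_le)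
    have "ennreal (\<Sum>i<fst x. dist (Y (snd x i)) (Y (snd x (Suc i)))) = ennreal (\<Sum>i<fst (m, %i. S (t i)). dist (\<sigma> (snd (m, %i. S (t i)) i)) (\<sigma> (snd (m, %i. S (t i)) (Suc i))))"
     using mt(1) \<sigma>S rng by (auto intro!: arg_cong[of _ _ ennreal] sum.cong)
    also have "\<dots> <= curve_length \<sigma> s s'" unfolding curve_length_def by (rule SUP_upper[OF p])
    finally show "ennreal (\<Sum>i<fst x. dist (Y (snd x i)) (Y (snd x (Suc i)))) <= curve_length \<sigma> s s'" .
   qed
  qed
  also have "\<dots> = ennreal (S (\<tau> s') - S (\<tau> s))" using le \<tau>[of s] s by (intro len(1)) auto
  also have "\<dots> = ennreal (s' - s)" using \<tau>[of s] \<tau>[of s'] s by simp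
  finally show ?thesis .
 qed
 have arc: "arclength_curve_in UNIV \<sigma> l" using l clen by (auto simp: arclength_curve_in_def)
 have "lint (%x. ennreal (h x)) \<sigma> 0 l <= lint (%x. ennreal (h x)) Y 0 T" if h: "continuous_on UNIV h" "\<And>x. 0 <= h x" for h :: "'a => real"
 proof (rule ennreal_le_epsilon)
  fix e0 :: real assume e0: "0 < e0"
  define e where "e = e0 / (T + 1)"
  have e: "0 < e" "e * T <= e0" using e0 T by (auto simp: e_def field_simps)
  have [measurable]: "Borel h" using h(1) by (rule borel_measurable_continuous_onI)
  have hm: "Borel (%x. ennreal (h x))" "Borel (%x. ennreal (h x + e))" by measurable
  have "0 <= (0::real) --> T <= T --> lint (%x. ennreal (h x)) \<sigma> (S 0) (S T) <= lint (%x. ennreal (h x + e)) Y 0 T"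
   using T(1)
  proof (induct rule: Bolzano[where P="%a b. 0 <= a --> b <= T --> lint (%x. ennreal (h x)) \<sigma> (S a) (S b) <= lint (%x. ennreal (h x + e)) Y a b"])
   case (trans a b c)
   show ?case
   proof (intro impI)
    assume ac: "0 <= a" "c <= T"
    have "lint (%x. ennreal (h x)) \<sigma> (S a) (S c) = lint (%x. ennreal (h x)) \<sigma> (S a) (S b) + lint (%x. ennreal (h x)) \<sigma> (S b) (S c)"
     using S_range[of a] S_range[of c] len(2)[of a b] len(2)[of b c] trans ac
     by (intro lint_add[OF hm(1) arc, symmetric]) auto
    also have "\<dots> <= lint (%x. ennreal (h x + e)) Y a b + lint (%x. ennreal (h x + e)) Y b c"
     using trans ac by (intro add_mono) auto
    also have "\<dots> = lint (%x. ennreal (h x + e)) Y a c" using trans by (intro lip1_lint_add[OF lip hm(2)]) auto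
    finally show "lint (%x. ennreal (h x)) \<sigma> (S a) (S c) <= lint (%x. ennreal (h x + e)) Y a c" .
   qed
  next
   case (local x)
   obtain d where d: "0 < d" "\<And>y. dist y (Y x) < d ==> dist (h y) (h (Y x)) < e / 2"
    using h(1) e(1) by (metis UNIV_I continuous_on_iff half_gt_zero)
   have "0 <= a --> b <= T --> lint (%x. ennreal (h x)) \<sigma> (S a) (S b) <= lint (%x. ennreal (h x + e)) Y a b"
    if ab: "a <= x" "x <= b" "b - a < d" for a b
   proof (intro impI)
    assume ab2: "0 <= a" "b <= T"
    define c where "c = h (Y x) + e / 2"
    have near: "\<bar>h (Y t) - h (Y x)\<bar> < e / 2" if "a <= t" "t <= b" for t
    proof -
     have "dist (Y t) (Y x) <= \<bar>t - x\<bar>" using lip by (simp add: lip1_def)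
     also have "\<dots> < d" using that ab by (simp add: abs_if)
     finally show ?thesis using d(2) by (simp add: dist_real_def)
    qed
    have c0: "0 <= c" using h(2)[of "Y x"] e by (simp add: c_def)
    have "lint (%x. ennreal (h x)) \<sigma> (S a) (S b) <= lint (%_. ennreal c) \<sigma> (S a) (S b)"
     unfolding lint_def
    proof (intro nn_integral_mono)
     fix s
     have "h (\<sigma> s) <= c" if "S a <= s" "s <= S b"
     proof -
      have s: "0 <= s" "s <= l" using that S_range[of a] S_range[of b] ab ab2 by auto
      \<comment> \<open>Where \<open>S\<close> is constant, \<open>\<tau> s\<close> may fall outside
        the interval from \<open>a\<close> to \<open>b\<close>; clamping it back changes neither its
        value under \<open>S\<close> nor the point of the curve.\<close>
      define t where "t = min b (max a (\<tau> s))"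
      have "S t = s"
      proof (cases "\<tau> s < a")
       case True
       then have "S (\<tau> s) <= S a" using \<tau>[OF s] by (intro len(2)) auto
       then show ?thesis using True \<tau>[OF s] that ab by (simp add: t_def)
      next
       case False
       show ?thesis
       proof (cases "b < \<tau> s")
        case True
        then have "S b <= S (\<tau> s)" using ab ab2 by (intro len(2)) auto
        then show ?thesis using True \<tau>[OF s] that ab by (simp add: t_def)
       qed (use False \<tau>[OF s] in \<open>simp add: t_def\<close>)
      qed
      moreover have t: "a <= t" "t <= b" using ab by (auto simp: t_def)
      ultimately have "\<sigma> s = Y t" using \<sigma>S[of t] ab2 by auto
      then show ?thesis using le_less_trans[OF abs_ge_self near[OF t]] by (simp add: c_def)
     qed
     then show "ennreal (h (\<sigma> s)) * indicator {S a..S b} s <= ennreal c * indicator {S a..S b} s"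
      by (auto simp: indicator_def intro!: ennreal_leI)
    qed
    also have "\<dots> = ennreal (c * (S b - S a))" using len(2)[of a b] ab ab2 c0 by (intro lint_const) auto
    also have "\<dots> <= ennreal (c * (b - a))" using len(3)[of a b] ab ab2 c0 by (intro ennreal_leI mult_left_mono) auto
    also have "\<dots> = lint (%_. ennreal c) Y a b" using ab c0 by (intro lint_const[symmetric]) auto
    also have "\<dots> <= lint (%x. ennreal (h x + e)) Y a b"
     unfolding lint_def
    proof (intro nn_integral_mono)
     fix t
     have "c <= h (Y t) + e" if "a <= t" "t <= b" using le_less_trans[OF abs_ge_minus_self near[OF that]] by (simp add: c_def)
     then show "ennreal c * indicator {a..b} t <= ennreal (h (Y t) + e) * indicator {a..b} t"
      by (auto simp: indicator_def intro!: ennreal_leI)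
    qed
    finally show "lint (%x. ennreal (h x)) \<sigma> (S a) (S b) <= lint (%x. ennreal (h x + e)) Y a b" .
   qed
   then show ?case using d(1) by blast
  qed
  then have "lint (%x. ennreal (h x)) \<sigma> 0 l <= lint (%x. ennreal (h x + e)) Y 0 T" by (simp add: S0 l_def)
  also have "\<dots> = lint (%x. ennreal (h x)) Y 0 T + lint (%_. ennreal e) Y 0 T"
   unfolding lint_def using lip1_measurable[OF lip hm(1)] h(2) e
   by (subst nn_integral_add[symmetric]) (auto intro!: nn_integral_cong simp: indicator_def)
  also have "lint (%_. ennreal e) Y 0 T = ennreal (e * (T - 0))" using T e by (intro lint_const) auto
  also have "lint (%x. ennreal (h x)) Y 0 T + ennreal (e * (T - 0)) <= lint (%x. ennreal (h x)) Y 0 T + ennreal e0"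
   using e by (intro add_left_mono ennreal_leI) simp
  finally show "lint (%x. ennreal (h x)) \<sigma> 0 l <= lint (%x. ennreal (h x)) Y 0 T + ennreal e0" .
 qed
 moreover have "\<sigma> 0 = Y 0" using \<sigma>S[of 0] S0 T by simp
 ultimately show thesis using arc that by blast
qed

section \<open>Exceptional sets have open neighbourhoods of small capacity\<close>

definition lsc :: "('a::euclidean_space => ennreal) => bool" where
 "lsc \<rho> \<longleftrightarrow> (\<forall>c. open {x. c < \<rho> x})"

lemma lsc_measurable: "lsc \<rho> ==> Borel \<rho>"
 unfolding lsc_def by (intro borel_measurableI_greater) auto

text \<open>Continuous approximation from below by inf-convolution.\<close>

lemma lsc_approx:
 fixes \<rho> :: "'a::euclidean_space => ennreal"
 assumes lsc: "lsc \<rho>"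
 obtains \<kappa> :: "nat => 'a => real" where "\<And>i x. 0 <= \<kappa> i x" "\<And>i x. \<kappa> i x <= real i" "\<And>i x y. \<bar>\<kappa> i x - \<kappa> i y\<bar> <= real i * dist x y"
  "\<And>i j x. i <= j ==> \<kappa> i x <= \<kappa> j x" "\<And>x. (SUP i. ennreal (\<kappa> i x)) = \<rho> x"
  "\<And>i x c d. \<forall>y. dist x y < d --> ennreal c <= \<rho> y ==> 0 <= c ==> c <= real i ==> c <= real i * d ==> c <= \<kappa> i x"
proof -
 define m where "m i y = enn2real (min (\<rho> y) (of_nat i))" for i :: nat and y
 have m0: "0 <= m i y" for i y by (simp add: m_def)
 have em: "ennreal (m i y) = min (\<rho> y) (of_nat i)" for i y
  unfolding m_def by (rule ennreal_enn2real) (simp add: min_less_iff_disj of_nat_less_top)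
 have mi: "m i y <= real i" for i y
  using em[of i y] by (metis ennreal_le_iff ennreal_of_nat_eq_real_of_nat min.cobounded2 of_nat_0_le_iff)
 have mmono: "m i y <= m j y" if "i <= j" for i j y
 proof -
  have "ennreal (m i y) <= ennreal (m j y)" unfolding em using that by (intro min.mono) auto
  then show ?thesis using m0 by simp
 qed
 define \<kappa> where "\<kappa> i x = (INF y. m i y + real i * dist x y)" for i x
 have bdd: "bdd_below (range (%y. m i y + real i * dist x y))" for i x
  by (rule bdd_belowI[of _ 0]) (auto intro!: add_nonneg_nonneg m0)
 have lower: "\<kappa> i x <= m i y + real i * dist x y" for i x y
  unfolding \<kappa>_def by (rule cINF_lower[OF bdd]) simp
 have \<kappa>0: "0 <= \<kappa> i x" for i x
  unfolding \<kappa>_def by (rule cINF_greatest) (auto intro!: add_nonneg_nonneg m0)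
 have \<kappa>m: "\<kappa> i x <= m i x" for i x using lower[of i x x] by simp
 have lip: "\<kappa> i x <= \<kappa> i z + real i * dist x z" for i x z
 proof -
  have "\<kappa> i x - real i * dist x z <= \<kappa> i z"
   unfolding \<kappa>_def[of i z]
  proof (rule cINF_greatest)
   fix y
   have "\<kappa> i x <= m i y + real i * dist x y" by (rule lower)
   also have "\<dots> <= m i y + real i * (dist x z + dist z y)"
    by (intro add_left_mono mult_left_mono dist_triangle) auto
   finally show "\<kappa> i x - real i * dist x z <= m i y + real i * dist z y" by (simp add: algebra_simps)
  qed simp
  then show ?thesis by simp
 qed
 \<comment> \<open>Inside the ball the truncated \<open>\<rho>\<close> is at least \<open>c\<close>;
   outside it the distance penalty alone is.\<close>
 have big: "c <= \<kappa> i x" if c: "\<And>y. dist x y < d ==> ennreal c <= \<rho> y" "0 <= c" "c <= real i" "c <= real i * d" for i x c d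
  unfolding \<kappa>_def
 proof (rule cINF_greatest)
  fix y
  show "c <= m i y + real i * dist x y"
  proof (cases "dist x y < d")
   case True
   have "ennreal c <= of_nat i" using ennreal_leI[OF c(3)] by (simp add: ennreal_of_nat_eq_real_of_nat)
   then have "ennreal c <= ennreal (m i y)" unfolding em using c(1)[OF True] by simp
   then show ?thesis using m0[of i y] by (simp add: add_increasing2)
  next
   case False
   then have "real i * d <= real i * dist x y" by (intro mult_left_mono) auto
   then show ?thesis using c(4) m0[of i y] by linarith
  qed
 qed simp
 show thesis
 proof (rule that[of \<kappa>])
  show "0 <= \<kappa> i x" for i x by (rule \<kappa>0)
  show "\<kappa> i x <= real i" for i x using \<kappa>m[of i x] mi[of i x] by linarith
  show "\<bar>\<kappa> i x - \<kappa> i y\<bar> <= real i * dist x y" for i x y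
   using lip[of i x y] lip[of i y x] by (simp add: abs_le_iff dist_commute)
  show "\<kappa> i x <= \<kappa> j x" if "i <= j" for i j x
   unfolding \<kappa>_def
  proof (rule cINF_mono[OF _ bdd])
   fix y
   show "\<exists>n\<in>UNIV. m i n + real i * dist x n <= m j y + real j * dist x y"
    using mmono[OF that, of y] that by (intro bexI[of _ y] add_mono mult_right_mono) auto
  qed simp
  show "c <= \<kappa> i x" if "\<forall>y. dist x y < d --> ennreal c <= \<rho> y" "0 <= c" "c <= real i" "c <= real i * d" for i x c d
   by (rule big[of x d]) (use that in auto)
  show "(SUP i. ennreal (\<kappa> i x)) = \<rho> x" for x
  proof (rule antisym)
   show "(SUP i. ennreal (\<kappa> i x)) <= \<rho> x"
   proof (rule SUP_least)
    fix i
    have "ennreal (\<kappa> i x) <= ennreal (m i x)" by (rule ennreal_leI[OF \<kappa>m])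
    also have "\<dots> <= \<rho> x" unfolding em by simp
    finally show "ennreal (\<kappa> i x) <= \<rho> x" .
   qed
   show "\<rho> x <= (SUP i. ennreal (\<kappa> i x))"
   proof (rule dense_le)
    fix a assume a: "a < \<rho> x"
    then obtain c where c: "a = ennreal c" "0 <= c" by (cases a) auto
    have "open {y. ennreal c < \<rho> y}" using lsc by (simp add: lsc_def)
    then obtain d where d: "0 < d" "ball x d \<subseteq> {y. ennreal c < \<rho> y}"
     using a c by (metis mem_Collect_eq open_contains_ball)
    obtain i :: nat where i: "max c (c / d) < real i" using reals_Archimedean2 by blast
    have "c <= \<kappa> i x"
     by (rule big[of x d]) (use d i c in \<open>auto simp: field_simps intro: less_imp_le\<close>)
    then have "ennreal c <= ennreal (\<kappa> i x)" by (rule ennreal_leI)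
    then show "a <= (SUP i. ennreal (\<kappa> i x))" unfolding c(1) by (rule order_trans) (intro SUP_upper UNIV_I)
   qed
  qed
 qed
qed

lemma INF_ennreal_const_add':
 fixes f :: "'i => ennreal"
 assumes "I \<noteq> {}" shows "(INF i\<in>I. c + f i) = c + (INF i\<in>I. f i)"
proof (rule antisym)
 show "c + (INF i\<in>I. f i) <= (INF i\<in>I. c + f i)" by (intro INF_greatest add_left_mono INF_lower)
 show "(INF i\<in>I. c + f i) <= c + (INF i\<in>I. f i)"
 proof (cases "c = top")
  case False
  show ?thesis
  proof (rule ennreal_le_epsilon)
   fix e :: real assume e: "0 < e" and fin: "c + (INF i\<in>I. f i) < top"
   have "(INF i\<in>I. f i) < (INF i\<in>I. f i) + ennreal e"
    using fin e by (cases "INF i\<in>I. f i") (auto simp: ennreal_less_iff simp flip: ennreal_plus)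
   then obtain i where i: "i \<in> I" "f i < (INF i\<in>I. f i) + ennreal e" by (auto simp: INF_less_iff)
   have "(INF i\<in>I. c + f i) <= c + f i" using i(1) by (rule INF_lower)
   also have "\<dots> <= c + ((INF i\<in>I. f i) + ennreal e)" using i(2) by (intro add_left_mono) simp
   finally show "(INF i\<in>I. c + f i) <= c + (INF i\<in>I. f i) + ennreal e" by (simp add: add.assoc)
  qed
 qed simp
qed

text \<open>Minimal cost of reaching the complement of \<open>V\<close>, where stopping inside \<open>V\<close> costs \<open>1\<close>.\<close>

definition cost :: "('a::euclidean_space => real) => 'a set => 'a => ennreal" where
 "cost \<kappa> V x = (INF q\<in>{(Y, L). lip1 Y \<and> 0 <= L \<and> Y 0 = x}.
  lint (%x. ennreal (\<kappa> x)) (fst q) 0 (snd q) + indicator V (fst q (snd q)))"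

lemma cost_le: "lip1 Y ==> 0 <= L ==> Y 0 = x ==> cost \<kappa> V x <= lint (%x. ennreal (\<kappa> x)) Y 0 L + indicator V (Y L)"
 unfolding cost_def by (rule INF_lower2[of "(Y, L)"]) auto

lemma cost_le_indicator: "cost \<kappa> V x <= indicator V x"
 using cost_le[of "%_. x" 0 x \<kappa> V] by (simp add: lip1_def)

lemma cost_le_1: "cost \<kappa> V x <= 1"
 using cost_le_indicator[of \<kappa> V x] by (rule order_trans) (auto simp: indicator_def)

lemma lint_shift:
 fixes g :: "'a::euclidean_space => ennreal"
 assumes "lip1 Y" "Borel g"
 shows "lint g Y 0 L = (\<integral>\<^sup>+t\<in>{c..c+L}. g (Y (t - c)) \<partial>lborel)"
proof -
 note [measurable] = lip1_measurable[OF assms]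
 have 1: "Borel (%t. g (Y t) * indicator {0..L} t)" by measurable
 show ?thesis unfolding lint_def
  by (subst nn_integral_real_affine[OF 1, of 1 "- c"]) (auto intro!: nn_integral_cong simp: indicator_def)
qed

text \<open>Running along \<open>Y\<close> first and then along a competitor for \<open>Y L\<close>
  gives a competitor for \<open>Y 0\<close>.\<close>

lemma cost_triangle:
 assumes lip: "lip1 Y" and L: "0 <= L" and [measurable]: "Borel \<kappa>"
 shows "cost \<kappa> V (Y 0) <= lint (%x. ennreal (\<kappa> x)) Y 0 L + cost \<kappa> V (Y L)"
proof -
 let ?g = "%x. ennreal (\<kappa> x)"
 have g: "Borel (?g)" by measurable
 have "cost \<kappa> V (Y 0) <= lint ?g Y 0 L + (lint ?g \<eta> 0 M + indicator V (\<eta> M))"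
  if \<eta>: "lip1 \<eta>" "0 <= M" "\<eta> 0 = Y L" for \<eta> M
 proof -
  define \<zeta> where "\<zeta> t = (if t <= L then Y t else \<eta> (t - L))" for t
  have "lip1 \<zeta>" unfolding lip1_def
  proof (intro allI)
   have *: "dist (\<zeta> s) (\<zeta> t) <= t - s" if st: "s <= t" for s t
   proof (cases "t <= L \<or> L < s")
    case True
    then show ?thesis using lip \<eta>(1) st unfolding lip1_def \<zeta>_def
     by (smt (verit, del_insts))
   next
    case False
    have "dist (Y s) (\<eta> (t - L)) <= dist (Y s) (Y L) + dist (\<eta> 0) (\<eta> (t - L))"
     using dist_triangle[of "Y s" "\<eta> (t - L)" "Y L"] \<eta>(3) by simp
    also have "\<dots> <= \<bar>s - L\<bar> + \<bar>0 - (t - L)\<bar>"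
     using lip \<eta>(1) unfolding lip1_def by (intro add_mono) blast+
    also have "\<dots> = t - s" using False by simp
    finally show ?thesis using False by (simp add: \<zeta>_def)
   qed
   show "dist (\<zeta> s) (\<zeta> t) <= \<bar>s - t\<bar>" for s t
    using *[of s t] *[of t s] by (cases "s <= t") (auto simp: dist_commute)
  qed
  moreover have "\<zeta> 0 = Y 0" using L by (simp add: \<zeta>_def)
  moreover have "\<zeta> (L + M) = \<eta> M" using \<eta> by (auto simp: \<zeta>_def)
  ultimately have "cost \<kappa> V (Y 0) <= lint ?g \<zeta> 0 (L + M) + indicator V (\<eta> M)"
   using cost_le[of \<zeta> "L + M" "Y 0" \<kappa> V] L \<eta> by simp
  also have "lint ?g \<zeta> 0 (L + M) = lint ?g \<zeta> 0 L + lint ?g \<zeta> L (L + M)"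
   using L \<eta> by (intro lip1_lint_add[symmetric] \<open>lip1 \<zeta>\<close> g) auto
  also have "lint ?g \<zeta> 0 L = lint ?g Y 0 L"
   unfolding lint_def by (intro nn_integral_cong) (auto simp: \<zeta>_def indicator_def)
  also have "lint ?g \<zeta> L (L + M) = lint ?g \<eta> 0 M"
   unfolding lint_shift[OF \<eta>(1) g, of M L] unfolding lint_def using \<eta>(3)
   by (intro nn_integral_cong) (auto simp: \<zeta>_def indicator_def)
  finally show ?thesis by (simp add: add.assoc)
 qed
 then have "cost \<kappa> V (Y 0) <= (INF q\<in>{(\<eta>, M). lip1 \<eta> \<and> 0 <= M \<and> \<eta> 0 = Y L}.
  lint ?g Y 0 L + (lint ?g (fst q) 0 (snd q) + indicator V (fst q (snd q))))"
  by (intro INF_greatest) auto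
 also have "\<dots> = lint ?g Y 0 L + cost \<kappa> V (Y L)"
 proof -
  have "(%_. Y L, 0::real) \<in> {(\<eta>, M). lip1 \<eta> \<and> 0 <= M \<and> \<eta> 0 = Y L}" by (simp add: lip1_def)
  then have ne: "{(\<eta>, M). lip1 \<eta> \<and> 0 <= (M::real) \<and> \<eta> 0 = Y L} \<noteq> {}" by blast
  show ?thesis unfolding cost_def by (rule INF_ennreal_const_add'[OF ne])
 qed
 finally show ?thesis .
qed

lemma clamp_lip1:
 assumes "\<And>s t. 0 <= s ==> s <= l ==> 0 <= t ==> t <= l ==> dist (Y s) (Y t) <= \<bar>s - t\<bar>" "0 <= l"
 shows "lip1 (%t. Y (max 0 (min l t)))"
 unfolding lip1_def
proof (intro allI)
 fix s t
 have "dist (Y (max 0 (min l s))) (Y (max 0 (min l t))) <= \<bar>max 0 (min l s) - max 0 (min l t)\<bar>"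
  using assms(2) by (intro assms(1)) auto
 also have "\<dots> <= \<bar>s - t\<bar>" by (auto simp: max_def min_def)
 finally show "dist (Y (max 0 (min l s))) (Y (max 0 (min l t))) <= \<bar>s - t\<bar>" .
qed

text \<open>\<open>cost_triangle\<close> is applied to the curve and to its reversal. The curve is
  extended by constants to fit the class \<open>lip1\<close> on the whole line.\<close>

lemma cost_ugrad:
 fixes \<kappa> :: "'a::euclidean_space => real"
 assumes [measurable]: "Borel \<kappa>"
 shows "ugrad (%x. enn2real (cost \<kappa> V x)) (%x. ennreal (\<kappa> x))"
proof (rule ugradI)
 show g: "Borel (%x. ennreal (\<kappa> x))" by measurable
 fix Y :: "real => 'a" and l assume c: "arclength_curve_in UNIV Y l"
 have l: "0 < l" using c by (auto simp: arclength_curve_in_def)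
 define \<delta> where "\<delta> t = Y (max 0 (min l t))" for t
 have \<delta>: "lip1 \<delta>" unfolding \<delta>_def[abs_def] using l by (intro clamp_lip1 arclength_dist_le[OF c]) auto
 have \<delta>': "lip1 (%t. \<delta> (l - t))" unfolding lip1_def
 proof (intro allI)
  fix s t
  have "dist (\<delta> (l - s)) (\<delta> (l - t)) <= \<bar>(l - s) - (l - t)\<bar>" using \<delta> unfolding lip1_def by blast
  then show "dist (\<delta> (l - s)) (\<delta> (l - t)) <= \<bar>s - t\<bar>" by (simp add: abs_minus_commute)
 qed
 let ?I = "lint (%x. ennreal (\<kappa> x)) Y 0 l"
 have e1: "lint (%x. ennreal (\<kappa> x)) \<delta> 0 l = ?I"
  unfolding lint_def by (intro nn_integral_cong) (auto simp: \<delta>_def indicator_def)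
 have e2: "lint (%x. ennreal (\<kappa> x)) (%t. \<delta> (l - t)) 0 l = ?I"
 proof -
  note [measurable] = lip1_measurable[OF \<delta> g]
  have 1: "Borel (%t. ennreal (\<kappa> (\<delta> t)) * indicator {0..l} t)" by measurable
  have "lint (%x. ennreal (\<kappa> x)) \<delta> 0 l = lint (%x. ennreal (\<kappa> x)) (%t. \<delta> (l - t)) 0 l"
   unfolding lint_def by (subst nn_integral_real_affine[OF 1, of "-1" l]) (auto intro!: nn_integral_cong simp: indicator_def)
  then show ?thesis using e1 by simp
 qed
 have \<delta>0: "\<delta> 0 = Y 0" "\<delta> l = Y l" using l by (auto simp: \<delta>_def)
 have 1: "cost \<kappa> V (Y 0) <= ?I + cost \<kappa> V (Y l)"
  using cost_triangle[OF \<delta>, of l \<kappa> V] l e1 \<delta>0 by simp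
 have 2: "cost \<kappa> V (Y l) <= ?I + cost \<kappa> V (Y 0)"
  using cost_triangle[OF \<delta>', of l \<kappa> V] l e2 \<delta>0 by simp
 have fin: "cost \<kappa> V x < top" for x using cost_le_1[of \<kappa> V x] by (rule le_less_trans) simp
 show "ennreal \<bar>enn2real (cost \<kappa> V (Y 0)) - enn2real (cost \<kappa> V (Y l))\<bar> <= ?I"
 proof (cases ?I)
  case (real i)
  obtain a b where ab: "cost \<kappa> V (Y 0) = ennreal a" "0 <= a" "cost \<kappa> V (Y l) = ennreal b" "0 <= b"
   using fin[of "Y 0"] fin[of "Y l"] by (metis ennreal_cases less_top)
  have "a <= i + b" "b <= i + a" using 1 2 unfolding ab real using ab real by (auto simp flip: ennreal_plus)
  then show ?thesis unfolding real ab using ab by (intro ennreal_leI) (auto simp: abs_le_iff)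
 qed simp
qed

text \<open>The upper gradient is at most \<open>M\<close>, and two points are joined by a segment.
  The cost is thus continuous although it is an infimum over curves, so its superlevel sets are
  open.\<close>

lemma cost_lipschitz:
 fixes \<kappa> :: "'a::euclidean_space => real"
 assumes m: "Borel \<kappa>" and M: "\<And>x. \<kappa> x <= M" "0 <= M"
 shows "\<bar>enn2real (cost \<kappa> V x) - enn2real (cost \<kappa> V y)\<bar> <= M * dist x y"
proof (cases "x = y")
 case False
 define e where "e = (y - x) /\<^sub>R norm (y - x)"
 have e: "norm e = 1" "x + norm (y - x) *\<^sub>R e = y" using False by (auto simp: e_def)
 have "ennreal \<bar>enn2real (cost \<kappa> V (x + 0 *\<^sub>R e)) - enn2real (cost \<kappa> V (x + norm (y - x) *\<^sub>R e))\<bar> <= lint (%x. ennreal (\<kappa> x)) (%t. x + t *\<^sub>R e) 0 (norm (y - x))"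
  by (rule ugrad_subcurve[OF cost_ugrad[OF m] arclength_segment[OF e(1), of "norm (y - x)"]]) (use False in auto)
 also have "\<dots> <= lint (%x. ennreal M) (%t. x + t *\<^sub>R e) 0 (norm (y - x))" by (intro lint_mono ennreal_leI M)
 also have "\<dots> = ennreal (M * (norm (y - x) - 0))" using M by (intro lint_const) auto
 finally show ?thesis using e M by (simp add: dist_norm norm_minus_commute)
qed (use M in simp)

lemma enn_pow_mult_indicator: "0 < p ==> enn_pow (c * indicator A x) p = enn_pow c p * indicator A x"
 by (auto simp: indicator_def)

text \<open>In the spirit of the Vitali-Caratheodory theorem: dyadic level sets are enlarged to open
  sets \<open>T j\<close>, and the supremum of the resulting step functions is lower semicontinuous.
  Values up to 1 belong to no level set, which explains the summand 1; points with infinite value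
  are put into every \<open>T j\<close>.\<close>

lemma lsc_majorant:
 fixes \<rho>0 :: "'a::euclidean_space => ennreal"
 assumes [measurable]: "Borel (\<rho>0)" and fin: "pint p \<rho>0 < \<infinity>" and p: "0 < p"
 obtains \<rho> where "lsc \<rho>" "pint p \<rho> < \<infinity>" "\<And>x. \<rho>0 x <= 1 + \<rho> x"
proof -
 define B where "B j = {x. ennreal (2 ^ j) < \<rho>0 x \<and> \<rho>0 x <= ennreal (2 ^ Suc j)}" for j :: nat
 define N where "N = {x. \<rho>0 x = \<infinity>}"
 have [measurable]: "B j \<in> sets borel" for j unfolding B_def by measurable
 have [measurable]: "N \<in> sets borel" unfolding N_def by measurable
 have N0: "emeasure lborel N = 0"
  using pint_AE_finite[OF assms(1) fin] by (subst (asm) AE_iff_measurable[of N]) (auto simp: N_def)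
 \<comment> \<open>With this excess measure and the height \<open>2 ^ Suc j\<close>, the set added
   to the j-th level contributes at most \<open>(1/2) ^ Suc j\<close> to the energy.\<close>
 define e where "e j = (1/2) ^ Suc j / (2 ^ Suc j) powr p" for j :: nat
 have e: "0 < e j" for j by (simp add: e_def)
 have "\<exists>T. open T \<and> B j \<union> N \<subseteq> T \<and> emeasure lebesgue (T - (B j \<union> N)) < ennreal (e j)" for j
  by (rule sets_lebesgue_outer_open[of "B j \<union> N" "e j"]) (use e in auto)
 then obtain T where T: "\<And>j. open (T j)" "\<And>j. B j \<union> N \<subseteq> T j" "\<And>j. emeasure lebesgue (T j - (B j \<union> N)) < ennreal (e j)"
  by metis
 have [measurable]: "T j \<in> sets borel" for j using T by simp
 define \<rho> where "\<rho> x = (SUP j. ennreal (2 ^ Suc j) * indicator (T j) x)" for x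
 have "lsc \<rho>" unfolding lsc_def
 proof
  fix c
  have "{x. c < \<rho> x} = (\<Union>j. if c < ennreal (2 ^ Suc j) then T j else {})"
   unfolding \<rho>_def less_SUP_iff by (auto simp: indicator_def split: if_splits)
  also have "open \<dots>" by (intro open_UN) (use T in auto)
  finally show "open {x. c < \<rho> x}" .
 qed
 moreover have "pint p \<rho> < \<infinity>"
 proof -
  define \<mu> where "\<mu> = density lborel (%x. enn_pow (\<rho>0 x) p)"
  have mT: "emeasure lborel (T j) <= emeasure lborel (B j) + ennreal (e j)" for j
  proof -
   have "emeasure lborel (T j) <= emeasure lborel ((B j \<union> N) \<union> (T j - (B j \<union> N)))"
    by (intro emeasure_mono) auto
   also have "\<dots> <= emeasure lborel (B j \<union> N) + emeasure lborel (T j - (B j \<union> N))"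
    by (intro emeasure_subadditive) auto
   also have "\<dots> <= emeasure lborel (B j) + ennreal (e j)"
   proof (intro add_mono)
    show "emeasure lborel (B j \<union> N) <= emeasure lborel (B j)"
     using emeasure_subadditive[of "B j" lborel N] N0 by simp
    have "emeasure lebesgue (T j - (B j \<union> N)) = emeasure lborel (T j - (B j \<union> N))"
     by simp
    then show "emeasure lborel (T j - (B j \<union> N)) <= ennreal (e j)" using T(3)[of j] by simp
   qed
   finally show ?thesis .
  qed
  have mB: "ennreal ((2 ^ Suc j) powr p) * emeasure lborel (B j) <= ennreal (2 powr p) * emeasure \<mu> (B j)" for j
  proof -
   have "ennreal ((2 ^ Suc j) powr p) * emeasure lborel (B j) = ennreal (2 powr p) * (\<integral>\<^sup>+x. ennreal ((2 ^ j) powr p) * indicator (B j) x \<partial>lborel)"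
    by (subst nn_integral_cmult_indicator) (auto simp: powr_mult ennreal_mult' mult.assoc)
   also have "\<dots> <= ennreal (2 powr p) * (\<integral>\<^sup>+x. enn_pow (\<rho>0 x) p * indicator (B j) x \<partial>lborel)"
   proof (intro mult_left_mono nn_integral_mono)
    fix x
    show "ennreal ((2 ^ j) powr p) * indicator (B j) x <= enn_pow (\<rho>0 x) p * indicator (B j) x"
     using enn_pow_mono[OF p, of "ennreal (2 ^ j)" "\<rho>0 x"] by (auto simp: indicator_def B_def enn_pow_ennreal)
   qed simp
   also have "(\<integral>\<^sup>+x. enn_pow (\<rho>0 x) p * indicator (B j) x \<partial>lborel) = emeasure \<mu> (B j)"
    unfolding \<mu>_def by (subst emeasure_density) auto
   finally show ?thesis .
  qed
  have dis: "disjoint_family B"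
   unfolding disjoint_family_on_def
  proof (intro ballI impI)
   have *: "B i \<inter> B j = {}" if "i < j" for i j
   proof -
    have "(2::real) ^ Suc i <= 2 ^ j" using that by (intro power_increasing) auto
    then have le: "ennreal (2 ^ Suc i) <= ennreal (2 ^ j)" by (rule ennreal_leI)
    have False if "x \<in> B i" "x \<in> B j" for x
    proof -
     have "ennreal (2 ^ j) < \<rho>0 x" "\<rho>0 x <= ennreal (2 ^ Suc i)" using that by (auto simp: B_def)
     from less_le_trans[OF this(1) order_trans[OF this(2) le]] show False by simp
    qed
    then show ?thesis by blast
   qed
   fix i j :: nat assume "i \<noteq> j"
   then show "B i \<inter> B j = {}" using *[of i j] *[of j i] by (cases "i < j") auto
  qed
  have "pint p \<rho> <= (\<Sum>j. pint p (%x. ennreal (2 ^ Suc j) * indicator (T j) x))"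
   unfolding \<rho>_def by (rule pint_SUP_le) (use p in auto)
  also have "\<dots> = (\<Sum>j. ennreal ((2 ^ Suc j) powr p) * emeasure lborel (T j))"
   unfolding pint_def enn_pow_mult_indicator[OF p]
   by (intro suminf_cong, subst nn_integral_cmult_indicator) (auto simp: enn_pow_ennreal simp del: power_Suc)
  also have "\<dots> <= (\<Sum>j. ennreal (2 powr p) * emeasure \<mu> (B j) + ennreal (1 * (1/2) ^ Suc j))"
  proof (intro suminf_le)
   fix j
   have "ennreal ((2 ^ Suc j) powr p) * emeasure lborel (T j) <= ennreal ((2 ^ Suc j) powr p) * (emeasure lborel (B j) + ennreal (e j))"
    by (intro mult_left_mono mT) simp
   also have "\<dots> = ennreal ((2 ^ Suc j) powr p) * emeasure lborel (B j) + ennreal ((2 ^ Suc j) powr p * e j)"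
    by (simp add: distrib_left ennreal_mult' del: power_Suc)
   also have "(2 ^ Suc j) powr p * e j = 1 * (1/2) ^ Suc j" by (simp add: e_def del: power_Suc)
   finally show "ennreal ((2 ^ Suc j) powr p) * emeasure lborel (T j) <= ennreal (2 powr p) * emeasure \<mu> (B j) + ennreal (1 * (1/2) ^ Suc j)"
    using mB[of j] by (meson add_right_mono order_trans)
  qed auto
  also have "\<dots> = (\<Sum>j. ennreal (2 powr p) * emeasure \<mu> (B j)) + (\<Sum>j. ennreal (1 * (1/2) ^ Suc j))"
   by (rule suminf_add[symmetric]) auto
  also have "\<dots> = ennreal (2 powr p) * emeasure \<mu> (\<Union>j. B j) + ennreal 1"
  proof -
   have "(\<Sum>j. emeasure \<mu> (B j)) = emeasure \<mu> (\<Union>j. B j)"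
    by (rule suminf_emeasure) (use dis in \<open>auto simp: \<mu>_def\<close>)
   moreover have "(\<Sum>j. ennreal (1 * (1/2) ^ Suc j)) = ennreal 1" by (rule suminf_half_pow_ennreal) simp
   ultimately show ?thesis by (simp only: ennreal_suminf_cmult)
  qed
  also have "\<dots> <= ennreal (2 powr p) * pint p \<rho>0 + ennreal 1"
  proof (intro add_right_mono mult_left_mono)
   have "emeasure \<mu> (\<Union>j. B j) <= emeasure \<mu> UNIV" by (intro emeasure_mono) (auto simp: \<mu>_def)
   also have "emeasure \<mu> UNIV = pint p \<rho>0" unfolding \<mu>_def pint_def by (subst emeasure_density) auto
   finally show "emeasure \<mu> (\<Union>j. B j) <= pint p \<rho>0" .
  qed simp
  also have "\<dots> < \<infinity>" using fin by (simp add: ennreal_mult_less_top)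
  finally show ?thesis .
 qed
 moreover have "\<rho>0 x <= 1 + \<rho> x" for x
 proof (cases "\<rho>0 x")
  case (real r)
  show ?thesis
  proof (cases "r <= 1")
   case True
   then have "\<rho>0 x <= 1" using real by simp
   then show ?thesis by (rule order_trans) simp
  next
   case False
   have "\<exists>n::nat. r <= 2 ^ n" using real_arch_pow[of 2 r] by (auto intro: less_imp_le)
   then have L: "r <= 2 ^ (LEAST n. r <= 2 ^ n)" by (rule LeastI_ex)
   define n where "n = (LEAST n. r <= 2 ^ n)"
   have "n \<noteq> 0" using L False unfolding n_def[symmetric] by (cases n) auto
   then obtain j where j: "n = Suc j" by (cases n) auto
   have "\<not> r <= 2 ^ j" using not_less_Least[of j "%n. r <= 2 ^ n"] j unfolding n_def by simp
   then have "x \<in> B j" using L real unfolding n_def[symmetric] j B_def by (simp add: ennreal_less_iff del: power_Suc)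
   then have "x \<in> T j" using T(2)[of j] by blast
   then have "ennreal (2 ^ Suc j) <= \<rho> x"
    unfolding \<rho>_def by (intro SUP_upper2[of j]) (auto simp del: power_Suc)
   then have "\<rho>0 x <= \<rho> x" using \<open>x \<in> B j\<close> unfolding B_def by (auto intro: order_trans)
   then show ?thesis by (rule order_trans) simp
  qed
 next
  case top
  then have inT: "x \<in> T j" for j using T(2)[of j] by (auto simp: N_def)
  have "\<rho> x = \<infinity>"
  proof (rule ccontr)
   assume "\<rho> x \<noteq> \<infinity>"
   then obtain s where s: "\<rho> x = ennreal s" "0 <= s" by (cases "\<rho> x") auto
   obtain j :: nat where j: "s < 2 ^ j" using real_arch_pow[of 2 s] by auto
   have "ennreal (2 ^ Suc j) <= \<rho> x"
    unfolding \<rho>_def by (intro SUP_upper2[of j]) (use inT in \<open>auto simp del: power_Suc\<close>)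
   then have "(2::real) ^ Suc j <= s" using s by (simp del: power_Suc)
   moreover have "(2::real) ^ j <= 2 ^ Suc j" by simp
   ultimately show False using j by linarith
  qed
  then show ?thesis by simp
 qed
 ultimately show thesis by (rule that)
qed

lemma lsc_max: "lsc f ==> lsc g ==> lsc (%x. max (f x) (g x))"
 unfolding lsc_def less_max_iff_disj by (auto simp: Collect_disj_eq)

lemma lsc_cmult:
 assumes "lsc f" "0 < c" shows "lsc (%x. ennreal c * f x)"
 unfolding lsc_def
proof
 fix d
 have "{x. d < ennreal c * f x} = {x. ennreal (1/c) * d < f x}"
 proof (intro Collect_cong)
  fix x
  have "d < ennreal c * f x \<longleftrightarrow> \<not> ennreal c * f x <= ennreal c * (ennreal (1/c) * d)"
   using assms(2) by (simp add: mult.assoc[symmetric] ennreal_mult'[symmetric] not_le)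
  also have "\<dots> \<longleftrightarrow> \<not> f x <= ennreal (1/c) * d"
   using assms(2) by (subst ennreal_mult_le_mult_iff) auto
  finally show "d < ennreal c * f x \<longleftrightarrow> ennreal (1/c) * d < f x" by (simp add: not_le)
 qed
 then show "open {x. d < ennreal c * f x}" using assms(1) by (simp add: lsc_def)
qed

lemma lsc_open_indicator: "open T ==> lsc (%x. c * indicator T x)"
 unfolding lsc_def
proof
 fix d assume "open T"
 have "{x. d < c * indicator T x} = (if d < c then T else {})" by (auto simp: indicator_def)
 then show "open {x. d < c * indicator T x}" using \<open>open T\<close> by simp
qed

lemma exists_small_scale:
 assumes "P < \<infinity>" "0 < p" "0 < e" obtains c :: real where "0 < c" "c <= 1" "ennreal (c powr p) * P <= ennreal e"
proof -
 define Q where "Q = enn2real P + 1"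
 have Q: "0 < Q" by (simp add: Q_def add_nonneg_pos)
 have PQ: "P <= ennreal Q"
 proof -
  have "P = ennreal (enn2real P)" using assms by simp
  also have "\<dots> <= ennreal Q" by (rule ennreal_leI) (simp add: Q_def)
  finally show ?thesis .
 qed
 define c where "c = min 1 ((e / Q) powr (1/p))"
 have c: "0 < c" "c <= 1" using assms Q by (auto simp: c_def)
 have "c powr p <= ((e / Q) powr (1/p)) powr p" using c assms by (intro powr_mono2) (auto simp: c_def)
 also have "\<dots> = e / Q" using assms Q by (simp add: powr_powr)
 finally have "c powr p * Q <= e" using Q by (simp add: field_simps)
 then have "ennreal (c powr p * Q) <= ennreal e" by (rule ennreal_leI)
 moreover have "ennreal (c powr p) * P <= ennreal (c powr p * Q)"
  using PQ Q by (simp add: ennreal_mult' mult_left_mono)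
 ultimately have "ennreal (c powr p) * P <= ennreal e" by (rule order_trans[rotated])
 with c show thesis by (rule that)
qed

text \<open>The least cost of leaving a small open set \<open>V\<close> containing \<open>Z\<close>
  serves as test function: it vanishes off \<open>V\<close> and has \<open>\<rho>\<close> as an
  upper gradient. If it were at most 1/2 at a point of \<open>Z\<close>, cheap curves leaving
  \<open>V\<close> would converge to a curve from that point with finite integral of
  \<open>\<rho>\<close>, contrary to the choice of \<open>\<rho>0\<close>. Continuous weights
  \<open>\<kappa> i\<close> below \<open>\<rho>\<close> make the costs continuous, hence the
  neighbourhood open.\<close>

lemma exceptional_bounded_open_nbhd:
 fixes Z :: "'a::euclidean_space set"
 assumes Z: "Z \<in> null_sets lebesgue" "Z \<subseteq> ball 0 R" and pz: "pae p (%Y l. Y ` {0..l} \<inter> Z = {})" and p: "0 < p" and e0: "0 < e0"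
 obtains G where "open G" "Z \<subseteq> G" "Cap p G <= ennreal e0"
proof -
 obtain \<rho>0 where \<rho>0: "Borel (\<rho>0)" "pint p \<rho>0 < \<infinity>"
  and av: "\<And>Y l. arclength_curve_in UNIV Y l ==> lint \<rho>0 Y 0 l < \<infinity> ==> Y ` {0..l} \<inter> Z = {}"
  using pz unfolding pae_def by blast
 obtain \<rho>1 where \<rho>1: "lsc \<rho>1" "pint p \<rho>1 < \<infinity>" "\<And>x. \<rho>0 x <= 1 + \<rho>1 x"
  by (rule lsc_majorant[OF \<rho>0 p]) (rule that)
 \<comment> \<open>One share \<open>e\<close> pays for the measure of \<open>V\<close> and two for
   \<open>\<rho>\<close>; doubling the test function costs the factor
   \<open>2 powr p\<close>.\<close>
 define e where "e = e0 / (3 * 2 powr p)"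
 have e: "0 < e" using e0 by (simp add: e_def)
 obtain \<eta> where \<eta>: "0 < \<eta>" "\<eta> <= 1" "ennreal (\<eta> powr p) * pint p \<rho>1 <= ennreal e"
  by (rule exists_small_scale[OF \<rho>1(2) p e])
 define BB where "BB = ball (0::'a) (R + 1)"
 have BBo: "open BB" and [measurable]: "BB \<in> sets borel" by (auto simp: BB_def)
 have "emeasure lborel BB < \<infinity>" unfolding BB_def using emeasure_bounded_finite[OF bounded_ball] by auto
 then obtain \<delta> where \<delta>: "0 < \<delta>" "\<delta> <= 1" "ennreal (\<delta> powr p) * emeasure lborel BB <= ennreal e"
  by (rule exists_small_scale[OF _ p e])
 \<comment> \<open>The part with \<open>\<rho>1\<close> makes curves that meet \<open>Z\<close>
   infinitely expensive; the constant \<open>\<delta>\<close> on the larger ball keeps the weight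
   bounded below on \<open>V\<close>, so that cheap curves leave \<open>V\<close> within parameter
   length \<open>1 / \<delta>\<close>.\<close>
 define \<rho> where "\<rho> x = max (ennreal \<eta> * \<rho>1 x) (ennreal \<delta> * indicator BB x)" for x
 have lsc: "lsc \<rho>" unfolding \<rho>_def[abs_def] by (intro lsc_max lsc_cmult lsc_open_indicator \<rho>1 \<eta> BBo)
 have [measurable]: "Borel (\<rho>1)" "Borel \<rho>" using \<rho>1 lsc lsc_measurable by auto
 have pr: "pint p \<rho> <= ennreal (2 * e)"
 proof -
  have "pint p \<rho> <= (\<integral>\<^sup>+x. enn_pow (ennreal \<eta> * \<rho>1 x) p + enn_pow (ennreal \<delta> * indicator BB x) p \<partial>lborel)"
   unfolding pint_def \<rho>_def by (intro nn_integral_mono) (auto simp: max_def)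
  also have "\<dots> = pint p (%x. ennreal \<eta> * \<rho>1 x) + (\<integral>\<^sup>+x. ennreal (\<delta> powr p) * indicator BB x \<partial>lborel)"
   unfolding pint_def enn_pow_mult_indicator[OF p] enn_pow_ennreal[OF less_imp_le[OF \<delta>(1)]]
   by (rule nn_integral_add) measurable
  also have "\<dots> = ennreal (\<eta> powr p) * pint p \<rho>1 + ennreal (\<delta> powr p) * emeasure lborel BB"
   using \<eta> p by (subst nn_integral_cmult_indicator) (auto simp: pint_cmult)
  also have "\<dots> <= ennreal e + ennreal e" by (intro add_mono \<eta> \<delta>)
  finally show ?thesis using e by (simp flip: ennreal_plus)
 qed
 obtain T where T: "open T" "Z \<subseteq> T" "emeasure lebesgue (T - Z) < ennreal e"
  by (rule sets_lebesgue_outer_open[of Z e]) (use Z e in auto)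
 define V where "V = T \<inter> ball 0 R"
 have V: "open V" "Z \<subseteq> V" "V \<subseteq> ball 0 R" using T Z by (auto simp: V_def)
 have [measurable]: "V \<in> sets borel" using V by simp
 have mV: "emeasure lborel V <= ennreal e"
 proof -
  have "emeasure lborel V = emeasure lebesgue V" by simp
  also have "\<dots> <= emeasure lebesgue ((T - Z) \<union> Z)" using T(1) Z(1) by (intro emeasure_mono) (auto simp: V_def)
  also have "\<dots> = emeasure lebesgue (T - Z)" using T(1) Z(1) by (intro emeasure_Un_null_set) auto
  finally show ?thesis using T(3) by (meson less_imp_le order_trans)
 qed
 obtain \<kappa> :: "nat => 'a => real" where \<kappa>: "\<And>i x. 0 <= \<kappa> i x" "\<And>i x. \<kappa> i x <= real i" "\<And>i x y. \<bar>\<kappa> i x - \<kappa> i y\<bar> <= real i * dist x y"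
  "\<And>i j x. i <= j ==> \<kappa> i x <= \<kappa> j x" "\<And>x. (SUP i. ennreal (\<kappa> i x)) = \<rho> x"
  "\<And>i x c d. \<forall>y. dist x y < d --> ennreal c <= \<rho> y ==> 0 <= c ==> c <= real i ==> c <= real i * d ==> c <= \<kappa> i x"
  by (rule lsc_approx[OF lsc]) (rule that)
 have c\<kappa>: "continuous_on UNIV (\<kappa> i)" for i
  by (rule lipschitz_on_continuous_on[of "real i"]) (use \<kappa>(3)[of i] in \<open>auto simp: lipschitz_on_def dist_real_def\<close>)
 have \<kappa>m[measurable]: "Borel (\<kappa> i)" for i by (rule borel_measurable_continuous_onI[OF c\<kappa>])
 define F where "F i x = enn2real (cost (\<kappa> i) V x)" for i x
 have Fcost: "ennreal (F i x) = cost (\<kappa> i) V x" for i x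
  unfolding F_def by (rule ennreal_enn2real) (rule le_less_trans[OF cost_le_1], simp)
 have F01: "0 <= F i x" "F i x <= 1" for i x
  using cost_le_1[of "\<kappa> i" V x] unfolding Fcost[symmetric] by (auto simp: F_def)
 have FV: "F i x <= indicator V x" for i x
  using cost_le_indicator[of "\<kappa> i" V x] F01[of i x] unfolding Fcost[symmetric] by (auto simp: indicator_def split: if_splits)
 have cF: "continuous_on UNIV (F i)" for i
  by (rule lipschitz_on_continuous_on[of "real i"])
   (use cost_lipschitz[OF \<kappa>m \<kappa>(2), of i V] in \<open>auto simp: lipschitz_on_def dist_real_def F_def\<close>)
 have [measurable]: "Borel (F i)" for i by (rule borel_measurable_continuous_onI[OF cF])
 define Fs where "Fs x = (SUP i. F i x)" for x
 have bdd: "bdd_above (range (%i. F i x))" for x using F01 by (auto intro!: bdd_aboveI[of _ 1])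
 have Fs_ge: "F i x <= Fs x" for i x unfolding Fs_def by (rule cSUP_upper[OF _ bdd]) simp
 have FsV: "Fs x <= indicator V x" for x unfolding Fs_def using FV by (intro cSUP_least) auto
 have Fs0: "0 <= Fs x" for x using F01(1)[of 0 x] Fs_ge[of 0 x] by linarith
 have Fsm: "Borel Fs" unfolding Fs_def[abs_def] by (rule borel_measurable_cSUP) (use bdd in auto)
 have uFs: "ugrad Fs \<rho>"
 proof -
  have "ugrad (%x. SUP i. F i x) (%x. SUP i. ennreal (\<kappa> i x))"
   by (rule ugrad_SUP) (use F01 cost_ugrad[OF \<kappa>m, of _ V] in \<open>auto simp: F_def[abs_def]\<close>)
  then show ?thesis by (simp add: \<kappa>(5) Fs_def[abs_def])
 qed
 define G where "G = (\<Union>i. {x. 1/2 < F i x})"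
 have "open G" unfolding G_def
  by (intro open_UN ballI open_Collect_less continuous_on_const cF)
 moreover have "Z \<subseteq> G"
 proof
  fix z assume z: "z \<in> Z"
  show "z \<in> G"
  proof (rule ccontr)
   assume "z \<notin> G"
   then have Fz: "F i z <= 1/2" for i unfolding G_def by (auto simp: not_less)
   \<comment> \<open>3/4 lies strictly between 1/2, the bound on the infimum, and 1, the price of
     stopping inside \<open>V\<close>; so a curve below it exists and must end outside
     \<open>V\<close>.\<close>
   have "\<exists>Y L. lip1 Y \<and> 0 <= L \<and> Y 0 = z \<and> lint (%x. ennreal (\<kappa> i x)) Y 0 L + indicator V (Y L) < ennreal (3/4)" for i
   proof -
    have "cost (\<kappa> i) V z < ennreal (3/4)" unfolding Fcost[symmetric] using Fz[of i] by (intro ennreal_lessI) auto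
    then show ?thesis unfolding cost_def INF_less_iff by auto
   qed
   then obtain Y L where Y: "\<And>i. lip1 (Y i)" "\<And>i. 0 <= L i" "\<And>i. Y i 0 = z"
    and cst: "\<And>i. lint (%x. ennreal (\<kappa> i x)) (Y i) 0 (L i) + indicator V (Y i (L i)) < ennreal (3/4)" by metis
   have out: "Y i (L i) \<notin> V" for i
   proof
    assume "Y i (L i) \<in> V"
    then have "ennreal 1 <= lint (%x. ennreal (\<kappa> i x)) (Y i) 0 (L i) + indicator V (Y i (L i))" by simp
    from le_less_trans[OF this cst] have "(1::real) < 3/4" by (subst (asm) ennreal_less_iff) auto
    then show False by simp
   qed
   have cst2: "lint (%x. ennreal (\<kappa> i x)) (Y i) 0 (L i) <= ennreal (3/4)" for i
    using cst[of i] out[of i] by simp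
   define X where "X i = {t\<in>{0..L i}. Y i t \<notin> V}" for i
   \<comment> \<open>First exit time from \<open>V\<close>. Up to it the weight is at least
     \<open>\<delta>\<close> for \<open>i >= 1\<close>, which bounds it by
     \<open>1 / \<delta>\<close>.\<close>
   define Ti where "Ti i = Inf (X i)" for i
   have Xc: "closed (X i)" for i
   proof -
    have "X i = {0..L i} \<inter> Y i -` (- V)" by (auto simp: X_def)
    then show ?thesis using lip1_continuous[OF Y(1)[of i]] V(1)
     by (auto intro!: closed_Int closed_vimage continuous_on_subset)
   qed
   have Xb: "bdd_below (X i)" "X i \<noteq> {}" for i using out[of i] Y(2)[of i] by (auto simp: X_def)
   have TX: "Ti i \<in> X i" for i unfolding Ti_def by (rule closed_contains_Inf[OF Xb(2,1) Xc])
   have Tin: "Y i t \<in> V" if "0 <= t" "t < Ti i" for i t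
   proof (rule ccontr)
    assume "Y i t \<notin> V"
    then have "t \<in> X i" using that TX[of i] by (auto simp: X_def)
    then have "Ti i <= t" unfolding Ti_def using Xb(1) by (intro cInf_lower)
    then show False using that by simp
   qed
   have \<delta>\<kappa>: "\<delta> <= \<kappa> i x" if "1 <= i" "x \<in> ball 0 R" for i x
   proof (rule \<kappa>(6)[of x 1])
    show "\<forall>y. dist x y < 1 --> ennreal \<delta> <= \<rho> y"
    proof (intro allI impI)
     fix y assume "dist x y < 1"
     then have "y \<in> BB" unfolding BB_def using that(2) dist_triangle[of 0 y x] by simp
     then show "ennreal \<delta> <= \<rho> y" by (simp add: \<rho>_def)
    qed
   qed (use that \<delta> in auto)
   define T' where "T' = 1 / \<delta>"
   have T': "0 < T'" using \<delta> by (simp add: T'_def)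
   have Tb: "0 <= Ti i \<and> Ti i <= T'" if "1 <= i" for i
   proof -
    have T0: "0 <= Ti i" "Ti i <= L i" using TX[of i] by (auto simp: X_def)
    have "ennreal (\<delta> * (Ti i - 0)) = lint (%_. ennreal \<delta>) (Y i) 0 (Ti i)"
     using T0 \<delta> by (intro lint_const[symmetric]) auto
    also have "\<dots> <= lint (%x. ennreal (\<kappa> i x)) (Y i) 0 (Ti i)"
    proof (rule lint_mono_AE)
     show "AE t in lborel. 0 <= t \<and> t <= Ti i --> ennreal \<delta> <= ennreal (\<kappa> i (Y i t))"
      using AE_lborel_singleton[of "Ti i"]
     proof eventually_elim
      case (elim t)
      then show ?case using Tin[of t i] \<delta>\<kappa>[OF that] V(3) by (auto intro!: ennreal_leI)
     qed
    qed
    also have "\<dots> <= lint (%x. ennreal (\<kappa> i x)) (Y i) 0 (L i)" using T0 by (intro lint_mono_interval) auto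
    also have "\<dots> <= ennreal (3/4)" by (rule cst2)
    finally have "\<delta> * Ti i <= 3/4" by (simp add: ennreal_le_iff)
    then have "Ti i <= T'" using \<delta> unfolding T'_def by (simp add: field_simps)
    then show ?thesis using T0 by simp
   qed
   \<comment> \<open>The lower bound \<open>\<delta>\<close> on \<open>\<kappa> i\<close> requires
     \<open>i >= 1\<close>, hence the curves \<open>Y (Suc n)\<close>.\<close>
   obtain g k where g: "continuous_on {0..T'} g" "strict_mono (k :: nat => nat)"
    and unif: "\<And>e. 0 < e ==> \<exists>N. \<forall>n x. n \<ge> N \<and> x \<in> {0..T'} --> norm (Y (Suc (k n)) x - g x) < e"
   proof (rule Arzela_Ascoli[of "{0..T'}" "%n. Y (Suc n)" "norm z + T'"])
    show "norm (Y (Suc n) x) <= norm z + T'" if "x \<in> {0..T'}" for n x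
    proof -
     have "dist (Y (Suc n) x) z <= \<bar>x - 0\<bar>" using Y(1)[of "Suc n"] Y(3)[of "Suc n"] unfolding lip1_def by metis
     then show ?thesis using that norm_triangle_sub[of "Y (Suc n) x" z] by (simp add: dist_norm)
    qed
    show "\<exists>d. 0 < d \<and> (\<forall>n y. y \<in> {0..T'} \<and> norm (x - y) < d --> norm (Y (Suc n) x - Y (Suc n) y) < e)" if "x \<in> {0..T'}" "0 < e" for x e
    proof (intro exI[of _ e] conjI allI impI that)
     fix n y assume y: "y \<in> {0..T'} \<and> norm (x - y) < e"
     have "dist (Y (Suc n) x) (Y (Suc n) y) <= \<bar>x - y\<bar>" using Y(1)[of "Suc n"] unfolding lip1_def by blast
     then show "norm (Y (Suc n) x - Y (Suc n) y) < e" using y by (simp add: dist_norm)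
    qed
   qed (use that in auto)
   have "\<exists>\<tau>\<in>{0..T'}. \<exists>m. strict_mono m \<and> ((%n. Ti (Suc (k n))) \<circ> m) \<longlonglongrightarrow> \<tau>"
    using compact_Icc[of 0 T'] unfolding compact_def using Tb by (metis Suc_le_mono atLeastAtMost_iff le0 One_nat_def)
   then obtain \<tau> m where \<tau>: "\<tau> \<in> {0..T'}" "strict_mono m" "((%n. Ti (Suc (k n))) \<circ> m) \<longlonglongrightarrow> \<tau>" by blast
   define J where "J n = Suc (k (m n))" for n
   have J: "n <= J n" for n using seq_suble[OF g(2), of "m n"] seq_suble[OF \<tau>(2), of n] by (simp add: J_def)
   have TJ: "(%n. Ti (J n)) \<longlonglongrightarrow> \<tau>" using \<tau>(3) by (simp add: J_def comp_def)
   have lim: "(%n. Y (J n) t) \<longlonglongrightarrow> g t" if tT: "t \<in> {0..T'}" for t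
   proof (rule LIMSEQ_I)
    fix e :: real assume "0 < e"
    then obtain N where N: "\<And>n. N <= n ==> norm (Y (Suc (k n)) t - g t) < e" using unif[of e] tT by blast
    have "norm (Y (J n) t - g t) < e" if "N <= n" for n
     unfolding J_def using seq_suble[OF \<tau>(2), of n] that by (intro N) simp
    then show "\<exists>no. \<forall>n\<ge>no. norm (Y (J n) t - g t) < e" by blast
   qed
   define \<zeta> where "\<zeta> t = g (max 0 (min T' t))" for t
   have \<zeta>g: "\<zeta> t = g t" if "t \<in> {0..T'}" for t using that by (simp add: \<zeta>_def)
   have lip: "lip1 \<zeta>" unfolding \<zeta>_def[abs_def]
   proof (rule clamp_lip1)
    fix s t assume st: "0 <= s" "s <= T'" "0 <= t" "t <= T'"
    have "(%n. dist (Y (J n) s) (Y (J n) t)) \<longlonglongrightarrow> dist (g s) (g t)" using st by (intro tendsto_dist lim) auto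
    moreover have "dist (Y (J n) s) (Y (J n) t) <= \<bar>s - t\<bar>" for n using Y(1)[of "J n"] unfolding lip1_def by blast
    ultimately show "dist (g s) (g t) <= \<bar>s - t\<bar>" by (intro LIMSEQ_le_const2) auto
   qed (use T' in simp)
   have \<zeta>0: "\<zeta> 0 = z"
   proof -
    have "(%n. Y (J n) 0) \<longlonglongrightarrow> g 0" using T' by (intro lim) auto
    then have "g 0 = z" unfolding Y(3) using LIMSEQ_unique[OF tendsto_const] by metis
    then show ?thesis using T' by (simp add: \<zeta>_def)
   qed
   have "\<zeta> \<tau> \<notin> V"
   proof -
    have "(%n. Y (J n) (Ti (J n)) - Y (J n) \<tau>) \<longlonglongrightarrow> 0"
    proof (rule Lim_null_comparison)
     show "eventually (%n. norm (Y (J n) (Ti (J n)) - Y (J n) \<tau>) <= \<bar>Ti (J n) - \<tau>\<bar>) sequentially"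
     proof (rule always_eventually, rule allI)
      fix n
      show "norm (Y (J n) (Ti (J n)) - Y (J n) \<tau>) <= \<bar>Ti (J n) - \<tau>\<bar>"
       using Y(1)[of "J n"] unfolding lip1_def dist_norm by blast
     qed
     show "(%n. \<bar>Ti (J n) - \<tau>\<bar>) \<longlonglongrightarrow> 0" using TJ by (simp add: LIM_zero tendsto_rabs_zero)
    qed
    from tendsto_add[OF this lim[OF \<tau>(1)]]
    have "(%n. Y (J n) (Ti (J n))) \<longlonglongrightarrow> \<zeta> \<tau>" using \<zeta>g[OF \<tau>(1)] by simp
    then have "\<zeta> \<tau> \<in> - V"
     using closed_sequentially[of "- V" "%n. Y (J n) (Ti (J n))" "\<zeta> \<tau>"] V(1) TX by (simp add: X_def closed_Compl)
    then show ?thesis by simp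
   qed
   then have zt: "\<zeta> \<tau> \<noteq> z" using z V(2) by blast
   define D where "D = dist (\<zeta> \<tau>) z"
   have D: "0 < D" "D <= \<tau>" using zt lip[unfolded lip1_def, rule_format, of \<tau> 0] \<zeta>0 \<tau>(1) by (auto simp: D_def)
   \<comment> \<open>Stopping before \<open>\<tau>\<close> makes \<open>\<tau>'\<close> precede the
     exit times for large indices. The distance \<open>D\<close> cannot be covered in the remaining
     time \<open>D / 2\<close>, so the limit curve is already away from \<open>z\<close> at
     \<open>\<tau>'\<close>.\<close>
   define \<tau>' where "\<tau>' = \<tau> - D / 2"
   have \<tau>': "0 <= \<tau>'" "\<tau>' < \<tau>" "\<tau>' <= T'" using D \<tau>(1) by (auto simp: \<tau>'_def)
   have "\<zeta> \<tau>' \<noteq> \<zeta> 0"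
   proof
    assume "\<zeta> \<tau>' = \<zeta> 0"
    then have "D <= \<bar>\<tau> - \<tau>'\<bar>" using lip[unfolded lip1_def, rule_format, of \<tau> \<tau>'] \<zeta>0 by (simp add: D_def)
    then show False using D by (simp add: \<tau>'_def)
   qed
   then obtain \<sigma> l where \<sigma>: "arclength_curve_in UNIV \<sigma> l" "\<sigma> 0 = \<zeta> 0"
    and rep: "\<And>h. continuous_on UNIV h ==> (\<And>x. 0 <= h x) ==> lint (%x. ennreal (h x)) \<sigma> 0 l <= lint (%x. ennreal (h x)) \<zeta> 0 \<tau>'"
    using arclength_reparametrization[OF lip \<tau>'(1), of \<tau>'] \<tau>'(1) by (metis atLeastAtMost_iff order_refl)
   \<comment> \<open>With \<open>j\<close> fixed, \<open>\<kappa> j\<close> is continuous and is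
     dominated by the weight of the n-th curve for large \<open>n\<close>, so the bound passes to
     the limit; monotone convergence in \<open>j\<close> then recovers
     \<open>\<rho>\<close>.\<close>
   have bound: "lint (%x. ennreal (\<kappa> j x)) \<zeta> 0 \<tau>' <= ennreal (3/4)" for j
   proof (rule LIMSEQ_le_const2)
    show "(%n. lint (%x. ennreal (\<kappa> j x)) (Y (J n)) 0 \<tau>') \<longlonglongrightarrow> lint (%x. ennreal (\<kappa> j x)) \<zeta> 0 \<tau>'"
     unfolding lint_def
    proof (rule nn_integral_dominated_convergence[where w="%t. ennreal (real j) * indicator {0..\<tau>'} t"])
     have m: "Borel (%t. ennreal (\<kappa> j (Y' t)))" if "lip1 Y'" for Y'
      by (rule lip1_measurable[OF that, of "%x. ennreal (\<kappa> j x)"]) measurable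
     note [measurable] = m[OF lip] m[OF Y(1)]
     show "(%t. ennreal (\<kappa> j (Y (J n) t)) * indicator {0..\<tau>'} t) \<in> borel_measurable lborel" for n by measurable
     show "(%t. ennreal (\<kappa> j (\<zeta> t)) * indicator {0..\<tau>'} t) \<in> borel_measurable lborel" by measurable
     show "AE t in lborel. ennreal (\<kappa> j (Y (J n) t)) * indicator {0..\<tau>'} t <= ennreal (real j) * indicator {0..\<tau>'} t" for n
      by (intro AE_I2 mult_right_mono ennreal_leI \<kappa>) simp
     show "(\<integral>\<^sup>+t. ennreal (real j) * indicator {0..\<tau>'} t \<partial>lborel) < \<infinity>"
      using \<tau>'(1) by (subst nn_integral_cmult_indicator) (auto simp: ennreal_mult_less_top)
     show "AE t in lborel. (%n. ennreal (\<kappa> j (Y (J n) t)) * indicator {0..\<tau>'} t) \<longlonglongrightarrow> ennreal (\<kappa> j (\<zeta> t)) * indicator {0..\<tau>'} t"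
     proof (rule AE_I2)
      fix t
      show "(%n. ennreal (\<kappa> j (Y (J n) t)) * indicator {0..\<tau>'} t) \<longlonglongrightarrow> ennreal (\<kappa> j (\<zeta> t)) * indicator {0..\<tau>'} t"
      proof (cases "t \<in> {0..\<tau>'}")
       case True
       then have t: "t \<in> {0..T'}" using \<tau>' by auto
       have "(%n. \<kappa> j (Y (J n) t)) \<longlonglongrightarrow> \<kappa> j (g t)"
        by (rule continuous_on_tendsto_compose[OF c\<kappa> lim[OF t]]) auto
       then show ?thesis using True \<zeta>g[OF t] by (simp add: tendsto_ennrealI)
      qed simp
     qed
    qed measurable
    have "eventually (%n. \<tau>' < Ti (J n)) sequentially" by (rule order_tendstoD(1)[OF TJ \<tau>'(2)])
    then obtain N where N: "\<And>n. N <= n ==> \<tau>' < Ti (J n)" by (auto simp: eventually_sequentially)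
    have "lint (%x. ennreal (\<kappa> j x)) (Y (J n)) 0 \<tau>' <= ennreal (3/4)" if n: "max N j <= n" for n
    proof -
     have "lint (%x. ennreal (\<kappa> j x)) (Y (J n)) 0 \<tau>' <= lint (%x. ennreal (\<kappa> (J n) x)) (Y (J n)) 0 \<tau>'"
      using n J[of n] by (intro lint_mono ennreal_leI \<kappa>(4)) auto
     also have "\<dots> <= lint (%x. ennreal (\<kappa> (J n) x)) (Y (J n)) 0 (L (J n))"
      using N[of n] n TX[of "J n"] by (intro lint_mono_interval) (auto simp: X_def)
     also have "\<dots> <= ennreal (3/4)" by (rule cst2)
     finally show ?thesis .
    qed
    then show "\<exists>N. \<forall>n\<ge>N. lint (%x. ennreal (\<kappa> j x)) (Y (J n)) 0 \<tau>' <= ennreal (3/4)" by blast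
   qed
   have "lint \<rho> \<sigma> 0 l = (\<integral>\<^sup>+t. (SUP j. ennreal (\<kappa> j (\<sigma> t)) * indicator {0..l} t) \<partial>lborel)"
    unfolding lint_def by (intro nn_integral_cong) (auto simp: \<kappa>(5)[symmetric] indicator_def)
   also have "\<dots> = (SUP j. \<integral>\<^sup>+t. ennreal (\<kappa> j (\<sigma> t)) * indicator {0..l} t \<partial>lborel)"
   proof (rule nn_integral_monotone_convergence_SUP)
    show "incseq (%j t. ennreal (\<kappa> j (\<sigma> t)) * indicator {0..l} t)"
     by (auto simp: incseq_def le_fun_def intro!: mult_right_mono ennreal_leI \<kappa>(4))
    show "(%t. ennreal (\<kappa> j (\<sigma> t)) * indicator {0..l} t) \<in> borel_measurable lborel" for j
     using measurable_compose_curve[of "%x. ennreal (\<kappa> j x)", OF _ \<sigma>(1)] by simp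
   qed
   also have "\<dots> <= ennreal (3/4)"
   proof (rule SUP_least)
    fix j
    show "(\<integral>\<^sup>+t. ennreal (\<kappa> j (\<sigma> t)) * indicator {0..l} t \<partial>lborel) <= ennreal (3/4)"
     using order_trans[OF rep[OF c\<kappa> \<kappa>(1)] bound, of j] by (simp add: lint_def)
   qed
   finally have "lint \<rho> \<sigma> 0 l < \<infinity>" by (rule le_less_trans) simp
   moreover have "ennreal \<eta> * lint \<rho>1 \<sigma> 0 l <= lint \<rho> \<sigma> 0 l"
   proof -
    have "ennreal \<eta> * lint \<rho>1 \<sigma> 0 l = lint (%x. ennreal \<eta> * \<rho>1 x) \<sigma> 0 l"
     by (rule lint_cmult[symmetric, OF _ \<sigma>(1)]) auto
    also have "\<dots> <= lint \<rho> \<sigma> 0 l" by (intro lint_mono) (simp add: \<rho>_def)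
    finally show ?thesis .
   qed
   ultimately have "ennreal \<eta> * lint \<rho>1 \<sigma> 0 l < \<infinity>" by (rule le_less_trans[rotated])
   then have fin1: "lint \<rho>1 \<sigma> 0 l < \<infinity>" using \<eta>(1) by (auto simp: ennreal_mult_less_top)
   have l: "0 < l" using \<sigma>(1) by (simp add: arclength_curve_in_def)
   have "lint \<rho>0 \<sigma> 0 l <= lint (%x. ennreal 1 + \<rho>1 x) \<sigma> 0 l" using \<rho>1(3) by (intro lint_mono) simp
   also have "\<dots> = lint (%x. ennreal 1) \<sigma> 0 l + lint \<rho>1 \<sigma> 0 l"
    by (rule lint_add_fun[OF _ _ \<sigma>(1)]) (use l in auto)
   also have "\<dots> < \<infinity>" using fin1 l by (subst lint_const) auto
   finally have "\<sigma> ` {0..l} \<inter> Z = {}" by (rule av[OF \<sigma>(1)])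
   moreover have "\<sigma> 0 \<in> \<sigma> ` {0..l}" using l by auto
   ultimately show False using z \<sigma>(2) \<zeta>0 by auto
  qed
 qed
 moreover have "Cap p G <= ennreal e0"
 proof -
  have "Cap p G <= pint p (%x. ennreal \<bar>2 * Fs x\<bar>) + pint p (%x. ennreal 2 * \<rho> x)"
  proof (rule Cap_le)
   show "(%x. 2 * Fs x) \<in> borel_measurable lebesgue" using Fsm by (intro measurable_completion) measurable
   show "ugrad (%x. 2 * Fs x) (%x. ennreal 2 * \<rho> x)" by (rule ugrad_scale[OF uFs]) simp
   fix x assume "x \<in> G"
   then obtain i where "1/2 < F i x" by (auto simp: G_def)
   then show "1 <= 2 * Fs x" using Fs_ge[of i x] by linarith
  qed
  also have "\<dots> <= ennreal (2 powr p) * ennreal e + ennreal (2 powr p) * ennreal (2 * e)"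
  proof (intro add_mono)
   have "pint p (%x. ennreal \<bar>2 * Fs x\<bar>) <= pint p (%x. ennreal 2 * indicator V x)"
   proof (rule pint_mono[OF p])
    show "ennreal \<bar>2 * Fs x\<bar> <= ennreal 2 * indicator V x" for x
     using FsV[of x] Fs0[of x] ennreal_leI[of "2 * Fs x" 2] by (auto simp: indicator_def split: if_splits)
   qed
   also have "\<dots> = ennreal (2 powr p) * emeasure lborel V"
    unfolding pint_def enn_pow_mult_indicator[OF p] by (subst nn_integral_cmult_indicator) (auto simp: enn_pow_def)
   also have "\<dots> <= ennreal (2 powr p) * ennreal e" by (intro mult_left_mono mV) simp
   finally show "pint p (%x. ennreal \<bar>2 * Fs x\<bar>) <= ennreal (2 powr p) * ennreal e" .
   show "pint p (%x. ennreal 2 * \<rho> x) <= ennreal (2 powr p) * ennreal (2 * e)"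
    using pr p by (subst pint_cmult) (auto intro!: mult_left_mono)
  qed
  also have "\<dots> = ennreal (2 powr p * e + 2 powr p * (2 * e))"
   using e by (subst ennreal_plus) (auto simp: ennreal_mult')
  also have "2 powr p * e + 2 powr p * (2 * e) = e0" by (simp add: e_def field_simps)
  finally show ?thesis .
 qed
 ultimately show thesis by (rule that)
qed

text \<open>The parts of \<open>Z\<close> in the balls of integer radius receive neighbourhoods of
  geometrically decreasing capacity, whose union is taken.\<close>

lemma exceptional_open_nbhd:
 fixes Z :: "'a::euclidean_space set"
 assumes Z: "Z \<in> null_sets lebesgue" and pz: "pae p (%Y l. Y ` {0..l} \<inter> Z = {})" and p: "0 < p" and e: "0 < e"
 obtains G where "open G" "Z \<subseteq> G" "Cap p G < ennreal e"
proof -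
 have "\<exists>G. open G \<and> Z \<inter> ball 0 (real n) \<subseteq> G \<and> Cap p G < ennreal ((e/2) * (1/2) ^ Suc n)" for n
 proof -
  define d where "d = (e/4) * (1/2) ^ Suc n"
  have d: "0 < d" "d < (e/2) * (1/2) ^ Suc n" using e by (auto simp: d_def)
  have n: "Z \<inter> ball 0 (real n) \<in> null_sets lebesgue"
   by (rule null_sets_completion_subset[OF _ Z]) auto
  obtain G where "open G" "Z \<inter> ball 0 (real n) \<subseteq> G" "Cap p G <= ennreal d"
   by (rule exceptional_bounded_open_nbhd[OF n _ pae_mono[OF pz] p d(1), of "real n"]) auto
  then show ?thesis using ennreal_lessI[OF _ d(2)] d by (meson le_less_trans less_trans)
 qed
 then obtain G where G: "\<And>n. open (G n)" "\<And>n. Z \<inter> ball 0 (real n) \<subseteq> G n" "\<And>n. Cap p (G n) < ennreal ((e/2) * (1/2) ^ Suc n)"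
  by metis
 have "Z \<subseteq> (\<Union>n. G n)"
 proof
  fix z assume "z \<in> Z"
  obtain n :: nat where "norm z < n" using reals_Archimedean2 by blast
  then have "z \<in> Z \<inter> ball 0 (real n)" using \<open>z \<in> Z\<close> by simp
  then show "z \<in> (\<Union>n. G n)" using G(2) by blast
 qed
 moreover have "Cap p (\<Union>n. G n) <= ennreal (e/2)" "open (\<Union>n. G n)"
  using open_Union_small[of G p "e/2", OF G(1,3)] p e by auto
 moreover have "ennreal (e/2) < ennreal e" using e by (intro ennreal_lessI) auto
 ultimately show thesis using that by (meson le_less_trans)
qed

lemma exceptional_Cap_zero:
 assumes "Z \<in> null_sets lebesgue" "pae p (%Y l. Y ` {0..l} \<inter> Z = {})" "0 < p"
 shows "Cap p Z = 0"
proof (rule le_inverse_Suc_imp_0)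
 fix n :: nat
 obtain G where "Z \<subseteq> G" "Cap p G < ennreal (1 / Suc n)"
  by (rule exceptional_open_nbhd[OF assms, of "1 / Suc n"]) auto
 then show "Cap p Z <= ennreal (1 / Suc n)" using Cap_mono[of Z G p] by (meson less_imp_le order_trans)
qed

section \<open>Quasicontinuity of bounded Newtonian functions\<close>

lemma AE_interval_exists_near:
 fixes P :: "real => bool"
 assumes "AE t in lborel. a <= t \<and> t <= b --> P t" "a < b" "s \<in> {a..b}" "0 < d"
 obtains t where "t \<in> {a..b}" "\<bar>t - s\<bar> <= d" "P t"
proof -
 define I where "I = {max a (s - d)..min b (s + d)}"
 have "emeasure lborel I > 0" unfolding I_def using assms by (subst emeasure_lborel_Icc) auto
 have "\<exists>t\<in>I. P t"
 proof (rule ccontr)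
  assume *: "\<not> (\<exists>t\<in>I. P t)"
  have "AE t in lborel. t \<notin> I"
   using assms(1) by eventually_elim (use * in \<open>auto simp: I_def\<close>)
  then have "emeasure lborel I = 0" by (subst (asm) AE_iff_measurable[of I]) (auto simp: I_def)
  with \<open>emeasure lborel I > 0\<close> show False by simp
 qed
 then obtain t where "t \<in> I" "P t" by blast
 then show thesis using that[of t] by (auto simp: I_def abs_le_iff)
qed

lemma telescoping_bound:
 fixes a :: "nat => real"
 assumes "\<And>k. m <= k ==> \<bar>a (Suc k) - a k\<bar> <= (1/2) ^ k" "a \<longlonglongrightarrow> L" "m <= k"
 shows "\<bar>a k - L\<bar> <= 2 * (1/2) ^ k"
proof -
 have "\<bar>a (k + j) - a k\<bar> <= 2 * (1/2) ^ k - 2 * (1/2) ^ (k + j)" for j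
 proof (induction j)
  case (Suc j)
  have "\<bar>a (Suc (k + j)) - a (k + j)\<bar> <= (1/2) ^ (k + j)" using assms by (intro assms(1)) simp
  moreover have "2 * (1/2::real) ^ (k + Suc j) = (1/2) ^ (k + j)" by simp
  moreover have "\<bar>a (k + Suc j) - a k\<bar> <= \<bar>a (Suc (k + j)) - a (k + j)\<bar> + \<bar>a (k + j) - a k\<bar>" by simp
  ultimately show ?case using Suc by argo
 qed simp
 then have le: "\<bar>a (k + j) - a k\<bar> <= 2 * (1/2) ^ k" for j by (rule order_trans) simp
 have "(%j. \<bar>a (k + j) - a k\<bar>) \<longlonglongrightarrow> \<bar>L - a k\<bar>"
  using LIMSEQ_ignore_initial_segment[OF assms(2), of k] by (intro tendsto_intros) (simp add: add.commute)
 then have "\<bar>L - a k\<bar> <= 2 * (1/2) ^ k" by (rule LIMSEQ_le_const2) (use le in blast)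
 then show ?thesis by (simp add: abs_minus_commute)
qed

lemma weakly_diff_moll:
 assumes wd: "weakly_diff f w" and f: "locint f" and w: "locint w" and r: "0 < r"
 shows "(moll r f has_derivative (%h. moll r w x \<bullet> h)) (at x)"
proof (rule moll_weak_gradient[OF _ f _ w _ _ r])
 show "weak_gradient UNIV f w"
  by (rule weakly_diff_weak_gradient[OF wd]) (use f w in \<open>auto dest: locint_measurable\<close>)
qed auto

text \<open>Successive mollifications differ by more than \<open>(1/2) ^ k\<close> only on open sets
  of small capacity, so off the union of a tail they converge uniformly. Their limit is
  \<open>f\<close> off a null set \<open>Z\<close>, and \<open>Z\<close> is exceptional: along
  almost every curve the mollifications and \<open>f\<close> share the modulus of continuity given
  by \<open>?gH\<close>, so convergence at almost every parameter spreads to every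
  parameter.\<close>

theorem newtonian_quasicontinuous:
 fixes f :: "'a::euclidean_space => real"
 assumes f: "f \<in> borel_measurable lebesgue" "\<And>x. \<bar>f x\<bar> <= M" "pint p (%x. ennreal \<bar>f x\<bar>) < \<infinity>"
  and u: "ugrad f g" and gp: "pint p g < \<infinity>" and p: "1 < p" and e: "0 < e"
 obtains G where "open G" "Cap p G < ennreal e" "continuous_on (- G) f"
proof -
 have p0: "0 < p" using p by simp
 have gm: "Borel g" using u by (rule ugrad_measurable)
 obtain f' where f': "Borel f'" "\<And>x. \<bar>f' x\<bar> <= M" "AE x in lborel. f x = f' x"
  by (rule borel_version_bounded[OF f(1,2)]) (rule that)
 have fp: "pint p (%x. ennreal \<bar>f' x\<bar>) < \<infinity>"
 proof -
  have "AE x in lborel. ennreal \<bar>f' x\<bar> = ennreal \<bar>f x\<bar>" using f'(3) by eventually_elim simp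
  from pint_cong_AE[OF this, of p] show ?thesis using f(3) by simp
 qed
 obtain w where w: "Borel w" "weakly_diff f' w" "AE x in lborel. ennreal (norm (w x)) <= g x"
  by (rule newtonian_weakly_diff[OF u gp p f'(1,2,3) fp]) (rule that)
 have wp: "pnorm p w < \<infinity>" by (rule le_less_trans[OF pint_mono_AE[OF p0 w(3)] gp])
 have fp': "pnorm p f' < \<infinity>" using fp by simp
 have lf: "locint f'" by (rule locint_Lp[OF f'(1) _ fp']) (use p in simp)
 have lw: "locint w" by (rule locint_Lp[OF w(1) _ wp]) (use p in simp)
 note [measurable] = f'(1) w(1)
 obtain r where r: "\<And>k::nat. 0 < r k" "r \<longlonglongrightarrow> 0"
  and rf: "\<And>k. pnorm p (%x. moll (r k) f' x - f' x) <= ennreal (((1/4) ^ Suc k) powr p)"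
  and rw: "\<And>k. pnorm p (%x. moll (r k) w x - w x) <= ennreal (((1/4) ^ Suc k) powr p)"
  by (rule fast_radii[OF f'(1) fp' w(1) wp p]) (rule that)
 define F where "F k = moll (r k) f'" for k
 define W where "W k = moll (r k) w" for k
 have FW: "(F k has_derivative (%h. W k x \<bullet> h)) (at x)" for k x
  unfolding F_def W_def by (rule weakly_diff_moll[OF w(2) lf lw r(1)])
 have cW: "continuous_on UNIV (W k)" and cF: "continuous_on UNIV (F k)" for k
  unfolding W_def F_def by (rule moll_continuous[OF lw r(1)], rule moll_continuous[OF lf r(1)])
 have [measurable]: "Borel (F k)" "Borel (W k)" for k
  by (rule borel_measurable_continuous_onI[OF cF], rule borel_measurable_continuous_onI[OF cW])
 define A where "A k = {x. (1/2) ^ k < \<bar>F (Suc k) x - F k x\<bar>}" for k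
 have oA: "open (A k)" for k unfolding A_def by (intro open_Collect_less continuous_intros cF)
 have diffp: "pnorm p (%x. a (Suc k) x - a k x) <= ennreal (2 * 2 powr p * ((1/4) ^ Suc k) powr p)"
  if [measurable]: "\<And>k. Borel (a k)" "Borel b"
   and ab: "\<And>k. pnorm p (%x. a k x - b x) <= ennreal (((1/4) ^ Suc k) powr p)"
  for a :: "nat => 'a => 'b::euclidean_space" and b k
 proof -
  have "pnorm p (%x. a (Suc k) x - a k x) <= pint p (%x. ennreal (norm (a (Suc k) x - b x)) + ennreal (norm (a k x - b x)))"
  proof (rule pint_mono[OF p0])
   fix x
   have "norm (a (Suc k) x - a k x) <= norm (a (Suc k) x - b x) + norm (a k x - b x)"
    using norm_triangle_ineq4[of "a (Suc k) x - b x" "a k x - b x"] by simp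
   from ennreal_leI[OF this] show "ennreal (norm (a (Suc k) x - a k x)) <= ennreal (norm (a (Suc k) x - b x)) + ennreal (norm (a k x - b x))" by simp
  qed
  also have "\<dots> <= ennreal (2 powr p) * (pnorm p (%x. a (Suc k) x - b x) + pnorm p (%x. a k x - b x))"
   by (rule pint_add_le) (use p0 in auto)
  also have "\<dots> <= ennreal (2 powr p) * (ennreal (((1/4) ^ Suc k) powr p) + ennreal (((1/4) ^ Suc k) powr p))"
  proof (intro mult_left_mono add_mono ab order_trans[OF ab[of "Suc k"]] ennreal_leI powr_mono2)
   show "(1/4::real) ^ Suc (Suc k) <= (1/4) ^ Suc k" by (rule power_decreasing) auto
  qed (use p0 in auto)
  also have "\<dots> = ennreal (2 * 2 powr p * ((1/4) ^ Suc k) powr p)"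
   by (simp add: ennreal_mult' mult_ac flip: ennreal_plus mult_2)
  finally show ?thesis .
 qed
 \<comment> \<open>The bound of \<open>diffp\<close> enters twice, for values and for gradients,
   whence the 4. Its factor \<open>2 powr p\<close> and the scaling by \<open>2 ^ k\<close> combine
   with \<open>(1/4) ^ Suc k\<close> to \<open>(1/2) ^ Suc k\<close>, whose exponent
   \<open>p\<close> may be dropped because the base is at most 1 and \<open>p > 1\<close>.\<close>
 have capA: "Cap p (A k) <= ennreal (4 * (1/2) ^ Suc k)" for k
 proof -
  let ?f = "%x. F (Suc k) x - F k x" and ?w = "%x. W (Suc k) x - W k x"
  have ug: "ugrad (%x. 2 ^ k * \<bar>?f x\<bar>) (%x. ennreal (2 ^ k) * ennreal (norm (?w x)))"
  proof (rule ugrad_scale)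
   have "ugrad ?f (%x. ennreal (norm (?w x)))"
   proof (rule C1_ugrad)
    show "(?f has_derivative (%h. ?w x \<bullet> h)) (at x)" for x
     by (rule has_derivative_eq_rhs[OF has_derivative_diff[OF FW FW]]) (auto simp: inner_diff_left)
   qed (intro continuous_intros cW)
   then show "ugrad (%x. \<bar>?f x\<bar>) (%x. ennreal (norm (?w x)))" by (rule ugrad_contraction) simp
  qed simp
  have "Cap p (A k) <= pint p (%x. ennreal \<bar>2 ^ k * \<bar>?f x\<bar>\<bar>) + pint p (%x. ennreal (2 ^ k) * ennreal (norm (?w x)))"
  proof (rule Cap_le[OF _ _ ug])
   have m: "(%x. 2 ^ k * \<bar>?f x\<bar>) \<in> borel_measurable lborel" by measurable
   show "(%x. 2 ^ k * \<bar>?f x\<bar>) \<in> borel_measurable lebesgue" by (rule measurable_completion[OF m])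
   fix x assume "x \<in> A k"
   then have "2 ^ k * (1/2) ^ k <= 2 ^ k * \<bar>?f x\<bar>" unfolding A_def by (intro mult_left_mono) auto
   then show "1 <= 2 ^ k * \<bar>?f x\<bar>" by (simp add: power_mult_distrib[symmetric])
  qed
  also have "(%x. ennreal \<bar>2 ^ k * \<bar>?f x\<bar>\<bar>) = (%x. ennreal (2 ^ k) * ennreal (norm (?f x)))"
   by (auto simp: fun_eq_iff abs_mult ennreal_mult')
  also have "pint p (%x. ennreal (2 ^ k) * ennreal (norm (?f x))) + pint p (%x. ennreal (2 ^ k) * ennreal (norm (?w x)))
   = ennreal ((2 ^ k) powr p) * (pnorm p (%x. ?f x) + pnorm p (%x. ?w x))"
   using p0 by (subst (1 2) pint_cmult) (auto simp: distrib_left)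
  also have "\<dots> <= ennreal ((2 ^ k) powr p) * (ennreal (2 * 2 powr p * ((1/4) ^ Suc k) powr p) + ennreal (2 * 2 powr p * ((1/4) ^ Suc k) powr p))"
  proof (intro mult_left_mono add_mono)
   show "pnorm p (%x. ?f x) <= ennreal (2 * 2 powr p * ((1/4) ^ Suc k) powr p)"
    by (rule diffp[of F f', OF borel_measurable_continuous_onI[OF cF] f'(1)]) (use rf in \<open>auto simp: F_def\<close>)
   show "pnorm p (%x. ?w x) <= ennreal (2 * 2 powr p * ((1/4) ^ Suc k) powr p)"
    by (rule diffp[of W w, OF borel_measurable_continuous_onI[OF cW] w(1)]) (use rw in \<open>auto simp: W_def\<close>)
  qed simp
  also have "\<dots> = ennreal (4 * ((2 ^ k) powr p * 2 powr p * ((1/4) ^ Suc k) powr p))"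
   by (subst ennreal_plus[symmetric], simp, simp, subst ennreal_mult'[symmetric], simp, intro arg_cong[where f=ennreal])
    (simp add: algebra_simps del: power_Suc)
  also have "(2 ^ k) powr p * 2 powr p * ((1/4) ^ Suc k) powr p = ((1/2) ^ Suc k) powr p"
  proof -
   have "(2::real) ^ k * 2 * (1/4) ^ Suc k = (1/2) ^ Suc k"
    by (simp add: power_mult_distrib[symmetric] mult.commute[of _ 2] flip: power_Suc)
   then show ?thesis by (simp add: powr_mult[symmetric] del: power_Suc)
  qed
  also have "ennreal (4 * ((1/2) ^ Suc k) powr p) <= ennreal (4 * (1/2) ^ Suc k)"
  proof (intro ennreal_leI mult_left_mono)
   have "(1/2::real) ^ Suc k <= 1" by (rule power_le_one) auto
   then have "((1/2::real) ^ Suc k) powr p <= ((1/2) ^ Suc k) powr 1" using p by (intro powr_mono') auto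
   then show "((1/2::real) ^ Suc k) powr p <= (1/2) ^ Suc k" by simp
  qed simp
  finally show ?thesis .
 qed
 define Z where "Z = {x. \<not> (%k. F k x) \<longlonglongrightarrow> f x}"
 have limF: "AE x in lborel. (%k. F k x) \<longlonglongrightarrow> f x"
  using fast_moll(1)[OF f'(1) fp' p r(1) rf] f'(3) by eventually_elim (simp add: F_def)
 have Z0: "Z \<in> null_sets lebesgue"
 proof -
  obtain N where N: "N \<in> null_sets lborel" "Z \<subseteq> N"
   using limF by (rule AE_E) (auto simp: null_sets_def Z_def intro: that)
  show ?thesis by (rule null_sets_completion_subset[OF N(2)]) (rule null_sets_completionI[OF N(1)])
 qed
 obtain H where H: "Borel H" "pint p (%x. ennreal (H x)) < \<infinity>" "AE x in lborel. \<forall>k. norm (W k x) <= H x"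
  using fast_moll(2)[OF w(1) wp p r(1) rw] unfolding W_def by blast
 note [measurable] = H(1) gm
 let ?gH = "%x. g x + ennreal (H x)"
 have gHm: "Borel (?gH)" by measurable
 have "pae p (%Y l. lint ?gH Y 0 l < \<infinity> \<and> (AE t in lborel. 0 <= t \<and> t <= l --> (\<forall>k. norm (W k (Y t)) <= H (Y t)))
   \<and> (AE t in lborel. 0 <= t \<and> t <= l --> (%k. F k (Y t)) \<longlonglongrightarrow> f (Y t)))"
  by (intro pae_conj pae_finite pae_null H(3) limF pint_add_finite gp H(2) p0 gHm) measurable
 then have pz: "pae p (%Y l. Y ` {0..l} \<inter> Z = {})"
 proof (rule pae_mono)
  fix Y :: "real => 'a" and l
  assume c: "arclength_curve_in UNIV Y l" and *: "lint ?gH Y 0 l < \<infinity> \<and> (AE t in lborel. 0 <= t \<and> t <= l --> (\<forall>k. norm (W k (Y t)) <= H (Y t)))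
   \<and> (AE t in lborel. 0 <= t \<and> t <= l --> (%k. F k (Y t)) \<longlonglongrightarrow> f (Y t))"
  have l: "0 < l" using c by (simp add: arclength_curve_in_def)
  have both: "ennreal \<bar>F k (Y a) - F k (Y b)\<bar> <= lint ?gH Y a b" "ennreal \<bar>f (Y a) - f (Y b)\<bar> <= lint ?gH Y a b"
   if ab: "0 <= a" "a <= b" "b <= l" for a b k
  proof -
   have "ennreal \<bar>F k (Y a) - F k (Y b)\<bar> <= lint (%x. ennreal (norm (W k x))) Y a b"
    by (rule ugrad_subcurve[OF C1_ugrad[OF FW cW] c ab])
   also have "\<dots> <= lint ?gH Y a b"
   proof (rule lint_mono_AE)
    show "AE t in lborel. a <= t \<and> t <= b --> ennreal (norm (W k (Y t))) <= g (Y t) + ennreal (H (Y t))"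
     using conjunct1[OF conjunct2[OF *]]
    proof eventually_elim
     case (elim t)
     show ?case
     proof
      assume "a <= t \<and> t <= b"
      then have "norm (W k (Y t)) <= H (Y t)" using elim ab by auto
      then have "ennreal (norm (W k (Y t))) <= ennreal (H (Y t))" by (rule ennreal_leI)
      then show "ennreal (norm (W k (Y t))) <= g (Y t) + ennreal (H (Y t))" by (rule order_trans) simp
     qed
    qed
   qed
   finally show "ennreal \<bar>F k (Y a) - F k (Y b)\<bar> <= lint ?gH Y a b" .
   show "ennreal \<bar>f (Y a) - f (Y b)\<bar> <= lint ?gH Y a b"
    by (rule order_trans[OF ugrad_subcurve[OF u c ab]]) (intro lint_mono, simp)
  qed
  have "(%k. F k (Y s)) \<longlonglongrightarrow> f (Y s)" if s: "s \<in> {0..l}" for s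
  proof (rule LIMSEQ_I)
   fix e :: real assume e: "0 < e"
   obtain d where d: "d > 0" "\<And>a b. 0 <= a ==> b <= l ==> s - d <= a ==> b <= s + d ==> lint ?gH Y a b < ennreal (e / 4)"
    by (rule lint_small[OF gHm c conjunct1[OF *], of "ennreal (e / 4)" s]) (use e in \<open>auto intro: that\<close>)
   obtain t where t: "t \<in> {0..l}" "\<bar>t - s\<bar> <= d" "(%k. F k (Y t)) \<longlonglongrightarrow> f (Y t)"
    by (rule AE_interval_exists_near[OF conjunct2[OF conjunct2[OF *]] l s d(1)]) (rule that)
   have close: "\<bar>F k (Y s) - F k (Y t)\<bar> <= e / 4" "\<bar>f (Y s) - f (Y t)\<bar> <= e / 4" for k
   proof -
    define a b where "a = min s t" and "b = max s t"
    have ab: "0 <= a" "a <= b" "b <= l" "s - d <= a" "b <= s + d" using s t by (auto simp: a_def b_def abs_le_iff)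
    have small: "lint ?gH Y a b < ennreal (e / 4)" by (rule d(2)[OF ab(1,3,4,5)])
    have "\<bar>F k (Y a) - F k (Y b)\<bar> <= e / 4" "\<bar>f (Y a) - f (Y b)\<bar> <= e / 4"
     using le_less_trans[OF both(1)[OF ab(1-3), of k] small] le_less_trans[OF both(2)[OF ab(1-3)] small] e
     by (auto simp: ennreal_less_iff)
    then show "\<bar>F k (Y s) - F k (Y t)\<bar> <= e / 4" "\<bar>f (Y s) - f (Y t)\<bar> <= e / 4"
     by (cases "s <= t"; simp add: a_def b_def min_def max_def abs_minus_commute)+
   qed
   obtain N where N: "\<And>k. N <= k ==> norm (F k (Y t) - f (Y t)) < e / 4" using LIMSEQ_D[OF t(3), of "e / 4"] e by auto
   have "norm (F k (Y s) - f (Y s)) < e" if "N <= k" for k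
   proof -
    have "\<bar>F k (Y s) - f (Y s)\<bar> <= \<bar>F k (Y s) - F k (Y t)\<bar> + \<bar>F k (Y t) - f (Y t)\<bar> + \<bar>f (Y s) - f (Y t)\<bar>" by simp
    also have "\<dots> < e / 4 + e / 4 + e / 4 + e / 4"
     using close(1)[of k] close(2) N[OF that] e by simp
    finally show ?thesis by simp
   qed
   then show "\<exists>no. \<forall>k\<ge>no. norm (F k (Y s) - f (Y s)) < e" by blast
  qed
  then show "Y ` {0..l} \<inter> Z = {}" by (auto simp: Z_def)
 qed
 \<comment> \<open>The bounds \<open>capA\<close> over the tail sum to less than
   \<open>5 * (1/2) ^ m\<close>, with 5 in place of 4 for strictness, and this has to stay below the
   quarter share of \<open>e / 2\<close> in \<open>Cap_Un_less\<close>.\<close>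
 obtain m where "(1/2) ^ m < e / 40" using real_arch_pow_inv[of "e / 40" "1/2"] e by auto
 then have m: "5 * (1/2) ^ m < e / 2 * (1/4)" by simp
 obtain G0 where G0: "open G0" "Z \<subseteq> G0" "Cap p G0 < ennreal (e / 2 * (1/2))"
  by (rule exceptional_open_nbhd[OF Z0 pz p0, of "e / 2 * (1/2)"]) (use e in \<open>auto intro: that\<close>)
 have G1: "open (\<Union>n. A (m + n))" "Cap p (\<Union>n. A (m + n)) <= ennreal (5 * (1/2) ^ m)"
 proof -
  have "Cap p (A (m + n)) < ennreal (5 * (1/2) ^ m * (1/2) ^ Suc n)" for n
  proof (rule le_less_trans[OF capA ennreal_lessI])
   have "4 * (1/2::real) ^ Suc (m + n) = 4 * ((1/2) ^ m * (1/2) ^ Suc n)" by (simp add: power_add)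
   also have "\<dots> < 5 * ((1/2) ^ m * (1/2) ^ Suc n)" by (intro mult_strict_right_mono) auto
   finally show "4 * (1/2::real) ^ Suc (m + n) < 5 * (1/2) ^ m * (1/2) ^ Suc n" by (simp add: mult.assoc)
  qed simp
  from open_Union_small[of "%n. A (m + n)" p, OF oA this p0]
  show "open (\<Union>n. A (m + n))" "Cap p (\<Union>n. A (m + n)) <= ennreal (5 * (1/2) ^ m)" by auto
 qed
 define G where "G = G0 \<union> (\<Union>n. A (m + n))"
 have "Cap p G <= ennreal (e / 2)"
  unfolding G_def
 proof (rule Cap_Un_less[OF G0(3) _ p0])
  show "Cap p (\<Union>n. A (m + n)) < ennreal (e / 2 * (1 / 4))"
   by (rule le_less_trans[OF G1(2) ennreal_lessI[OF _ m]]) (use e in simp)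
 qed (use e in simp)
 then have "Cap p G < ennreal e" by (rule le_less_trans) (use e in \<open>auto intro: ennreal_lessI\<close>)
 moreover have "continuous_on (- G) f"
 proof (rule uniform_limit_theorem[where F=sequentially])
  show "eventually (%k. continuous_on (- G) (F k)) sequentially" using continuous_on_subset[OF cF] by auto
  show "uniform_limit (- G) F f sequentially"
  proof (rule uniform_limitI)
   fix \<epsilon> :: real assume \<epsilon>: "0 < \<epsilon>"
   obtain N where "(1/2) ^ N < \<epsilon> / 2" using real_arch_pow_inv[of "\<epsilon> / 2" "1/2"] \<epsilon> by auto
   then have N: "2 * (1/2) ^ N < \<epsilon>" by simp
   have "\<forall>x\<in>- G. dist (F k x) (f x) < \<epsilon>" if k: "max N m <= k" for k
   proof
    fix x assume x: "x \<in> - G"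
    have "\<bar>F k x - f x\<bar> <= 2 * (1/2) ^ k"
    proof (rule telescoping_bound[of m "%k. F k x"])
     show "\<bar>F (Suc j) x - F j x\<bar> <= (1/2) ^ j" if "m <= j" for j
     proof -
      obtain n where "j = m + n" using \<open>m <= j\<close> by (metis le_Suc_ex)
      then show ?thesis using x by (auto simp: G_def A_def not_less)
     qed
     show "(%k. F k x) \<longlonglongrightarrow> f x" using x G0(2) by (auto simp: G_def Z_def)
    qed (use k in simp)
    also have "\<dots> <= 2 * (1/2) ^ N" using k by (intro mult_left_mono power_decreasing) auto
    finally show "dist (F k x) (f x) < \<epsilon>" using N by (simp add: dist_real_def)
   qed
   then show "eventually (%k. \<forall>x\<in>- G. dist (F k x) (f x) < \<epsilon>) sequentially" unfolding eventually_sequentially by blast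
  qed
 qed simp
 moreover have "open G" unfolding G_def using G0(1) G1(1) by blast
 ultimately show thesis using that by blast
qed

section \<open>Comparing weak gradients\<close>

lemma borel_version:
 fixes f :: "'a::euclidean_space => 'b::euclidean_space"
 assumes [measurable]: "f \<in> borel_measurable lebesgue"
 obtains f' where "Borel f'" "AE x in lborel. f x = f' x"
proof -
 have "\<exists>h. Borel h \<and> (AE x in lborel. f x \<bullet> b = h x)" for b
 proof -
  have "(%x. f x \<bullet> b) \<in> borel_measurable lebesgue" by measurable
  from completion_ex_borel_measurable_real[OF this] show ?thesis by auto
 qed
 then obtain h where [measurable]: "\<And>b. Borel (h b)" and h: "\<And>b. AE x in lborel. f x \<bullet> b = h b x" by metis
 have "AE x in lborel. \<forall>b\<in>Basis. f x \<bullet> b = h b x" by (subst AE_finite_all) (use h in auto)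
 then have "AE x in lborel. f x = (\<Sum>b\<in>Basis. h b x *\<^sub>R b)"
 proof eventually_elim
  case (elim x)
  have "f x = (\<Sum>b\<in>Basis. (f x \<bullet> b) *\<^sub>R b)" by (simp add: euclidean_representation)
  also have "\<dots> = (\<Sum>b\<in>Basis. h b x *\<^sub>R b)" using elim by (intro sum.cong) auto
  finally show ?case .
 qed
 then show thesis by (intro that[of "%x. \<Sum>b\<in>Basis. h b x *\<^sub>R b"]) auto
qed

lemma set_nn_integral_pint: "(\<integral>\<^sup>+x\<in>E. enn_pow (f x) p \<partial>lebesgue) = pint p (%x. f x * indicator E x)"
 unfolding pint_def nn_integral_completion by (intro nn_integral_cong) (auto simp: indicator_def)

lemma set_nn_integral_pint_norm:
 "(\<integral>\<^sup>+x\<in>E. ennreal (norm (f x) powr p) \<partial>lebesgue) = pint p (%x. ennreal (norm (f x)) * indicator E x)"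
 unfolding set_nn_integral_pint[symmetric] by (simp add: enn_pow_ennreal)

lemma Lp_borel_extension:
 fixes f :: "'a::euclidean_space => 'b::euclidean_space"
 assumes G: "G \<in> sets lebesgue" and f: "f \<in> borel_measurable (restrict_space lebesgue G)"
  and fin: "(\<integral>\<^sup>+x\<in>G. ennreal (norm (f x) powr p) \<partial>lebesgue) < \<infinity>"
 obtains f' where "Borel f'" "pnorm p f' < \<infinity>" "AE x in lborel. f' x = indicator G x *\<^sub>R f x"
proof -
 have "(%x. indicator G x *\<^sub>R f x) \<in> borel_measurable lebesgue"
  using f G by (subst (asm) borel_measurable_restrict_space_iff) auto
 then obtain f' where f': "Borel f'" "AE x in lborel. indicator G x *\<^sub>R f x = f' x"
  by (rule borel_version) (rule that)
 have "AE x in lborel. ennreal (norm (f' x)) = ennreal (norm (f x)) * indicator G x"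
  using f'(2) by eventually_elim (auto simp: indicator_def)
 from pint_cong_AE[OF this, of p] have "pnorm p f' < \<infinity>"
  using fin by (simp add: set_nn_integral_pint_norm)
 moreover have "AE x in lborel. f' x = indicator G x *\<^sub>R f x" using f'(2) by eventually_elim simp
 ultimately show thesis using f'(1) that by blast
qed

text \<open>Extension by 0 is in general not Sobolev across the boundary of \<open>G\<close>; it
  provides globally defined Borel functions to mollify, and gradients are compared only inside
  \<open>G\<close>.\<close>

lemma sobolev_borel_extension:
 assumes s: "sobolev_classical p G v w"
 obtains v' w' where "Borel v'" "pnorm p v' < \<infinity>" "AE x in lborel. v' x = indicator G x * v x"
  "Borel w'" "pnorm p w' < \<infinity>" "AE x in lborel. w' x = indicator G x *\<^sub>R w x"
proof -
 have G: "G \<in> sets lebesgue" using s by (auto simp: sobolev_classical_def)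
 obtain v' where v': "Borel v'" "pnorm p v' < \<infinity>" "AE x in lborel. v' x = indicator G x *\<^sub>R v x"
  by (rule Lp_borel_extension[OF G, of v p]) (use s in \<open>auto simp: sobolev_classical_def Lp_real_def intro: that\<close>)
 obtain w' where "Borel w'" "pnorm p w' < \<infinity>" "AE x in lborel. w' x = indicator G x *\<^sub>R w x"
  by (rule Lp_borel_extension[OF G, of w p]) (use s in \<open>auto simp: sobolev_classical_def Lp_vec_def intro: that\<close>)
 with v' show thesis using that by simp
qed

lemma weak_gradient_lborel:
 fixes v :: "'a::euclidean_space => real"
 assumes C: "C1c R \<phi>"
 shows "Borel v' ==> AE x in lborel. v' x = indicator G x * v x ==>
   (LINT x : G | lebesgue. v x * frechet_derivative \<phi> (at x) b) = (\<integral>x. v' x * (grad \<phi> x \<bullet> b) \<partial>lborel)"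
  and "Borel w' ==> AE x in lborel. w' x = indicator G x *\<^sub>R w x ==>
   (LINT x : G | lebesgue. (w x \<bullet> b) * \<phi> x) = (\<integral>x. (w' x \<bullet> b) * \<phi> x \<partial>lborel)"
proof -
 note K = C1cD[OF C]
 note [measurable] = K(8,9)
 show "(LINT x : G | lebesgue. v x * frechet_derivative \<phi> (at x) b) = (\<integral>x. v' x * (grad \<phi> x \<bullet> b) \<partial>lborel)"
  if [measurable]: "Borel v'" and ae: "AE x in lborel. v' x = indicator G x * v x"
  unfolding set_lebesgue_integral_def
 proof (rule trans[OF integral_cong_AE_completion integral_completion])
  show "AE x in lborel. indicat_real G x *\<^sub>R (v x * frechet_derivative \<phi> (at x) b) = v' x * (grad \<phi> x \<bullet> b)"
   using ae by eventually_elim (simp add: grad_inner[OF K(1)])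
 qed measurable
 show "(LINT x : G | lebesgue. (w x \<bullet> b) * \<phi> x) = (\<integral>x. (w' x \<bullet> b) * \<phi> x \<partial>lborel)"
  if [measurable]: "Borel w'" and ae: "AE x in lborel. w' x = indicator G x *\<^sub>R w x"
  unfolding set_lebesgue_integral_def
 proof (rule trans[OF integral_cong_AE_completion integral_completion])
  show "AE x in lborel. indicat_real G x *\<^sub>R (w x \<bullet> b * \<phi> x) = (w' x \<bullet> b) * \<phi> x"
   using ae by eventually_elim simp
 qed measurable
qed

lemma test_function_vanishes:
 assumes t: "test_function G \<phi>" and x: "x \<notin> G"
 shows "\<phi> x = 0" "grad \<phi> x = 0"
proof -
 let ?S = "- closure {x. \<phi> x \<noteq> 0}"
 have xS: "x \<in> ?S" using t x by (auto simp: test_function_def)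
 have z: "\<phi> y = 0" if "y \<in> ?S" for y using that closure_subset[of "{x. \<phi> x \<noteq> 0}"] by auto
 show "\<phi> x = 0" by (rule z[OF xS])
 have "((%_. 0) has_derivative (%h. 0 \<bullet> h)) (at x)" by simp
 then have "(\<phi> has_derivative (%h. 0 \<bullet> h)) (at x)"
  by (rule has_derivative_transform_within_open[OF _ open_Compl[OF closed_closure] xS]) (rule z[symmetric])
 then show "grad \<phi> x = 0" by (rule grad_unique)
qed

text \<open>On \<open>G\<close> the difference of the two functions has the difference of the
  gradients as weak gradient, and a weak gradient vanishes almost everywhere on the zero set of its
  function.\<close>

lemma weak_gradient_agree:
 fixes v :: "'a::euclidean_space => real"
 assumes s: "sobolev_classical p G v w" and p: "1 < p"
  and f: "Borel f" "pnorm p f < \<infinity>"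
  and w2: "Borel w2" "pnorm p w2 < \<infinity>" and wd: "weakly_diff f w2"
 shows "AE x in lborel. x \<in> G \<and> v x = f x --> w x = w2 x"
proof -
 have p0: "0 < p" using p by simp
 have G: "open G" and wg: "weak_gradient G v w" using s by (auto simp: sobolev_classical_def)
 obtain v' w' where v': "Borel v'" "pnorm p v' < \<infinity>" "AE x in lborel. v' x = indicator G x * v x"
  and w': "Borel w'" "pnorm p w' < \<infinity>" "AE x in lborel. w' x = indicator G x *\<^sub>R w x"
  by (rule sobolev_borel_extension[OF s]) (rule that)
 have [measurable]: "G \<in> sets borel" using G by simp
 note [measurable] = v'(1) w'(1) f(1) w2(1)
 define vd where "vd x = indicator G x * (v' x - f x)" for x
 define wd' where "wd' x = indicator G x *\<^sub>R (w' x - w2 x)" for x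
 have [measurable]: "Borel vd" "Borel wd'" unfolding vd_def[abs_def] wd'_def[abs_def] by measurable
 have avd: "AE x in lborel. vd x = indicator G x * (v x - f x)" using v'(3) by eventually_elim (auto simp: vd_def indicator_def)
 have awd: "AE x in lborel. wd' x = indicator G x *\<^sub>R (w x - w2 x)" using w'(3) by eventually_elim (auto simp: wd'_def indicator_def)
 have loc: "locint v'" "locint f" "locint w'" "locint w2"
  using locint_Lp[OF v'(1) _ v'(2)] locint_Lp[OF f(1) _ f(2)] locint_Lp[OF w'(1) _ w'(2)] locint_Lp[OF w2(1) _ w2(2)] p by auto
 have "weak_gradient G (%x. v x - f x) (%x. w x - w2 x)"
  unfolding weak_gradient_def
 proof (intro allI impI ballI)
  fix \<phi> :: "'a => real" and b :: 'a assume t: "test_function G \<phi>" and b: "b \<in> Basis"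
  obtain R where C: "C1c R \<phi>" by (rule test_function_C1c[OF t])
  note K = C1cD[OF C] and V = C1c_vanishes_beyond[OF C]
  note [measurable] = K(8,9)
  obtain B where B: "\<And>x. \<bar>\<phi> x\<bar> <= B" "\<And>x. norm (grad \<phi> x) <= B" by (rule C1c_bounded[OF C]) (rule that)
  have i1: "integrable lborel (%x. h x * (grad \<phi> x \<bullet> b))" if "locint h" for h :: "'a => real"
   using integrable_inner_left[OF locint_mult_integrable[OF that K(9) B(2) V(2)], of b] by simp
  have i2: "integrable lborel (%x. (h x \<bullet> b) * \<phi> x)" if "locint h" for h :: "'a => 'a"
   using locint_mult_integrable[OF locint_inner[OF that] K(8), of B R b] B(1) V(1) by simp
  have "(LINT x : G | lebesgue. (v x - f x) * frechet_derivative \<phi> (at x) b) = (\<integral>x. vd x * (grad \<phi> x \<bullet> b) \<partial>lborel)"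
   by (rule weak_gradient_lborel(1)[OF C _ avd]) measurable
  also have "\<dots> = (\<integral>x. v' x * (grad \<phi> x \<bullet> b) - f x * (grad \<phi> x \<bullet> b) \<partial>lborel)"
   by (intro Bochner_Integration.integral_cong) (use test_function_vanishes[OF t] in \<open>auto simp: vd_def indicator_def left_diff_distrib\<close>)
  also have "\<dots> = (\<integral>x. v' x * (grad \<phi> x \<bullet> b) \<partial>lborel) - (\<integral>x. f x * (grad \<phi> x \<bullet> b) \<partial>lborel)"
   by (intro Bochner_Integration.integral_diff i1 loc)
  also have "(\<integral>x. v' x * (grad \<phi> x \<bullet> b) \<partial>lborel) = - (\<integral>x. (w' x \<bullet> b) * \<phi> x \<partial>lborel)"
   using wg t b unfolding weak_gradient_def weak_gradient_lborel(1)[OF C v'(1,3), symmetric] weak_gradient_lborel(2)[OF C w'(1,3), symmetric]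
   by blast
  also have "(\<integral>x. f x * (grad \<phi> x \<bullet> b) \<partial>lborel) = - (\<integral>x. (w2 x \<bullet> b) * \<phi> x \<partial>lborel)"
   using wd C b unfolding weakly_diff_def by blast
  also have "- (\<integral>x. (w' x \<bullet> b) * \<phi> x \<partial>lborel) - - (\<integral>x. (w2 x \<bullet> b) * \<phi> x \<partial>lborel)
    = - (\<integral>x. (w' x \<bullet> b) * \<phi> x - (w2 x \<bullet> b) * \<phi> x \<partial>lborel)"
   using Bochner_Integration.integral_diff[OF i2[OF loc(3)] i2[OF loc(4)]] by simp
  also have "(\<integral>x. (w' x \<bullet> b) * \<phi> x - (w2 x \<bullet> b) * \<phi> x \<partial>lborel) = (\<integral>x. (wd' x \<bullet> b) * \<phi> x \<partial>lborel)"
   by (intro Bochner_Integration.integral_cong)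
    (use test_function_vanishes[OF t] in \<open>auto simp: wd'_def indicator_def left_diff_distrib inner_diff_left\<close>)
  also have "\<dots> = (LINT x : G | lebesgue. ((w x - w2 x) \<bullet> b) * \<phi> x)"
   by (rule weak_gradient_lborel(2)[OF C _ awd, symmetric]) measurable
  finally show "(LINT x : G | lebesgue. (v x - f x) * frechet_derivative \<phi> (at x) b) = - (LINT x : G | lebesgue. ((w x - w2 x) \<bullet> b) * \<phi> x)" .
 qed
 then have "AE x in lborel. x \<in> G \<and> vd x = 0 --> wd' x = 0"
 proof (rule weak_gradient_zero_on_zero_set[OF _ G p])
  have le: "pnorm p (%x. indicator G x *\<^sub>R (a x - b x)) < \<infinity>"
   if [measurable]: "Borel a" "Borel b"
    and fin: "pnorm p a < \<infinity>" "pnorm p b < \<infinity>"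
   for a b :: "'a => 'b::euclidean_space"
  proof (rule le_less_trans[OF pint_mono[OF p0] pint_add_finite[OF _ _ p0 fin]])
   fix x
   have "norm (indicator G x *\<^sub>R (a x - b x)) <= norm (a x) + norm (b x)"
    using norm_triangle_ineq4[of "a x" "b x"] by (auto simp: indicator_def)
   from ennreal_leI[OF this] show "ennreal (norm (indicator G x *\<^sub>R (a x - b x))) <= ennreal (norm (a x)) + ennreal (norm (b x))" by simp
  qed measurable
  show "pnorm p vd < \<infinity>" using le[OF v'(1) f(1) v'(2) f(2)] by (simp add: vd_def)
  show "pnorm p wd' < \<infinity>" using le[OF w'(1) w2(1) w'(2) w2(2)] by (simp add: wd'_def)
 qed (use avd awd in auto)
 with avd awd show ?thesis by eventually_elim auto
qed

section \<open>The fine gradient is almost an upper gradient\<close>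

text \<open>A small multiple of the density that defines the exceptional family is added to
  \<open>d\<close>. On exceptional curves its integral is infinite, so the inequality holds
  trivially, and dominated convergence makes the extra energy arbitrarily small.\<close>

lemma pae_upper_gradient:
 fixes u :: "'a::euclidean_space => ereal"
 assumes d[measurable]: "Borel d" and dp: "pint p d < \<infinity>" and p: "0 < p" and e: "0 < e"
  and pa: "pae p (%Y l. Y ` {0..l} \<subseteq> U --> ediff (u (Y 0)) (u (Y l)) <= lint d Y 0 l)"
 obtains g where "upper_gradient U u g" "pint p g <= pint p d + ennreal e"
proof -
 obtain \<rho> where \<rho>[measurable]: "Borel \<rho>" and \<rho>p: "pint p \<rho> < \<infinity>"
  and \<rho>c: "\<And>Y l. arclength_curve_in UNIV Y l ==> lint \<rho> Y 0 l < \<infinity> ==> Y ` {0..l} \<subseteq> U ==> ediff (u (Y 0)) (u (Y l)) <= lint d Y 0 l"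
  using pa unfolding pae_def by blast
 define g where "g n x = d x + ennreal (1 / Suc n) * \<rho> x" for n x
 have [measurable]: "Borel (g n)" for n unfolding g_def[abs_def] by measurable
 have ug: "upper_gradient U u (g n)" for n
  unfolding upper_gradient_def line_integral_eq_lint
 proof (intro conjI allI impI)
  show "g n \<in> borel_measurable (restrict_space borel U)" by (intro measurable_restrict_space1) measurable
  fix Y l assume c: "arclength_curve_in U Y l"
  have l: "0 <= l" "Y ` {0..l} \<subseteq> U" using c by (auto simp: arclength_curve_in_def)
  have s: "lint (g n) Y 0 l = lint d Y 0 l + ennreal (1 / Suc n) * lint \<rho> Y 0 l"
   unfolding g_def lint_cmult[OF \<rho> c order_refl order_refl, symmetric] by (rule lint_add_fun[OF _ _ c]) auto
  show "ediff (u (Y 0)) (u (Y l)) <= lint (g n) Y 0 l"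
  proof (cases "lint \<rho> Y 0 l < \<infinity>")
   case True
   from order_trans[OF \<rho>c[OF arclength_UNIV[OF c] True l(2)]] show ?thesis by (simp add: s)
  next
   case False
   then have "lint \<rho> Y 0 l = top" by (metis infinity_ennreal_def less_top)
   then have "lint (g n) Y 0 l = top" unfolding s by (simp add: ennreal_mult_top)
   then show ?thesis by simp
  qed
 qed
 have "(%n. pint p (g n)) \<longlonglongrightarrow> pint p d"
  unfolding pint_def
 proof (rule nn_integral_dominated_convergence[where w="%x. enn_pow (d x + \<rho> x) p"])
  show "(\<integral>\<^sup>+x. enn_pow (d x + \<rho> x) p \<partial>lborel) < \<infinity>"
   using pint_add_finite[OF d \<rho> p dp \<rho>p] by (simp add: pint_def)
  have "ennreal (1 / Suc n) * \<rho> x <= 1 * \<rho> x" for n x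
   by (intro mult_right_mono) (auto simp: field_simps ennreal_le_1)
  then show "AE x in lborel. enn_pow (g n x) p <= enn_pow (d x + \<rho> x) p" for n
   unfolding g_def by (intro AE_I2 enn_pow_mono p add_left_mono) simp
  show "AE x in lborel. (%n. enn_pow (g n x) p) \<longlonglongrightarrow> enn_pow (d x) p"
   using pint_AE_finite[OF d dp] pint_AE_finite[OF \<rho> \<rho>p]
  proof eventually_elim
   case (elim x)
   obtain a b where ab: "d x = ennreal a" "\<rho> x = ennreal b" "0 <= a" "0 <= b" using elim by (cases "d x"; cases "\<rho> x") auto
   have eq: "enn_pow (g n x) p = ennreal ((a + inverse (real (Suc n)) * b) powr p)" for n
    unfolding g_def ab using ab(3,4) by (simp add: enn_pow_ennreal inverse_eq_divide flip: ennreal_mult' ennreal_plus)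
   have "(%n. a + inverse (real (Suc n)) * b) \<longlonglongrightarrow> a + 0 * b"
    by (intro tendsto_intros LIMSEQ_inverse_real_of_nat)
   then have "(%n. (a + inverse (real (Suc n)) * b) powr p) \<longlonglongrightarrow> a powr p"
    by (intro tendsto_powr2) (use ab p in auto)
   then show ?case unfolding eq ab(1) enn_pow_ennreal[OF ab(3)] by (rule tendsto_ennrealI)
  qed
 qed measurable
 moreover have "pint p d < pint p d + ennreal e" using dp e by (cases "pint p d") (auto simp: ennreal_lessI simp flip: ennreal_plus)
 ultimately have "eventually (%n. pint p (g n) < pint p d + ennreal e) sequentially" by (rule order_tendstoD(2))
 then obtain n where "pint p (g n) < pint p d + ennreal e" by (auto simp: eventually_sequentially)
 then show thesis using that[OF ug[of n]] by simp
qed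

text \<open>Along almost every curve the quasiopen set \<open>V\<close> acts like an open set, so a
  short piece through a point of \<open>V\<close> stays in \<open>V\<close> and well inside
  \<open>G\<close>. There the mollifications of the local representative are of class C^1, and they
  converge to \<open>u\<close> at almost every parameter; continuity of \<open>u\<close> along the
  curve reaches the remaining end points.\<close>

lemma pae_fine_local:
 fixes u :: "'a::euclidean_space => ereal"
 assumes s: "sobolev_classical p G v w" and V: "quasiopen p V" "V \<subseteq> G" and p: "1 < p"
  and uv: "AE x in lborel. x \<in> V --> u x = ereal (v x)" and wd: "AE x in lborel. x \<in> V --> ennreal (norm (w x)) <= d x"
 shows "pae p (%Y l. \<forall>s\<in>{0..l}. Y s \<in> V --> continuous_on {0..l} (%t. real_of_ereal (u (Y t))) -->
  (\<exists>\<delta>>0. \<forall>a b. 0 <= a --> a <= s --> s <= b --> b <= l --> b - a < \<delta> -->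
   ennreal \<bar>real_of_ereal (u (Y a)) - real_of_ereal (u (Y b))\<bar> <= lint d Y a b))"
proof -
 have p0: "0 < p" using p by simp
 have G: "open G" and wg: "weak_gradient G v w" using s by (auto simp: sobolev_classical_def)
 obtain v' w' where v': "Borel v'" "pnorm p v' < \<infinity>" "AE x in lborel. v' x = indicator G x * v x"
  and w': "Borel w'" "pnorm p w' < \<infinity>" "AE x in lborel. w' x = indicator G x *\<^sub>R w x"
  by (rule sobolev_borel_extension[OF s]) (rule that)
 have lv: "locint v'" by (rule locint_Lp[OF v'(1) _ v'(2)]) (use p in simp)
 have lw: "locint w'" by (rule locint_Lp[OF w'(1) _ w'(2)]) (use p in simp)
 note [measurable] = v'(1) w'(1)
 obtain r where r: "\<And>k::nat. 0 < r k" "r \<longlonglongrightarrow> 0"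
  and rv: "\<And>k. pnorm p (%x. moll (r k) v' x - v' x) <= ennreal (((1/4) ^ Suc k) powr p)"
  and rw: "\<And>k. pnorm p (%x. moll (r k) w' x - w' x) <= ennreal (((1/4) ^ Suc k) powr p)"
  by (rule fast_radii[OF v'(1,2) w'(1,2) p]) (rule that)
 have cw: "continuous_on UNIV (moll (r k) w')" for k by (rule moll_continuous[OF lw r(1)])
 have [measurable]: "Borel (moll (r k) w')" for k by (rule borel_measurable_continuous_onI[OF cw])
 \<comment> \<open>Errors of the mollified gradients. Their sum has finite energy, so along almost
   every curve their integrals form a convergent series and tend to 0.\<close>
 define E where "E k x = ennreal (norm (moll (r k) w' x - w' x))" for k x
 have Em[measurable]: "Borel (E k)" for k unfolding E_def[abs_def] by measurable
 have fE: "pint p (%x. \<Sum>k. E k x) < \<infinity>" by (rule pint_suminf_fast[OF Em p0]) (use rw in \<open>simp add: E_def[abs_def]\<close>)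
 define Q where "Q x \<longleftrightarrow> (%k. moll (r k) v' x) \<longlonglongrightarrow> v' x \<and> (x \<in> V --> u x = ereal (v' x) \<and> ennreal (norm (w' x)) <= d x)" for x
 have Q: "AE x in lborel. Q x"
  using fast_moll(1)[OF v'(1,2) p r(1) rv] v'(3) w'(3) uv wd
  by eventually_elim (use V(2) in \<open>auto simp: Q_def indicator_def\<close>)
 have "pae p (%Y l. lint (%x. \<Sum>k. E k x) Y 0 l < \<infinity> \<and> (AE t in lborel. 0 <= t \<and> t <= l --> Q (Y t)) \<and>
   (\<exists>W. open W \<and> {t\<in>{0..l}. Y t \<in> V} = {t\<in>{0..l}. Y t \<in> W}))"
  by (intro pae_conj p0 pae_finite[OF _ fE] pae_null[OF Q] pae_quasiopen V) measurable
 then show ?thesis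
 proof (rule pae_mono, intro ballI impI)
  fix Y :: "real => 'a" and l s
  let ?F = "%t. real_of_ereal (u (Y t))"
  assume c: "arclength_curve_in UNIV Y l" and s: "s \<in> {0..l}" "Y s \<in> V" and cF: "continuous_on {0..l} ?F"
   and *: "lint (%x. \<Sum>k. E k x) Y 0 l < \<infinity> \<and> (AE t in lborel. 0 <= t \<and> t <= l --> Q (Y t)) \<and>
   (\<exists>W. open W \<and> {t\<in>{0..l}. Y t \<in> V} = {t\<in>{0..l}. Y t \<in> W})"
  then obtain W where W: "open W" "{t\<in>{0..l}. Y t \<in> V} = {t\<in>{0..l}. Y t \<in> W}" by blast
  then have "Y s \<in> W \<inter> G" using s V(2) by blast
  moreover have "open (W \<inter> G)" using W(1) G by blast
  ultimately obtain \<rho>0 where \<rho>0: "0 < \<rho>0" "cball (Y s) \<rho>0 \<subseteq> W \<inter> G" by (meson open_contains_cball)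
  \<comment> \<open>Half of the radius is reserved for the curve, the other half for the support of
    the kernel.\<close>
  define \<rho> where "\<rho> = \<rho>0 / 2"
  have \<rho>: "0 < \<rho>" "cball (Y s) (2 * \<rho>) \<subseteq> W \<inter> G" using \<rho>0 by (auto simp: \<rho>_def)
  have hk: "(%k. lint (E k) Y 0 l) \<longlonglongrightarrow> 0"
  proof -
   have fin: "(\<Sum>k. lint (E k) Y 0 l) < \<infinity>" using * lint_suminf[OF Em c] by simp
   have k: "lint (E k) Y 0 l = ennreal (enn2real (lint (E k) Y 0 l))" for k
    using le_less_trans[OF sum_le_suminf[of "%k. lint (E k) Y 0 l" "{k}"] fin] by simp
   have "summable (%k. enn2real (lint (E k) Y 0 l))"
    by (rule summable_suminf_not_top) (use fin in \<open>simp_all add: less_top flip: k\<close>)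
   from tendsto_ennrealI[OF summable_LIMSEQ_zero[OF this]] show ?thesis unfolding k[symmetric] by simp
  qed
  show "\<exists>\<delta>>0. \<forall>a b. 0 <= a --> a <= s --> s <= b --> b <= l --> b - a < \<delta> --> ennreal \<bar>?F a - ?F b\<bar> <= lint d Y a b"
  proof (intro exI[of _ \<rho>] conjI \<rho>(1) allI impI)
   fix a b assume ab: "0 <= a" "a <= s" "s <= b" "b <= l" "b - a < \<rho>"
   have near: "Y t \<in> ball (Y s) \<rho>" if "t \<in> {a..b}" for t
    using arclength_dist_le[OF c, of s t] that ab by auto
   have inV: "Y t \<in> V" if t: "t \<in> {a..b}" for t
   proof -
    have "Y t \<in> cball (Y s) (2 * \<rho>)" using near[OF t] \<rho>(1) by simp
    then have "Y t \<in> W" using \<rho>(2) by blast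
    then have "t \<in> {t\<in>{0..l}. Y t \<in> W}" using t ab by simp
    then show ?thesis unfolding W(2)[symmetric] by simp
   qed
   have dif: "(moll (r k) v' has_derivative (%h. moll (r k) w' x \<bullet> h)) (at x)" if k: "r k < \<rho>" and x: "x \<in> ball (Y s) \<rho>" for k x
   proof (rule moll_weak_gradient[OF wg lv v'(3) lw w'(3) _ r(1)])
    have "cball x (r k) \<subseteq> cball (Y s) (2 * \<rho>)"
    proof
     fix y assume "y \<in> cball x (r k)"
     then show "y \<in> cball (Y s) (2 * \<rho>)" using dist_triangle[of "Y s" y x] k x by simp
    qed
    then show "cball x (r k) \<subseteq> G" using \<rho>(2) by blast
   qed
   \<comment> \<open>The estimate is settled for end points at which the mollifications converge to
     \<open>v'\<close> and \<open>v'\<close> equals \<open>u\<close>; \<open>Q\<close> holds at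
     almost every parameter.\<close>
   have good: "ennreal \<bar>?F a' - ?F b'\<bar> <= lint d Y a' b'" if a'b': "a <= a'" "a' <= b'" "b' <= b" and Q': "Q (Y a')" "Q (Y b')" for a' b'
   proof (rule LIMSEQ_le)
    have v'F: "v' (Y a') = ?F a'" "v' (Y b') = ?F b'" using Q' inV a'b' by (auto simp: Q_def)
    have "(%k. moll (r k) v' (Y a')) \<longlonglongrightarrow> v' (Y a')" "(%k. moll (r k) v' (Y b')) \<longlonglongrightarrow> v' (Y b')" using Q' by (auto simp: Q_def)
    from tendsto_ennrealI[OF tendsto_rabs[OF tendsto_diff[OF this]]]
    show "(%k. ennreal \<bar>moll (r k) v' (Y a') - moll (r k) v' (Y b')\<bar>) \<longlonglongrightarrow> ennreal \<bar>?F a' - ?F b'\<bar>" unfolding v'F .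
    show "(%k. lint d Y a' b' + lint (E k) Y 0 l) \<longlonglongrightarrow> lint d Y a' b'"
     using tendsto_add[OF tendsto_const hk, of "lint d Y a' b'"] by simp
    have "eventually (%k. r k < \<rho>) sequentially" by (rule order_tendstoD(2)[OF r(2) \<rho>(1)])
    then obtain N where N: "\<And>k. N <= k ==> r k < \<rho>" by (auto simp: eventually_sequentially)
    have "ennreal \<bar>moll (r k) v' (Y a') - moll (r k) v' (Y b')\<bar> <= lint d Y a' b' + lint (E k) Y 0 l" if k: "N <= k" for k
    proof -
     have "ennreal \<bar>moll (r k) v' (Y a') - moll (r k) v' (Y b')\<bar> <= lint (%x. ennreal (norm (moll (r k) w' x))) Y a' b'"
     proof (rule C1_curve[OF open_ball dif[OF N[OF k]] cw c])
      show "Y ` {a'..b'} \<subseteq> ball (Y s) \<rho>" using near a'b' by auto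
     qed (use ab a'b' in auto)
     also have "\<dots> <= lint (%x. ennreal (norm (w' x)) + E k x) Y a' b'"
     proof (rule lint_mono)
      fix t
      have "norm (moll (r k) w' (Y t)) <= norm (w' (Y t)) + norm (moll (r k) w' (Y t) - w' (Y t))"
       using norm_triangle_ineq[of "w' (Y t)" "moll (r k) w' (Y t) - w' (Y t)"] by simp
      from ennreal_leI[OF this] show "ennreal (norm (moll (r k) w' (Y t))) <= ennreal (norm (w' (Y t))) + E k (Y t)"
       by (simp add: E_def)
     qed
     also have "\<dots> = lint (%x. ennreal (norm (w' x))) Y a' b' + lint (E k) Y a' b'"
      by (rule lint_add_fun[OF _ _ c]) (use ab a'b' in auto)
     also have "\<dots> <= lint d Y a' b' + lint (E k) Y 0 l"
     proof (intro add_mono lint_mono_interval lint_mono_AE)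
      show "AE t in lborel. a' <= t \<and> t <= b' --> ennreal (norm (w' (Y t))) <= d (Y t)"
       using conjunct1[OF conjunct2[OF *]] by eventually_elim (use ab a'b' inV in \<open>auto simp: Q_def\<close>)
     qed (use ab a'b' in auto)
     finally show ?thesis .
    qed
    then show "\<exists>N. \<forall>k\<ge>N. ennreal \<bar>moll (r k) v' (Y a') - moll (r k) v' (Y b')\<bar> <= lint d Y a' b' + lint (E k) Y 0 l" by blast
   qed
   show "ennreal \<bar>?F a - ?F b\<bar> <= lint d Y a b"
   proof (cases "a < b")
    case True
    show ?thesis
    proof (rule ennreal_le_epsilon)
     fix e :: real assume e: "0 < e"
     have cont: "\<exists>h>0. \<forall>t\<in>{a..b}. \<bar>t - s\<bar> <= h --> \<bar>?F t - ?F s\<bar> < e / 2" if sab: "s \<in> {a..b}" for s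
     proof -
      have "continuous_on {a..b} ?F" using cF by (rule continuous_on_subset) (use ab in auto)
      then obtain h where "0 < h" "\<forall>t\<in>{a..b}. dist t s < h --> dist (?F t) (?F s) < e / 2"
       unfolding continuous_on_iff using sab e by (metis half_gt_zero)
      then show ?thesis by (intro exI[of _ "h / 2"]) (auto simp: dist_real_def)
     qed
     obtain h1 h2 where h: "0 < h1" "\<And>t. t \<in> {a..b} ==> \<bar>t - a\<bar> <= h1 ==> \<bar>?F t - ?F a\<bar> < e / 2"
      "0 < h2" "\<And>t. t \<in> {a..b} ==> \<bar>t - b\<bar> <= h2 ==> \<bar>?F t - ?F b\<bar> < e / 2"
      using cont[of a] cont[of b] True by auto
     define h where "h = min ((b - a) / 2) (min h1 h2)"
     have h0: "0 < h" "h <= h1" "h <= h2" "2 * h <= b - a"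
      using h(1,3) True min.cobounded1[of "(b - a) / 2" "min h1 h2"] by (simp_all add: h_def[symmetric]) (simp_all add: h_def)
     have AEQ: "AE t in lborel. a <= t \<and> t <= b --> Q (Y t)"
      using conjunct1[OF conjunct2[OF *]] by eventually_elim (use ab in auto)
     obtain a' where a': "a' \<in> {a..b}" "\<bar>a' - a\<bar> <= h" "Q (Y a')"
      by (rule AE_interval_exists_near[OF AEQ True, of a h]) (use True h0 in \<open>auto intro: that\<close>)
     obtain b' where b': "b' \<in> {a..b}" "\<bar>b' - b\<bar> <= h" "Q (Y b')"
      by (rule AE_interval_exists_near[OF AEQ True, of b h]) (use True h0 in \<open>auto intro: that\<close>)
     have le: "a' <= b'" using a'(2) b'(2) h0(4) by (simp add: abs_le_iff)
     have "\<bar>?F a' - ?F a\<bar> < e / 2" "\<bar>?F b' - ?F b\<bar> < e / 2"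
      using h(2)[OF a'(1) order_trans[OF a'(2) h0(2)]] h(4)[OF b'(1) order_trans[OF b'(2) h0(3)]] by auto
     then have "\<bar>?F a - ?F b\<bar> <= \<bar>?F a' - ?F b'\<bar> + e" by argo
     from ennreal_leI[OF this] have "ennreal \<bar>?F a - ?F b\<bar> <= ennreal \<bar>?F a' - ?F b'\<bar> + ennreal e" using e by simp
     also have "\<dots> <= lint d Y a b + ennreal e"
      using order_trans[OF good[OF _ le _ a'(3) b'(3)] lint_mono_interval[of a a' b' b]] a'(1) b'(1) by (intro add_right_mono) auto
     finally show "ennreal \<bar>?F a - ?F b\<bar> <= lint d Y a b + ennreal e" .
    qed
   next
    case False
    then have "a = b" using ab by simp
    then show ?thesis by simp
   qed
  qed
 qed
qed

lemma fine_gradientE: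
 fixes u :: "'a::euclidean_space => ereal"
 assumes "fine_gradient p U u D"
 obtains \<B> where "countable \<B>" "\<And>V. V \<in> \<B> ==> quasiopen p V" "\<Union>\<B> \<subseteq> U" "Cap p (U - \<Union>\<B>) = 0"
  "\<And>V. V \<in> \<B> ==> \<exists>G v w. V \<subseteq> G \<and> sobolev_classical p G v w \<and>
   (AE x in lborel. x \<in> V --> u x = ereal (v x)) \<and> (AE x in lborel. x \<in> V --> D x = w x)"
proof -
 from assms obtain \<B> where B: "quasicovering p U \<B>" and loc: "\<forall>V\<in>\<B>. \<exists>G v w. V \<subseteq> G \<and> sobolev_classical p G v w \<and>
   (AE x in lborel. x \<in> V --> u x = ereal (v x)) \<and> (AE x in lborel. x \<in> V --> D x = w x)"
  unfolding fine_gradient_def AE_completion_iff by (elim conjE exE)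
 show thesis by (rule that[of \<B>]) (use B loc in \<open>simp_all add: quasicovering_def\<close>)
qed

text \<open>For almost every curve in \<open>U\<close>, the curve lies in the union of the
  quasicovering, \<open>u\<close> is finite and continuous along it, and the estimate holds near
  each parameter. Bolzano's subdivision adds the local estimates up. \<open>d\<close> is a Borel
  majorant of the norm of \<open>D\<close>, which is only Lebesgue measurable.\<close>

theorem fine_gradient_upper_gradient:
 fixes u :: "'a::euclidean_space => ereal"
 assumes fg: "fine_gradient p U u D" and qc: "quasicontinuous_on p U u" and U: "quasiopen p U" and p: "1 < p" and e: "0 < e"
 obtains g where "upper_gradient U u g" "pint p g <= (\<integral>\<^sup>+x\<in>U. ennreal (norm (D x) powr p) \<partial>lebesgue) + ennreal e"
proof -
 have p0: "0 < p" using p by simp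
 have Um: "U \<in> sets lebesgue" by (rule quasiopen_measurable[OF U p0])
 have D: "D \<in> borel_measurable (restrict_space lebesgue U)" "(\<integral>\<^sup>+x\<in>U. ennreal (norm (D x) powr p) \<partial>lebesgue) < \<infinity>"
  using fg by (auto simp: fine_gradient_def Lp_vec_def)
 obtain \<B> where \<B>: "countable \<B>" "\<And>V. V \<in> \<B> ==> quasiopen p V" "\<Union>\<B> \<subseteq> U" "Cap p (U - \<Union>\<B>) = 0"
  and loc: "\<And>V. V \<in> \<B> ==> \<exists>G v w. V \<subseteq> G \<and> sobolev_classical p G v w \<and>
   (AE x in lborel. x \<in> V --> u x = ereal (v x)) \<and> (AE x in lborel. x \<in> V --> D x = w x)"
  by (rule fine_gradientE[OF fg]) (rule that)
 have "(%x. indicator U x *\<^sub>R D x) \<in> borel_measurable lebesgue" using D(1) Um by (subst (asm) borel_measurable_restrict_space_iff) auto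
 then have "(%x. ennreal (norm (indicator U x *\<^sub>R D x))) \<in> borel_measurable lebesgue" by measurable
 then obtain d where d: "Borel d" "\<And>x. ennreal (norm (indicator U x *\<^sub>R D x)) <= d x"
  "AE x in lborel. ennreal (norm (indicator U x *\<^sub>R D x)) = d x"
  by (rule borel_majorant) (rule that)
 have "AE x in lborel. d x = ennreal (norm (D x)) * indicator U x" using d(3) by eventually_elim (auto simp: indicator_def)
 from pint_cong_AE[OF this, of p] have dp: "pint p d = (\<integral>\<^sup>+x\<in>U. ennreal (norm (D x) powr p) \<partial>lebesgue)" by (simp add: set_nn_integral_pint_norm)
 let ?P = "%V Y l. \<forall>s\<in>{0..l}. Y s \<in> V --> continuous_on {0..l} (%t. real_of_ereal (u (Y t))) -->
  (\<exists>\<delta>>0. \<forall>a b. 0 <= a --> a <= s --> s <= b --> b <= l --> b - a < \<delta> -->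
   ennreal \<bar>real_of_ereal (u (Y a)) - real_of_ereal (u (Y b))\<bar> <= lint d Y a b)"
 have P: "pae p (?P V)" if V: "V \<in> \<B>" for V
 proof -
  obtain G uV wV where G: "V \<subseteq> G" "sobolev_classical p G uV wV"
   and ae: "AE x in lborel. x \<in> V --> u x = ereal (uV x)" "AE x in lborel. x \<in> V --> D x = wV x"
   using loc[OF V] by (elim exE conjE) (rule that)
  show ?thesis
  proof (rule pae_fine_local[OF G(2) \<B>(2)[OF V] G(1) p ae(1)])
   show "AE x in lborel. x \<in> V --> ennreal (norm (wV x)) <= d x"
    using ae(2)
   proof eventually_elim
    case (elim x)
    then show ?case using d(2)[of x] V \<B>(3) by (auto simp: indicator_def split: if_splits)
   qed
  qed
 qed
 have "pae p (%Y l. (\<forall>V\<in>\<B>. ?P V Y l) \<and> Y ` {0..l} \<inter> (U - \<Union>\<B>) = {} \<and>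
   (Y ` {0..l} \<subseteq> U --> (\<forall>t\<in>{0..l}. \<bar>u (Y t)\<bar> \<noteq> \<infinity>) \<and> continuous_on {0..l} (%t. real_of_ereal (u (Y t)))))"
  by (intro pae_conj pae_ball[OF p0 \<B>(1) P] p0 pae_avoids_Cap_zero[OF \<B>(4)] pae_quasicontinuous[OF qc])
 then have "pae p (%Y l. Y ` {0..l} \<subseteq> U --> ediff (u (Y 0)) (u (Y l)) <= lint d Y 0 l)"
 proof (rule pae_mono, intro impI)
  fix Y :: "real => 'a" and l
  let ?F = "%t. real_of_ereal (u (Y t))"
  assume c: "arclength_curve_in UNIV Y l" and all: "(\<forall>V\<in>\<B>. ?P V Y l) \<and> Y ` {0..l} \<inter> (U - \<Union>\<B>) = {} \<and>
   (Y ` {0..l} \<subseteq> U --> (\<forall>t\<in>{0..l}. \<bar>u (Y t)\<bar> \<noteq> \<infinity>) \<and> continuous_on {0..l} ?F)" and gU: "Y ` {0..l} \<subseteq> U"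
  from all have PV: "\<And>V. V \<in> \<B> ==> ?P V Y l" by (elim conjE) (erule bspec)
  have av: "Y ` {0..l} \<subseteq> \<Union>\<B>" using conjunct1[OF conjunct2[OF all]] gU by blast
  have fin: "\<And>t. t \<in> {0..l} ==> \<bar>u (Y t)\<bar> \<noteq> \<infinity>" and cF: "continuous_on {0..l} ?F"
   using mp[OF conjunct2[OF conjunct2[OF all]] gU] by simp_all
  have l: "0 < l" using c by (simp add: arclength_curve_in_def)
  have "0 <= (0::real) --> l <= l --> ennreal \<bar>?F 0 - ?F l\<bar> <= lint d Y 0 l"
  proof (rule Bolzano[where P="%a b. 0 <= a --> b <= l --> ennreal \<bar>?F a - ?F b\<bar> <= lint d Y a b"])
   show "0 <= l" using l by simp
   fix a b c' assume ab: "0 <= a --> b <= l --> ennreal \<bar>?F a - ?F b\<bar> <= lint d Y a b" "0 <= b --> c' <= l --> ennreal \<bar>?F b - ?F c'\<bar> <= lint d Y b c'"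
    and o: "a <= b" "b <= c'"
   show "0 <= a --> c' <= l --> ennreal \<bar>?F a - ?F c'\<bar> <= lint d Y a c'"
   proof (intro impI)
    assume ac: "0 <= a" "c' <= l"
    have "\<bar>?F a - ?F c'\<bar> <= \<bar>?F a - ?F b\<bar> + \<bar>?F b - ?F c'\<bar>" by simp
    from ennreal_leI[OF this] have "ennreal \<bar>?F a - ?F c'\<bar> <= ennreal \<bar>?F a - ?F b\<bar> + ennreal \<bar>?F b - ?F c'\<bar>" by simp
    also have "\<dots> <= lint d Y a b + lint d Y b c'" using ab ac o by (intro add_mono) auto
    also have "\<dots> = lint d Y a c'" by (rule lint_add[OF d(1) c]) (use ac o in auto)
    finally show "ennreal \<bar>?F a - ?F c'\<bar> <= lint d Y a c'" .
   qed
  next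
   fix s assume s: "0 <= s" "s <= l"
   then have "Y s \<in> \<Union>\<B>" using av by (simp add: image_subset_iff)
   then obtain V where V: "V \<in> \<B>" "Y s \<in> V" by blast
   then obtain \<delta> where "\<delta> > 0" and \<delta>: "\<And>a b. 0 <= a ==> a <= s ==> s <= b ==> b <= l ==> b - a < \<delta> ==> ennreal \<bar>?F a - ?F b\<bar> <= lint d Y a b"
    using PV[OF V(1)] s cF by (meson atLeastAtMost_iff)
   then show "\<exists>\<delta>>0. \<forall>a b. a <= s \<and> s <= b \<and> b - a < \<delta> --> 0 <= a --> b <= l --> ennreal \<bar>?F a - ?F b\<bar> <= lint d Y a b"
    by blast
  qed
  then show "ediff (u (Y 0)) (u (Y l)) <= lint d Y 0 l" using fin[of 0] fin[of l] l by (simp add: ediff_def)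
 qed
 from pae_upper_gradient[OF d(1) _ p0 e this] obtain g where "upper_gradient U u g" "pint p g <= pint p d + ennreal e"
  using D(2) dp by metis
 then show thesis using that dp by simp
qed

section \<open>Newtonian functions on quasiopen sets\<close>

text \<open>\<open>g\<close> is Borel only relative to \<open>U\<close>, and \<open>U\<close> is
  merely Lebesgue measurable, so its extension by 0 need not be Borel. A Borel majorant has the same
  energy and is still an upper gradient in \<open>U\<close>.\<close>

lemma upper_gradient_borel:
 fixes u :: "'a::euclidean_space => ereal"
 assumes ug: "upper_gradient U u g" and U: "U \<in> sets lebesgue"
 obtains h where "Borel h" "upper_gradient U u h" "pint p h = (\<integral>\<^sup>+x\<in>U. enn_pow (g x) p \<partial>lebesgue)"
proof -
 have g: "g \<in> borel_measurable (restrict_space borel U)" using ug by (simp add: upper_gradient_def)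
 have "g \<in> borel_measurable (restrict_space lebesgue U)"
 proof (rule measurableI)
  fix A :: "ennreal set" assume "A \<in> sets borel"
  from measurable_sets[OF g this] have "g -` A \<inter> U \<in> sets (restrict_space borel U)" by (simp add: space_restrict_space)
  then show "g -` A \<inter> space (restrict_space lebesgue U) \<in> sets (restrict_space lebesgue U)"
   by (auto simp: sets_restrict_space space_restrict_space)
 qed simp
 then have "(%x. g x * indicator U x) \<in> borel_measurable lebesgue"
  using U by (subst (asm) borel_measurable_restrict_space_iff_ennreal) auto
 then obtain h where h: "Borel h" "\<And>x. g x * indicator U x <= h x" "AE x in lborel. g x * indicator U x = h x"
  by (rule borel_majorant) (rule that)
 have "upper_gradient U u h"
  unfolding upper_gradient_def line_integral_eq_lint
 proof (intro conjI allI impI)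
  show "h \<in> borel_measurable (restrict_space borel U)" using h(1) by (rule measurable_restrict_space1)
  fix Y l assume c: "arclength_curve_in U Y l"
  then have "ediff (u (Y 0)) (u (Y l)) <= lint g Y 0 l"
   using ug unfolding upper_gradient_def line_integral_eq_lint by blast
  also have "\<dots> <= lint h Y 0 l"
  proof (rule lint_mono)
   fix t assume "0 <= t" "t <= l"
   then have "Y t \<in> U" using c by (auto simp: arclength_curve_in_def)
   then show "g (Y t) <= h (Y t)" using h(2)[of "Y t"] by simp
  qed
  finally show "ediff (u (Y 0)) (u (Y l)) <= lint h Y 0 l" .
 qed
 moreover have "pint p h = (\<integral>\<^sup>+x\<in>U. enn_pow (g x) p \<partial>lebesgue)" using pint_cong_AE[OF h(3), of p] by (simp add: set_nn_integral_pint)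
 ultimately show thesis using that h(1) by blast
qed

lemma upper_gradient_piece:
 fixes u :: "'a::euclidean_space => ereal"
 assumes ug: "upper_gradient U u h" and h: "Borel h" and c: "arclength_curve_in UNIV Y l"
  and ab: "0 <= a" "a < b" "b <= l" and im: "Y ` {a..b} \<subseteq> U"
 shows "ediff (u (Y a)) (u (Y b)) <= lint h Y a b"
proof -
 have "(%t. Y (a + t)) ` {0..b - a} \<subseteq> U"
 proof clarsimp
  fix t assume "0 <= t" "t <= b - a"
  then show "Y (a + t) \<in> U" using im by (auto simp: image_subset_iff)
 qed
 from arclength_restrict[OF arclength_subcurve[OF c ab] this]
 have "ediff (u (Y (a + 0))) (u (Y (a + (b - a)))) <= line_integral h (%t. Y (a + t)) (b - a)"
  using ug unfolding upper_gradient_def by blast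
 also have "\<dots> = lint h Y a b" by (rule lint_subcurve[OF _ c]) (use ab h in auto)
 finally show ?thesis by simp
qed

section \<open>Cutoffs and local patches of a quasiopen set\<close>

lemma pint_bounded_support:
 fixes f :: "'a::euclidean_space => real"
 assumes "\<And>x. \<bar>f x\<bar> <= M" "\<And>x. R <= norm x ==> f x = 0" "0 < p"
 shows "pint p (%x. ennreal \<bar>f x\<bar>) < \<infinity>"
proof -
 have "pint p (%x. ennreal \<bar>f x\<bar>) <= pint p (%x. ennreal M * indicator (ball (0::'a) R) x)"
  using assms by (intro pint_mono) (auto simp: indicator_def intro!: ennreal_leI)
 also have "\<dots> = enn_pow (ennreal M) p * emeasure lborel (ball (0::'a) R)"
  unfolding pint_def enn_pow_mult_indicator[OF assms(3)] by (subst nn_integral_cmult_indicator) auto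
 also have "\<dots> < \<infinity>"
 proof -
  have "enn_pow (ennreal M) p < top" by (simp add: less_top[symmetric] enn_pow_eq_top_iff)
  then show ?thesis using emeasure_bounded_finite[of "ball (0::'a) R"] by (simp add: ennreal_mult_less_top)
 qed
 finally show ?thesis .
qed

text \<open>Off \<open>G\<close> both functions are continuous, so the set is relatively open there;
  adding the open set \<open>G\<close> absorbs what happens inside it.\<close>

lemma quasi_open_Un:
 fixes f g :: "'a::euclidean_space => real"
 assumes "open G" "continuous_on (- G) f" "continuous_on (- G) g"
 shows "open ({x. a < f x \<and> \<bar>g x\<bar> < b} \<union> G)"
proof -
 have *: "\<exists>T. open T \<and> T \<inter> - G = k -` B \<inter> - G" if "continuous_on (- G) k" "open B" for k :: "'a => real" and B
  using that unfolding continuous_on_open_invariant by blast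
 obtain S T where "open S" "S \<inter> - G = f -` {a<..} \<inter> - G" "open T" "T \<inter> - G = g -` {-b<..<b} \<inter> - G"
  using *[OF assms(2), of "{a<..}"] *[OF assms(3), of "{-b<..<b}"] by auto
 then have "{x. a < f x \<and> \<bar>g x\<bar> < b} \<union> G = (S \<inter> T) \<union> G" by (auto simp: set_eq_iff abs_less_iff) (smt (verit))+
 then show ?thesis using \<open>open S\<close> \<open>open T\<close> assms(1) by auto
qed

text \<open>On curves inside \<open>U\<close> this is the Leibniz rule. A curve that leaves
  \<open>U\<close> passes through a zero of \<open>\<eta>\<close>, and since the modulus of the
  product is at most \<open>m * \<eta>\<close>, the increments of \<open>\<eta>\<close> before and
  after that point pay for everything.\<close>

lemma cutoff_ugrad:
 fixes u :: "'a::euclidean_space => ereal"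
 assumes ug: "upper_gradient U u h" and h: "Borel h"
  and \<eta>: "\<And>x. 0 <= \<eta> x" "\<And>x. \<eta> x <= 1" "\<And>x. x \<notin> U ==> \<eta> x = 0" "ugrad \<eta> k" and m: "0 <= m"
 shows "ugrad (%x. real_of_ereal (max (ereal (-m)) (min (ereal m) (u x))) * \<eta> x) (%x. h x + ennreal m * k x)"
proof (rule ugradI)
 let ?c = "%x. real_of_ereal (max (ereal (-m)) (min (ereal m) (u x)))"
 have k[measurable]: "Borel k" by (rule ugrad_measurable[OF \<eta>(4)])
 note [measurable] = h
 show "Borel (%x. h x + ennreal m * k x)" by measurable
 have cb: "\<bar>?c x\<bar> <= m" for x using m by (cases "u x") (auto simp: max_def min_def)
 fix Y :: "real => 'a" and l assume c: "arclength_curve_in UNIV Y l"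
 have l: "0 < l" using c by (simp add: arclength_curve_in_def)
 have sum: "lint (%x. h x + ennreal m * k x) Y 0 l = lint h Y 0 l + ennreal m * lint k Y 0 l"
  unfolding lint_cmult[OF k c order_refl order_refl, symmetric] by (rule lint_add_fun[OF _ _ c]) auto
 show "ennreal \<bar>?c (Y 0) * \<eta> (Y 0) - ?c (Y l) * \<eta> (Y l)\<bar> <= lint (%x. h x + ennreal m * k x) Y 0 l"
 proof (cases "Y ` {0..l} \<subseteq> U")
  case True
  have eq: "?c (Y 0) * \<eta> (Y 0) - ?c (Y l) * \<eta> (Y l) = (?c (Y 0) - ?c (Y l)) * \<eta> (Y 0) + ?c (Y l) * (\<eta> (Y 0) - \<eta> (Y l))"
   by algebra
  have "\<bar>?c (Y 0) * \<eta> (Y 0) - ?c (Y l) * \<eta> (Y l)\<bar> <= \<bar>(?c (Y 0) - ?c (Y l)) * \<eta> (Y 0)\<bar> + \<bar>?c (Y l) * (\<eta> (Y 0) - \<eta> (Y l))\<bar>"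
   unfolding eq by (rule abs_triangle_ineq)
  also have "\<dots> = \<bar>?c (Y 0) - ?c (Y l)\<bar> * \<eta> (Y 0) + \<bar>?c (Y l)\<bar> * \<bar>\<eta> (Y 0) - \<eta> (Y l)\<bar>"
   unfolding abs_mult abs_of_nonneg[OF \<eta>(1)] ..
  also have "\<dots> <= \<bar>?c (Y 0) - ?c (Y l)\<bar> * 1 + m * \<bar>\<eta> (Y 0) - \<eta> (Y l)\<bar>"
   by (intro add_mono mult_left_mono mult_right_mono cb \<eta>(2)) auto
  finally have "ennreal \<bar>?c (Y 0) * \<eta> (Y 0) - ?c (Y l) * \<eta> (Y l)\<bar> <= ennreal (\<bar>?c (Y 0) - ?c (Y l)\<bar> * 1 + m * \<bar>\<eta> (Y 0) - \<eta> (Y l)\<bar>)" by (rule ennreal_leI)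
  also have "\<dots> = ennreal \<bar>?c (Y 0) - ?c (Y l)\<bar> + ennreal m * ennreal \<bar>\<eta> (Y 0) - \<eta> (Y l)\<bar>" using m by (simp add: ennreal_mult')
  also have "\<dots> <= lint h Y 0 l + ennreal m * lint k Y 0 l"
  proof (intro add_mono mult_left_mono)
   show "ennreal \<bar>?c (Y 0) - ?c (Y l)\<bar> <= lint h Y 0 l"
    by (rule order_trans[OF ediff_clamp_le upper_gradient_piece[OF ug h c _ l _ True]]) auto
   show "ennreal \<bar>\<eta> (Y 0) - \<eta> (Y l)\<bar> <= lint k Y 0 l" by (rule ugrad_subcurve[OF \<eta>(4) c]) (use l in auto)
  qed simp
  finally show ?thesis unfolding sum .
 next
  case False
  then obtain t where t: "t \<in> {0..l}" "Y t \<notin> U" by blast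
  have z: "\<eta> (Y t) = 0" by (rule \<eta>(3)[OF t(2)])
  have b: "\<bar>?c x * \<eta> x\<bar> <= m * \<eta> x" for x using cb[of x] \<eta>(1)[of x] unfolding abs_mult by (simp add: mult_right_mono)
  have "\<bar>?c (Y 0) * \<eta> (Y 0) - ?c (Y l) * \<eta> (Y l)\<bar> <= m * \<bar>\<eta> (Y 0) - \<eta> (Y t)\<bar> + m * \<bar>\<eta> (Y t) - \<eta> (Y l)\<bar>"
   unfolding z diff_0_right diff_0 abs_minus_cancel abs_of_nonneg[OF \<eta>(1)]
   by (rule order_trans[OF abs_triangle_ineq4 add_mono[OF b b]])
  from ennreal_leI[OF this] have "ennreal \<bar>?c (Y 0) * \<eta> (Y 0) - ?c (Y l) * \<eta> (Y l)\<bar>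
    <= ennreal m * (ennreal \<bar>\<eta> (Y 0) - \<eta> (Y t)\<bar> + ennreal \<bar>\<eta> (Y t) - \<eta> (Y l)\<bar>)"
   using m by (simp add: ennreal_mult' distrib_left)
  also have "\<dots> <= ennreal m * (lint k Y 0 t + lint k Y t l)"
   using t by (intro mult_left_mono add_mono ugrad_subcurve[OF \<eta>(4) c]) auto
  also have "\<dots> = ennreal m * lint k Y 0 l" using t by (subst lint_add[OF k c]) auto
  also have "\<dots> <= lint h Y 0 l + ennreal m * lint k Y 0 l" by simp
  finally show ?thesis unfolding sum .
 qed
qed

text \<open>On \<open>V\<close> the cutoff \<open>\<eta>\<close> is 1 and the truncation is
  inactive, so \<open>u\<close> equals the Newtonian function \<open>f\<close> there.
  \<open>V\<close> is quasiopen because it is described by strict inequalities between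
  quasicontinuous functions. \<open>1 - \<eta>\<close> vanishes on \<open>V\<close>, so up to a null
  set of \<open>V\<close> the upper gradient of \<open>\<eta>\<close> can be made a small multiple
  of \<open>k\<close>, which leaves \<open>h\<close> alone as bound for the gradient.\<close>

lemma newtonian_patch:
 fixes u :: "'a::euclidean_space => ereal"
 assumes U: "U \<in> sets lebesgue" and um: "u \<in> borel_measurable (restrict_space lebesgue U)"
  and ug: "upper_gradient U u h" and h: "Borel h" and hp: "pint p h < \<infinity>" and p: "1 < p" and m: "0 < m"
  and e0: "e0 \<in> borel_measurable lebesgue" "\<And>x. 0 <= e0 x" "\<And>x. e0 x <= 1" "\<And>x. x \<notin> U ==> e0 x = 0"
   "\<And>x. m <= norm x ==> e0 x = 0" "ugrad e0 k" "pint p k < \<infinity>"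
 obtains V f F w where "V \<subseteq> U" "\<And>x. x \<in> V ==> u x = ereal (f x)" "\<And>x. x \<in> U ==> 1/2 < e0 x ==> \<bar>u x\<bar> < ereal m ==> x \<in> V"
  "\<And>e. 0 < e ==> \<exists>G. open G \<and> Cap p G < ennreal e \<and> continuous_on (- G) f \<and> open (V \<union> G)"
  "Borel F" "AE x in lborel. f x = F x" "pnorm p F < \<infinity>"
  "Borel w" "pnorm p w < \<infinity>" "weakly_diff F w"
  "AE x in lborel. x \<in> V --> ennreal (norm (w x)) <= h x"
proof -
 have p0: "0 < p" using p by simp
 let ?c = "%x. real_of_ereal (max (ereal (-m)) (min (ereal m) (u x)))"
 define \<eta> where "\<eta> x = min 1 (2 * e0 x)" for x
 define f where "f x = ?c x * \<eta> x" for x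
 define V where "V = {x. 1/2 < e0 x \<and> \<bar>f x\<bar> < m}"
 have \<eta>: "\<And>x. 0 <= \<eta> x" "\<And>x. \<eta> x <= 1" "\<And>x. x \<notin> U ==> \<eta> x = 0" using e0(2,4) by (auto simp: \<eta>_def)
 have cb: "\<bar>?c x\<bar> <= m" for x using m by (cases "u x") (auto simp: max_def min_def)
 have fb: "\<bar>f x\<bar> <= m" for x
  unfolding f_def abs_mult using mult_mono[OF cb[of x] \<eta>(2)[of x]] \<eta>(1)[of x] m by simp
 have f0: "m <= norm x ==> f x = 0" for x using e0(5) by (simp add: f_def \<eta>_def)
 note [measurable] = h e0(1)
 have k[measurable]: "Borel k" by (rule ugrad_measurable[OF e0(6)])
 have u2: "ugrad \<eta> (%x. ennreal 2 * k x)"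
  by (rule ugrad_contraction[OF ugrad_scale[OF e0(6)]]) (auto simp: \<eta>_def min_def)
 have k2: "pint p (%x. ennreal 2 * k x) < \<infinity>" by (rule pint_cmult_finite) (use p0 e0(7) in auto)
 have fm[measurable]: "f \<in> borel_measurable lebesgue"
 proof -
  have "?c \<in> borel_measurable (restrict_space lebesgue U)" using um by measurable
  then have "(%x. indicator U x *\<^sub>R ?c x) \<in> borel_measurable lebesgue" using U by (subst (asm) borel_measurable_restrict_space_iff) auto
  then have "(%x. (indicator U x *\<^sub>R ?c x) * min 1 (2 * e0 x)) \<in> borel_measurable lebesgue" by measurable
  also have "(%x. (indicator U x *\<^sub>R ?c x) * min 1 (2 * e0 x)) = f"
   using \<eta>(3) by (auto simp: f_def \<eta>_def fun_eq_iff indicator_def)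
  finally show ?thesis .
 qed
 have fp: "pint p (%x. ennreal \<bar>f x\<bar>) < \<infinity>" by (rule pint_bounded_support[OF fb f0 p0])
 have ep: "pint p (%x. ennreal \<bar>e0 x\<bar>) < \<infinity>" by (rule pint_bounded_support[of e0 1 m]) (use e0 p0 in auto)
 have fin: "pint p (%x. h x + ennreal m * k' x) < \<infinity>" if [measurable]: "Borel k'" and k': "pint p k' < \<infinity>" for k'
  by (intro pint_add_finite pint_cmult_finite hp k' p0) (use m in \<open>auto intro: less_imp_le\<close>)
 have uf: "ugrad f (%x. h x + ennreal m * k' x)" if "ugrad \<eta> k'" for k'
  unfolding f_def[abs_def] by (rule cutoff_ugrad[OF ug h \<eta> that]) (use m in auto)
 have VU: "V \<subseteq> U" using e0(4) by (force simp: V_def)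
 have V1: "\<eta> x = 1" if "x \<in> V" for x using that by (simp add: V_def \<eta>_def)
 have Vu: "u x = ereal (f x)" if "x \<in> V" for x
 proof -
  have "f x = ?c x" "\<bar>?c x\<bar> < m" using that V1[OF that] by (auto simp: f_def V_def)
  then show ?thesis by (cases "u x") (auto simp: max_def min_def split: if_splits)
 qed
 have Vin: "x \<in> V" if "1/2 < e0 x" "\<bar>u x\<bar> < ereal m" for x
 proof -
  have "\<eta> x = 1" using that(1) by (simp add: \<eta>_def)
  then have "\<bar>f x\<bar> < m" using that(2) by (cases "u x") (auto simp: f_def max_def min_def)
  then show ?thesis using that(1) by (simp add: V_def)
 qed
 have qV: "\<exists>G. open G \<and> Cap p G < ennreal e \<and> continuous_on (- G) f \<and> open (V \<union> G)" if e: "0 < e" for e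
 proof -
  have q: "0 < e / 2 * (1/2)" "0 < e / 2 * (1/4)" using e by auto
  obtain G1 where G1: "open G1" "Cap p G1 < ennreal (e / 2 * (1/2))" "continuous_on (- G1) f"
   by (rule newtonian_quasicontinuous[OF fm fb fp uf[OF u2] fin p q(1)]) (use k2 in \<open>auto intro: that\<close>)
  have eb: "\<bar>e0 x\<bar> <= 1" for x using e0(2,3)[of x] by simp
  obtain G2 where G2: "open G2" "Cap p G2 < ennreal (e / 2 * (1/4))" "continuous_on (- G2) e0"
   by (rule newtonian_quasicontinuous[OF e0(1) eb ep e0(6,7) p q(2)]) (rule that)
  have c: "continuous_on (- (G1 \<union> G2)) e0" "continuous_on (- (G1 \<union> G2)) f"
   using G1(3) G2(3) by (auto elim: continuous_on_subset)
  have "Cap p (G1 \<union> G2) <= ennreal (e / 2)" by (rule Cap_Un_less[OF G1(2) G2(2) p0]) (use e in simp)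
  then have "Cap p (G1 \<union> G2) < ennreal e" by (rule le_less_trans) (use e in \<open>auto intro: ennreal_lessI\<close>)
  moreover have "open (V \<union> (G1 \<union> G2))" unfolding V_def by (rule quasi_open_Un[OF _ c]) (use G1 G2 in auto)
  ultimately show ?thesis using G1(1) G2(1) c(2) by (intro exI[of _ "G1 \<union> G2"]) auto
 qed
 obtain F where F: "Borel F" "\<And>x. \<bar>F x\<bar> <= m" "AE x in lborel. f x = F x"
  by (rule borel_version_bounded[OF fm fb]) (rule that)
 have "AE x in lborel. ennreal \<bar>F x\<bar> = ennreal \<bar>f x\<bar>" using F(3) by eventually_elim simp
 from pint_cong_AE[OF this, of p] have Fp: "pint p (%x. ennreal \<bar>F x\<bar>) < \<infinity>" using fp by simp
 have "{x \<in> space lebesgue. 1/2 < e0 x \<and> \<bar>f x\<bar> < m} \<in> sets lebesgue" by measurable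
 then have Vm: "V \<in> sets lebesgue" by (simp add: V_def)
 \<comment> \<open>\<open>ugrad_vanishing\<close> asks for a Borel set, while \<open>V\<close> is
   only Lebesgue measurable; \<open>A\<close> exhausts \<open>V\<close> up to a null set.\<close>
 obtain A N where AN: "A \<in> sets lborel" "N \<in> null_sets lborel" "V - A \<subseteq> N" "A \<subseteq> V"
 proof -
  from Vm obtain S N N' where "V = S \<union> N" "N \<subseteq> N'" "N' \<in> null_sets lborel" "S \<in> sets lborel" by (rule sets_completionE)
  then show thesis by (intro that[of S N']) auto
 qed
 have A[measurable]: "A \<in> sets borel" using AN(1) by simp
 have step: "\<exists>w. Borel w \<and> weakly_diff F w \<and> pnorm p w < \<infinity> \<and>
   (AE x in lborel. x \<in> A --> ennreal (norm (w x)) <= h x + ennreal m * (ennreal (1 / Suc n) * (ennreal 2 * k x)))" for n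
 proof -
  let ?k = "%x. ennreal 2 * k x * indicator (- A) x + ennreal (1 / Suc n) * (ennreal 2 * k x)"
  have "ugrad (%x. 1 - \<eta> x) (%x. ennreal 2 * k x)" by (rule ugrad_contraction[OF u2]) simp
  then have "ugrad (%x. 1 - \<eta> x) ?k" by (rule ugrad_vanishing) (use AN(4) V1 in auto)
  then have uk: "ugrad \<eta> ?k" by (rule ugrad_contraction) simp
  have kp: "pint p ?k < \<infinity>"
  proof (intro pint_add_finite p0 pint_cmult_finite k2 e0(7))
   show "pint p (%x. ennreal 2 * k x * indicator (- A) x) < \<infinity>"
    by (rule le_less_trans[OF pint_mono[OF p0] k2]) (auto simp: indicator_def)
  qed auto
  obtain w where w: "Borel w" "weakly_diff F w" "AE x in lborel. ennreal (norm (w x)) <= h x + ennreal m * ?k x"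
   by (rule newtonian_weakly_diff[OF uf[OF uk] fin[OF ugrad_measurable[OF uk] kp] p F(1,2,3) Fp]) (rule that)
  have "pnorm p w < \<infinity>"
   by (rule le_less_trans[OF pint_mono_AE[OF p0 w(3)] fin[OF ugrad_measurable[OF uk] kp]])
  moreover have "AE x in lborel. x \<in> A --> ennreal (norm (w x)) <= h x + ennreal m * (ennreal (1 / Suc n) * (ennreal 2 * k x))"
   using w(3) by eventually_elim auto
  ultimately show ?thesis using w(1,2) by blast
 qed
 define w where "w n = (SOME w. Borel w \<and> weakly_diff F w \<and> pnorm p w < \<infinity> \<and>
   (AE x in lborel. x \<in> A --> ennreal (norm (w x)) <= h x + ennreal m * (ennreal (1 / Suc n) * (ennreal 2 * k x))))" for n
 have w: "Borel (w n)" "weakly_diff F (w n)" "pnorm p (%x. w n x) < \<infinity>"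
  "AE x in lborel. x \<in> A --> ennreal (norm (w n x)) <= h x + ennreal m * (ennreal (1 / Suc n) * (ennreal 2 * k x))" for n
  using someI_ex[OF step[of n], folded w_def] by simp_all
 \<comment> \<open>Each \<open>n\<close> has its own weak gradient of \<open>F\<close> with its own
   bound. By uniqueness they all agree with \<open>w 0\<close>, which therefore satisfies the bound
   for every \<open>n\<close>.\<close>
 have "AE x in lborel. \<forall>n. w n x = w 0 x \<and> (x \<in> A --> ennreal (norm (w n x)) <= h x + ennreal m * (ennreal (1 / Suc n) * (ennreal 2 * k x)))"
  by (subst AE_all_countable, intro allI AE_conjI w weakly_diff_unique[OF w(2) w(2) w(1) w(1) w(3) w(3) p])
 moreover have "AE x in lborel. x \<notin> N" by (rule AE_not_in[OF AN(2)])
 ultimately have wh: "AE x in lborel. x \<in> V --> ennreal (norm (w 0 x)) <= h x"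
  using pint_AE_finite[OF k e0(7)]
 proof eventually_elim
  case (elim x)
  show ?case
  proof
   assume "x \<in> V"
   then have xA: "x \<in> A" using AN(3) elim by blast
   obtain b where b: "k x = ennreal b" "0 <= b" using elim(3) by (cases "k x") auto
   have "(%n. m * (inverse (real (Suc n)) * (2 * b))) \<longlonglongrightarrow> m * (0 * (2 * b))"
    by (intro tendsto_intros LIMSEQ_inverse_real_of_nat)
   from tendsto_add[OF tendsto_const tendsto_ennrealI[OF this], of "h x"]
   have "(%n. h x + ennreal (m * (inverse (real (Suc n)) * (2 * b)))) \<longlonglongrightarrow> h x" by simp
   moreover have "ennreal (norm (w 0 x)) <= h x + ennreal (m * (inverse (real (Suc n)) * (2 * b)))" for n
   proof -
    have "ennreal (norm (w n x)) <= h x + ennreal m * (ennreal (1 / Suc n) * (ennreal 2 * k x))" using elim(1) xA by blast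
    also have "ennreal m * (ennreal (1 / Suc n) * (ennreal 2 * k x)) = ennreal (m * (inverse (real (Suc n)) * (2 * b)))"
    proof -
     have "0 <= m" "0 <= 1 / real (Suc n)" "0 <= (2::real)" using m by auto
     then show ?thesis unfolding b(1) inverse_eq_divide by (simp only: ennreal_mult')
    qed
    finally show ?thesis using elim(1) by metis
   qed
   ultimately show "ennreal (norm (w 0 x)) <= h x" by (intro LIMSEQ_le_const) auto
  qed
 qed
 show thesis
 proof (rule that[of V f F "w 0"])
  show "x \<in> V" if "x \<in> U" "1/2 < e0 x" "\<bar>u x\<bar> < ereal m" for x by (rule Vin[OF that(2,3)])
  show "pnorm p F < \<infinity>" using Fp by simp
 qed (rule VU Vu qV F w wh | assumption)+
qed

lemma AE_null_sets_lebesgue: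
 assumes "AE x in lborel. x \<notin> Z" shows "Z \<in> null_sets (lebesgue :: 'a::euclidean_space measure)"
proof -
 obtain N where N: "N \<in> null_sets lborel" "Z \<subseteq> N" using assms by (rule AE_E) (auto simp: null_sets_def intro: that)
 show ?thesis by (rule null_sets_completion_subset[OF N(2)]) (rule null_sets_completionI[OF N(1)])
qed

lemma null_sets_lebesgue_AE: "Z \<in> null_sets lebesgue ==> AE x in lborel. x \<notin> Z"
 using AE_not_in[of Z lebesgue] by (simp only: AE_completion_iff)

text \<open>If such a point lies on a curve along which \<open>e\<close> is continuous, a short
  piece of the curve starting or ending there stays in \<open>U\<close>. The increment of
  \<open>u\<close> over it counts as infinite, which contradicts a finite integral of
  \<open>h\<close>.\<close>

lemma infinite_value_exceptional:
 fixes u :: "'a::euclidean_space => ereal"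
 assumes ug: "upper_gradient U u h" and h: "Borel h" and hp: "pint p h < \<infinity>" and p: "0 < p"
  and e: "ugrad e k" "pint p k < \<infinity>" "\<And>x. 0 < e x ==> x \<in> U"
 shows "pae p (%Y l. Y ` {0..l} \<inter> {x. \<bar>u x\<bar> = \<infinity> \<and> 0 < e x} = {})"
proof -
 have "pae p (%Y l. lint h Y 0 l < \<infinity> \<and> lint k Y 0 l < \<infinity>)"
  by (intro pae_conj p pae_finite h hp e(2) ugrad_measurable[OF e(1)])
 then show ?thesis
 proof (rule pae_mono)
  fix Y :: "real => 'a" and l
  assume c: "arclength_curve_in UNIV Y l" and fin: "lint h Y 0 l < \<infinity> \<and> lint k Y 0 l < \<infinity>"
  show "Y ` {0..l} \<inter> {x. \<bar>u x\<bar> = \<infinity> \<and> 0 < e x} = {}"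
  proof (rule ccontr)
  assume "Y ` {0..l} \<inter> {x. \<bar>u x\<bar> = \<infinity> \<and> 0 < e x} \<noteq> {}"
  then have "\<exists>t\<in>{0..l}. \<bar>u (Y t)\<bar> = \<infinity> \<and> 0 < e (Y t)" unfolding ex_in_conv[symmetric] by (elim exE IntE imageE CollectE) (rule bexI, simp_all)
  then obtain t where t: "t \<in> {0..l}" "\<bar>u (Y t)\<bar> = \<infinity>" "0 < e (Y t)" by (elim bexE conjE) (rule that)
  have l: "0 < l" using c by (simp add: arclength_curve_in_def)
  have "continuous_on {0..l} (%t. e (Y t))" by (rule ugrad_continuous_on_curve[OF e(1) c]) (use fin in simp)
  from this[unfolded continuous_on_iff, rule_format, OF t(1,3)]
  obtain \<delta> where \<delta>: "0 < \<delta>" "\<And>s. s \<in> {0..l} ==> dist s t < \<delta> ==> dist (e (Y s)) (e (Y t)) < e (Y t)" by blast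
  have U: "Y s \<in> U" if "s \<in> {0..l}" "\<bar>s - t\<bar> < \<delta>" for s
  proof (rule e(3))
   have "\<bar>e (Y s) - e (Y t)\<bar> < e (Y t)" using \<delta>(2)[OF that(1)] that(2) by (simp add: dist_real_def)
   then show "0 < e (Y s)" by argo
  qed
  obtain a b where ab: "0 <= a" "a < b" "b <= l" "a = t \<or> b = t" "\<And>s. s \<in> {a..b} ==> \<bar>s - t\<bar> < \<delta>"
  proof (cases "t < l")
   case True
   show thesis by (rule that[of t "min l (t + \<delta> / 2)"]) (use t(1) True \<delta>(1) in \<open>auto simp: abs_less_iff\<close>)
  next
   case False
   show thesis by (rule that[of "max 0 (t - \<delta> / 2)" t]) (use t(1) l False \<delta>(1) in \<open>auto simp: abs_less_iff\<close>)
  qed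
  have "Y ` {a..b} \<subseteq> U" using U ab by auto
  from upper_gradient_piece[OF ug h c ab(1-3) this] have "ediff (u (Y a)) (u (Y b)) <= lint h Y 0 l"
   using lint_mono_interval[OF ab(1,3), of h Y] by (rule order_trans)
  moreover have "ediff (u (Y a)) (u (Y b)) = \<infinity>" using ab(4) t(2) by (auto simp: ediff_def)
  ultimately show False using conjunct1[OF fin] by (simp add: top_unique)
  qed
 qed
qed

text \<open>The cutoffs are positive parts of the difference between a Lipschitz cutoff of the open
  set \<open>U \<union> G k\<close> and a test function \<open>v k\<close> that is 1 on
  \<open>G k\<close>, so they vanish off \<open>U\<close>. A point of \<open>U\<close> missed by all
  patches either has \<open>v k\<close> at least 1/2 for every \<open>k\<close>, which describes a
  set of zero capacity, or \<open>u\<close> is infinite there with some cutoff positive.\<close>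

lemma newtonian_cover:
 fixes u :: "'a::euclidean_space => ereal"
 assumes U: "quasiopen p U" and um: "u \<in> borel_measurable (restrict_space lebesgue U)"
  and up: "(\<integral>\<^sup>+x\<in>U. enn_pow (eabs_enn (u x)) p \<partial>lebesgue) < \<infinity>"
  and ug: "upper_gradient U u h" and h: "Borel h" and hp: "pint p h < \<infinity>" and p: "1 < p"
 obtains V f F w where "\<And>i::nat. V i \<subseteq> U" "\<And>i x. x \<in> V i ==> u x = ereal (f i x)"
  "\<And>i e. 0 < e ==> \<exists>G. open G \<and> Cap p G < ennreal e \<and> continuous_on (- G) (f i) \<and> open (V i \<union> G)"
  "\<And>i. Borel (F i)" "\<And>i. AE x in lborel. f i x = F i x" "\<And>i. pnorm p (%x. F i x) < \<infinity>"
  "\<And>i. Borel (w i)" "\<And>i. pnorm p (%x. w i x) < \<infinity>" "\<And>i. weakly_diff (F i) (w i)"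
  "\<And>i. AE x in lborel. x \<in> V i --> ennreal (norm (w i x)) <= h x"
  "U - (\<Union>i. V i) \<in> null_sets lebesgue" "pae p (%Y l. Y ` {0..l} \<inter> (U - (\<Union>i. V i)) = {})"
proof -
 have p0: "0 < p" using p by simp
 have Um: "U \<in> sets lebesgue" by (rule quasiopen_measurable[OF U p0])
 \<comment> \<open>The factor \<open>2 powr (-p)\<close> anticipates that \<open>2 * v k\<close>
   will be the test function for \<open>Z1\<close>.\<close>
 have "\<exists>G. open G \<and> Cap p G < ennreal (2 powr (-p) / Suc k) \<and> open (U \<union> G)" for k
  using U unfolding quasiopen_def by simp
 then obtain G where G: "\<And>k. open (G k)" "\<And>k. Cap p (G k) < ennreal (2 powr (-p) / Suc k)" "\<And>k. open (U \<union> G k)" by metis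
 have "\<exists>v g. v \<in> borel_measurable lebesgue \<and> (\<forall>x. 0 <= v x \<and> v x <= 1) \<and> (\<forall>x\<in>G k. v x = (1::real)) \<and>
   ugrad v g \<and> pint p (%x. ennreal (v x)) + pint p g < ennreal (2 powr (-p) / Suc k)" for k
  by (rule Cap_witness[OF G(2)[of k] p0]) blast
 then obtain v hv where v[measurable]: "\<And>k. v k \<in> borel_measurable lebesgue" and v01: "\<And>k x. 0 <= v k x \<and> v k x <= 1"
  and vG: "\<And>k x. x \<in> G k ==> v k x = (1::real)" and uv: "\<And>k. ugrad (v k) (hv k)"
  and vp: "\<And>k. pint p (%x. ennreal (v k x)) + pint p (hv k) < ennreal (2 powr (-p) / Suc k)" by metis
 have [measurable]: "Borel (hv k)" for k by (rule ugrad_measurable[OF uv])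
 \<comment> \<open>Closed set on which the Lipschitz cutoff is to vanish; the complement of a ball
   makes the support bounded and \<open>C k m\<close> nonempty.\<close>
 define C where "C k m = - (U \<union> G k) \<union> - ball (0::'a) (real (Suc m))" for k m
 have C: "closed (C k m)" "C k m \<noteq> {}" for k m
 proof -
  show "closed (C k m)" unfolding C_def by (intro closed_Un closed_Compl G(3) open_ball)
  have "ball (0::'a) (real (Suc m)) \<noteq> UNIV" using bounded_ball not_bounded_UNIV by metis
  then show "C k m \<noteq> {}" by (auto simp: C_def)
 qed
 have [measurable]: "C k m \<in> sets borel" for k m using C(1) by simp
 define \<psi> where "\<psi> k m x = min 1 (real (Suc m) * infdist x (C k m))" for k m x
 have \<psi>01: "0 <= \<psi> k m x" "\<psi> k m x <= 1" for k m x by (auto simp: \<psi>_def infdist_nonneg)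
 have \<psi>C: "\<psi> k m x = 0" if "x \<in> C k m" for k m x using that by (simp add: \<psi>_def)
 have u\<psi>: "ugrad (\<psi> k m) (%x. ennreal (real (Suc m)) * indicator (- C k m) x)" for k m
 proof (rule ugrad_lipschitz_vanishing)
  fix x y
  have "\<bar>\<psi> k m x - \<psi> k m y\<bar> <= \<bar>real (Suc m) * infdist x (C k m) - real (Suc m) * infdist y (C k m)\<bar>" unfolding \<psi>_def by linarith
  also have "\<dots> = real (Suc m) * \<bar>infdist x (C k m) - infdist y (C k m)\<bar>" unfolding right_diff_distrib[symmetric] abs_mult by simp
  also have "\<dots> <= real (Suc m) * dist x y" by (intro mult_left_mono infdist_triangle_abs) simp
  finally show "\<bar>\<psi> k m x - \<psi> k m y\<bar> <= real (Suc m) * dist x y" .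
 qed (use \<psi>C in auto)
 define e0 where "e0 k m x = max 0 (\<psi> k m x - v k x)" for k m x
 define kk where "kk k m x = ennreal (real (Suc m)) * indicator (- C k m) x + hv k x" for k m x
 have e01: "0 <= e0 k m x" "e0 k m x <= 1" for k m x using \<psi>01[of k m x] v01[of k x] by (auto simp: e0_def)
 have e0U: "e0 k m x = 0" if "x \<notin> U" for k m x
 proof (cases "x \<in> G k")
  case True
  then show ?thesis using vG[OF True] \<psi>01[of k m x] by (simp add: e0_def)
 next
  case False
  then have "x \<in> C k m" using that by (simp add: C_def)
  then show ?thesis using \<psi>C v01[of k x] by (simp add: e0_def)
 qed
 have e0m: "e0 k m x = 0" if "real (Suc m) <= norm x" for k m x
 proof -
  have "x \<in> C k m" using that by (simp add: C_def)
  then show ?thesis using \<psi>C v01[of k x] by (simp add: e0_def)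
 qed
 have ue: "ugrad (e0 k m) (kk k m)" for k m
  unfolding kk_def[abs_def]
 proof (rule ugrad_add[OF u\<psi> uv])
  show "\<bar>e0 k m x - e0 k m y\<bar> <= \<bar>\<psi> k m x - \<psi> k m y\<bar> + \<bar>v k x - v k y\<bar>" for x y unfolding e0_def by linarith
 qed
 have kp: "pint p (kk k m) < \<infinity>" for k m
  unfolding kk_def[abs_def]
 proof (intro pint_add_finite p0)
  have "pint p (%x. ennreal \<bar>real (Suc m) * indicator (- C k m) x\<bar>) < \<infinity>"
   by (rule pint_bounded_support[of _ "real (Suc m)" "real (Suc m)"]) (use p0 in \<open>auto simp: C_def indicator_def\<close>)
  also have "(%x. ennreal \<bar>real (Suc m) * indicator (- C k m) x\<bar>) = (%x. ennreal (real (Suc m)) * indicator (- C k m) x)"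
   by (auto simp: fun_eq_iff indicator_def)
  finally show "pint p (%x. ennreal (real (Suc m)) * indicator (- C k m) x) < \<infinity>" .
  have "pint p (hv k) <= pint p (%x. ennreal (v k x)) + pint p (hv k)" by simp
  also note vp
  finally show "pint p (hv k) < \<infinity>" by (rule less_trans) simp
 qed measurable
 have em: "e0 k m \<in> borel_measurable lebesgue" for k m
 proof -
  have "continuous_on UNIV (\<psi> k m)" unfolding \<psi>_def[abs_def] by (intro continuous_intros continuous_on_infdist)
  then have "\<psi> k m \<in> borel_measurable lborel" using borel_measurable_continuous_onI by auto
  then have [measurable]: "\<psi> k m \<in> borel_measurable lebesgue" by (rule measurable_completion)
  show ?thesis unfolding e0_def[abs_def] by measurable
 qed
 define P where "P k m q \<longleftrightarrow> (case q of (V, f, F, w) =>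
   V \<subseteq> U \<and> (\<forall>x\<in>V. u x = ereal (f x)) \<and> (\<forall>x. x \<in> U --> 1/2 < e0 k m x --> \<bar>u x\<bar> < ereal (real (Suc m)) --> x \<in> V) \<and>
   (\<forall>e>0. \<exists>G. open G \<and> Cap p G < ennreal e \<and> continuous_on (- G) f \<and> open (V \<union> G)) \<and>
   Borel F \<and> (AE x in lborel. f x = F x) \<and> pnorm p F < \<infinity> \<and>
   Borel w \<and> pnorm p w < \<infinity> \<and> weakly_diff F w \<and>
   (AE x in lborel. x \<in> V --> ennreal (norm (w x)) <= h x))"
  for k m :: nat and q :: "'a set \<times> ('a => real) \<times> ('a => real) \<times> ('a => 'a)"
 have "\<exists>q. P k m q" for k m
 proof (rule newtonian_patch[OF Um um ug h hp p _ em[of k m] e01(1)[of k m] e01(2)[of k m] e0U[of _ k m] e0m[of m _ k] ue[of k m] kp[of k m]])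
  show "0 < real (Suc m)" by simp
 next
  fix V :: "'a set" and f F :: "'a => real" and w :: "'a => 'a"
  assume 1: "V \<subseteq> U" "\<And>x. x \<in> V ==> u x = ereal (f x)" "\<And>x. x \<in> U ==> 1 / 2 < e0 k m x ==> \<bar>u x\<bar> < ereal (real (Suc m)) ==> x \<in> V"
   "\<And>e. 0 < e ==> \<exists>G. open G \<and> Cap p G < ennreal e \<and> continuous_on (- G) f \<and> open (V \<union> G)"
   "Borel F" "AE x in lborel. f x = F x" "pnorm p F < \<infinity>"
   "Borel w" "pnorm p w < \<infinity>" "weakly_diff F w"
   "AE x in lborel. x \<in> V --> ennreal (norm (w x)) <= h x"
  have "P k m (V, f, F, w)"
   unfolding P_def prod.case
  proof (intro conjI ballI allI impI)
   show "u x = ereal (f x)" if "x \<in> V" for x by (rule 1(2)[OF that])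
   show "x \<in> V" if "x \<in> U" "1 / 2 < e0 k m x" "\<bar>u x\<bar> < ereal (real (Suc m))" for x by (rule 1(3)[OF that])
   show "\<exists>G. open G \<and> Cap p G < ennreal e \<and> continuous_on (- G) f \<and> open (V \<union> G)" if "0 < e" for e by (rule 1(4)[OF that])
  qed (rule 1)+
  then show "\<exists>q. P k m q" by (rule exI)
 qed
 then obtain q where q: "\<And>k m. P k m (q k m)" by metis
 \<comment> \<open>Pairs of indices are enumerated as a single sequence; \<open>k\<close> selects
   the open set \<open>U \<union> G k\<close>, and \<open>m\<close> governs the truncation level,
   the slope of the cutoff and the radius of the ball.\<close>
 define Q where "Q i = (case prod_decode i of (k, m) => q k m)" for i
 define V where "V i = fst (Q i)" for i
 define f where "f i = fst (snd (Q i))" for i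
 define F where "F i = fst (snd (snd (Q i)))" for i
 define w where "w i = snd (snd (snd (Q i)))" for i
 have QP: "P (fst (prod_decode i)) (snd (prod_decode i)) (V i, f i, F i, w i)" for i
  using q[of "fst (prod_decode i)" "snd (prod_decode i)"] by (simp add: V_def f_def F_def w_def Q_def split_beta)
 note QP' = QP[unfolded P_def prod.case]
 note c1 = conjunct1[OF QP'] and r1 = conjunct2[OF QP']
 note c2 = conjunct1[OF r1] and r2 = conjunct2[OF r1]
 note c3 = conjunct1[OF r2] and r3 = conjunct2[OF r2]
 note c4 = conjunct1[OF r3] and r4 = conjunct2[OF r3]
 note c5 = conjunct1[OF r4] and r5 = conjunct2[OF r4]
 note c6 = conjunct1[OF r5] and r6 = conjunct2[OF r5]
 note c7 = conjunct1[OF r6] and r7 = conjunct2[OF r6]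
 note c8 = conjunct1[OF r7] and r8 = conjunct2[OF r7]
 note c9 = conjunct1[OF r8] and r9 = conjunct2[OF r8]
 note c10 = conjunct1[OF r9] and r10 = conjunct2[OF r9]
 have inV: "x \<in> (\<Union>i. V i)" if "x \<in> U" "1/2 < e0 k m x" "\<bar>u x\<bar> < ereal (real (Suc m))" for x k m
 proof -
  have "x \<in> V (prod_encode (k, m))" using c3[of "prod_encode (k, m)", rule_format, of x] that unfolding prod_encode_inverse fst_conv snd_conv by blast
  then show ?thesis by blast
 qed
 define Z1 where "Z1 = (\<Inter>k. {x. 1/2 <= v k x})"
 define Z2 where "Z2 k m = {x. \<bar>u x\<bar> = \<infinity> \<and> 0 < e0 k m x}" for k m
 have Z: "U - (\<Union>i. V i) \<subseteq> Z1 \<union> (\<Union>k m. Z2 k m)"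
 proof
  fix x assume x: "x \<in> U - (\<Union>i. V i)"
  show "x \<in> Z1 \<union> (\<Union>k m. Z2 k m)"
  proof (rule ccontr)
   assume n: "x \<notin> Z1 \<union> (\<Union>k m. Z2 k m)"
   then obtain k where k: "v k x < 1/2" by (auto simp: Z1_def not_le)
   have "x \<in> U \<union> G k" using x by simp
   then obtain d where d: "0 < d" "ball x d \<subseteq> U \<union> G k" using G(3)[of k] open_contains_ball by metis
   \<comment> \<open>For large \<open>m\<close> the point has distance at least
     \<open>1 / Suc m\<close> from \<open>C k m\<close>, both from the complement of
     \<open>U \<union> G k\<close> and from that of the ball, so the Lipschitz cutoff reaches its
     cap 1 there.\<close>
   have e0: "1/2 < e0 k m x" if m: "norm x + 1 <= m" "1 / d <= m" for m
   proof -
    obtain y where y: "y \<in> C k m" "infdist x (C k m) = dist x y" by (rule infdist_attains_inf[OF C]) (rule that)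
    have "d <= dist x y \<or> 1 <= dist x y"
    proof (cases "y \<in> U \<union> G k")
     case True
     then have "real (Suc m) <= norm y" using y(1) by (auto simp: C_def not_less)
     then have "1 <= dist x y" using m(1) norm_triangle_sub[of y x] by (simp add: dist_norm norm_minus_commute)
     then show ?thesis ..
    next
     case False
     then have "y \<notin> ball x d" using d(2) by blast
     then show ?thesis by simp
    qed
    then have "1 <= real (Suc m) * dist x y"
    proof
     assume "d <= dist x y"
     have "1 <= real m * d" using m(2) d(1) by (simp add: divide_le_eq)
     also have "\<dots> <= real (Suc m) * dist x y" using \<open>d <= dist x y\<close> d(1) by (intro mult_mono) auto
     finally show ?thesis .
    next
     assume "1 <= dist x y"
     then have "1 * 1 <= real (Suc m) * dist x y" by (intro mult_mono) auto
     then show ?thesis by simp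
    qed
    then have "\<psi> k m x = 1" unfolding \<psi>_def y(2) by simp
    then show ?thesis using k by (simp add: e0_def)
   qed
   obtain m0 :: nat where m0: "norm x + 1 + 1 / d <= m0" using real_arch_simple by blast
   have m0': "norm x + 1 <= m0" "1 / d <= m0" using m0 d(1) norm_ge_zero[of x] divide_pos_pos[of 1 d] by linarith+
   have "\<bar>u x\<bar> \<noteq> \<infinity>"
   proof
    assume "\<bar>u x\<bar> = \<infinity>"
    then have "x \<in> Z2 k m0" using e0[OF m0'] by (simp add: Z2_def)
    then show False using n by blast
   qed
   then obtain a where a: "u x = ereal a" by (cases "u x") auto
   obtain m1 :: nat where m1: "\<bar>a\<bar> <= m1" using real_arch_simple by blast
   have "x \<in> (\<Union>i. V i)"
   proof (rule inV)
    show "1/2 < e0 k (max m0 m1) x" using m0' by (intro e0) auto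
    show "\<bar>u x\<bar> < ereal (real (Suc (max m0 m1)))" using m1 by (auto simp: a)
   qed (use x in simp)
   then show False using x by blast
  qed
 qed
 have capZ1: "Cap p Z1 = 0"
 proof (rule le_inverse_Suc_imp_0)
  fix k :: nat
  have "Cap p Z1 <= pint p (%x. ennreal \<bar>2 * v k x\<bar>) + pint p (%x. ennreal 2 * hv k x)"
  proof (rule Cap_le)
   show "(%x. 2 * v k x) \<in> borel_measurable lebesgue" by measurable
   show "ugrad (%x. 2 * v k x) (%x. ennreal 2 * hv k x)" by (rule ugrad_scale[OF uv]) simp
   fix x assume "x \<in> Z1"
   then have "1/2 <= v k x" by (simp add: Z1_def)
   then show "1 <= 2 * v k x" by simp
  qed
  also have "pint p (%x. ennreal \<bar>2 * v k x\<bar>) = ennreal (2 powr p) * pint p (%x. ennreal (v k x))"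
  proof -
   have "enn_pow (ennreal \<bar>2 * v k x\<bar>) p = ennreal (2 powr p) * enn_pow (ennreal (v k x)) p" for x
    using enn_pow_mult[of 2 p "ennreal (v k x)"] v01[of k x] p0 by (simp add: abs_mult ennreal_mult)
   then have "pint p (%x. ennreal \<bar>2 * v k x\<bar>) = (\<integral>\<^sup>+x. ennreal (2 powr p) * enn_pow (ennreal (v k x)) p \<partial>lebesgue)"
    unfolding pint_def nn_integral_completion by simp
   also have "\<dots> = ennreal (2 powr p) * (\<integral>\<^sup>+x. enn_pow (ennreal (v k x)) p \<partial>lebesgue)" by (rule nn_integral_cmult) measurable
   finally show ?thesis unfolding pint_def nn_integral_completion .
  qed
  also have "pint p (%x. ennreal 2 * hv k x) = ennreal (2 powr p) * pint p (hv k)" by (rule pint_cmult) (use p0 in auto)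
  also have "ennreal (2 powr p) * pint p (%x. ennreal (v k x)) + ennreal (2 powr p) * pint p (hv k)
   <= ennreal (2 powr p) * ennreal (2 powr (-p) / Suc k)"
   unfolding distrib_left[symmetric] by (intro mult_left_mono less_imp_le vp) simp
  also have "\<dots> = ennreal (1 / Suc k)" unfolding ennreal_mult'[symmetric, OF powr_ge_zero] powr_minus by (simp add: divide_inverse)
  finally show "Cap p Z1 <= ennreal (1 / Suc k)" .
 qed
 have finU: "AE x in lborel. x \<in> U --> \<bar>u x\<bar> \<noteq> \<infinity>"
 proof -
  have "(%x. enn_pow (eabs_enn (u x)) p) \<in> borel_measurable (restrict_space lebesgue U)"
   using um unfolding eabs_enn_def by measurable
  then have "(%x. enn_pow (eabs_enn (u x)) p * indicator U x) \<in> borel_measurable lebesgue"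
   using Um by (subst (asm) borel_measurable_restrict_space_iff_ennreal) auto
  then have "AE x in lebesgue. enn_pow (eabs_enn (u x)) p * indicator U x \<noteq> \<infinity>"
   by (rule nn_integral_PInf_AE) (use up in auto)
  then have "AE x in lborel. enn_pow (eabs_enn (u x)) p * indicator U x \<noteq> \<infinity>" by (simp only: AE_completion_iff)
  then show ?thesis by eventually_elim (auto simp: enn_pow_eq_top_iff eabs_enn_def)
 qed
 have null: "U - (\<Union>i. V i) \<in> null_sets lebesgue"
 proof (rule AE_null_sets_lebesgue)
  show "AE x in lborel. x \<notin> U - (\<Union>i. V i)"
   using null_sets_lebesgue_AE[OF Cap_zero_null[OF capZ1 p0]] finU
  proof eventually_elim
   case (elim x)
   show ?case
   proof
    assume x: "x \<in> U - (\<Union>i. V i)"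
    then have "x \<in> (\<Union>k m. Z2 k m)" using Z elim(1) by blast
    then show False using elim(2) x by (auto simp: Z2_def)
   qed
  qed
 qed
 have e0pos: "x \<in> U" if "0 < e0 k m x" for k m x using e0U[of x k m] that by (cases "x \<in> U") auto
 have "pae p (%Y l. Y ` {0..l} \<inter> Z1 = {} \<and> (\<forall>k m. Y ` {0..l} \<inter> Z2 k m = {}))"
 proof (rule pae_conj[OF p0 pae_avoids_Cap_zero[OF capZ1 p0]])
  have "pae p (%Y l. Y ` {0..l} \<inter> Z2 k m = {})" for k m
   unfolding Z2_def by (rule infinite_value_exceptional[OF ug h hp p0 ue kp e0pos])
  from pae_all[OF p0 this] have "pae p (%Y l. \<forall>m. Y ` {0..l} \<inter> Z2 k m = {})" for k .
  from pae_all[OF p0 this] show "pae p (%Y l. \<forall>k m. Y ` {0..l} \<inter> Z2 k m = {})" .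
 qed
 then have pa: "pae p (%Y l. Y ` {0..l} \<inter> (U - (\<Union>i. V i)) = {})"
 proof (rule pae_mono)
  fix Y :: "real => 'a" and l
  assume a: "Y ` {0..l} \<inter> Z1 = {} \<and> (\<forall>k m. Y ` {0..l} \<inter> Z2 k m = {})"
  have "Y ` {0..l} \<inter> (Z1 \<union> (\<Union>k m. Z2 k m)) = {}" using a by blast
  with Int_mono[OF order_refl Z, of "Y ` {0..l}"] show "Y ` {0..l} \<inter> (U - (\<Union>i. V i)) = {}" by (simp only: subset_empty)
 qed
 show thesis by (rule that[of V f F w]) (rule c1 bspec[OF c2] c4[rule_format] c5 c6 c7 c8 c9 c10 r10 null pa | assumption)+
qed

text \<open>The patches of \<open>newtonian_cover\<close> form a quasicovering, and their gradients,
  each bounded by the Borel version \<open>h\<close> of \<open>g\<close>, agree on overlaps. Any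
  other fine gradient agrees with them too, because local representatives that coincide with
  \<open>u\<close> on a common part have equal weak gradients there; this yields the energy bound
  for every \<open>D\<close>.\<close>

theorem newtonian_fine:
 fixes u :: "'a::euclidean_space => ereal"
 assumes U: "quasiopen p U" and um: "u \<in> borel_measurable (restrict_space lebesgue U)"
  and up: "(\<integral>\<^sup>+x\<in>U. enn_pow (eabs_enn (u x)) p \<partial>lebesgue) < \<infinity>"
  and ug: "upper_gradient U u g" and gp: "(\<integral>\<^sup>+x\<in>U. enn_pow (g x) p \<partial>lebesgue) < \<infinity>" and p: "1 < p"
 shows "\<exists>D. fine_gradient p U u D" "quasicontinuous_on p U u"
  "\<And>D. fine_gradient p U u D ==> (\<integral>\<^sup>+x\<in>U. ennreal (norm (D x) powr p) \<partial>lebesgue) <= (\<integral>\<^sup>+x\<in>U. enn_pow (g x) p \<partial>lebesgue)"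
proof -
 have p0: "0 < p" using p by simp
 have Um: "U \<in> sets lebesgue" by (rule quasiopen_measurable[OF U p0])
 obtain h where h: "Borel h" "upper_gradient U u h" "pint p h = (\<integral>\<^sup>+x\<in>U. enn_pow (g x) p \<partial>lebesgue)"
  by (rule upper_gradient_borel[OF ug Um]) (rule that)
 have hp: "pint p h < \<infinity>" using gp h(3) by simp
 obtain V f F w where VU: "\<And>i::nat. V i \<subseteq> U" and Vu: "\<And>i x. x \<in> V i ==> u x = ereal (f i x)"
  and Vq: "\<And>i e. 0 < e ==> \<exists>G. open G \<and> Cap p G < ennreal e \<and> continuous_on (- G) (f i) \<and> open (V i \<union> G)"
  and F: "\<And>i. Borel (F i)" "\<And>i. AE x in lborel. f i x = F i x" "\<And>i. pnorm p (%x. F i x) < \<infinity>"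
  and w: "\<And>i. Borel (w i)" "\<And>i. pnorm p (%x. w i x) < \<infinity>" "\<And>i. weakly_diff (F i) (w i)"
  and wh: "\<And>i. AE x in lborel. x \<in> V i --> ennreal (norm (w i x)) <= h x"
  and Zn: "U - (\<Union>i. V i) \<in> null_sets lebesgue" and Zp: "pae p (%Y l. Y ` {0..l} \<inter> (U - (\<Union>i. V i)) = {})"
  by (rule newtonian_cover[OF U um up h(2,1) hp p]) (rule that)
 have qo: "quasiopen p (V i)" for i unfolding quasiopen_def using Vq by blast
 note [measurable] = F(1) w(1)
 have le: "(\<integral>\<^sup>+x\<in>U. ennreal (norm (D x) powr p) \<partial>lebesgue) <= pint p h"
  if "AE x in lborel. x \<in> U --> ennreal (norm (D x)) <= h x" for D :: "'a => 'a"
  unfolding set_nn_integral_pint_norm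
 proof (rule pint_mono_AE[OF p0])
  show "AE x in lborel. ennreal (norm (D x)) * indicator U x <= h x" using that by eventually_elim (auto simp: indicator_def)
 qed
 have sob: "sobolev_classical p UNIV (F i) (w i)" for i
  unfolding sobolev_classical_def Lp_real_def Lp_vec_def
 proof (intro conjI)
  show "weak_gradient UNIV (F i) (w i)" by (rule weakly_diff_weak_gradient[OF w(3) F(1) w(1)]) simp
  have "F i \<in> borel_measurable lborel" "w i \<in> borel_measurable lborel" by measurable
  then show "F i \<in> borel_measurable (restrict_space lebesgue UNIV)" "w i \<in> borel_measurable (restrict_space lebesgue UNIV)"
   by (auto intro: measurable_completion)
  show "(\<integral>\<^sup>+x\<in>UNIV. ennreal (\<bar>F i x\<bar> powr p) \<partial>lebesgue) < \<infinity>"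
   using F(3)[of i] unfolding real_norm_def[symmetric] set_nn_integral_pint_norm by simp
  show "(\<integral>\<^sup>+x\<in>UNIV. ennreal (norm (w i x) powr p) \<partial>lebesgue) < \<infinity>" using w(2)[of i] unfolding set_nn_integral_pint_norm by simp
 qed simp
 have uF: "AE x in lborel. x \<in> V i --> u x = ereal (F i x)" for i
  using F(2)[of i] by eventually_elim (use Vu in auto)
 have agree: "AE x in lborel. x \<in> V' \<and> x \<in> V i --> D x = w i x"
  if s: "sobolev_classical p G v wv" "V' \<subseteq> G" and ae: "AE x in lborel. x \<in> V' --> u x = ereal (v x)" "AE x in lborel. x \<in> V' --> D x = wv x" for V' G v wv i and D :: "'a => 'a"
  using weak_gradient_agree[OF s(1) p F(1,3) w(1,2,3), of i] ae uF[of i]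
  by eventually_elim (use s(2) in auto)
 show "(\<integral>\<^sup>+x\<in>U. ennreal (norm (D x) powr p) \<partial>lebesgue) <= (\<integral>\<^sup>+x\<in>U. enn_pow (g x) p \<partial>lebesgue)" if fg: "fine_gradient p U u D" for D
  unfolding h(3)[symmetric]
 proof (rule le)
  obtain \<B> where \<B>: "countable \<B>" "Cap p (U - \<Union>\<B>) = 0"
   and loc: "\<And>V. V \<in> \<B> ==> \<exists>G v w. V \<subseteq> G \<and> sobolev_classical p G v w \<and>
   (AE x in lborel. x \<in> V --> u x = ereal (v x)) \<and> (AE x in lborel. x \<in> V --> D x = w x)"
   by (rule fine_gradientE[OF fg]) (rule that)
  have "AE x in lborel. x \<in> V' \<and> x \<in> V i --> D x = w i x" if "V' \<in> \<B>" for V' i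
  proof -
   obtain G v wv where "V' \<subseteq> G" "sobolev_classical p G v wv" "AE x in lborel. x \<in> V' --> u x = ereal (v x)" "AE x in lborel. x \<in> V' --> D x = wv x"
    using loc[OF \<open>V' \<in> \<B>\<close>] by (elim exE conjE) (rule that)
   then show ?thesis by (intro agree)
  qed
  then have "AE x in lborel. \<forall>V'\<in>\<B>. \<forall>i. x \<in> V' \<and> x \<in> V i --> D x = w i x"
   by (subst AE_ball_countable[OF \<B>(1)]) (simp add: AE_all_countable)
  moreover have "AE x in lborel. \<forall>i. x \<in> V i --> ennreal (norm (w i x)) <= h x" unfolding AE_all_countable using wh by blast
  moreover note null_sets_lebesgue_AE[OF Zn] null_sets_lebesgue_AE[OF Cap_zero_null[OF \<B>(2) p0]]
  ultimately show "AE x in lborel. x \<in> U --> ennreal (norm (D x)) <= h x"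
  proof eventually_elim
   case (elim x)
   show ?case
   proof
    assume "x \<in> U"
    then obtain V' i where "V' \<in> \<B>" "x \<in> V'" "x \<in> V i" using elim(3,4) by blast
    then show "ennreal (norm (D x)) <= h x" using elim(1,2) by simp
   qed
  qed
 qed
 \<comment> \<open>The least index of a patch containing \<open>x\<close> makes the choice
   measurable; by \<open>cons\<close> it is immaterial almost everywhere which patch is
   taken.\<close>
 define D where "D x = w (LEAST i. x \<in> V i) x" for x
 have Vm[measurable]: "V i \<in> sets lebesgue" for i by (rule quasiopen_measurable[OF qo p0])
 have Dm: "D \<in> borel_measurable lebesgue"
  unfolding D_def[abs_def]
 proof (rule measurable_compose_countable)
  fix i
  have "w i \<in> borel_measurable lborel" by measurable
  then show "w i \<in> borel_measurable lebesgue" by (rule measurable_completion)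
 next
  show "(%x. LEAST i. x \<in> V i) \<in> measurable lebesgue (count_space UNIV)" by (rule measurable_Least) measurable
 qed
 have cons: "AE x in lborel. \<forall>i j. x \<in> V i \<and> x \<in> V j --> w i x = w j x"
  unfolding AE_all_countable
 proof (intro allI)
  fix i j
  show "AE x in lborel. x \<in> V i \<and> x \<in> V j --> w i x = w j x"
   by (rule agree[OF sob[of i] subset_UNIV uF]) simp
 qed
 have DV: "AE x in lborel. \<forall>i. x \<in> V i --> D x = w i x"
  using cons
 proof eventually_elim
  case (elim x)
  show ?case
  proof (intro allI impI)
   fix i assume x: "x \<in> V i"
   have "x \<in> V (LEAST i. x \<in> V i)" using x by (rule LeastI)
   then show "D x = w i x" unfolding D_def using elim x by blast
  qed
 qed
 have Dh: "AE x in lborel. x \<in> U --> ennreal (norm (D x)) <= h x"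
 proof -
  have "AE x in lborel. \<forall>i. x \<in> V i --> ennreal (norm (w i x)) <= h x" unfolding AE_all_countable using wh by blast
  with DV null_sets_lebesgue_AE[OF Zn] show ?thesis by eventually_elim auto
 qed
 have "fine_gradient p U u D"
  unfolding fine_gradient_def Lp_ereal_def Lp_vec_def
 proof (intro conjI exI[of _ "range V"] ballI)
  show "D \<in> borel_measurable (restrict_space lebesgue U)" using Dm by (rule measurable_restrict_space1)
  show "(\<integral>\<^sup>+x\<in>U. ennreal (norm (D x) powr p) \<partial>lebesgue) < \<infinity>" by (rule le_less_trans[OF le[OF Dh] hp])
  show "quasicovering p U (range V)"
   unfolding quasicovering_def using qo VU exceptional_Cap_zero[OF Zn Zp p0] by auto
  fix V' assume "V' \<in> range V"
  then obtain i where i: "V' = V i" by blast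
  show "\<exists>G uV wV. V' \<subseteq> G \<and> sobolev_classical p G uV wV \<and> (AE x in lebesgue. x \<in> V' --> u x = ereal (uV x)) \<and> (AE x in lebesgue. x \<in> V' --> D x = wV x)"
   unfolding i AE_completion_iff
  proof (intro exI conjI)
   show "sobolev_classical p UNIV (F i) (w i)" by (rule sob)
   show "AE x in lborel. x \<in> V i --> u x = ereal (F i x)" by (rule uF)
   show "AE x in lborel. x \<in> V i --> D x = w i x" using DV by eventually_elim simp
  qed simp
 qed (use um up in auto)
 then show "\<exists>D. fine_gradient p U u D" by blast
 show "quasicontinuous_on p U u"
  unfolding quasicontinuous_on_def
 proof (intro allI impI)
  fix e :: real assume e: "0 < e"
  obtain G0 where G0: "open G0" "U - (\<Union>i. V i) \<subseteq> G0" "Cap p G0 < ennreal (e / 2 * (1/2))"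
   by (rule exceptional_open_nbhd[OF Zn Zp p0, of "e / 2 * (1/2)"]) (use e in \<open>auto intro: that\<close>)
  \<comment> \<open>\<open>e / 16\<close> lies strictly below \<open>e / 2 * (1/4)\<close>, the
    share that \<open>Cap_Un_less\<close> grants to the union of the \<open>G i\<close>.\<close>
  have "\<exists>G. open G \<and> Cap p G < ennreal (e / 16 * (1/2) ^ Suc i) \<and> continuous_on (- G) (f i) \<and> open (V i \<union> G)" for i
   using e by (intro Vq) simp
  then obtain G where G: "\<And>i. open (G i)" "\<And>i. Cap p (G i) < ennreal (e / 16 * (1/2) ^ Suc i)" "\<And>i. continuous_on (- G i) (f i)" "\<And>i. open (V i \<union> G i)"
   by metis
  have Gu: "open (\<Union>i. G i)" "Cap p (\<Union>i. G i) <= ennreal (e / 16)"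
   by (rule open_Union_small[OF G(1,2) p0]; use e in simp)+
  define H where "H = G0 \<union> (\<Union>i. G i)"
  have "Cap p H <= ennreal (e / 2)" unfolding H_def
  proof (rule Cap_Un_less[OF G0(3) _ p0])
   show "Cap p (\<Union>i. G i) < ennreal (e / 2 * (1/4))" by (rule le_less_trans[OF Gu(2)]) (use e in \<open>auto intro: ennreal_lessI\<close>)
  qed (use e in simp)
  then have capH: "Cap p H < ennreal e" by (rule le_less_trans) (use e in \<open>auto intro: ennreal_lessI\<close>)
  have inV: "\<exists>i. x \<in> V i" if "x \<in> U - H" for x using that G0(2) by (auto simp: H_def)
  have "continuous_on (U - H) (%x. real_of_ereal (u x))"
   unfolding continuous_on_eq_continuous_within
  proof
   fix x assume x: "x \<in> U - H"
   then obtain i where i: "x \<in> V i" using inV by blast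
   \<comment> \<open>Off \<open>H\<close> the patch \<open>V i\<close> is relatively open: it
     coincides there with the open set \<open>V i \<union> G i\<close>, and \<open>u\<close> is the
     continuous function \<open>f i\<close> on it.\<close>
   let ?T = "V i \<union> G i"
   have sub: "(U - H) \<inter> ?T \<subseteq> V i" by (auto simp: H_def)
   have "continuous_on ((U - H) \<inter> ?T) (f i)" by (rule continuous_on_subset[OF G(3)[of i]]) (auto simp: H_def)
   then have "continuous_on ((U - H) \<inter> ?T) (%x. real_of_ereal (u x))"
    by (rule continuous_on_eq) (use sub Vu in \<open>auto simp: subset_iff\<close>)
   then have "continuous (at x within (U - H) \<inter> ?T) (%x. real_of_ereal (u x))"
    using x i unfolding continuous_on_eq_continuous_within by blast
   moreover have "at x within (U - H) \<inter> ?T = at x within (U - H)"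
    by (rule at_within_nhd[of x ?T]) (use i G(4)[of i] in auto)
   ultimately show "continuous (at x within (U - H)) (%x. real_of_ereal (u x))" by simp
  qed
  moreover have "\<forall>x\<in>U - H. \<bar>u x\<bar> \<noteq> \<infinity>" using inV Vu by fastforce
  moreover have "open H" using G0(1) Gu(1) by (auto simp: H_def)
  ultimately show "\<exists>G. open G \<and> Cap p G < ennreal e \<and> (\<forall>x\<in>U - G. \<bar>u x\<bar> \<noteq> \<infinity>) \<and> continuous_on (U - G) (%x. real_of_ereal (u x))"
   using capH by blast
 qed
qed

text \<open>Everything reduces to comparing the infimum of the energies of upper gradients with the
  energy of a fine gradient. One inequality is \<open>fine_gradient_upper_gradient\<close> with
  \<open>e\<close> tending to 0; the other is \<open>newtonian_fine\<close> applied to each upper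
  gradient, trivial where its energy is infinite.\<close>

theorem theorem1p1:
  fixes p :: real and U :: "'a::euclidean_space set" and u :: "'a \<Rightarrow> ereal"
  assumes "1 < p" and "quasiopen p U"
  shows "(N1p p U u \<longleftrightarrow> W1p_KM p U u \<and> quasicontinuous_on p U u) \<and>
         (N1p p U u \<longrightarrow> (\<forall>D. fine_gradient p U u D \<longrightarrow> N1p_norm p U u = W1p_KM_norm p U u D))"
proof -
 have p0: "0 < p" using assms(1) by simp
 let ?A = "\<integral>\<^sup>+x\<in>U. enn_pow (eabs_enn (u x)) p \<partial>lebesgue"
 let ?g = "%g. \<integral>\<^sup>+x\<in>U. enn_pow (g x) p \<partial>lebesgue"
 let ?D = "%D::'a => 'a. \<integral>\<^sup>+x\<in>U. ennreal (norm (D x) powr p) \<partial>lebesgue"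
 have witness: "\<exists>g. upper_gradient U u g \<and> ?A < \<infinity> \<and> ?g g < \<infinity>" "u \<in> borel_measurable (restrict_space lebesgue U)" if N: "N1p p U u"
 proof -
  have "N1p_energy p U u < \<infinity>" using N by (simp add: N1p_def)
  then show "\<exists>g. upper_gradient U u g \<and> ?A < \<infinity> \<and> ?g g < \<infinity>" by (rule energy_witness) auto
  show "u \<in> borel_measurable (restrict_space lebesgue U)" using N by (simp add: N1p_def)
 qed
 have up: "(INF g \<in> {g. upper_gradient U u g}. ?g g) <= ?D D" if fg: "fine_gradient p U u D" and qc: "quasicontinuous_on p U u" for D
 proof (rule ennreal_le_epsilon)
  fix e :: real assume "0 < e"
  then obtain g where g: "upper_gradient U u g" "pint p g <= ?D D + ennreal e"
   by (rule fine_gradient_upper_gradient[OF fg qc assms(2,1)]) (rule that)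
  have "(INF g \<in> {g. upper_gradient U u g}. ?g g) <= ?g g" using g(1) by (intro INF_lower) simp
  also have "\<dots> <= pint p g" unfolding set_nn_integral_pint by (rule pint_mono[OF p0]) (auto simp: indicator_def)
  also note g(2)
  finally show "(INF g \<in> {g. upper_gradient U u g}. ?g g) <= ?D D + ennreal e" .
 qed
 have "W1p_KM p U u \<and> quasicontinuous_on p U u" if N: "N1p p U u"
 proof -
  obtain g where g: "upper_gradient U u g" "?A < \<infinity>" "?g g < \<infinity>" using witness(1)[OF N] by blast
  note * = newtonian_fine[OF assms(2) witness(2)[OF N] g(2,1,3) assms(1)]
  show ?thesis unfolding W1p_KM_def using *(1,2) by blast
 qed
 moreover have "N1p p U u" if W: "W1p_KM p U u" and qc: "quasicontinuous_on p U u"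
 proof -
  obtain D where D: "fine_gradient p U u D" using W by (auto simp: W1p_KM_def)
  then have "u \<in> borel_measurable (restrict_space lebesgue U)" "?A < \<infinity>" "?D D < \<infinity>"
   by (simp_all add: fine_gradient_def Lp_ereal_def Lp_vec_def)
  then show ?thesis using up[OF D qc] unfolding N1p_def N1p_energy_def by (auto intro: le_less_trans)
 qed
 moreover have "N1p_norm p U u = W1p_KM_norm p U u D" if N: "N1p p U u" and D: "fine_gradient p U u D" for D
 proof -
  obtain g0 where g0: "upper_gradient U u g0" "?A < \<infinity>" "?g g0 < \<infinity>" using witness(1)[OF N] by blast
  note * = newtonian_fine[OF assms(2) witness(2)[OF N] g0(2)]
  have "?D D <= (INF g \<in> {g. upper_gradient U u g}. ?g g)"
  proof (rule INF_greatest)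
   fix g assume "g \<in> {g. upper_gradient U u g}"
   then have g: "upper_gradient U u g" by simp
   show "?D D <= ?g g"
   proof (cases "?g g < \<infinity>")
    case True
    show ?thesis by (rule *(3)[OF g True assms(1) D])
   qed (simp add: not_less top_unique)
  qed
  with up[OF D *(2)[OF g0(1,3) assms(1)]] have "?D D = (INF g \<in> {g. upper_gradient U u g}. ?g g)" by (rule antisym[rotated])
  then show ?thesis unfolding N1p_norm_def W1p_KM_norm_def N1p_energy_def by simp
 qed
 ultimately show ?thesis by blast
qed

end
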